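(* Let $\beta_0,\dots,\beta_{n-1}\colon U\to\mathbb{C}$ be nonzero holomorphic functions on a simply-connected domain $U\subset\mathbb{C}$, let $F_1,\dots,F_{n+1}\colon U\to\mathbb{C}^{2n+1}$ be the maps constructed from them (and from constants of integration) as in the context, and let $g\colon L^2\to\mathbb{S}^{2n}$ be the map given by $$g=\frac{1}{\|\mathrm{Re}(F_{n+1})\|}\,\mathrm{Re}(F_{n+1}),$$ where $L^2=U$ with the induced metric. Then the map $g\colon L^2\to\mathbb{S}^{2n}$ parametrizes a generalized pseudoholomorphic surface. Conversely, any pseudoholomorphic surface in $\mathbb{S}^{2n}$ can be locally obtained in this way.
   Context: Notation. $\langle\cdot,\cdot\rangle$ is the complex bilinear symmetric product $\langle a,b\rangle=\sum_k a_kb_k$ on $\mathbb{C}^m$; the Hermitian product of $a,b$ is $\langle a,\bar b\rangle$, and $\|a\|^2=\langle a,\bar a\rangle$. For $\phi\in\mathbb{C}^m$ write $\phi^2=\langle\phi,\phi\rangle$. Put $\partial=\partial/\partial z$. Re is taken componentwise. Construction. Let $\beta_s\colon U\to\mathbb{C}$, $0\le s\le n-1$, be nonzero holomorphic functions on a simply-connected domain $U\subset\mathbb{C}$, and put $\beta_n=1$. Setting $\alpha_0=\beta_0$, define successively maps $\alpha_r\colon U\to\mathbb{C}^{2r+1}$ by $$\alpha_{r+1}=\beta_{r+1}\left(1-\phi_r^2,\ i(1+\phi_r^2),\ 2\phi_r\right),\qquad \phi_r=\int^z\alpha_r\,dz,\qquad 0\le r\le n-1,$$ where each $\phi_r$ is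 a holomorphic primitive of $\alpha_r$ (so constants of integration are also part of the data). Define $F_s\colon U\to\mathbb{C}^{2n+1}$, $1\le s\le n+1$, by $$F_1=\alpha_n,\qquad F_{r+1}=\partial F_r-\frac{1}{\|F_r\|^2}\langle\partial F_r,\bar F_r\rangle F_r,\quad 1\le r\le n.$$ Definitions. $\mathbb{S}^{2n}\subset\mathbb{R}^{2n+1}$ is the unit sphere. A minimal surface $f$ in $\mathbb{S}^{2n}\subset\mathbb{R}^{2n+1}$ is pseudoholomorphic if, when parametrized by an isothermal coordinate $z$, it satisfies $\langle\partial^jf,\partial^kf\rangle=0$ for $j+k>0$ ($j,k\ge0$), where $\partial^0f=f$. "Generalized" means that the metric induced on the surface is singular at most at isolated points.
   Formalization: g is claimed only where its formula is defined (extended to U up to sign); the converse is after a holomorphic coordinate change: near every point up to sign and an isometric embedding of S^{2m}, m≤n; exactly, for substantial surfaces, near all but isolated points. *)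

theory Defs
  imports "HOL-Analysis.Analysis"
begin

text \<open>
  The dimensions \<open>2r + 1\<close> vary inside the construction, so a vector of \<open>N\<close>-dimensional real or
  complex space is a function on \<^typ>\<open>nat\<close> of which only the values at \<open>k < N\<close> are relevant, and
  vector-valued maps are compared on these components only.  Indices start at \<open>0\<close>.
\<close>

section \<open>Calculus in the coordinate \<open>z = x + iy\<close>\<close>

definition dx :: "(complex \<Rightarrow> 'a::real_normed_vector) \<Rightarrow> complex \<Rightarrow> 'a" where
  "dx u z = frechet_derivative u (at z) 1"

definition dy :: "(complex \<Rightarrow> 'a::real_normed_vector) \<Rightarrow> complex \<Rightarrow> 'a" where
  "dy u z = frechet_derivative u (at z) \<i>"

definition dz :: "(complex \<Rightarrow> complex) \<Rightarrow> complex \<Rightarrow> complex" where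
  "dz u z = (dx u z - \<i> * dy u z) / 2"

primrec C_k_on :: "nat \<Rightarrow> complex set \<Rightarrow> (complex \<Rightarrow> 'a::real_normed_vector) \<Rightarrow> bool" where
  "C_k_on 0 U u \<longleftrightarrow> continuous_on U u"
| "C_k_on (Suc k) U u \<longleftrightarrow> u differentiable_on U \<and> C_k_on k U (dx u) \<and> C_k_on k U (dy u)"

definition smooth_on :: "complex set \<Rightarrow> (complex \<Rightarrow> 'a::real_normed_vector) \<Rightarrow> bool" where
  "smooth_on U u \<longleftrightarrow> (\<forall>k. C_k_on k U u)"

definition vdx :: "(complex \<Rightarrow> nat \<Rightarrow> 'a::real_normed_vector) \<Rightarrow> complex \<Rightarrow> nat \<Rightarrow> 'a" where
  "vdx f z k = dx (\<lambda>w. f w k) z"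

definition vdy :: "(complex \<Rightarrow> nat \<Rightarrow> 'a::real_normed_vector) \<Rightarrow> complex \<Rightarrow> nat \<Rightarrow> 'a" where
  "vdy f z k = dy (\<lambda>w. f w k) z"

definition vdz :: "(complex \<Rightarrow> nat \<Rightarrow> complex) \<Rightarrow> complex \<Rightarrow> nat \<Rightarrow> complex" where
  "vdz f z k = dz (\<lambda>w. f w k) z"

text \<open>The symmetric bilinear product; no conjugation over the complex numbers.\<close>

definition bprod :: "nat \<Rightarrow> (nat \<Rightarrow> 'a::comm_semiring_1) \<Rightarrow> (nat \<Rightarrow> 'a) \<Rightarrow> 'a" where
  "bprod N a b = (\<Sum>k<N. a k * b k)"

definition cnjv :: "(nat \<Rightarrow> complex) \<Rightarrow> nat \<Rightarrow> complex" where
  "cnjv a k = cnj (a k)"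

section \<open>Pseudoholomorphic surfaces in the sphere\<close>

text \<open>Surfaces are written in an isothermal coordinate \<open>z \<in> U\<close>; the coefficients of the induced metric
  are the products of \<^const>\<open>vdx\<close> and \<^const>\<open>vdy\<close>.\<close>

definition isothermal_on :: "nat \<Rightarrow> complex set \<Rightarrow> (complex \<Rightarrow> nat \<Rightarrow> real) \<Rightarrow> bool" where
  "isothermal_on N U f \<longleftrightarrow>
     (\<forall>z\<in>U. bprod N (vdx f z) (vdx f z) = bprod N (vdy f z) (vdy f z)
          \<and> bprod N (vdx f z) (vdy f z) = 0)"

definition metric_singular :: "nat \<Rightarrow> complex set \<Rightarrow> (complex \<Rightarrow> nat \<Rightarrow> real) \<Rightarrow> complex set" where
  "metric_singular N U f =
     {z\<in>U. bprod N (vdx f z) (vdx f z) * bprod N (vdy f z) (vdy f z)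
            - (bprod N (vdx f z) (vdy f z))\<^sup>2 = 0}"

text \<open>Component normal to the surface inside the unit sphere.  At a regular point in an isothermal
  coordinate the position vector \<open>f\<close> and the two partial derivatives are mutually orthogonal.\<close>

definition normal_part ::
  "nat \<Rightarrow> (complex \<Rightarrow> nat \<Rightarrow> real) \<Rightarrow> complex \<Rightarrow> (nat \<Rightarrow> real) \<Rightarrow> nat \<Rightarrow> real" where
  "normal_part N f z v k =
     v k - bprod N v (f z) * f z k
       - bprod N v (vdx f z) / bprod N (vdx f z) (vdx f z) * vdx f z k
       - bprod N v (vdy f z) / bprod N (vdy f z) (vdy f z) * vdy f z k"

text \<open>Mean curvature vector in the sphere: half the trace of the second fundamental form with respect
  to the induced metric, in an isothermal coordinate.\<close>

definition mean_curvature_vector ::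
  "nat \<Rightarrow> (complex \<Rightarrow> nat \<Rightarrow> real) \<Rightarrow> complex \<Rightarrow> nat \<Rightarrow> real" where
  "mean_curvature_vector N f z k =
     (normal_part N f z (vdx (vdx f) z) k + normal_part N f z (vdy (vdy f) z) k)
       / (2 * bprod N (vdx f z) (vdx f z))"

definition complexify :: "(complex \<Rightarrow> nat \<Rightarrow> real) \<Rightarrow> complex \<Rightarrow> nat \<Rightarrow> complex" where
  "complexify f z k = of_real (f z k)"

definition generalized_pseudoholomorphic ::
  "nat \<Rightarrow> complex set \<Rightarrow> (complex \<Rightarrow> nat \<Rightarrow> real) \<Rightarrow> bool" where
  "generalized_pseudoholomorphic n U f \<longleftrightarrow>
     (let N = 2 * n + 1 in
      open U \<and> (\<forall>k<N. smooth_on U (\<lambda>z. f z k)) \<and> (\<forall>z\<in>U. bprod N (f z) (f z) = 1)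
      \<and> isothermal_on N U f
      \<and> metric_singular N U f sparse_in U
      \<and> (\<forall>z\<in>U - metric_singular N U f. \<forall>k<N. mean_curvature_vector N f z k = 0)
      \<and> (\<forall>z\<in>U. \<forall>j l. j + l > 0 \<longrightarrow>
           bprod N ((vdz ^^ j) (complexify f) z) ((vdz ^^ l) (complexify f) z) = 0))"

definition pseudoholomorphic ::
  "nat \<Rightarrow> complex set \<Rightarrow> (complex \<Rightarrow> nat \<Rightarrow> real) \<Rightarrow> bool" where
  "pseudoholomorphic n U f \<longleftrightarrow>
     generalized_pseudoholomorphic n U f \<and> metric_singular (2 * n + 1) U f = {}"

text \<open>Substantial: not contained in a proper totally geodesic subsphere.\<close>

definition substantial :: "nat \<Rightarrow> complex set \<Rightarrow> (complex \<Rightarrow> nat \<Rightarrow> real) \<Rightarrow> bool" where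
  "substantial n U f \<longleftrightarrow>
     \<not> (\<exists>c. (\<exists>k<2 * n + 1. c k \<noteq> 0) \<and> (\<forall>z\<in>U. bprod (2 * n + 1) (f z) c = 0))"

section \<open>The construction\<close>

text \<open>\<open>\<phi> r\<close> is the chosen primitive of \<open>\<alpha>\<^sub>r\<close>, so it carries the constants of integration.  Only
  \<open>\<beta> s\<close> for \<open>s < n\<close> is used; the convention \<open>\<beta>\<^sub>n = 1\<close> is built into \<open>coef\<close>.\<close>

definition coef :: "nat \<Rightarrow> (nat \<Rightarrow> complex \<Rightarrow> complex) \<Rightarrow> nat \<Rightarrow> complex \<Rightarrow> complex" where
  "coef n \<beta> s z = (if s = n then 1 else \<beta> s z)"

primrec alpha :: "nat \<Rightarrow> (nat \<Rightarrow> complex \<Rightarrow> complex) \<Rightarrow> (nat \<Rightarrow> complex \<Rightarrow> nat \<Rightarrow> complex) \<Rightarrow>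
    nat \<Rightarrow> complex \<Rightarrow> nat \<Rightarrow> complex" where
  "alpha n \<beta> \<phi> 0 = (\<lambda>z k. coef n \<beta> 0 z)"
| "alpha n \<beta> \<phi> (Suc r) =
     (\<lambda>z k. coef n \<beta> (Suc r) z *
        (if k = 0 then 1 - bprod (2 * r + 1) (\<phi> r z) (\<phi> r z)
         else if k = 1 then \<i> * (1 + bprod (2 * r + 1) (\<phi> r z) (\<phi> r z))
         else 2 * \<phi> r z (k - 2)))"

definition construction_data :: "nat \<Rightarrow> complex set \<Rightarrow> (nat \<Rightarrow> complex \<Rightarrow> complex) \<Rightarrow>
    (nat \<Rightarrow> complex \<Rightarrow> nat \<Rightarrow> complex) \<Rightarrow> bool" where
  "construction_data n U \<beta> \<phi> \<longleftrightarrow>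
     open U \<and> U \<noteq> {} \<and> simply_connected U
     \<and> (\<forall>s<n. \<beta> s holomorphic_on U \<and> (\<exists>z\<in>U. \<beta> s z \<noteq> 0))
     \<and> (\<forall>r<n. \<forall>k<2 * r + 1. \<forall>z\<in>U.
          ((\<lambda>w. \<phi> r w k) has_field_derivative alpha n \<beta> \<phi> r z k) (at z))"

text \<open>The sequence starts at index \<open>1\<close>; the value at index \<open>0\<close> is a dummy.\<close>

primrec F :: "nat \<Rightarrow> (nat \<Rightarrow> complex \<Rightarrow> complex) \<Rightarrow> (nat \<Rightarrow> complex \<Rightarrow> nat \<Rightarrow> complex) \<Rightarrow>
    nat \<Rightarrow> complex \<Rightarrow> nat \<Rightarrow> complex" where
  "F n \<beta> \<phi> 0 = (\<lambda>z k. 0)"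
| "F n \<beta> \<phi> (Suc r) =
     (if r = 0 then alpha n \<beta> \<phi> n
      else (\<lambda>z k. vdz (F n \<beta> \<phi> r) z k
              - 1 / bprod (2 * n + 1) (F n \<beta> \<phi> r z) (cnjv (F n \<beta> \<phi> r z))
                * bprod (2 * n + 1) (vdz (F n \<beta> \<phi> r) z) (cnjv (F n \<beta> \<phi> r z))
                * F n \<beta> \<phi> r z k))"

definition g :: "nat \<Rightarrow> (nat \<Rightarrow> complex \<Rightarrow> complex) \<Rightarrow> (nat \<Rightarrow> complex \<Rightarrow> nat \<Rightarrow> complex) \<Rightarrow>
    complex \<Rightarrow> nat \<Rightarrow> real" where
  "g n \<beta> \<phi> z k =
     1 / L2_set (\<lambda>j. Re (F n \<beta> \<phi> (n + 1) z j)) {..<2 * n + 1} * Re (F n \<beta> \<phi> (n + 1) z k)"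

definition degenerate_points :: "nat \<Rightarrow> complex set \<Rightarrow> (nat \<Rightarrow> complex \<Rightarrow> complex) \<Rightarrow>
    (nat \<Rightarrow> complex \<Rightarrow> nat \<Rightarrow> complex) \<Rightarrow> complex set" where
  "degenerate_points n U \<beta> \<phi> =
     {z\<in>U. \<exists>r\<in>{1..n + 1}. \<forall>k<2 * n + 1. F n \<beta> \<phi> r z k = 0}"

text \<open>The set on which no division by zero occurs in the formulas for the \<open>F\<close>'s and for \<open>g\<close>.  It can
  be a proper subset of \<open>U\<close>: \<open>Re F\<^sub>n\<^sub>+\<^sub>1\<close> is the product of a unit vector field and the harmonic
  function \<open>\<plusminus>2\<^sup>n Re (\<beta>\<^sub>0 \<cdots> \<beta>\<^sub>n\<^sub>-\<^sub>1)\<close>, and crossing a zero line of the latter changes the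
  sign of \<open>g\<close>.\<close>

definition g_domain :: "nat \<Rightarrow> complex set \<Rightarrow> (nat \<Rightarrow> complex \<Rightarrow> complex) \<Rightarrow>
    (nat \<Rightarrow> complex \<Rightarrow> nat \<Rightarrow> complex) \<Rightarrow> complex set" where
  "g_domain n U \<beta> \<phi> =
     {z\<in>U. (\<forall>r\<in>{1..n}. \<exists>k<2 * n + 1. F n \<beta> \<phi> r z k \<noteq> 0)
          \<and> (\<exists>k<2 * n + 1. Re (F n \<beta> \<phi> (n + 1) z k) \<noteq> 0)}"

definition agrees_up_to_sign :: "nat \<Rightarrow> complex set \<Rightarrow> (nat \<Rightarrow> complex \<Rightarrow> complex) \<Rightarrow>
    (nat \<Rightarrow> complex \<Rightarrow> nat \<Rightarrow> complex) \<Rightarrow> (complex \<Rightarrow> nat \<Rightarrow> real) \<Rightarrow> bool" where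
  "agrees_up_to_sign n U \<beta> \<phi> G \<longleftrightarrow>
     (\<forall>z\<in>g_domain n U \<beta> \<phi>.
        (\<forall>k<2 * n + 1. G z k = g n \<beta> \<phi> z k) \<or> (\<forall>k<2 * n + 1. G z k = - g n \<beta> \<phi> z k))"

text \<open>Holomorphic change of isothermal coordinate around \<open>p\<close>.\<close>

definition coordinate_change ::
  "complex set \<Rightarrow> (complex \<Rightarrow> complex) \<Rightarrow> complex set \<Rightarrow> complex \<Rightarrow> bool" where
  "coordinate_change U \<psi> V p \<longleftrightarrow>
     \<psi> holomorphic_on U \<and> inj_on \<psi> U \<and> \<psi> ` U \<subseteq> V \<and> p \<in> \<psi> ` U"

definition linear_isometry :: "nat \<Rightarrow> nat \<Rightarrow> (nat \<Rightarrow> nat \<Rightarrow> real) \<Rightarrow> bool" where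
  "linear_isometry M N A \<longleftrightarrow>
     (\<forall>i<M. \<forall>j<M. (\<Sum>k<N. A k i * A k j) = (if i = j then 1 else 0))"

end

theory Submission
  imports Defs "HOL-Complex_Analysis.Complex_Analysis"
begin

text \<open>\<^emph>\<open>From data to surfaces.\<close>  The map \<open>\<alpha>\<^sub>n\<close> begins a moving frame \<open>frame \<phi> n 0, \<dots>, frame \<phi> n n\<close> of isotropic
vectors: it arises from the frame one level below by prefixing two coordinates, and its derivatives satisfy
\<open>w\<^sub>j' = 2 \<beta>\<^sub>n\<^sub>-\<^sub>1\<^sub>-\<^sub>j w\<^sub>j\<^sub>+\<^sub>1\<close> (\<open>frame_iso\<close>, \<open>frame_deriv\<close>).  Orthogonalising the frame gives vectors \<open>W\<^sub>j\<close>,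
the \<open>F\<close>'s are their multiples, \<open>F\<^sub>r\<^sub>+\<^sub>1 = P\<^sub>r W\<^sub>r\<close> with \<open>P\<^sub>r\<close> a product of \<open>r\<close> factors \<open>2 \<beta>\<^sub>s\<close> (\<open>F_eq\<close>), and \<open>W\<^sub>n\<close> is
a real unit vector field \<open>u\<close>, because it is the only direction left beside the isotropic span of
\<open>W\<^sub>0, \<dots>, W\<^sub>n\<^sub>-\<^sub>1\<close> and its conjugate.  Hence \<open>g\<close> is \<open>u\<close> up to the sign of \<open>Re P\<^sub>n\<close>.  A real unit field orthogonal to
the \<open>w\<^sub>j\<close> with \<open>j < n\<close> has all its \<open>\<partial>\<close>-derivatives in the isotropic span of the conjugates of the \<open>W\<^sub>j\<close>, so it is
pseudoholomorphic (\<open>adapted_pseudoholomorphic\<close>).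

\<^emph>\<open>From surfaces to data.\<close>  A minimal surface is a harmonic map, and Gram--Schmidt applied to \<open>f, \<partial>f, \<partial>\<^sup>2f, \<dots>\<close> gives
its harmonic sequence \<open>H\<^sub>j\<close>, with the structure equations \<open>\<partial>H\<^sub>j = H\<^sub>j\<^sub>+\<^sub>1 + \<kappa>\<^sub>j H\<^sub>j\<close> and
\<open>\<partial>\<close>-bar \<open>H\<^sub>j\<^sub>+\<^sub>1 = - (\<rho>\<^sub>j\<^sub>+\<^sub>1 / \<rho>\<^sub>j) H\<^sub>j\<close>, where \<open>\<rho>\<^sub>j = \<parallel>H\<^sub>j\<parallel>\<^sup>2\<close> (\<open>Dbar_step\<close>).  Isotropy bounds the number of nonzero \<open>H\<^sub>j\<close>.
The products of the \<open>\<rho>\<^sub>j\<close> are logarithmically subharmonic up to a bounded error, so their zeros are isolated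
unless they fill a neighbourhood (\<open>zeros_accumulate_imp_zero\<close>), and the sequence stops at one order \<open>m \<le> n\<close> off a
sparse set (\<open>order_exists\<close>).  The projection onto the span of \<open>f\<close>, the \<open>H\<^sub>j\<close> and their conjugates is then
constant (\<open>pr_constant\<close>): the surface lies in a totally geodesic sphere of dimension \<open>2 m\<close>.

The last vector of the sequence yields a holomorphic curve, the directrix \<open>cnj H\<^sub>m / \<rho>\<^sub>m\<close>, whose derivatives of
order below \<open>m\<close> are isotropic and orthogonal to \<open>f\<close>.  After division by one of its components it extends over the sparse
set, by the great Picard theorem (\<open>directrix_germ\<close>).  An isotropic curve is a multiple of
\<open>(1 - \<phi>\<^sup>2, \<i> (1 + \<phi>\<^sup>2), 2 \<phi>)\<close> wherever a fixed linear form does not vanish on it, and \<open>\<phi>'\<close> is again isotropic in a space of two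
dimensions less; descending in this way recovers the functions \<open>\<beta>\<^sub>s\<close> and \<open>\<phi>\<^sub>s\<close> of the construction.  At a prescribed
point the linear form may vanish and the coordinates must be rotated first (\<open>generated_at_point\<close>); near any point it
fails on a sparse set only (\<open>generated_near\<close>).  Finally \<open>f\<close> and \<open>u\<close> are unit normals of the same frame and agree up to
sign (\<open>unit_normal_unique\<close>); the coordinate change \<open>z \<mapsto> \<omega> z\<close> multiplies \<open>P\<^sub>n\<close> by \<open>\<omega>\<^sup>n\<close> and so adjusts the sign of \<open>g\<close>.\<close>

section \<open>Directional derivatives\<close>

definition dd :: "complex \<Rightarrow> (complex \<Rightarrow> 'a::real_normed_vector) \<Rightarrow> complex \<Rightarrow> 'a" where
  "dd v u z = frechet_derivative u (at z) v"

lemma dx_dd: "dx = dd 1" and dy_dd: "dy = dd \<i>"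
  by (simp_all add: fun_eq_iff dx_def dy_def dd_def)

lemma dd_eq: "(u has_derivative D) (at z) \<Longrightarrow> dd v u z = D v"
  unfolding dd_def by (metis frechet_derivative_at)

lemma has_derivative_dd: "u differentiable (at z) \<Longrightarrow> (u has_derivative (\<lambda>v. dd v u z)) (at z)"
  unfolding dd_def by (simp add: frechet_derivative_works)

lemma dd_cong:
  assumes "open T" "z \<in> T" "\<And>w. w \<in> T \<Longrightarrow> u w = v w"
  shows "dd d u z = dd d v z"
proof -
  have "(u has_derivative D) (at z) \<longleftrightarrow> (v has_derivative D) (at z)" for D
    using has_derivative_transform_within_open[OF _ assms(1,2), of u D UNIV v]
      has_derivative_transform_within_open[OF _ assms(1,2), of v D UNIV u] assms(3) by auto
  then show ?thesis by (simp add: dd_def frechet_derivative_def)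
qed

lemma dd_const [simp]: "dd d (\<lambda>w. c) z = 0"
  by (simp add: dd_def)

lemma dd_add:
  assumes "u differentiable (at z)" "v differentiable (at z)"
  shows "dd d (\<lambda>w. u w + v w) z = dd d u z + dd d v z"
proof -
  have "((\<lambda>w. u w + v w) has_derivative (\<lambda>e. dd e u z + dd e v z)) (at z)"
    using assms by (intro has_derivative_add has_derivative_dd)
  then show ?thesis by (rule dd_eq)
qed

lemma dd_diff:
  assumes "u differentiable (at z)" "v differentiable (at z)"
  shows "dd d (\<lambda>w. u w - v w) z = dd d u z - dd d v z"
proof -
  have "((\<lambda>w. u w - v w) has_derivative (\<lambda>e. dd e u z - dd e v z)) (at z)"
    using assms by (intro has_derivative_diff has_derivative_dd)
  then show ?thesis by (rule dd_eq)
qed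

lemma dd_mult:
  fixes u v :: "complex \<Rightarrow> 'a::real_normed_field"
  assumes "u differentiable (at z)" "v differentiable (at z)"
  shows "dd d (\<lambda>w. u w * v w) z = dd d u z * v z + u z * dd d v z"
proof -
  have "((\<lambda>w. u w * v w) has_derivative (\<lambda>e. u z * dd e v z + dd e u z * v z)) (at z)"
    using assms by (intro has_derivative_mult has_derivative_dd)
  then have "dd d (\<lambda>w. u w * v w) z = u z * dd d v z + dd d u z * v z" by (rule dd_eq)
  then show ?thesis by (simp add: add.commute)
qed

lemma dd_sum:
  assumes "\<And>i. i \<in> I \<Longrightarrow> u i differentiable (at z)"
  shows "dd d (\<lambda>w. \<Sum>i\<in>I. u i w) z = (\<Sum>i\<in>I. dd d (u i) z)"
proof -
  have "((\<lambda>w. \<Sum>i\<in>I. u i w) has_derivative (\<lambda>e. \<Sum>i\<in>I. dd e (u i) z)) (at z)"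
    using assms by (intro has_derivative_sum has_derivative_dd)
  then show ?thesis by (rule dd_eq)
qed

lemma dd_bounded_linear:
  assumes "bounded_linear L" "u differentiable (at z)"
  shows "dd d (\<lambda>w. L (u w)) z = L (dd d u z)"
proof -
  have "((\<lambda>w. L (u w)) has_derivative (\<lambda>e. L (dd e u z))) (at z)"
    using bounded_linear.has_derivative[OF assms(1) has_derivative_dd[OF assms(2)]] .
  then show ?thesis by (rule dd_eq)
qed

lemma dd_inverse:
  fixes u :: "complex \<Rightarrow> 'a::real_normed_field"
  assumes "u differentiable (at z)" "u z \<noteq> 0"
  shows "dd d (\<lambda>w. inverse (u w)) z = - (dd d u z * (inverse (u z) * inverse (u z)))"
proof -
  have "((\<lambda>w. inverse (u w)) has_derivative (\<lambda>e. - (inverse (u z) * dd e u z * inverse (u z)))) (at z)"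
    using assms by (intro Deriv.has_derivative_inverse has_derivative_dd)
  then have "dd d (\<lambda>w. inverse (u w)) z = - (inverse (u z) * dd d u z * inverse (u z))" by (rule dd_eq)
  then show ?thesis by (simp add: mult.assoc mult.left_commute)
qed

lemma dd_field_derivative:
  assumes "(u has_field_derivative c) (at z)"
  shows "dd d u z = c * d"
proof -
  have "(u has_derivative (\<lambda>e. c * e)) (at z)" using assms by (simp add: has_field_derivative_def)
  then show ?thesis by (rule dd_eq)
qed

lemma dd_linear_combination:
  assumes "u differentiable (at z)"
  shows "dd d u z = Re d *\<^sub>R dd 1 u z + Im d *\<^sub>R dd \<i> u z"
proof -
  have l: "linear (\<lambda>v. dd v u z)"
    using has_derivative_dd[OF assms] has_derivative_linear by blast
  have "d = Re d *\<^sub>R 1 + Im d *\<^sub>R \<i>" by (simp add: complex_eq_iff)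
  then have "dd d u z = dd (Re d *\<^sub>R 1 + Im d *\<^sub>R \<i>) u z" by simp
  also have "\<dots> = Re d *\<^sub>R dd 1 u z + Im d *\<^sub>R dd \<i> u z"
    using linear_add[OF l] linear_scale[OF l] by metis
  finally show ?thesis .
qed

lemma has_vector_derivative_line:
  assumes "u differentiable (at (a + of_real t * v))"
  shows "((\<lambda>t. u (a + of_real t * v)) has_vector_derivative dd v u (a + of_real t * v)) (at t)"
proof -
  have l: "((\<lambda>t. a + complex_of_real t * v) has_derivative (\<lambda>h. of_real h * v)) (at t)"
    by (auto intro!: derivative_eq_intros)
  have "((\<lambda>t. u (a + complex_of_real t * v)) has_derivative (\<lambda>h. dd (of_real h * v) u (a + of_real t * v))) (at t)"
    using has_derivative_compose[OF l has_derivative_dd[OF assms]] .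
  moreover have "dd (of_real h * v) u (a + of_real t * v) = h *\<^sub>R dd v u (a + of_real t * v)" for h
    using linear_scale[OF has_derivative_linear[OF has_derivative_dd[OF assms]], of h v]
    by (simp add: scaleR_conv_of_real)
  ultimately show ?thesis by (simp add: has_vector_derivative_def)
qed

section \<open>Smooth functions\<close>

lemma C_k_on_SucD: "C_k_on (Suc k) U u \<Longrightarrow> C_k_on k U u"
proof (induction k arbitrary: u)
  case 0 then show ?case by (simp add: differentiable_imp_continuous_on)
next
  case (Suc k) then show ?case by (metis C_k_on.simps(2))
qed

lemma C_k_on_subset: "C_k_on k U u \<Longrightarrow> V \<subseteq> U \<Longrightarrow> C_k_on k V u"
  by (induction k arbitrary: u) (auto intro: continuous_on_subset differentiable_on_subset)

lemma differentiable_on_openD: "u differentiable_on U \<Longrightarrow> open U \<Longrightarrow> z \<in> U \<Longrightarrow> u differentiable (at z)"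
  by (metis at_within_open differentiable_on_def)

lemma differentiable_on_openI: "open U \<Longrightarrow> (\<And>z. z \<in> U \<Longrightarrow> u differentiable (at z)) \<Longrightarrow> u differentiable_on U"
  by (metis at_within_open differentiable_on_def)

lemma differentiable_cong_open:
  fixes u v :: "complex \<Rightarrow> 'a::real_normed_vector"
  assumes "open T" "z \<in> T" "\<And>w. w \<in> T \<Longrightarrow> u w = v w" "u differentiable (at z)"
  shows "v differentiable (at z)"
  using has_derivative_transform_within_open[OF has_derivative_dd[OF assms(4)] assms(1,2)] assms(3)
  by (auto simp: differentiable_def)

lemma C_k_on_cong:
  assumes "open U" "\<And>z. z \<in> U \<Longrightarrow> u z = v z" "C_k_on k U u"
  shows "C_k_on k U v"
  using assms(2,3)
proof (induction k arbitrary: u v)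
  case 0 then show ?case using continuous_on_cong[of U U u v] by simp
next
  case (Suc k)
  have "v differentiable_on U"
    using Suc.prems assms(1)
    by (auto intro!: differentiable_on_openI intro: differentiable_cong_open differentiable_on_openD)
  moreover have "C_k_on k U (dd d v)" if "C_k_on k U (dd d u)" for d
    by (rule Suc.IH[of "dd d u"]) (use that Suc.prems assms(1) in \<open>auto intro!: dd_cong\<close>)
  ultimately show ?case using Suc.prems by (simp add: dx_dd dy_dd)
qed

text \<open>Being \<open>C\<^sup>k\<close> is local; this is how fields whose sign is only locally constant are shown to be smooth.\<close>

lemma C_k_on_locally:
  assumes "open U" "\<And>z. z \<in> U \<Longrightarrow> \<exists>T. open T \<and> z \<in> T \<and> C_k_on k T u"
  shows "C_k_on k U u"
  using assms(2)
proof (induction k arbitrary: u)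
  case 0
  have "continuous (at z) u" if "z \<in> U" for z
    using 0[OF that] by (auto simp: continuous_on_eq_continuous_at)
  then show ?case by (simp add: continuous_at_imp_continuous_on)
next
  case (Suc k)
  have 1: "u differentiable (at z)" if "z \<in> U" for z
  proof -
    obtain T where "open T" "z \<in> T" "u differentiable_on T" using Suc.prems[OF \<open>z \<in> U\<close>] by auto
    then show ?thesis by (blast intro: differentiable_on_openD)
  qed
  have 2: "\<exists>T. open T \<and> z \<in> T \<and> C_k_on k T (dx u) \<and> C_k_on k T (dy u)" if zU: "z \<in> U" for z
  proof -
    obtain T where "open T" "z \<in> T" "C_k_on (Suc k) T u" using Suc.prems[OF zU] by blast
    then show ?thesis unfolding C_k_on.simps(2) by blast
  qed
  have "C_k_on k U (dx u)" by (rule Suc.IH) (use 2 in blast)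
  moreover have "C_k_on k U (dy u)" by (rule Suc.IH) (use 2 in blast)
  moreover have "u differentiable_on U" using 1 assms(1) by (rule differentiable_on_openI[rotated])
  ultimately show ?case unfolding C_k_on.simps(2) by blast
qed

lemma smooth_onD:
  assumes "smooth_on U u" "open U" "z \<in> U"
  shows "u differentiable (at z)"
proof -
  have "C_k_on (Suc 0) U u" using assms(1) unfolding smooth_on_def by blast
  then show ?thesis using assms differentiable_on_openD by auto
qed

lemma smooth_on_continuous: "smooth_on U u \<Longrightarrow> continuous_on U u"
  unfolding smooth_on_def using C_k_on.simps(1)[of U u] by blast

lemma smooth_on_dd:
  assumes "smooth_on U u"
  shows "smooth_on U (dd 1 u)" "smooth_on U (dd \<i> u)"
proof -
  have "C_k_on (Suc k) U u" for k using assms unfolding smooth_on_def by blast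
  then show "smooth_on U (dd 1 u)" "smooth_on U (dd \<i> u)"
    by (auto simp: smooth_on_def dx_dd dy_dd)
qed

lemma smooth_on_subset: "smooth_on U u \<Longrightarrow> V \<subseteq> U \<Longrightarrow> smooth_on V u"
  unfolding smooth_on_def using C_k_on_subset by blast

lemma smooth_on_cong:
  "smooth_on U u \<Longrightarrow> open U \<Longrightarrow> (\<And>z. z \<in> U \<Longrightarrow> u z = v z) \<Longrightarrow> smooth_on U v"
  unfolding smooth_on_def using C_k_on_cong by blast

lemma smooth_on_locally:
  assumes "open U" "\<And>z. z \<in> U \<Longrightarrow> \<exists>T. open T \<and> z \<in> T \<and> smooth_on T u"
  shows "smooth_on U u"
  unfolding smooth_on_def
  using assms(2) by (intro allI C_k_on_locally[OF assms(1)]) (force simp: smooth_on_def)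

lemma C_k_on_const: "C_k_on k U (\<lambda>z. c)"
proof (induction k arbitrary: c)
  case (Suc k)
  have "dx (\<lambda>z::complex. c) = (\<lambda>z. 0)" "dy (\<lambda>z::complex. c) = (\<lambda>z. 0)" by (auto simp: dx_dd dy_dd)
  with Suc show ?case by simp
qed simp

lemma C_k_on_add:
  assumes "open U" "C_k_on k U u" "C_k_on k U v"
  shows "C_k_on k U (\<lambda>z. u z + v z)"
  using assms(2,3)
proof (induction k arbitrary: u v)
  case 0 then show ?case by (auto intro: continuous_intros)
next
  case (Suc k)
  have d: "u differentiable (at z)" "v differentiable (at z)" if "z \<in> U" for z
    using Suc.prems that assms(1) by (auto intro: differentiable_on_openD)
  have "C_k_on k U (dd e (\<lambda>z. u z + v z))" if "C_k_on k U (dd e u)" "C_k_on k U (dd e v)" for e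
    by (rule C_k_on_cong[OF assms(1) _ Suc.IH[OF that]]) (simp add: dd_add d)
  then show ?case using Suc.prems by (simp add: dx_dd dy_dd differentiable_on_add)
qed

lemma C_k_on_mult:
  fixes u v :: "complex \<Rightarrow> 'a::real_normed_field"
  assumes "open U" "C_k_on k U u" "C_k_on k U v"
  shows "C_k_on k U (\<lambda>z. u z * v z)"
  using assms(2,3)
proof (induction k arbitrary: u v)
  case 0 then show ?case by (auto intro: continuous_intros)
next
  case (Suc k)
  have d: "u differentiable (at z)" "v differentiable (at z)" if "z \<in> U" for z
    using Suc.prems that assms(1) by (auto intro: differentiable_on_openD)
  note k = C_k_on_SucD[OF Suc.prems(1)] C_k_on_SucD[OF Suc.prems(2)]
  have "C_k_on k U (dd e (\<lambda>z. u z * v z))" if e: "C_k_on k U (dd e u)" "C_k_on k U (dd e v)" for e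
    by (rule C_k_on_cong[OF assms(1) _ C_k_on_add[OF assms(1) Suc.IH[OF e(1) k(2)] Suc.IH[OF k(1) e(2)]]])
       (simp add: dd_mult d)
  moreover have "(\<lambda>z. u z * v z) differentiable_on U"
    using Suc.prems by (auto intro!: differentiable_on_mult)
  ultimately show ?case using Suc.prems by (simp add: dx_dd dy_dd)
qed

lemma C_k_on_bounded_linear:
  assumes "bounded_linear L" "open U" "C_k_on k U u"
  shows "C_k_on k U (\<lambda>z. L (u z))"
  using assms(3)
proof (induction k arbitrary: u)
  case 0 then show ?case using assms(1) by (auto intro: bounded_linear.continuous_on)
next
  case (Suc k)
  have d: "u differentiable (at z)" if "z \<in> U" for z
    using Suc.prems that assms(2) by (auto intro: differentiable_on_openD)
  have "C_k_on k U (dd e (\<lambda>z. L (u z)))" if "C_k_on k U (dd e u)" for e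
    by (rule C_k_on_cong[OF assms(2) _ Suc.IH[OF that]]) (simp add: dd_bounded_linear assms d)
  moreover have "(\<lambda>z. L (u z)) differentiable (at z)" if "z \<in> U" for z
    using d[OF that] bounded_linear.has_derivative[OF assms(1)] by (auto simp: differentiable_def)
  ultimately show ?case using Suc.prems assms(2) by (simp add: dx_dd dy_dd differentiable_on_openI)
qed

lemma C_k_on_inverse:
  fixes u :: "complex \<Rightarrow> 'a::real_normed_field"
  assumes "open U" "\<And>z. z \<in> U \<Longrightarrow> u z \<noteq> 0" "C_k_on k U u"
  shows "C_k_on k U (\<lambda>z. inverse (u z))"
  using assms(3)
proof (induction k)
  case 0 then show ?case using assms(2) by (auto intro: continuous_intros)
next
  case (Suc k)
  have d: "u differentiable (at z)" if "z \<in> U" for z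
    using Suc.prems that assms(1) by (auto intro: differentiable_on_openD)
  note inv = Suc.IH[OF C_k_on_SucD[OF Suc.prems]]
  have "C_k_on k U (dd e (\<lambda>z. inverse (u z)))" if e: "C_k_on k U (dd e u)" for e
    by (rule C_k_on_cong[OF assms(1) _ C_k_on_bounded_linear[OF bounded_linear_minus[OF bounded_linear_ident] assms(1)
          C_k_on_mult[OF assms(1) e C_k_on_mult[OF assms(1) inv inv]]]])
       (simp add: dd_inverse d assms(2))
  moreover have "(\<lambda>z. inverse (u z)) differentiable (at z)" if "z \<in> U" for z
    using d[OF that] assms(2)[OF that] by (rule differentiable_inverse)
  ultimately show ?case using Suc.prems assms(1) by (simp add: dx_dd dy_dd differentiable_on_openI)
qed

named_theorems smooth_intros

lemma smooth_on_const [smooth_intros]: "smooth_on U (\<lambda>z. c)"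
  by (simp add: smooth_on_def C_k_on_const)

lemma smooth_on_add [smooth_intros]:
  "open U \<Longrightarrow> smooth_on U u \<Longrightarrow> smooth_on U v \<Longrightarrow> smooth_on U (\<lambda>z. u z + v z)"
  by (simp add: smooth_on_def C_k_on_add)

lemma smooth_on_mult [smooth_intros]:
  fixes u v :: "complex \<Rightarrow> 'a::real_normed_field"
  shows "open U \<Longrightarrow> smooth_on U u \<Longrightarrow> smooth_on U v \<Longrightarrow> smooth_on U (\<lambda>z. u z * v z)"
  by (simp add: smooth_on_def C_k_on_mult)

lemma smooth_on_bounded_linear:
  "bounded_linear L \<Longrightarrow> open U \<Longrightarrow> smooth_on U u \<Longrightarrow> smooth_on U (\<lambda>z. L (u z))"
  by (simp add: smooth_on_def C_k_on_bounded_linear)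

lemma smooth_on_minus [smooth_intros]:
  "open U \<Longrightarrow> smooth_on U u \<Longrightarrow> smooth_on U (\<lambda>z. - u z)"
  by (rule smooth_on_bounded_linear[OF bounded_linear_minus[OF bounded_linear_ident]])

lemma smooth_on_diff [smooth_intros]:
  assumes "open U" "smooth_on U u" "smooth_on U v" shows "smooth_on U (\<lambda>z. u z - v z)"
  using smooth_on_add[OF assms(1,2) smooth_on_minus[OF assms(1,3)]] by simp

lemma smooth_on_sum [smooth_intros]:
  assumes "open U" "\<And>i. i \<in> I \<Longrightarrow> smooth_on U (u i)"
  shows "smooth_on U (\<lambda>z. \<Sum>i\<in>I. u i z)"
  using assms(2) by (induction I rule: infinite_finite_induct) (auto intro: smooth_intros assms(1))

lemma smooth_on_prod [smooth_intros]:
  fixes u :: "'i \<Rightarrow> complex \<Rightarrow> 'a::real_normed_field"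
  assumes "open U" "\<And>i. i \<in> I \<Longrightarrow> smooth_on U (u i)"
  shows "smooth_on U (\<lambda>z. \<Prod>i\<in>I. u i z)"
  using assms(2) by (induction I rule: infinite_finite_induct) (auto intro: smooth_intros assms(1))

lemma smooth_on_power [smooth_intros]:
  fixes u :: "complex \<Rightarrow> 'a::real_normed_field"
  assumes "open U" "smooth_on U u"
  shows "smooth_on U (\<lambda>z. u z ^ n)"
  by (induction n) (auto intro: smooth_intros assms)

lemma smooth_on_inverse [smooth_intros]:
  fixes u :: "complex \<Rightarrow> 'a::real_normed_field"
  shows "open U \<Longrightarrow> smooth_on U u \<Longrightarrow> (\<And>z. z \<in> U \<Longrightarrow> u z \<noteq> 0) \<Longrightarrow> smooth_on U (\<lambda>z. inverse (u z))"
  by (simp add: smooth_on_def C_k_on_inverse)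

lemma smooth_on_divide [smooth_intros]:
  fixes u :: "complex \<Rightarrow> 'a::real_normed_field"
  shows "open U \<Longrightarrow> smooth_on U u \<Longrightarrow> smooth_on U v \<Longrightarrow> (\<And>z. z \<in> U \<Longrightarrow> v z \<noteq> 0)
    \<Longrightarrow> smooth_on U (\<lambda>z. u z / v z)"
  by (simp add: divide_inverse smooth_on_mult smooth_on_inverse)

lemma smooth_on_cnj [smooth_intros]: "open U \<Longrightarrow> smooth_on U u \<Longrightarrow> smooth_on U (\<lambda>z. cnj (u z))"
  by (rule smooth_on_bounded_linear[OF bounded_linear_cnj])

lemma smooth_on_Re [smooth_intros]: "open U \<Longrightarrow> smooth_on U u \<Longrightarrow> smooth_on U (\<lambda>z. Re (u z))"
  by (rule smooth_on_bounded_linear[OF bounded_linear_Re])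

lemma smooth_on_Im [smooth_intros]: "open U \<Longrightarrow> smooth_on U u \<Longrightarrow> smooth_on U (\<lambda>z. Im (u z))"
  by (rule smooth_on_bounded_linear[OF bounded_linear_Im])

lemma smooth_on_of_real [smooth_intros]:
  "open U \<Longrightarrow> smooth_on U u \<Longrightarrow> smooth_on U (\<lambda>z. of_real (u z) :: complex)"
  by (rule smooth_on_bounded_linear[OF bounded_linear_of_real])

lemma holomorphic_imp_C_k_on:
  assumes "open U" "u holomorphic_on U"
  shows "C_k_on k U u"
  using assms(2)
proof (induction k arbitrary: u)
  case 0 then show ?case by (simp add: holomorphic_on_imp_continuous_on)
next
  case (Suc k)
  have d: "(u has_field_derivative deriv u z) (at z)" if "z \<in> U" for z
    using Suc.prems that assms(1) by (simp add: holomorphic_derivI)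
  have "C_k_on k U (dd e u)" for e
    by (rule C_k_on_cong[OF assms(1) _ Suc.IH[of "\<lambda>z. deriv u z * e"]])
       (use Suc.prems assms(1) in \<open>auto intro!: holomorphic_intros simp: dd_field_derivative[OF d]\<close>)
  moreover have "u differentiable_on U"
    using Suc.prems by (simp add: assms(1) differentiable_on_openI field_differentiable_imp_differentiable
        holomorphic_on_imp_differentiable_at)
  ultimately show ?case by (simp add: dx_dd dy_dd)
qed

lemma smooth_on_holomorphic: "open U \<Longrightarrow> u holomorphic_on U \<Longrightarrow> smooth_on U u"
  by (simp add: smooth_on_def holomorphic_imp_C_k_on)

section \<open>The operators \<open>\<partial>\<close> and \<open>\<partial>\<close>-bar\<close>

definition dzb :: "(complex \<Rightarrow> complex) \<Rightarrow> complex \<Rightarrow> complex" where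
  "dzb u z = (dx u z + \<i> * dy u z) / 2"

lemma dz_cong: "open T \<Longrightarrow> z \<in> T \<Longrightarrow> (\<And>w. w \<in> T \<Longrightarrow> u w = v w) \<Longrightarrow> dz u z = dz v z"
  using dd_cong[of T z u v] by (simp add: dz_def dx_dd dy_dd)

lemma dzb_cong: "open T \<Longrightarrow> z \<in> T \<Longrightarrow> (\<And>w. w \<in> T \<Longrightarrow> u w = v w) \<Longrightarrow> dzb u z = dzb v z"
  using dd_cong[of T z u v] by (simp add: dzb_def dx_dd dy_dd)

lemma dz_const [simp]: "dz (\<lambda>w. c) z = 0" and dzb_const [simp]: "dzb (\<lambda>w. c) z = 0"
  by (simp_all add: dz_def dzb_def dx_dd dy_dd)

lemma
  assumes "u differentiable (at z)" "v differentiable (at z)"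
  shows dz_add: "dz (\<lambda>w. u w + v w) z = dz u z + dz v z"
    and dzb_add: "dzb (\<lambda>w. u w + v w) z = dzb u z + dzb v z"
    and dz_diff: "dz (\<lambda>w. u w - v w) z = dz u z - dz v z"
    and dzb_diff: "dzb (\<lambda>w. u w - v w) z = dzb u z - dzb v z"
    and dz_mult: "dz (\<lambda>w. u w * v w) z = dz u z * v z + u z * dz v z"
    and dzb_mult: "dzb (\<lambda>w. u w * v w) z = dzb u z * v z + u z * dzb v z"
  by (simp_all add: dz_def dzb_def dx_dd dy_dd dd_add dd_diff dd_mult assms field_simps)

lemma
  assumes "\<And>i. i \<in> I \<Longrightarrow> u i differentiable (at z)"
  shows dz_sum: "dz (\<lambda>w. \<Sum>i\<in>I. u i w) z = (\<Sum>i\<in>I. dz (u i) z)"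
    and dzb_sum: "dzb (\<lambda>w. \<Sum>i\<in>I. u i w) z = (\<Sum>i\<in>I. dzb (u i) z)"
  by (simp_all add: dz_def dzb_def dx_dd dy_dd dd_sum assms sum_distrib_left sum_subtractf sum.distrib
      flip: sum_divide_distrib)

lemma
  assumes "u differentiable (at z)"
  shows dz_cmult: "dz (\<lambda>w. c * u w) z = c * dz u z"
    and dzb_cmult: "dzb (\<lambda>w. c * u w) z = c * dzb u z"
    and dz_minus: "dz (\<lambda>w. - u w) z = - dz u z"
    and dzb_minus: "dzb (\<lambda>w. - u w) z = - dzb u z"
  using dz_mult[OF differentiable_const[of c] assms] dzb_mult[OF differentiable_const[of c] assms]
    dz_mult[OF differentiable_const[of "-1"] assms] dzb_mult[OF differentiable_const[of "-1"] assms]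
  by simp_all

lemma
  assumes "u differentiable (at z)"
  shows dz_cnj: "dz (\<lambda>w. cnj (u w)) z = cnj (dzb u z)"
    and dzb_cnj: "dzb (\<lambda>w. cnj (u w)) z = cnj (dz u z)"
  by (simp_all add: dz_def dzb_def dx_dd dy_dd dd_bounded_linear[OF bounded_linear_cnj assms])

lemma differentiable_cnj: "u differentiable (at z) \<Longrightarrow> (\<lambda>w. cnj (u w)) differentiable (at z)"
  unfolding differentiable_def using bounded_linear.has_derivative[OF bounded_linear_cnj] by blast

lemma
  assumes "u differentiable (at z)" "u z \<noteq> 0"
  shows dz_inverse: "dz (\<lambda>w. inverse (u w)) z = - dz u z / (u z)\<^sup>2"
    and dzb_inverse: "dzb (\<lambda>w. inverse (u w)) z = - dzb u z / (u z)\<^sup>2"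
proof -
  have "(- (a * b) - \<i> * - (c * b)) / 2 = - ((a - \<i> * c) / 2) * b"
    "(- (a * b) + \<i> * - (c * b)) / 2 = - ((a + \<i> * c) / 2) * b" for a b c :: complex
    by (simp_all add: field_simps)
  moreover have "- X / (u z)\<^sup>2 = - X * (inverse (u z) * inverse (u z))" for X
    by (simp add: divide_inverse power2_eq_square)
  ultimately show "dz (\<lambda>w. inverse (u w)) z = - dz u z / (u z)\<^sup>2"
    "dzb (\<lambda>w. inverse (u w)) z = - dzb u z / (u z)\<^sup>2"
    unfolding dz_def dzb_def dx_dd dy_dd dd_inverse[OF assms] by metis+
qed

lemma
  assumes "(u has_field_derivative c) (at z)"
  shows dz_field_derivative: "dz u z = c" and dzb_field_derivative: "dzb u z = 0"
proof -
  have "\<i> * (c * \<i>) = - c" by (simp add: complex_eq_iff)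
  then show "dz u z = c" "dzb u z = 0"
    by (simp_all add: dz_def dzb_def dx_dd dy_dd dd_field_derivative[OF assms])
qed

lemma field_derivative_dz:
  assumes "u differentiable (at z)" "dzb u z = 0"
  shows "(u has_field_derivative dz u z) (at z)"
proof -
  have "dd 1 u z + \<i> * dd \<i> u z = 0" using assms(2) by (simp add: dzb_def dx_dd dy_dd)
  then have e: "dd \<i> u z = \<i> * dd 1 u z" by (simp add: complex_eq_iff)
  have "dz u z = dd 1 u z" unfolding dz_def dx_dd dy_dd e by (simp add: complex_eq_iff)
  moreover have "dd d u z = dd 1 u z * d" for d
    unfolding dd_linear_combination[OF assms(1), of d] e by (simp add: complex_eq_iff)
  then have "(\<lambda>d. dd d u z) = (\<lambda>d. dd 1 u z * d)" by (rule ext)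
  then have "(u has_derivative (\<lambda>d. dd 1 u z * d)) (at z)"
    using has_derivative_dd[OF assms(1)] by metis
  ultimately show ?thesis by (simp add: has_field_derivative_def)
qed

lemma smooth_on_dz [smooth_intros]:
  assumes "open U" "smooth_on U u" shows "smooth_on U (dz u)"
proof -
  have "smooth_on U (\<lambda>z. (dd 1 u z - \<i> * dd \<i> u z) / 2)"
    by (intro smooth_intros assms smooth_on_dd) auto
  then show ?thesis by (rule smooth_on_cong) (auto simp: assms dz_def dx_dd dy_dd)
qed

lemma smooth_on_dzb [smooth_intros]:
  assumes "open U" "smooth_on U u" shows "smooth_on U (dzb u)"
proof -
  have "smooth_on U (\<lambda>z. (dd 1 u z + \<i> * dd \<i> u z) / 2)"
    by (intro smooth_intros assms smooth_on_dd) auto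
  then show ?thesis by (rule smooth_on_cong) (auto simp: assms dzb_def dx_dd dy_dd)
qed

section \<open>Symmetry of second derivatives\<close>

lemma MVT_line:
  fixes u :: "complex \<Rightarrow> real"
  assumes "h > 0" "\<And>t. 0 \<le> t \<Longrightarrow> t \<le> h \<Longrightarrow> u differentiable (at (a + of_real t * v))"
  obtains t where "0 < t" "t < h" "u (a + of_real h * v) - u a = h * dd v u (a + of_real t * v)"
proof -
  have "((\<lambda>t. u (a + of_real t * v)) has_real_derivative dd v u (a + of_real t * v)) (at t)"
    if "0 \<le> t" "t \<le> h" for t
    using has_vector_derivative_line[OF assms(2)[OF that]]
    by (simp add: has_real_derivative_iff_has_vector_derivative)
  from MVT2[OF assms(1) this] that show ?thesis by auto
qed

text \<open>The second difference is symmetric in the two directions, which is what makes mixed derivatives agree in the limit.\<close>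

lemma second_difference:
  fixes u :: "complex \<Rightarrow> real"
  assumes "open U" "smooth_on U (dd v u)" "smooth_on U u" "h > 0" "norm v = 1" "norm w = 1"
    and sub: "cball z (2 * h) \<subseteq> U"
  obtains q where "norm (q - z) \<le> 2 * h"
    "u (z + of_real h * w + of_real h * v) - u (z + of_real h * w) - (u (z + of_real h * v) - u z)
       = h * h * dd w (dd v u) q"
proof -
  define p where "p = (\<lambda>a. u (a + of_real h * w) - u a)"
  have U: "z + of_real s * w + of_real t * v \<in> U" if "0 \<le> t" "t \<le> h" "0 \<le> s" "s \<le> h" for s t
  proof -
    have "norm (of_real s * w + of_real t * v) \<le> 2 * h"
      using norm_triangle_ineq[of "of_real s * w" "of_real t * v"] that assms(5,6) by (simp add: norm_mult)
    then have "dist (z + (of_real s * w + of_real t * v)) z \<le> 2 * h" by (simp add: dist_norm)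
    then have "z + of_real s * w + of_real t * v \<in> cball z (2 * h)"
      by (simp add: dist_commute add.assoc)
    then show ?thesis using sub by blast
  qed
  have du: "u differentiable (at x)" if "x \<in> U" for x using smooth_onD assms(1,3) that by blast
  have ddv: "dd v u differentiable (at x)" if "x \<in> U" for x using smooth_onD assms(1,2) that by blast
  have sh: "(\<lambda>a. u (a + of_real h * w)) differentiable (at x)"
    and sh': "dd v (\<lambda>a. u (a + of_real h * w)) x = dd v u (x + of_real h * w)"
    if "x + of_real h * w \<in> U" for x
  proof -
    have "((\<lambda>a. a + of_real h * w) has_derivative (\<lambda>d. d)) (at x)"
      by (auto intro!: derivative_eq_intros)
    from has_derivative_compose[OF this has_derivative_dd[OF du[OF that]]]
    have "((\<lambda>a. u (a + of_real h * w)) has_derivative (\<lambda>d. dd d u (x + of_real h * w))) (at x)" .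
    then show "(\<lambda>a. u (a + of_real h * w)) differentiable (at x)"
      "dd v (\<lambda>a. u (a + of_real h * w)) x = dd v u (x + of_real h * w)"
      by (auto simp: differentiable_def dest: dd_eq)
  qed
  have x1: "z + of_real t * v \<in> U" "z + of_real t * v + of_real h * w \<in> U" if "0 \<le> t" "t \<le> h" for t
    using U[OF that, of 0] U[OF that, of h] assms(4) by (auto simp: algebra_simps)
  have "p differentiable (at (z + of_real t * v))" if "0 \<le> t" "t \<le> h" for t
    unfolding p_def using sh[OF x1(2)[OF that]] du[OF x1(1)[OF that]] by (rule differentiable_diff)
  then obtain t where t: "0 < t" "t < h" "p (z + of_real h * v) - p z = h * dd v p (z + of_real t * v)"
    using MVT_line[OF assms(4), of p z v] by blast
  have "dd v p (z + of_real t * v) = dd v u (z + of_real t * v + of_real h * w) - dd v u (z + of_real t * v)"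
    unfolding p_def
    using dd_diff[OF sh du] sh' x1 t by simp
  moreover obtain s where s: "0 < s" "s < h"
    "dd v u (z + of_real t * v + of_real h * w) - dd v u (z + of_real t * v)
      = h * dd w (dd v u) (z + of_real t * v + of_real s * w)"
  proof (rule MVT_line[OF assms(4), of "dd v u" "z + of_real t * v" w])
    show "dd v u differentiable at (z + complex_of_real t * v + complex_of_real s * w)"
      if "0 \<le> s" "s \<le> h" for s
      using ddv U[of t s] that t by (simp add: algebra_simps)
  qed (use that in auto)
  ultimately have "p (z + of_real h * v) - p z = h * h * dd w (dd v u) (z + of_real t * v + of_real s * w)"
    using t by simp
  moreover have "norm (z + of_real t * v + of_real s * w - z) \<le> 2 * h"
    using norm_triangle_ineq[of "of_real t * v" "of_real s * w"] s t assms(5,6)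
    by (simp add: norm_mult algebra_simps)
  ultimately show ?thesis
    by (intro that[of "z + of_real t * v + of_real s * w"]) (auto simp: p_def algebra_simps)
qed

lemma dd_commute_real:
  fixes u :: "complex \<Rightarrow> real"
  assumes "open U" "smooth_on U u" "z \<in> U"
  shows "dd 1 (dd \<i> u) z = dd \<i> (dd 1 u) z"
proof (rule ccontr)
  assume ne: "dd 1 (dd \<i> u) z \<noteq> dd \<i> (dd 1 u) z"
  define e where "e = \<bar>dd 1 (dd \<i> u) z - dd \<i> (dd 1 u) z\<bar> / 2"
  have e: "e > 0" using ne by (simp add: e_def)
  have "continuous (at z) (dd 1 (dd \<i> u))" "continuous (at z) (dd \<i> (dd 1 u))"
    using smooth_on_continuous[OF smooth_on_dd(1)[OF smooth_on_dd(2)[OF assms(2)]]]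
      smooth_on_continuous[OF smooth_on_dd(2)[OF smooth_on_dd(1)[OF assms(2)]]] assms(1,3)
    by (auto simp: continuous_on_eq_continuous_at)
  then obtain d1 d2 where d: "d1 > 0" "\<And>x. dist x z < d1 \<Longrightarrow> dist (dd 1 (dd \<i> u) x) (dd 1 (dd \<i> u) z) < e"
     "d2 > 0" "\<And>x. dist x z < d2 \<Longrightarrow> dist (dd \<i> (dd 1 u) x) (dd \<i> (dd 1 u) z) < e"
    unfolding continuous_at_eps_delta using e by metis
  obtain r where r: "r > 0" "cball z r \<subseteq> U" using assms(1,3) open_contains_cball by blast
  define h where "h = min (r / 2) (min (d1 / 4) (d2 / 4))"
  have h: "h > 0" "2 * h \<le> r" "2 * h < d1" "2 * h < d2" using r d by (auto simp: h_def)
  then have sub: "cball z (2 * h) \<subseteq> U" using r(2) by force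
  obtain q where q: "norm (q - z) \<le> 2 * h"
    "u (z + of_real h * 1 + of_real h * \<i>) - u (z + of_real h * 1) - (u (z + of_real h * \<i>) - u z)
       = h * h * dd 1 (dd \<i> u) q"
    using second_difference[OF assms(1) smooth_on_dd(2)[OF assms(2)] assms(2) h(1) _ _ sub, of 1] by auto
  obtain q' where q': "norm (q' - z) \<le> 2 * h"
    "u (z + of_real h * \<i> + of_real h * 1) - u (z + of_real h * \<i>) - (u (z + of_real h * 1) - u z)
       = h * h * dd \<i> (dd 1 u) q'"
    using second_difference[OF assms(1) smooth_on_dd(1)[OF assms(2)] assms(2) h(1) _ _ sub, of \<i>] by auto
  have "h * h * dd 1 (dd \<i> u) q = h * h * dd \<i> (dd 1 u) q'"
    using q(2) q'(2) by (simp add: algebra_simps)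
  then have "dd 1 (dd \<i> u) q = dd \<i> (dd 1 u) q'" using h by simp
  moreover have "dist (dd 1 (dd \<i> u) q) (dd 1 (dd \<i> u) z) < e" using d(2) q(1) h by (simp add: dist_norm)
  moreover have "dist (dd \<i> (dd 1 u) q') (dd \<i> (dd 1 u) z) < e" using d(4) q'(1) h by (simp add: dist_norm)
  ultimately show False unfolding dist_real_def e_def by argo
qed

lemma dd_commute:
  fixes u :: "complex \<Rightarrow> complex"
  assumes "open U" "smooth_on U u" "z \<in> U"
  shows "dd 1 (dd \<i> u) z = dd \<i> (dd 1 u) z"
proof -
  have *: "dd d (dd e (\<lambda>w. L (u w))) z = L (dd d (dd e u) z)"
    if "bounded_linear L" "smooth_on U (dd e u)" for d e and L :: "complex \<Rightarrow> real"
  proof -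
    have "dd d (dd e (\<lambda>w. L (u w))) z = dd d (\<lambda>w. L (dd e u w)) z"
      by (rule dd_cong[OF assms(1,3)]) (metis dd_bounded_linear that(1) smooth_onD assms(1,2))
    also have "\<dots> = L (dd d (dd e u) z)"
      by (metis dd_bounded_linear that smooth_onD assms(1,3))
    finally show ?thesis .
  qed
  note s = smooth_on_dd[OF assms(2)]
  show ?thesis
    using dd_commute_real[OF assms(1) smooth_on_Re[OF assms(1,2)] assms(3)]
      dd_commute_real[OF assms(1) smooth_on_Im[OF assms(1,2)] assms(3)]
    by (simp add: * s bounded_linear_Re bounded_linear_Im complex_eq_iff)
qed

text \<open>Both orders of differentiation give a quarter of the Laplacian; the commutation drives the structure equations of the harmonic sequence.\<close>

lemma dz_dzb:
  assumes "open U" "smooth_on U u" "z \<in> U"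
  shows "dzb (dz u) z = (dx (dx u) z + dy (dy u) z) / 4"
    and "dz (dzb u) z = (dx (dx u) z + dy (dy u) z) / 4"
proof -
  have d: "dd 1 u differentiable (at z)" "dd \<i> u differentiable (at z)"
    using smooth_on_dd[OF assms(2)] smooth_onD assms(1,3) by blast+
  have D: "(dd 1 u has_derivative (\<lambda>v. dd v (dd 1 u) z)) (at z)" "(dd \<i> u has_derivative (\<lambda>v. dd v (dd \<i> u) z)) (at z)"
    using d by (auto intro: has_derivative_dd)
  have 1: "dd e (dz u) z = (dd e (dd 1 u) z - \<i> * dd e (dd \<i> u) z) / 2" for e
  proof -
    have "(dz u has_derivative (\<lambda>v. (dd v (dd 1 u) z - \<i> * dd v (dd \<i> u) z) / 2)) (at z)"
      unfolding dz_def dx_dd dy_dd by (auto intro!: derivative_eq_intros D)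
    from dd_eq[OF this] show ?thesis .
  qed
  have 2: "dd e (dzb u) z = (dd e (dd 1 u) z + \<i> * dd e (dd \<i> u) z) / 2" for e
  proof -
    have "(dzb u has_derivative (\<lambda>v. (dd v (dd 1 u) z + \<i> * dd v (dd \<i> u) z) / 2)) (at z)"
      unfolding dzb_def dx_dd dy_dd by (auto intro!: derivative_eq_intros D)
    from dd_eq[OF this] show ?thesis .
  qed
  note c = dd_commute[OF assms]
  show "dzb (dz u) z = (dx (dx u) z + dy (dy u) z) / 4"
    unfolding dzb_def[of "dz u"] dx_dd dy_dd 1 c by (auto simp: complex_eq_iff field_simps)
  show "dz (dzb u) z = (dx (dx u) z + dy (dy u) z) / 4"
    unfolding dz_def[of "dzb u"] dx_dd dy_dd 2 c by (auto simp: complex_eq_iff field_simps)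
qed

section \<open>Orthogonal systems of complex vectors\<close>

lemma bprod_commute: "bprod N a b = bprod N b (a :: nat \<Rightarrow> 'a::comm_semiring_1)"
  by (simp add: bprod_def mult.commute)

lemma bprod_cong: "(\<And>k. k < N \<Longrightarrow> a k = a' k) \<Longrightarrow> (\<And>k. k < N \<Longrightarrow> b k = b' k) \<Longrightarrow> bprod N a b = bprod N a' b'"
  by (simp add: bprod_def)

lemma
  fixes a :: "nat \<Rightarrow> complex"
  shows bprod_add: "bprod N (\<lambda>k. a k + b k) c = bprod N a c + bprod N b c"
    and bprod_diff: "bprod N (\<lambda>k. a k - b k) c = bprod N a c - bprod N b c"
    and bprod_minus: "bprod N (\<lambda>k. - a k) c = - bprod N a c"
    and bprod_scale: "bprod N (\<lambda>k. s * a k) c = s * bprod N a c"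
    and bprod_sum: "bprod N (\<lambda>k. \<Sum>i\<in>I. d i k) c = (\<Sum>i\<in>I. bprod N (d i) c)"
    and bprod_zero: "bprod N (\<lambda>k. 0) c = 0"
  by (simp_all add: bprod_def algebra_simps sum.distrib sum_subtractf sum_distrib_left sum_distrib_right
      sum_negf sum.swap[of _ I])

lemma
  fixes a :: "nat \<Rightarrow> complex"
  shows bprod_add_right: "bprod N c (\<lambda>k. a k + b k) = bprod N c a + bprod N c b"
    and bprod_diff_right: "bprod N c (\<lambda>k. a k - b k) = bprod N c a - bprod N c b"
    and bprod_scale_right: "bprod N c (\<lambda>k. s * a k) = s * bprod N c a"
    and bprod_sum_right: "bprod N c (\<lambda>k. \<Sum>i\<in>I. d i k) = (\<Sum>i\<in>I. bprod N c (d i))"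
  using bprod_add[of N a b c] bprod_diff[of N a b c] bprod_scale[of N s a c] bprod_sum[of N d I c]
  by (simp_all add: bprod_commute[of N c])

lemma cnjv_cnjv [simp]: "cnjv (cnjv a) = a"
  by (simp add: cnjv_def fun_eq_iff)

lemma cnj_bprod: "cnj (bprod N a b) = bprod N (cnjv a) (cnjv b)"
  by (simp add: bprod_def cnjv_def)

lemma bprod_cnjv_swap: "bprod N (cnjv a) b = cnj (bprod N a (cnjv b))"
  by (simp add: cnj_bprod)

definition nsq :: "nat \<Rightarrow> (nat \<Rightarrow> complex) \<Rightarrow> real" where
  "nsq N a = (\<Sum>k<N. (cmod (a k))\<^sup>2)"

lemma bprod_cnjv_self: "bprod N a (cnjv a) = of_real (nsq N a)"
  by (simp add: bprod_def cnjv_def nsq_def complex_norm_square del: of_real_power)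

lemma nsq_nonneg: "0 \<le> nsq N a" by (simp add: nsq_def sum_nonneg)

lemma nsq_eq_0_iff: "nsq N a = 0 \<longleftrightarrow> (\<forall>k<N. a k = 0)"
  by (auto simp: nsq_def sum_nonneg_eq_0_iff)

lemma nsq_pos_iff: "0 < nsq N a \<longleftrightarrow> (\<exists>k<N. a k \<noteq> 0)"
  using nsq_nonneg[of N a] nsq_eq_0_iff[of N a] by (auto simp: less_le)

lemma nsq_cnjv: "nsq N (cnjv a) = nsq N a" by (simp add: nsq_def cnjv_def)

locale orthogonal_system =
  fixes N :: nat and I :: "'i set" and e :: "'i \<Rightarrow> nat \<Rightarrow> complex"
  assumes finI: "finite I"
    and orth: "\<And>i j. i \<in> I \<Longrightarrow> j \<in> I \<Longrightarrow> i \<noteq> j \<Longrightarrow> bprod N (e i) (cnjv (e j)) = 0"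
    and nonzero: "\<And>i. i \<in> I \<Longrightarrow> nsq N (e i) \<noteq> 0"
begin

definition proj_coord :: "nat \<Rightarrow> nat \<Rightarrow> complex" where
  "proj_coord k l = (\<Sum>i\<in>I. cnj (e i k) / of_real (nsq N (e i)) * e i l)"

text \<open>\<open>proj_coord k\<close> is the orthogonal projection of the \<open>k\<close>-th basis vector, so this is Pythagoras.\<close>

lemma nsq_residual:
  assumes "k < N"
  shows "of_real (nsq N (\<lambda>l. of_bool (l = k) - proj_coord k l)) = 1 - proj_coord k k"
proof -
  define r where "r = (\<lambda>l. of_bool (l = k) - proj_coord k l)"
  have delta: "bprod N (\<lambda>l. of_bool (l = k)) (cnjv x) = cnj (x k)" for x
  proof -
    have "bprod N (\<lambda>l. of_bool (l = k)) (cnjv x) = (\<Sum>l<N. if l = k then cnj (x l) else 0)"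
      by (auto simp: bprod_def cnjv_def intro!: sum.cong)
    then show ?thesis using assms by simp
  qed
  have pe: "bprod N (proj_coord k) (cnjv x)
      = (\<Sum>i\<in>I. cnj (e i k) / of_real (nsq N (e i)) * bprod N (e i) (cnjv x))" for x
    unfolding proj_coord_def bprod_sum bprod_scale ..
  have perp: "bprod N r (cnjv (e j)) = 0" if "j \<in> I" for j
  proof -
    have "bprod N (proj_coord k) (cnjv (e j))
        = (\<Sum>i\<in>I. if i = j then cnj (e j k) / of_real (nsq N (e j)) * of_real (nsq N (e j)) else 0)"
      unfolding pe using orth that by (intro sum.cong) (auto simp: bprod_cnjv_self)
    also have "\<dots> = cnj (e j k)" using finI that nonzero[OF that] by simp
    finally show ?thesis by (simp add: r_def bprod_diff delta)
  qed
  have "bprod N (proj_coord k) (cnjv r) = 0"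
    unfolding pe using perp by (simp add: bprod_cnjv_swap[of N r, symmetric] bprod_commute[of N "e _"] cnj_bprod
        bprod_cnjv_swap)
  then have "bprod N r (cnjv r) = bprod N (\<lambda>l. of_bool (l = k)) (cnjv r)"
    by (subst (1) r_def) (simp add: bprod_diff)
  also have "\<dots> = cnj (r k)" by (rule delta)
  also have "\<dots> = cnj (1 - proj_coord k k)" by (simp add: r_def)
  finally have *: "of_real (nsq N r) = cnj (1 - proj_coord k k)" by (simp add: bprod_cnjv_self)
  then have "cnj (of_real (nsq N r)) = cnj (cnj (1 - proj_coord k k))" by (rule arg_cong)
  then show ?thesis by (simp add: r_def)
qed

text \<open>The trace of the complementary projection.  It yields the bound on the size of an orthogonal system, and completeness when that bound is attained.\<close>

lemma sum_nsq_residual: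
  "(\<Sum>k<N. nsq N (\<lambda>l. of_bool (l = k) - proj_coord k l)) = real N - real (card I)"
proof -
  have "(\<Sum>k<N. proj_coord k k) = (\<Sum>i\<in>I. bprod N (e i) (cnjv (e i)) / of_real (nsq N (e i)))"
    unfolding proj_coord_def bprod_def cnjv_def
    by (subst sum.swap) (simp add: sum_divide_distrib mult.commute)
  also have "\<dots> = (\<Sum>i\<in>I. 1)" by (intro sum.cong) (auto simp: bprod_cnjv_self nonzero)
  finally have s: "(\<Sum>k<N. proj_coord k k) = of_nat (card I)" by simp
  have "of_real (\<Sum>k<N. nsq N (\<lambda>l. of_bool (l = k) - proj_coord k l)) = (\<Sum>k<N. 1 - proj_coord k k)"
    by (simp add: nsq_residual)
  also have "\<dots> = of_nat N - of_nat (card I)" by (simp add: sum_subtractf s)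
  finally have "of_real (\<Sum>k<N. nsq N (\<lambda>l. of_bool (l = k) - proj_coord k l))
      = complex_of_real (real N - real (card I))" by simp
  then show ?thesis by (simp only: of_real_eq_iff)
qed

lemma card_le: "card I \<le> N"
  using sum_nonneg[of "{..<N}" "\<lambda>k. nsq N (\<lambda>l. of_bool (l = k) - proj_coord k l)"]
  by (simp add: nsq_nonneg sum_nsq_residual)

lemma proj_coord_complete:
  assumes "card I = N" "k < N" "l < N"
  shows "proj_coord k l = of_bool (l = k)"
proof -
  have "nsq N (\<lambda>l. of_bool (l = k) - proj_coord k l) = 0"
    using sum_nsq_residual assms
      sum_nonneg_eq_0_iff[of "{..<N}" "\<lambda>k. nsq N (\<lambda>l. of_bool (l = k) - proj_coord k l)"]
    by (simp add: nsq_nonneg)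
  then show ?thesis using assms(3) by (auto simp: nsq_eq_0_iff)
qed

lemma expansion:
  assumes "card I = N" "l < N"
  shows "x l = (\<Sum>i\<in>I. bprod N x (cnjv (e i)) / of_real (nsq N (e i)) * e i l)"
proof -
  have "x l = (\<Sum>k<N. x k * of_bool (l = k))"
    using assms(2) by (simp add: of_bool_def if_distrib cong: if_cong)
  also have "\<dots> = (\<Sum>k<N. x k * proj_coord k l)"
    using proj_coord_complete assms by (intro sum.cong) auto
  also have "\<dots> = (\<Sum>i\<in>I. bprod N x (cnjv (e i)) / of_real (nsq N (e i)) * e i l)"
    unfolding proj_coord_def sum_distrib_left bprod_def cnjv_def
    by (subst sum.swap) (simp add: sum_divide_distrib sum_distrib_left sum_distrib_right mult_ac)
  finally show ?thesis .
qed

lemma bprod_expansion: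
  assumes "card I = N"
  shows "bprod N x y = (\<Sum>i\<in>I. bprod N x (cnjv (e i)) / of_real (nsq N (e i)) * bprod N (e i) y)"
proof -
  have "bprod N x y = bprod N (\<lambda>l. \<Sum>i\<in>I. bprod N x (cnjv (e i)) / of_real (nsq N (e i)) * e i l) y"
    by (rule bprod_cong[OF expansion[OF assms] refl])
  then show ?thesis unfolding bprod_sum bprod_scale .
qed

end

section \<open>Gram--Schmidt\<close>

declare sum.cong [fundef_cong]

fun gs :: "nat \<Rightarrow> (nat \<Rightarrow> nat \<Rightarrow> complex) \<Rightarrow> nat \<Rightarrow> nat \<Rightarrow> complex" where
  "gs N v j = (\<lambda>k. v j k - (\<Sum>i<j. bprod N (v j) (cnjv (gs N v i)) / bprod N (gs N v i) (cnjv (gs N v i)) * gs N v i k))"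

declare gs.simps [simp del]

lemma gs_bprod:
  "bprod N (gs N v j) x = bprod N (v j) x
     - (\<Sum>i<j. bprod N (v j) (cnjv (gs N v i)) / bprod N (gs N v i) (cnjv (gs N v i)) * bprod N (gs N v i) x)"
  by (subst gs.simps) (simp only: bprod_diff bprod_sum bprod_scale)

lemma gs_orth_aux:
  assumes "\<And>i. i < j \<Longrightarrow> nsq N (gs N v i) \<noteq> 0" "i < j"
  shows "bprod N (gs N v j) (cnjv (gs N v i)) = 0"
  using assms
proof (induction j arbitrary: i rule: less_induct)
  case (less j)
  have o: "bprod N (gs N v a) (cnjv (gs N v i)) = 0" if "a < j" "a \<noteq> i" for a
  proof (cases "i < a")
    case True then show ?thesis using less that by auto
  next
    case False
    then have "bprod N (gs N v i) (cnjv (gs N v a)) = 0" using less that by auto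
    then show ?thesis using bprod_cnjv_swap[of N "gs N v i" "gs N v a"] by (simp add: bprod_commute[of N "gs N v a"])
  qed
  have "(\<Sum>a<j. bprod N (v j) (cnjv (gs N v a)) / bprod N (gs N v a) (cnjv (gs N v a)) * bprod N (gs N v a) (cnjv (gs N v i)))
     = (\<Sum>a<j. if a = i then bprod N (v j) (cnjv (gs N v i)) else 0)"
    using o less.prems by (intro sum.cong) (auto simp: bprod_cnjv_self)
  also have "\<dots> = bprod N (v j) (cnjv (gs N v i))" using less.prems(2) by simp
  finally show ?case by (simp add: gs_bprod[of N v j])
qed

lemma gs_orth:
  assumes "\<And>i. i < j \<Longrightarrow> nsq N (gs N v i) \<noteq> 0" "\<And>i. i < l \<Longrightarrow> nsq N (gs N v i) \<noteq> 0" "l \<noteq> j"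
  shows "bprod N (gs N v j) (cnjv (gs N v l)) = 0"
proof (cases "l < j")
  case True then show ?thesis using gs_orth_aux assms by blast
next
  case False
  then have "bprod N (gs N v l) (cnjv (gs N v j)) = 0" using gs_orth_aux assms by auto
  then show ?thesis using bprod_cnjv_swap[of N "gs N v l" "gs N v j"] by (simp add: bprod_commute[of N "gs N v j"])
qed

lemma gs_span:
  "\<exists>c. c j = 1 \<and> (\<forall>k. gs N v j k = (\<Sum>i\<le>j. c i * v i k))"
proof (induction j rule: less_induct)
  case (less j)
  then have "\<forall>a\<in>{..<j}. \<exists>c. \<forall>k. gs N v a k = (\<Sum>i\<le>a. c i * v i k)" by auto
  then obtain c where c: "\<And>a k. a < j \<Longrightarrow> gs N v a k = (\<Sum>i\<le>a. c a i * v i k)"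
    by (metis lessThan_iff)
  define q where "q = (\<lambda>a. bprod N (v j) (cnjv (gs N v a)) / bprod N (gs N v a) (cnjv (gs N v a)))"
  define d where "d = (\<lambda>i. if i = j then 1 else - (\<Sum>a<j. if i \<le> a then q a * c a i else 0))"
  have "gs N v j k = (\<Sum>i\<le>j. d i * v i k)" for k
  proof -
    have "gs N v j k = v j k - (\<Sum>a<j. q a * gs N v a k)" by (subst gs.simps) (simp add: q_def)
    also have "(\<Sum>a<j. q a * gs N v a k) = (\<Sum>a<j. \<Sum>i<j. (if i \<le> a then q a * c a i else 0) * v i k)"
    proof (rule sum.cong)
      fix a assume a: "a \<in> {..<j}"
      have "(\<Sum>i<j. (if i \<le> a then q a * c a i else 0) * v i k) = (\<Sum>i\<le>a. q a * c a i * v i k)"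
        using a by (intro sum.mono_neutral_cong_right) auto
      then show "q a * gs N v a k = (\<Sum>i<j. (if i \<le> a then q a * c a i else 0) * v i k)"
        using a by (simp add: c sum_distrib_left mult_ac)
    qed simp
    also have "\<dots> = (\<Sum>i<j. (\<Sum>a<j. if i \<le> a then q a * c a i else 0) * v i k)"
      by (subst sum.swap) (simp add: sum_distrib_right)
    also have "\<dots> = - (\<Sum>i<j. d i * v i k)" by (simp add: d_def sum_negf)
    finally show ?thesis by (simp add: d_def lessThan_Suc_atMost[symmetric])
  qed
  then show ?case by (intro exI[of _ d]) (simp add: d_def)
qed

text \<open>Functionals \<open>L i\<close> that are triangular on the family witness its linear independence, without any rank argument.\<close>

lemma gs_nonzero:
  assumes "\<And>i x. i \<le> j \<Longrightarrow> (\<And>k. k < N \<Longrightarrow> x k = 0) \<Longrightarrow> L i x = (0::complex)"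
    and lin: "\<And>i c. i \<le> j \<Longrightarrow> L i (\<lambda>k. \<Sum>a\<le>j. c a * v a k) = (\<Sum>a\<le>j. c a * L i (v a))"
    and tri: "\<And>i a. i \<le> j \<Longrightarrow> a \<le> j \<Longrightarrow> i < a \<Longrightarrow> L i (v a) = 0"
    and diag: "\<And>i. i \<le> j \<Longrightarrow> L i (v i) \<noteq> 0"
  shows "nsq N (gs N v j) \<noteq> 0"
proof
  assume z: "nsq N (gs N v j) = 0"
  obtain c where c: "c j = (1::complex)" "\<And>k. gs N v j k = (\<Sum>i\<le>j. c i * v i k)" using gs_span by blast
  define i where "i = (LEAST i. c i \<noteq> 0)"
  have ci: "c i \<noteq> 0" and ij: "i \<le> j" using c(1) LeastI[of "\<lambda>i. c i \<noteq> 0" j] Least_le[of "\<lambda>i. c i \<noteq> 0" j]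
    by (auto simp: i_def)
  have l0: "c a = 0" if "a < i" for a using not_less_Least[of a "\<lambda>i. c i \<noteq> 0"] that by (auto simp: i_def)
  have "L i (gs N v j) = 0" using assms(1)[OF ij, of "gs N v j"] z by (simp add: nsq_eq_0_iff)
  moreover have "gs N v j = (\<lambda>k. \<Sum>a\<le>j. c a * v a k)" using c(2) by blast
  ultimately have "(\<Sum>a\<le>j. c a * L i (v a)) = 0" using lin[OF ij, of c] by simp
  moreover have "(\<Sum>a\<le>j. c a * L i (v a)) = (\<Sum>a\<le>j. if a = i then c i * L i (v i) else 0)"
  proof (rule sum.cong)
    fix a assume "a \<in> {..j}"
    then show "c a * L i (v a) = (if a = i then c i * L i (v i) else 0)"
      using l0[of a] tri[OF ij, of a] by (cases a i rule: linorder_cases) auto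
  qed simp
  ultimately show False using ci ij diag[OF ij] by simp
qed

lemma gs_bprod_zero:
  assumes "\<And>i. i \<le> j \<Longrightarrow> bprod N (v i) x = 0"
  shows "bprod N (gs N v j) x = 0"
  using assms
proof (induction j rule: less_induct)
  case (less j) then show ?case by (subst gs_bprod) simp
qed

section \<open>Isotropic frames\<close>

text \<open>A maximal isotropic subspace, spanned by the orthogonal vectors \<open>W\<close>, its conjugate, and the real
  line of \<open>f\<close> decompose the whole space.\<close>

locale isotropic_frame =
  fixes N n :: nat and W :: "nat \<Rightarrow> nat \<Rightarrow> complex" and f :: "nat \<Rightarrow> complex"
  assumes N_eq: "N = 2 * n + 1"
    and W_orth: "\<And>i j. i < n \<Longrightarrow> j < n \<Longrightarrow> i \<noteq> j \<Longrightarrow> bprod N (W i) (cnjv (W j)) = 0"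
    and W_nonzero: "\<And>i. i < n \<Longrightarrow> nsq N (W i) \<noteq> 0"
    and W_iso: "\<And>i j. i < n \<Longrightarrow> j < n \<Longrightarrow> bprod N (W i) (W j) = 0"
    and W_f: "\<And>i. i < n \<Longrightarrow> bprod N (W i) f = 0"
    and W_cf: "\<And>i. i < n \<Longrightarrow> bprod N (W i) (cnjv f) = 0"
    and f_nonzero: "nsq N f \<noteq> 0"
begin

definition e :: "nat option + nat \<Rightarrow> nat \<Rightarrow> complex" where
  "e s = (case s of Inl None \<Rightarrow> f | Inl (Some i) \<Rightarrow> W i | Inr i \<Rightarrow> cnjv (W i))"

abbreviation "I \<equiv> insert None (Some ` {..<n}) <+> {..<n}"

lemma flip: "bprod N a (cnjv b) = 0 \<Longrightarrow> bprod N b (cnjv a) = 0"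
  by (metis bprod_commute bprod_cnjv_swap complex_cnj_zero)

lemma flip': "bprod N a b = 0 \<Longrightarrow> bprod N (cnjv a) (cnjv b) = 0"
  using cnj_bprod[of N a b] by simp

sublocale orthogonal_system N I e
proof
  show "finite I" by simp
  show "nsq N (e i) \<noteq> 0" if "i \<in> I" for i
    using that W_nonzero f_nonzero by (auto simp: e_def nsq_cnjv)
  show "bprod N (e i) (cnjv (e j)) = 0" if "i \<in> I" "j \<in> I" "i \<noteq> j" for i j
  proof -
    have o: "bprod N (W a) (cnjv (W b)) = (if a = b then of_real (nsq N (W a)) else 0)"
      "bprod N (cnjv (W a)) (W b) = (if a = b then of_real (nsq N (W a)) else 0)" if "a < n" "b < n" for a b
      using that W_orth flip[OF W_orth]
      by (auto simp: bprod_cnjv_self bprod_commute[of N "cnjv (W a)"] bprod_commute[of N "cnjv (W b)"])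
    show ?thesis
      using that W_iso W_f W_cf flip[OF W_cf] flip'[OF W_f] flip'[OF W_iso]
      by (auto simp: e_def o bprod_commute[of N f] split: if_splits)
  qed
qed

lemma card_I: "card I = N"
  by (subst card_Plus) (auto simp: card_insert_if card_image N_eq)

lemma bprod_frame:
  "bprod N x y = bprod N x (cnjv f) / of_real (nsq N f) * bprod N f y
     + (\<Sum>i<n. bprod N x (cnjv (W i)) / of_real (nsq N (W i)) * bprod N (W i) y)
     + (\<Sum>i<n. bprod N x (W i) / of_real (nsq N (W i)) * bprod N (cnjv (W i)) y)"
  unfolding bprod_expansion[OF card_I, of x y]
  by (subst sum.Plus) (auto simp: sum.reindex e_def nsq_cnjv)

lemma frame_expansion:
  assumes "l < N"
  shows "x l = bprod N x (cnjv f) / of_real (nsq N f) * f l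
     + (\<Sum>i<n. bprod N x (cnjv (W i)) / of_real (nsq N (W i)) * W i l)
     + (\<Sum>i<n. bprod N x (W i) / of_real (nsq N (W i)) * cnj (W i l))"
  using expansion[OF card_I assms, of x]
  by (subst (asm) sum.Plus) (auto simp: sum.reindex e_def nsq_cnjv cnjv_def)

end

section \<open>Calculus of vector-valued maps\<close>

definition vdzb :: "(complex \<Rightarrow> nat \<Rightarrow> complex) \<Rightarrow> complex \<Rightarrow> nat \<Rightarrow> complex" where
  "vdzb f z k = dzb (\<lambda>w. f w k) z"

definition vsmooth :: "complex set \<Rightarrow> nat \<Rightarrow> (complex \<Rightarrow> nat \<Rightarrow> complex) \<Rightarrow> bool" where
  "vsmooth U N a \<longleftrightarrow> (\<forall>k<N. smooth_on U (\<lambda>z. a z k))"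

lemma vsmoothD: "vsmooth U N a \<Longrightarrow> k < N \<Longrightarrow> smooth_on U (\<lambda>z. a z k)"
  by (simp add: vsmooth_def)

lemma vsmooth_differentiable:
  "vsmooth U N a \<Longrightarrow> open U \<Longrightarrow> z \<in> U \<Longrightarrow> k < N \<Longrightarrow> (\<lambda>z. a z k) differentiable (at z)"
  using smooth_onD vsmoothD by blast

lemma vsmooth_subset: "vsmooth U N a \<Longrightarrow> V \<subseteq> U \<Longrightarrow> vsmooth V N a"
  by (auto simp: vsmooth_def intro: smooth_on_subset)

lemma vsmooth_cong:
  "vsmooth U N a \<Longrightarrow> open U \<Longrightarrow> (\<And>z k. z \<in> U \<Longrightarrow> k < N \<Longrightarrow> a z k = b z k) \<Longrightarrow> vsmooth U N b"
  unfolding vsmooth_def by (metis (no_types, lifting) smooth_on_cong)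

lemma vsmooth_cnjv: "open U \<Longrightarrow> vsmooth U N a \<Longrightarrow> vsmooth U N (\<lambda>z. cnjv (a z))"
  by (auto simp: vsmooth_def cnjv_def intro: smooth_intros)

lemma vsmooth_vdz: "open U \<Longrightarrow> vsmooth U N a \<Longrightarrow> vsmooth U N (vdz a)"
  unfolding vsmooth_def vdz_def using smooth_on_dz by auto

lemma vsmooth_vdzb: "open U \<Longrightarrow> vsmooth U N a \<Longrightarrow> vsmooth U N (vdzb a)"
  unfolding vsmooth_def vdzb_def using smooth_on_dzb by auto

lemma vsmooth_diff: "open U \<Longrightarrow> vsmooth U N a \<Longrightarrow> vsmooth U N b \<Longrightarrow> vsmooth U N (\<lambda>z k. a z k - b z k)"
  by (auto simp: vsmooth_def intro: smooth_intros)

lemma vsmooth_scale: "open U \<Longrightarrow> smooth_on U s \<Longrightarrow> vsmooth U N a \<Longrightarrow> vsmooth U N (\<lambda>z k. s z * a z k)"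
  by (auto simp: vsmooth_def intro: smooth_intros)

lemma vsmooth_sum:
  "open U \<Longrightarrow> (\<And>i. i \<in> I \<Longrightarrow> vsmooth U N (a i)) \<Longrightarrow> vsmooth U N (\<lambda>z k. \<Sum>i\<in>I. a i z k)"
  unfolding vsmooth_def by (auto intro!: smooth_on_sum)

lemma smooth_on_bprod:
  "open U \<Longrightarrow> vsmooth U N a \<Longrightarrow> vsmooth U N b \<Longrightarrow> smooth_on U (\<lambda>z. bprod N (a z) (b z))"
  unfolding bprod_def by (intro smooth_on_sum smooth_on_mult) (auto simp: vsmooth_def)

lemma vdz_cong: "open U \<Longrightarrow> z \<in> U \<Longrightarrow> (\<And>z. z \<in> U \<Longrightarrow> a z k = b z k) \<Longrightarrow> vdz a z k = vdz b z k"
  unfolding vdz_def by (rule dz_cong)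

lemma vdzb_cong: "open U \<Longrightarrow> z \<in> U \<Longrightarrow> (\<And>z. z \<in> U \<Longrightarrow> a z k = b z k) \<Longrightarrow> vdzb a z k = vdzb b z k"
  unfolding vdzb_def by (rule dzb_cong)

lemma
  assumes "\<And>k. k < N \<Longrightarrow> (\<lambda>z. a z k) differentiable (at z)" "\<And>k. k < N \<Longrightarrow> (\<lambda>z. b z k) differentiable (at z)"
  shows dz_bprod: "dz (\<lambda>z. bprod N (a z) (b z)) z = bprod N (vdz a z) (b z) + bprod N (a z) (vdz b z)"
    and dzb_bprod: "dzb (\<lambda>z. bprod N (a z) (b z)) z = bprod N (vdzb a z) (b z) + bprod N (a z) (vdzb b z)"
proof -
  have d: "(\<lambda>z. a z k * b z k) differentiable (at z)" if "k < N" for k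
    using assms[OF that] by (rule differentiable_mult)
  show "dz (\<lambda>z. bprod N (a z) (b z)) z = bprod N (vdz a z) (b z) + bprod N (a z) (vdz b z)"
    unfolding bprod_def vdz_def sum.distrib[symmetric]
    by (subst dz_sum[where u = "\<lambda>k z. a z k * b z k"]) (use d assms in \<open>auto intro!: sum.cong dz_mult\<close>)
  show "dzb (\<lambda>z. bprod N (a z) (b z)) z = bprod N (vdzb a z) (b z) + bprod N (a z) (vdzb b z)"
    unfolding bprod_def vdzb_def sum.distrib[symmetric]
    by (subst dzb_sum[where u = "\<lambda>k z. a z k * b z k"]) (use d assms in \<open>auto intro!: sum.cong dzb_mult\<close>)
qed

lemma
  assumes "open U" "vsmooth U N a" "vsmooth U N b" "z \<in> U" "\<And>z. z \<in> U \<Longrightarrow> bprod N (a z) (b z) = c"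
  shows vdz_const_bprod: "bprod N (vdz a z) (b z) = - bprod N (a z) (vdz b z)"
    and vdzb_const_bprod: "bprod N (vdzb a z) (b z) = - bprod N (a z) (vdzb b z)"
proof -
  note d = vsmooth_differentiable[OF assms(2,1,4)] vsmooth_differentiable[OF assms(3,1,4)]
  have "dz (\<lambda>z. bprod N (a z) (b z)) z = 0"
    using dz_cong[OF assms(1,4), of "\<lambda>z. bprod N (a z) (b z)" "\<lambda>z. c"] assms(5) by simp
  then show "bprod N (vdz a z) (b z) = - bprod N (a z) (vdz b z)"
    by (simp add: dz_bprod[OF d] eq_neg_iff_add_eq_0)
  have "dzb (\<lambda>z. bprod N (a z) (b z)) z = 0"
    using dzb_cong[OF assms(1,4), of "\<lambda>z. bprod N (a z) (b z)" "\<lambda>z. c"] assms(5) by simp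
  then show "bprod N (vdzb a z) (b z) = - bprod N (a z) (vdzb b z)"
    by (simp add: dzb_bprod[OF d] eq_neg_iff_add_eq_0)
qed

lemma
  assumes "(\<lambda>z. a z k) differentiable (at z)"
  shows vdz_cnjv: "vdz (\<lambda>z. cnjv (a z)) z k = cnj (vdzb a z k)"
    and vdzb_cnjv: "vdzb (\<lambda>z. cnjv (a z)) z k = cnj (vdz a z k)"
  using assms by (simp_all add: vdz_def vdzb_def cnjv_def dz_cnj dzb_cnj)

lemma holomorphic_vsmooth:
  "open U \<Longrightarrow> (\<And>k. k < N \<Longrightarrow> (\<lambda>z. a z k) holomorphic_on U) \<Longrightarrow> vsmooth U N a"
  by (simp add: vsmooth_def smooth_on_holomorphic)

subsection \<open>Real maps\<close>

lemma complexify_vsmooth: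
  "open U \<Longrightarrow> (\<And>k. k < N \<Longrightarrow> smooth_on U (\<lambda>z. f z k)) \<Longrightarrow> vsmooth U N (complexify f)"
  unfolding vsmooth_def complexify_def by (auto intro: smooth_intros)

lemma bprod_of_real: "bprod N (\<lambda>k. of_real (a k)) (\<lambda>k. of_real (b k)) = of_real (bprod N a b)"
  by (simp add: bprod_def)

lemma bprod_complexify: "bprod N (complexify f z) (complexify h z) = of_real (bprod N (f z) (h z))"
  by (simp add: bprod_def complexify_def)

lemma cnjv_complexify [simp]: "cnjv (complexify f z) = complexify f z"
  by (simp add: cnjv_def complexify_def fun_eq_iff)

lemma
  assumes "(\<lambda>z. f z k) differentiable (at z)"
  shows dd_complexify: "dd v (\<lambda>z. complexify f z k) z = of_real (dd v (\<lambda>z. f z k) z)"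
    and vdz_complexify: "vdz (complexify f) z k = (of_real (vdx f z k) - \<i> * of_real (vdy f z k)) / 2"
    and vdzb_complexify: "vdzb (complexify f) z k = cnj (vdz (complexify f) z k)"
proof -
  show *: "dd v (\<lambda>z. complexify f z k) z = of_real (dd v (\<lambda>z. f z k) z)" for v
    unfolding complexify_def by (rule dd_bounded_linear[OF bounded_linear_of_real assms])
  show "vdz (complexify f) z k = (of_real (vdx f z k) - \<i> * of_real (vdy f z k)) / 2"
    "vdzb (complexify f) z k = cnj (vdz (complexify f) z k)"
    using * by (simp_all add: vdz_def vdzb_def vdx_def vdy_def dz_def dzb_def dx_dd dy_dd)
qed

lemma laplace_complexify:
  assumes "open U" "smooth_on U (\<lambda>z. f z k)" "z \<in> U"
  shows "vdzb (vdz (complexify f)) z k = of_real (vdx (vdx f) z k + vdy (vdy f) z k) / 4"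
proof -
  have sm: "smooth_on U (\<lambda>z. complexify f z k)"
    unfolding complexify_def using assms by (intro smooth_intros)
  have "vdzb (vdz (complexify f)) z k = (dx (dx (\<lambda>z. complexify f z k)) z + dy (dy (\<lambda>z. complexify f z k)) z) / 4"
    unfolding vdzb_def vdz_def using dz_dzb(1)[OF assms(1) sm assms(3)] by simp
  moreover have "dd v (dd v (\<lambda>z. complexify f z k)) z = of_real (dd v (dd v (\<lambda>z. f z k)) z)" if "v = 1 \<or> v = \<i>" for v
  proof -
    have "dd v (dd v (\<lambda>z. complexify f z k)) z = dd v (\<lambda>z. of_real (dd v (\<lambda>z. f z k) z)) z"
      by (rule dd_cong[OF assms(1,3)]) (rule dd_complexify[where f = f and k = k], rule smooth_onD[OF assms(2,1)])
    also have "\<dots> = of_real (dd v (dd v (\<lambda>z. f z k)) z)"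
      using smooth_on_dd[OF assms(2)] that assms(1,3)
      by (intro dd_bounded_linear[OF bounded_linear_of_real]) (auto intro: smooth_onD)
    finally show ?thesis .
  qed
  ultimately show ?thesis by (simp add: dx_dd dy_dd vdx_def vdy_def)
qed

lemma
  assumes "\<And>k. k < N \<Longrightarrow> (\<lambda>z. f z k) differentiable (at z)"
  shows bprod_vdz_complexify: "bprod N (vdz (complexify f) z) (vdz (complexify f) z)
      = (of_real (bprod N (vdx f z) (vdx f z) - bprod N (vdy f z) (vdy f z))
          - 2 * \<i> * of_real (bprod N (vdx f z) (vdy f z))) / 4"
    and nsq_vdz_complexify: "nsq N (vdz (complexify f) z)
      = (bprod N (vdx f z) (vdx f z) + bprod N (vdy f z) (vdy f z)) / 4"
proof -
  have e: "vdz (complexify f) z k = (of_real (vdx f z k) - \<i> * of_real (vdy f z k)) / 2" if "k < N" for k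
    by (rule vdz_complexify[where f = f and k = k, OF assms[OF that]])
  have "vdz (complexify f) z k * vdz (complexify f) z k
      = (of_real (vdx f z k * vdx f z k) - of_real (vdy f z k * vdy f z k) - 2 * \<i> * of_real (vdx f z k * vdy f z k)) / 4"
    if "k < N" for k
    by (simp add: e[OF that] complex_eq_iff field_simps)
  then have "bprod N (vdz (complexify f) z) (vdz (complexify f) z) = (\<Sum>k<N.
      (of_real (vdx f z k * vdx f z k) - of_real (vdy f z k * vdy f z k) - 2 * \<i> * of_real (vdx f z k * vdy f z k)) / 4)"
    unfolding bprod_def by (intro sum.cong) auto
  then show "bprod N (vdz (complexify f) z) (vdz (complexify f) z)
      = (of_real (bprod N (vdx f z) (vdx f z) - bprod N (vdy f z) (vdy f z))
          - 2 * \<i> * of_real (bprod N (vdx f z) (vdy f z))) / 4"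
    by (simp add: bprod_def sum_subtractf sum_divide_distrib[symmetric] sum_distrib_left)
  have "(cmod (vdz (complexify f) z k))\<^sup>2 = (vdx f z k * vdx f z k + vdy f z k * vdy f z k) / 4" if "k < N" for k
    unfolding e[OF that] cmod_power2 by (simp add: field_simps power2_eq_square)
  then have "nsq N (vdz (complexify f) z) = (\<Sum>k<N. (vdx f z k * vdx f z k + vdy f z k * vdy f z k) / 4)"
    unfolding nsq_def by (intro sum.cong) auto
  then show "nsq N (vdz (complexify f) z)
      = (bprod N (vdx f z) (vdx f z) + bprod N (vdy f z) (vdy f z)) / 4"
    by (simp add: bprod_def sum.distrib sum_divide_distrib[symmetric])
qed

section \<open>Frames along an isotropic curve\<close>

locale isotropic_curve =
  fixes n N :: nat and U :: "complex set" and w :: "nat \<Rightarrow> complex \<Rightarrow> nat \<Rightarrow> complex"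
    and \<gamma> :: "nat \<Rightarrow> complex \<Rightarrow> complex"
  assumes U: "open U" and N_eq: "N = 2 * n + 1" and n1: "1 \<le> n"
    and hol: "\<And>j k. j \<le> n \<Longrightarrow> k < N \<Longrightarrow> (\<lambda>z. w j z k) holomorphic_on U"
    and deriv: "\<And>j k z. j < n \<Longrightarrow> k < N \<Longrightarrow> z \<in> U \<Longrightarrow>
      ((\<lambda>z. w j z k) has_field_derivative \<gamma> j z * w (Suc j) z k) (at z)"
    and iso: "\<And>i j z. i \<le> n \<Longrightarrow> j \<le> n \<Longrightarrow> z \<in> U \<Longrightarrow> bprod N (w i z) (w j z) = of_bool (i = n \<and> j = n)"
    and nondeg: "\<And>j z. j \<le> n \<Longrightarrow> z \<in> U \<Longrightarrow> nsq N (gs N (\<lambda>j. w j z) j) \<noteq> 0"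
begin

definition W :: "nat \<Rightarrow> complex \<Rightarrow> nat \<Rightarrow> complex" where
  "W j z = gs N (\<lambda>j. w j z) j"

lemma W_nz: "j \<le> n \<Longrightarrow> z \<in> U \<Longrightarrow> nsq N (W j z) \<noteq> 0"
  by (simp add: W_def nondeg)

lemma W_orth: "i \<le> n \<Longrightarrow> j \<le> n \<Longrightarrow> z \<in> U \<Longrightarrow> i \<noteq> j \<Longrightarrow> bprod N (W i z) (cnjv (W j z)) = 0"
  unfolding W_def by (rule gs_orth) (simp_all add: nondeg)

lemma vsmooth_w: "j \<le> n \<Longrightarrow> vsmooth U N (w j)"
  by (rule holomorphic_vsmooth[OF U hol])

lemma W_eq: "W j z k = w j z k - (\<Sum>i<j. bprod N (w j z) (cnjv (W i z)) / bprod N (W i z) (cnjv (W i z)) * W i z k)"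
  unfolding W_def by (subst gs.simps) simp

lemma vsmooth_W: "j \<le> n \<Longrightarrow> vsmooth U N (W j)"
proof (induction j rule: less_induct)
  case (less j)
  have i: "vsmooth U N (W i)" if "i < j" for i using less.IH[OF that] that less.prems by simp
  have "smooth_on U (\<lambda>z. bprod N (w j z) (cnjv (W i z)) / bprod N (W i z) (cnjv (W i z)))" if "i < j" for i
  proof (rule smooth_on_divide[OF U])
    show "smooth_on U (\<lambda>z. bprod N (w j z) (cnjv (W i z)))" "smooth_on U (\<lambda>z. bprod N (W i z) (cnjv (W i z)))"
      by (rule smooth_on_bprod[OF U _ vsmooth_cnjv[OF U i[OF that]]];
          use vsmooth_w less.prems i[OF that] in blast)+
    show "bprod N (W i z) (cnjv (W i z)) \<noteq> 0" if "z \<in> U" for z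
      using W_nz[of i z] \<open>i < j\<close> less.prems that by (simp add: bprod_cnjv_self)
  qed
  then have "vsmooth U N (\<lambda>z k. \<Sum>i<j. bprod N (w j z) (cnjv (W i z)) / bprod N (W i z) (cnjv (W i z)) * W i z k)"
    using i by (intro vsmooth_sum vsmooth_scale U) auto
  then have sm: "vsmooth U N (\<lambda>z k. w j z k - (\<Sum>i<j. bprod N (w j z) (cnjv (W i z)) / bprod N (W i z) (cnjv (W i z)) * W i z k))"
    using vsmooth_w[OF less.prems] vsmooth_diff[OF U] by blast
  show ?case by (rule vsmooth_cong[OF sm U]) (subst W_eq, rule refl)
qed

lemma smooth_on_gs_coeff:
  assumes "j \<le> n" "i \<le> n"
  shows "smooth_on U (\<lambda>z. bprod N (w j z) (cnjv (W i z)) / bprod N (W i z) (cnjv (W i z)))"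
proof (rule smooth_on_divide[OF U])
  show "smooth_on U (\<lambda>z. bprod N (w j z) (cnjv (W i z)))" "smooth_on U (\<lambda>z. bprod N (W i z) (cnjv (W i z)))"
    by (rule smooth_on_bprod[OF U _ vsmooth_cnjv[OF U vsmooth_W[OF assms(2)]]];
        use vsmooth_w vsmooth_W assms in blast)+
  show "bprod N (W i z) (cnjv (W i z)) \<noteq> 0" if "z \<in> U" for z
    using W_nz[OF assms(2) that] by (simp add: bprod_cnjv_self)
qed

lemma vdz_w: "j < n \<Longrightarrow> k < N \<Longrightarrow> z \<in> U \<Longrightarrow> vdz (w j) z k = \<gamma> j z * w (Suc j) z k"
  unfolding vdz_def by (rule dz_field_derivative[OF deriv])

lemma vdzb_w: "j \<le> n \<Longrightarrow> k < N \<Longrightarrow> z \<in> U \<Longrightarrow> vdzb (w j) z k = 0"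
  unfolding vdzb_def by (rule dzb_field_derivative[OF holomorphic_derivI[OF hol U]])

lemma vdz_cnj_w: "j \<le> n \<Longrightarrow> k < N \<Longrightarrow> z \<in> U \<Longrightarrow> vdz (\<lambda>z. cnjv (w j z)) z k = 0"
  using vdz_cnjv[OF vsmooth_differentiable[OF vsmooth_w U]] vdzb_w by simp

lemma bprod_W_zero:
  assumes "j \<le> n" "\<And>i. i \<le> j \<Longrightarrow> bprod N x (w i z) = 0"
  shows "bprod N x (W j z) = 0"
  using gs_bprod_zero[of j N "\<lambda>j. w j z" x] assms by (simp add: W_def bprod_commute[of N x])

lemma bprod_cW_zero:
  assumes "j \<le> n" "\<And>i. i \<le> j \<Longrightarrow> bprod N x (cnjv (w i z)) = 0"
  shows "bprod N x (cnjv (W j z)) = 0"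
proof -
  have "bprod N (cnjv x) (w i z) = 0" if "i \<le> j" for i
    using assms(2)[OF that] bprod_cnjv_swap[of N x "w i z"] by simp
  then have "bprod N (cnjv x) (W j z) = 0" by (rule bprod_W_zero[OF assms(1)])
  then show ?thesis using cnj_bprod[of N "cnjv x" "W j z"] by simp
qed

lemma W_iso:
  assumes "i \<le> n" "j \<le> n" "z \<in> U" "i < n \<or> j < n"
  shows "bprod N (W i z) (W j z) = 0"
proof -
  have "bprod N (w a z) (W j z) = 0" if "a \<le> i" for a
    by (rule bprod_W_zero[OF assms(2)]) (use iso assms that in auto)
  then have "bprod N (W j z) (W i z) = 0"
    by (intro bprod_W_zero[OF assms(1)]) (simp add: bprod_commute)
  then show ?thesis by (simp add: bprod_commute)
qed

lemma W_n_unit: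
  assumes "z \<in> U" shows "bprod N (W n z) (W n z) = 1"
proof -
  have a: "bprod N (W n z) (w j z) = 0" if "j < n" for j
    unfolding W_def bprod_commute[of N _ "w j z"]
    using gs_bprod_zero[of n N "\<lambda>j. w j z" "w j z"] iso[of _ j z] assms that by (simp add: bprod_commute[of N "w j z"])
  have "bprod N (W n z) (W n z) = bprod N (w n z) (W n z)"
    using W_iso[of _ n z] assms
    by (subst (1) W_def, subst gs_bprod) (simp add: W_def[symmetric])
  also have "\<dots> = bprod N (W n z) (w n z)" by (rule bprod_commute)
  also have "\<dots> = bprod N (w n z) (w n z)"
  proof -
    have "bprod N (W i z) (w n z) = 0" if "i < n" for i
      using bprod_W_zero[of i "w n z" z] iso[of n _ z] that assms by (simp add: bprod_commute[of N "W i z"])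
    then show ?thesis by (subst W_def, subst gs_bprod) (simp add: W_def[symmetric])
  qed
  finally show ?thesis using iso[of n n z] assms by simp
qed

lemma frame_W:
  assumes "z \<in> U" shows "isotropic_frame N n (\<lambda>i. W i z) (W n z)"
proof
  show "nsq N (W n z) \<noteq> 0" using W_nz assms by simp
qed (use N_eq W_orth W_nz W_iso assms in auto)

text \<open>The conjugate of \<open>W n\<close> is orthogonal to the isotropic span and to its conjugate, hence a multiple of \<open>W n\<close>; its bilinear square fixes the factor as 1.\<close>

lemma W_n_real:
  assumes "z \<in> U" "k < N" shows "cnj (W n z k) = W n z k"
proof -
  interpret f: isotropic_frame N n "\<lambda>i. W i z" "W n z" by (rule frame_W[OF assms(1)])
  define c where "c = bprod N (cnjv (W n z)) (cnjv (W n z)) / of_real (nsq N (W n z))"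
  have "bprod N (cnjv (W n z)) (cnjv (W i z)) = 0" "bprod N (cnjv (W n z)) (W i z) = 0" if "i < n" for i
    using W_iso[of n i z] W_orth[of n i z] that assms by (simp_all add: cnj_bprod[symmetric] bprod_cnjv_swap)
  then have l: "cnj (W n z l) = c * W n z l" if "l < N" for l
    using f.frame_expansion[OF that, of "cnjv (W n z)"] by (simp add: cnjv_def c_def)
  have "c = cnj (bprod N (W n z) (W n z)) / of_real (nsq N (W n z))" by (simp add: c_def cnj_bprod)
  then have c: "c = of_real (1 / nsq N (W n z))" using W_n_unit[OF assms(1)] by simp
  have "of_real (nsq N (W n z)) = bprod N (W n z) (cnjv (W n z))" by (simp add: bprod_cnjv_self)
  also have "\<dots> = bprod N (W n z) (\<lambda>l. c * W n z l)" by (rule bprod_cong) (simp_all add: l cnjv_def)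
  also have "\<dots> = c" using W_n_unit[OF assms(1)] by (simp add: bprod_scale_right)
  finally have "nsq N (W n z) = 1 / nsq N (W n z)" unfolding c of_real_eq_iff .
  then have "nsq N (W n z) * nsq N (W n z) = 1"
    using W_nz[of n z] assms(1) by (metis div_self nonzero_divide_eq_eq order_refl)
  then have "nsq N (W n z) = 1" using nsq_nonneg[of N "W n z"]
    by (metis abs_of_nonneg abs_mult_self_eq mult.right_neutral real_sqrt_abs2 real_sqrt_one)
  then show ?thesis using l[OF assms(2)] c by simp
qed

text \<open>The span of \<open>W 0, \<dots>, W j\<close> is spanned by holomorphic vectors, so \<open>\<partial>\<close>-bar does not leave it.\<close>

lemma vdzb_W_orth:
  assumes "j \<le> n" "r \<le> n" "j \<le> r" "z \<in> U"
  shows "bprod N (vdzb (W j) z) (cnjv (W r z)) = 0"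
  using assms(1,3)
proof (induction j rule: less_induct)
  case (less j)
  define q where "q = (\<lambda>i z. bprod N (w j z) (cnjv (W i z)) / bprod N (W i z) (cnjv (W i z)))"
  have sq: "smooth_on U (q i)" if "i < j" for i
    unfolding q_def by (rule smooth_on_gs_coeff) (use that less.prems in auto)
  have dq: "q i differentiable (at z)" if "i < j" for i using smooth_onD[OF sq[OF that] U assms(4)] .
  have dW: "(\<lambda>z. W i z k) differentiable (at z)" if "i \<le> j" "k < N" for i k
    using vsmooth_differentiable[OF vsmooth_W U assms(4) that(2)] that less.prems by auto
  have dw: "(\<lambda>z. w j z k) differentiable (at z)" if "k < N" for k
    using vsmooth_differentiable[OF vsmooth_w U assms(4) that] less.prems by auto
  have "vdzb (W j) z k = - (\<Sum>i<j. dzb (q i) z * W i z k + q i z * vdzb (W i) z k)" if k: "k < N" for k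
  proof -
    have qW: "(\<lambda>z. q i z * W i z k) differentiable (at z)" if "i < j" for i
      using dq[OF that] dW[of i k] that k by (intro differentiable_mult) auto
    have "vdzb (W j) z k = dzb (\<lambda>z. w j z k - (\<Sum>i<j. q i z * W i z k)) z"
      unfolding vdzb_def by (rule dzb_cong[OF U assms(4)]) (subst W_eq, simp add: q_def)
    also have "\<dots> = dzb (\<lambda>z. w j z k) z - dzb (\<lambda>z. \<Sum>i<j. q i z * W i z k) z"
      by (rule dzb_diff[OF dw[OF k]]) (use qW in \<open>auto intro!: differentiable_sum\<close>)
    also have "dzb (\<lambda>z. w j z k) z = 0" using vdzb_w[of j k z] less.prems k assms(4) by (simp add: vdzb_def)
    also have "dzb (\<lambda>z. \<Sum>i<j. q i z * W i z k) z = (\<Sum>i<j. dzb (\<lambda>z. q i z * W i z k) z)"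
      by (rule dzb_sum) (use qW in auto)
    also have "\<dots> = (\<Sum>i<j. dzb (q i) z * W i z k + q i z * vdzb (W i) z k)"
      by (intro sum.cong refl) (use dq dW k in \<open>simp add: dzb_mult vdzb_def\<close>)
    finally show ?thesis by simp
  qed
  then have "bprod N (vdzb (W j) z) (cnjv (W r z))
     = bprod N (\<lambda>k. - (\<Sum>i<j. dzb (q i) z * W i z k + q i z * vdzb (W i) z k)) (cnjv (W r z))"
    by (rule bprod_cong) auto
  also have "\<dots> = - (\<Sum>i<j. dzb (q i) z * bprod N (W i z) (cnjv (W r z)) + q i z * bprod N (vdzb (W i) z) (cnjv (W r z)))"
    unfolding bprod_minus bprod_sum bprod_add bprod_scale ..
  also have "\<dots> = 0"
    using less W_orth[of _ r z] assms by (simp add: sum.neutral)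
  finally show ?case .
qed

lemma vdz_W_in_span:
  assumes "r < n" "z \<in> U"
  shows "\<exists>b. \<forall>k<N. vdz (W r) z k = \<gamma> r z * W (Suc r) z k + (\<Sum>i\<le>r. b i * W i z k)"
  using assms(1)
proof (induction r rule: less_induct)
  case (less r)
  define q where "q = (\<lambda>r i z. bprod N (w r z) (cnjv (W i z)) / bprod N (W i z) (cnjv (W i z)))"
  have w_W: "w r z k = W r z k + (\<Sum>i<r. q r i z * W i z k)" for r z k
    unfolding q_def by (subst (1) W_eq) simp
  have "\<forall>i\<in>{..<r}. \<exists>b. \<forall>k<N. vdz (W i) z k = \<gamma> i z * W (Suc i) z k + (\<Sum>l\<le>i. b l * W l z k)"
    using less by auto
  then obtain b where b: "\<And>i k. i < r \<Longrightarrow> k < N \<Longrightarrow>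
      vdz (W i) z k = \<gamma> i z * W (Suc i) z k + (\<Sum>l\<le>i. b i l * W l z k)" by (metis lessThan_iff)
  have sq: "smooth_on U (q r i)" if "i < r" for i
    unfolding q_def by (rule smooth_on_gs_coeff) (use that less.prems in auto)
  have dq: "q r i differentiable (at z)" if "i < r" for i using smooth_onD[OF sq[OF that] U assms(2)] .
  have dW: "(\<lambda>z. W i z k) differentiable (at z)" if "i \<le> r" "k < N" for i k
    using vsmooth_differentiable[OF vsmooth_W U assms(2) that(2)] that less.prems by auto
  have dw: "(\<lambda>z. w r z k) differentiable (at z)" if "k < N" for k
    using vsmooth_differentiable[OF vsmooth_w U assms(2) that] less.prems by auto
  define c where "c = (\<lambda>l. \<gamma> r z * q (Suc r) l z - (\<Sum>i<r. (if l = i then dz (q r i) z else 0)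
       + q r i z * ((if l = Suc i then \<gamma> i z else 0) + (if l \<le> i then b i l else 0))))"
  have "vdz (W r) z k = \<gamma> r z * W (Suc r) z k + (\<Sum>l\<le>r. c l * W l z k)" if k: "k < N" for k
  proof -
    have qW: "(\<lambda>z. q r i z * W i z k) differentiable (at z)" if "i < r" for i
      using dq[OF that] dW[of i k] that k by (intro differentiable_mult) auto
    have "vdz (W r) z k = dz (\<lambda>z. w r z k - (\<Sum>i<r. q r i z * W i z k)) z"
      unfolding vdz_def by (rule dz_cong[OF U assms(2)]) (simp add: w_W)
    also have "\<dots> = dz (\<lambda>z. w r z k) z - dz (\<lambda>z. \<Sum>i<r. q r i z * W i z k) z"
      by (rule dz_diff[OF dw[OF k]]) (use qW in \<open>auto intro!: differentiable_sum\<close>)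
    also have "dz (\<lambda>z. w r z k) z = \<gamma> r z * w (Suc r) z k"
      using vdz_w[of r k z] less.prems k assms(2) by (simp add: vdz_def)
    also have "dz (\<lambda>z. \<Sum>i<r. q r i z * W i z k) z = (\<Sum>i<r. dz (\<lambda>z. q r i z * W i z k) z)"
      by (rule dz_sum) (use qW in auto)
    also have "\<dots> = (\<Sum>i<r. dz (q r i) z * W i z k + q r i z * vdz (W i) z k)"
      by (intro sum.cong refl) (use dq dW k in \<open>simp add: dz_mult vdz_def\<close>)
    also have "\<dots> = (\<Sum>i<r. \<Sum>l\<le>r. ((if l = i then dz (q r i) z else 0)
       + q r i z * ((if l = Suc i then \<gamma> i z else 0) + (if l \<le> i then b i l else 0))) * W l z k)"
    proof (rule sum.cong)
      fix i assume i: "i \<in> {..<r}"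
      have 1: "(\<Sum>l\<le>r. (if l = i then dz (q r i) z * W l z k else 0)) = dz (q r i) z * W i z k" using i by simp
      have 2: "(\<Sum>l\<le>r. (if l = Suc i then \<gamma> i z * W l z k else 0)) = \<gamma> i z * W (Suc i) z k" using i by simp
      have 3: "(\<Sum>l\<le>r. (if l \<le> i then b i l * W l z k else 0)) = (\<Sum>l\<le>i. b i l * W l z k)"
        using i by (intro sum.mono_neutral_cong_right) auto
      have "(\<Sum>l\<le>r. ((if l = i then dz (q r i) z else 0)
         + q r i z * ((if l = Suc i then \<gamma> i z else 0) + (if l \<le> i then b i l else 0))) * W l z k)
        = (\<Sum>l\<le>r. (if l = i then dz (q r i) z * W l z k else 0)
           + q r i z * ((if l = Suc i then \<gamma> i z * W l z k else 0) + (if l \<le> i then b i l * W l z k else 0)))"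
        by (intro sum.cong) (auto simp: algebra_simps)
      also have "\<dots> = dz (q r i) z * W i z k + q r i z * vdz (W i) z k"
        using i k by (simp only: sum.distrib sum_distrib_left[symmetric] 1 2 3) (simp add: b)
      finally show "dz (q r i) z * W i z k + q r i z * vdz (W i) z k = (\<Sum>l\<le>r. ((if l = i then dz (q r i) z else 0)
         + q r i z * ((if l = Suc i then \<gamma> i z else 0) + (if l \<le> i then b i l else 0))) * W l z k)" by simp
    qed simp
    also have "\<dots> = (\<Sum>l\<le>r. (\<Sum>i<r. (if l = i then dz (q r i) z else 0)
       + q r i z * ((if l = Suc i then \<gamma> i z else 0) + (if l \<le> i then b i l else 0))) * W l z k)"
      by (subst sum.swap) (simp only: sum_distrib_right)
    finally show ?thesis
      unfolding w_W[of "Suc r"] c_def lessThan_Suc_atMost left_diff_distrib sum_subtractf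
      by (simp only: distrib_left sum_distrib_left mult.assoc add_diff_eq)
  qed
  then show ?case by blast
qed

text \<open>Only the components along \<open>W r\<close> and \<open>W (Suc r)\<close> survive, since \<open>\<partial>\<close>-bar of a lower vector stays in a lower span.\<close>

lemma vdz_W:
  assumes "r < n" "z \<in> U" "k < N"
  shows "vdz (W r) z k = \<gamma> r z * W (Suc r) z k
      + bprod N (vdz (W r) z) (cnjv (W r z)) / bprod N (W r z) (cnjv (W r z)) * W r z k"
proof -
  obtain b where b: "\<And>k. k < N \<Longrightarrow> vdz (W r) z k = \<gamma> r z * W (Suc r) z k + (\<Sum>i\<le>r. b i * W i z k)"
    using vdz_W_in_span[OF assms(1,2)] by blast
  have B: "bprod N (vdz (W r) z) (cnjv (W j z)) = b j * bprod N (W j z) (cnjv (W j z))" if "j \<le> r" for j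
  proof -
    have "bprod N (vdz (W r) z) (cnjv (W j z))
        = bprod N (\<lambda>k. \<gamma> r z * W (Suc r) z k + (\<Sum>i\<le>r. b i * W i z k)) (cnjv (W j z))"
      by (rule bprod_cong) (auto simp: b)
    also have "\<dots> = \<gamma> r z * bprod N (W (Suc r) z) (cnjv (W j z)) + (\<Sum>i\<le>r. b i * bprod N (W i z) (cnjv (W j z)))"
      unfolding bprod_add bprod_sum bprod_scale ..
    also have "(\<Sum>i\<le>r. b i * bprod N (W i z) (cnjv (W j z))) = (\<Sum>i\<le>r. if i = j then b j * bprod N (W j z) (cnjv (W j z)) else 0)"
      by (rule sum.cong) (use W_orth[of _ j z] assms that in auto)
    also have "bprod N (W (Suc r) z) (cnjv (W j z)) = 0"
      using W_orth[of "Suc r" j z] assms that by simp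
    finally show ?thesis using that by simp
  qed
  have "b j = 0" if "j < r" for j
  proof -
    have "bprod N (vdz (W r) z) (cnjv (W j z)) = - bprod N (W r z) (vdz (\<lambda>z. cnjv (W j z)) z)"
      by (rule vdz_const_bprod[OF U vsmooth_W vsmooth_cnjv[OF U vsmooth_W] assms(2)])
         (use assms that W_orth[of r j] in auto)
    also have "bprod N (W r z) (vdz (\<lambda>z. cnjv (W j z)) z) = bprod N (W r z) (cnjv (vdzb (W j) z))"
      using assms that by (intro bprod_cong refl)
        (simp add: vdz_cnjv[where a = "W j", OF vsmooth_differentiable[OF vsmooth_W U]] cnjv_def)
    also have "\<dots> = cnj (bprod N (vdzb (W j) z) (cnjv (W r z)))"
      by (simp add: cnj_bprod bprod_commute[of N "W r z"])
    also have "\<dots> = 0" using vdzb_W_orth[of j r z] assms that by simp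
    finally show ?thesis using B[of j] W_nz[of j z] that assms by (simp add: bprod_cnjv_self)
  qed
  then have "(\<Sum>i\<le>r. b i * W i z k) = (\<Sum>i\<le>r. if i = r then b r * W r z k else 0)"
    by (intro sum.cong) auto
  then have "vdz (W r) z k = \<gamma> r z * W (Suc r) z k + b r * W r z k" using b[OF assms(3)] by simp
  moreover have "b r = bprod N (vdz (W r) z) (cnjv (W r z)) / bprod N (W r z) (cnjv (W r z))"
    using B[of r] W_nz[of r z] assms by (simp add: bprod_cnjv_self)
  ultimately show ?thesis by simp
qed

end

section \<open>Real maps adapted to an isotropic curve\<close>

lemma bprod_vdz_self:
  assumes "\<And>k. k < N \<Longrightarrow> (\<lambda>z. f z k) differentiable (at z)"
  shows "bprod N (vdz (complexify f) z) (complexify f z)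
    = (of_real (bprod N (vdx f z) (f z)) - \<i> * of_real (bprod N (vdy f z) (f z))) / 2"
proof -
  have "vdz (complexify f) z k * complexify f z k
      = (of_real (vdx f z k * f z k) - \<i> * of_real (vdy f z k * f z k)) / 2" if "k < N" for k
    unfolding vdz_complexify[where f = f and k = k, OF assms[OF that]] by (simp add: complexify_def algebra_simps)
  then have "bprod N (vdz (complexify f) z) (complexify f z)
      = (\<Sum>k<N. (of_real (vdx f z k * f z k) - \<i> * of_real (vdy f z k * f z k)) / 2)"
    unfolding bprod_def by (intro sum.cong) auto
  then show ?thesis
    by (simp add: bprod_def sum_subtractf sum_divide_distrib[symmetric] sum_distrib_left)
qed

lemma bprod_real_combination:
  assumes "\<And>k. k < N \<Longrightarrow> v1 k + v2 k = c * h k"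
  shows "bprod N v1 a + bprod N v2 a = c * bprod N h (a :: nat \<Rightarrow> real)"
proof -
  have "bprod N v1 a + bprod N v2 a = (\<Sum>k<N. (v1 k + v2 k) * a k)"
    by (simp add: bprod_def sum.distrib distrib_right)
  also have "\<dots> = (\<Sum>k<N. c * h k * a k)" using assms by (intro sum.cong) auto
  finally show ?thesis by (simp add: bprod_def sum_distrib_left mult.assoc)
qed

text \<open>A vector proportional to the position has no component normal to the surface in the sphere: minimality follows once the Laplacian is radial.\<close>

lemma normal_part_sum_zero:
  assumes "\<And>k. k < N \<Longrightarrow> v1 k + v2 k = c * f z k" "bprod N (f z) (f z) = 1"
    and "bprod N (f z) (vdx f z) = 0" "bprod N (f z) (vdy f z) = 0" "k < N"
  shows "normal_part N f z v1 k + normal_part N f z v2 k = 0"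
proof -
  note c = bprod_real_combination[of N v1 v2 c "f z", OF assms(1)]
  have 1: "bprod N v2 (f z) = c - bprod N v1 (f z)" "bprod N v2 (vdx f z) = - bprod N v1 (vdx f z)"
    "bprod N v2 (vdy f z) = - bprod N v1 (vdy f z)"
    using c[of "f z"] c[of "vdx f z"] c[of "vdy f z"] assms(2-4) by auto
  show ?thesis unfolding normal_part_def 1 using assms(1)[OF assms(5)]
    by (simp add: algebra_simps)
qed

lemma metric_singular_eq:
  assumes "isothermal_on N U f" "\<And>z k. z \<in> U \<Longrightarrow> k < N \<Longrightarrow> (\<lambda>z. f z k) differentiable (at z)"
  shows "metric_singular N U f = {z \<in> U. nsq N (vdz (complexify f) z) = 0}"
proof -
  have "bprod N (vdx f z) (vdx f z) * bprod N (vdy f z) (vdy f z) - (bprod N (vdx f z) (vdy f z))\<^sup>2 = 0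
      \<longleftrightarrow> nsq N (vdz (complexify f) z) = 0" if z: "z \<in> U" for z
  proof -
    have "nsq N (vdz (complexify f) z) = bprod N (vdx f z) (vdx f z) / 2"
      "bprod N (vdy f z) (vdy f z) = bprod N (vdx f z) (vdx f z)" "bprod N (vdx f z) (vdy f z) = 0"
      using nsq_vdz_complexify[of N f z] assms z by (auto simp: isothermal_on_def)
    then show ?thesis by auto
  qed
  then show ?thesis unfolding metric_singular_def by blast
qed

lemma vsmooth_funpow_vdz: "open U \<Longrightarrow> vsmooth U N a \<Longrightarrow> vsmooth U N ((vdz ^^ j) a)"
  by (induction j) (auto intro: vsmooth_vdz)

context isotropic_curve
begin

lemma adapted_frame:
  assumes "z \<in> U" "bprod N (h z) (h z) = 1" "\<And>j. j < n \<Longrightarrow> bprod N (w j z) (complexify h z) = 0"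
  shows "isotropic_frame N n (\<lambda>i. W i z) (complexify h z)"
proof
  have *: "bprod N (complexify h z) (W i z) = 0" if "i < n" for i
    using assms(3) that by (intro bprod_W_zero) (auto simp: bprod_commute[of N "complexify h z"])
  then show "bprod N (W i z) (complexify h z) = 0" "bprod N (W i z) (cnjv (complexify h z)) = 0" if "i < n" for i
    using that by (simp_all add: bprod_commute[of N "W i z"])
  have "complex_of_real (nsq N (complexify h z)) = 1"
    using bprod_cnjv_self[of N "complexify h z"] assms(2) by (simp add: bprod_complexify)
  then show "nsq N (complexify h z) \<noteq> 0" by auto
qed (use N_eq W_orth W_nz W_iso assms in auto)

text \<open>The frame relations confine all derivatives \<open>\<partial>\<^sup>j f\<close> with \<open>j > 0\<close> to the span of the conjugates of the \<open>W\<close>, which is isotropic and orthogonal to \<open>f\<close>.  The first derivative can vanish only where the last frame coefficient does, since it pairs with \<open>w (n - 1)\<close> to \<open>- \<gamma> (n - 1)\<close> times the product of \<open>f\<close> with \<open>w n\<close>.\<close>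

theorem adapted_pseudoholomorphic:
  assumes V: "open V" "V \<subseteq> U"
    and f: "\<And>k. k < N \<Longrightarrow> smooth_on V (\<lambda>z. f z k)"
    and unit: "\<And>z. z \<in> V \<Longrightarrow> bprod N (f z) (f z) = 1"
    and perp: "\<And>z j. z \<in> V \<Longrightarrow> j < n \<Longrightarrow> bprod N (w j z) (complexify f z) = 0"
    and sparse: "{z \<in> V. \<gamma> (n - 1) z = 0} sparse_in V"
  shows "generalized_pseudoholomorphic n V f"
    and "metric_singular N V f \<subseteq> {z \<in> V. \<gamma> (n - 1) z = 0}"
proof -
  define X where "X = (\<lambda>j. (vdz ^^ j) (complexify f))"
  have X0: "X 0 = complexify f" and XS: "X (Suc j) = vdz (X j)" for j by (simp_all add: X_def)
  have smX: "vsmooth V N (X j)" for j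
    unfolding X_def by (intro vsmooth_funpow_vdz complexify_vsmooth V f)
  have df: "(\<lambda>z. f z k) differentiable (at z)" if "z \<in> V" "k < N" for z k
    using smooth_onD[OF f[OF that(2)] V(1) that(1)] .
  have frame: "isotropic_frame N n (\<lambda>i. W i z) (complexify f z)" if "z \<in> V" for z
    using adapted_frame[of z f] unit[OF that] perp[OF that] that V(2) by auto
  have ff: "bprod N (complexify f z) (complexify f z) = 1" "nsq N (complexify f z) = 1" if "z \<in> V" for z
  proof -
    show *: "bprod N (complexify f z) (complexify f z) = 1" using unit[OF that] by (simp add: bprod_complexify)
    have "complex_of_real (nsq N (complexify f z)) = of_real 1"
      using bprod_cnjv_self[of N "complexify f z"] * by simp
    then show "nsq N (complexify f z) = 1" by (simp only: of_real_eq_iff)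
  qed
  \<comment> \<open>\<open>\<partial>\<^sup>j f\<close> stays in the bilinear complement of the conjugate frame, which is antiholomorphic.\<close>
  have A: "bprod N (X j z) (cnjv (w l z)) = 0" if "z \<in> V" "l < n" for j l z
    using that(1)
  proof (induction j arbitrary: z)
    case 0
    have "cnj (bprod N (w l z) (complexify f z)) = 0" using perp[OF 0 that(2)] by simp
    then show ?case unfolding cnj_bprod X0 by (simp add: bprod_commute)
  next
    case (Suc j)
    have sw: "vsmooth V N (w l)" using vsmooth_subset[OF vsmooth_w V(2)] that by simp
    have "bprod N (vdz (X j) z) (cnjv (w l z)) = - bprod N (X j z) (vdz (\<lambda>z. cnjv (w l z)) z)"
      by (rule vdz_const_bprod[OF V(1) smX vsmooth_cnjv[OF V(1) sw] Suc.prems Suc.IH])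
    also have "bprod N (X j z) (vdz (\<lambda>z. cnjv (w l z)) z) = bprod N (X j z) (\<lambda>k. 0)"
      using vdz_cnj_w[of l _ z] that Suc.prems V(2) by (intro bprod_cong refl) auto
    finally show ?case by (simp add: XS bprod_def)
  qed
  have A': "bprod N (X j z) (cnjv (W i z)) = 0" if "z \<in> V" "i < n" for j i z
    using that A by (intro bprod_cW_zero) auto
  have P: "bprod N x y = bprod N x (complexify f z) * bprod N (complexify f z) y"
    if "z \<in> V" "\<And>i. i < n \<Longrightarrow> bprod N x (cnjv (W i z)) = 0" "\<And>i. i < n \<Longrightarrow> bprod N (cnjv (W i z)) y = 0" for x y z
    unfolding isotropic_frame.bprod_frame[OF frame[OF that(1)], of x y] using that ff by simp
  have B: "bprod N (X (Suc j) z) (complexify f z) = 0" if "z \<in> V" for j z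
    using that
  proof (induction j arbitrary: z)
    case 0
    have "bprod N (vdz (complexify f) z) (complexify f z) = - bprod N (complexify f z) (vdz (complexify f) z)"
      by (rule vdz_const_bprod[OF V(1) smX[of 0, unfolded X0] smX[of 0, unfolded X0] 0 ff(1)])
    then show ?case by (simp add: XS X0 bprod_commute[of N "complexify f z"])
  next
    case (Suc j)
    have "bprod N (X (Suc (Suc j)) z) (complexify f z) = - bprod N (X (Suc j) z) (X (Suc 0) z)"
      unfolding XS[of "Suc j"] XS[of 0] X0
      by (rule vdz_const_bprod[OF V(1) smX smX[of 0, unfolded X0] Suc.prems Suc.IH])
    also have "bprod N (X (Suc j) z) (X (Suc 0) z) = 0"
      using P[OF Suc.prems, of "X (Suc j) z" "X (Suc 0) z"] A' Suc.prems Suc.IH[OF Suc.prems]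
      by (simp add: bprod_commute[of N "cnjv _"])
    finally show ?case by simp
  qed
  have C: "bprod N (X j z) (X l z) = 0" if "z \<in> V" "j + l > 0" for j l z
  proof -
    have "bprod N (X j z) (X l z) = bprod N (X j z) (complexify f z) * bprod N (complexify f z) (X l z)"
      using A' that(1) by (intro P) (auto simp: bprod_commute[of N "cnjv _"])
    then show ?thesis using B[OF that(1)] that(2)
      by (cases j; cases l) (auto simp: bprod_commute[of N "complexify f z"])
  qed
  have X1: "X (Suc 0) = vdz (complexify f)" using XS[of 0] by (simp add: X0)
  have isoth: "isothermal_on N V f"
    unfolding isothermal_on_def
  proof
    fix z assume z: "z \<in> V"
    have "bprod N (vdz (complexify f) z) (vdz (complexify f) z) = 0" using C[OF z, of "Suc 0" "Suc 0"] by (simp add: X1)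
    then show "bprod N (vdx f z) (vdx f z) = bprod N (vdy f z) (vdy f z) \<and> bprod N (vdx f z) (vdy f z) = 0"
      using bprod_vdz_complexify[of N f z, OF df[OF z]] by (simp add: complex_eq_iff)
  qed
  have tang: "bprod N (f z) (vdx f z) = 0" "bprod N (f z) (vdy f z) = 0" if "z \<in> V" for z
    using B[OF that, of 0] bprod_vdz_self[of N f z, OF df[OF that]]
    by (simp_all add: XS X0 complex_eq_iff bprod_commute[of N "f z"])
  show sing: "metric_singular N V f \<subseteq> {z \<in> V. \<gamma> (n - 1) z = 0}"
  proof
    fix z assume "z \<in> metric_singular N V f"
    then have z: "z \<in> V" "nsq N (X (Suc 0) z) = 0"
      using metric_singular_eq[OF isoth df] by (auto simp: X1)
    have sw: "vsmooth V N (w (n - 1))" using vsmooth_subset[OF vsmooth_w V(2)] by simp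
    have "bprod N (vdz (complexify f) z) (w (n - 1) z) = - bprod N (complexify f z) (vdz (w (n - 1)) z)"
      by (rule vdz_const_bprod[OF V(1) smX[of 0, unfolded X0] sw z(1), where c = 0])
         (use perp n1 in \<open>auto simp: bprod_commute[of N "complexify f _"]\<close>)
    moreover have "bprod N (vdz (complexify f) z) (w (n - 1) z) = 0"
      using z(2) by (simp add: X1 nsq_eq_0_iff bprod_def)
    moreover have "bprod N (complexify f z) (vdz (w (n - 1)) z) = bprod N (complexify f z) (\<lambda>k. \<gamma> (n - 1) z * w n z k)"
      using vdz_w[of "n - 1" _ z] n1 z(1) V(2) by (intro bprod_cong refl) auto
    ultimately have g: "\<gamma> (n - 1) z * bprod N (complexify f z) (w n z) = 0" by (simp add: bprod_scale_right)
    have "bprod N (w n z) (W i z) = 0" if "i < n" for i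
      using iso[of n _ z] that z(1) V(2) by (intro bprod_W_zero) auto
    then have "bprod N (w n z) (w n z) = bprod N (w n z) (complexify f z) * bprod N (complexify f z) (w n z)"
      unfolding isotropic_frame.bprod_frame[OF frame[OF z(1)], of "w n z" "w n z"] using ff z(1)
      by (simp add: bprod_commute[of N "W _ z"])
    then have "bprod N (complexify f z) (w n z) \<noteq> 0" using iso[of n n z] z(1) V(2) by auto
    then show "z \<in> {z \<in> V. \<gamma> (n - 1) z = 0}" using g z(1) by simp
  qed
  have mean: "mean_curvature_vector N f z k = 0" if z: "z \<in> V" and k: "k < N" for z k
  proof -
    define Y where "Y = vdzb (X (Suc 0)) z"
    define L where "L = (\<lambda>k. vdx (vdx f) z k + vdy (vdy f) z k)"
    have YL: "Y l = of_real (L l) / 4" if "l < N" for l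
      unfolding Y_def X1 L_def by (rule laplace_complexify[where f = f, OF V(1) f[OF that] z])
    have Yw: "bprod N Y (cnjv (w j z)) = 0" if j: "j < n" for j
    proof -
      have sw: "vsmooth V N (w j)" using vsmooth_subset[OF vsmooth_w V(2)] j by simp
      have dw: "(\<lambda>z. w j z k) differentiable (at z)" if "k < N" for k
        using vsmooth_differentiable[OF sw V(1) z that] .
      have zU: "z \<in> U" using z V(2) by blast
      have "bprod N Y (cnjv (w j z)) = - bprod N (X (Suc 0) z) (vdzb (\<lambda>z. cnjv (w j z)) z)"
        unfolding Y_def by (rule vdzb_const_bprod[OF V(1) smX vsmooth_cnjv[OF V(1) sw] z A[OF _ j]])
      also have "bprod N (X (Suc 0) z) (vdzb (\<lambda>z. cnjv (w j z)) z)
          = bprod N (X (Suc 0) z) (\<lambda>k. cnj (\<gamma> j z) * cnjv (w (Suc j) z) k)"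
        by (intro bprod_cong refl) (simp add: vdzb_cnjv[where a = "w j", OF dw] vdz_w[OF j _ zU] cnjv_def)
      also have "\<dots> = cnj (\<gamma> j z) * bprod N (X (Suc 0) z) (cnjv (w (Suc j) z))" by (rule bprod_scale_right)
      also have "bprod N (X (Suc 0) z) (cnjv (w (Suc j) z)) = 0"
      proof (cases "Suc j < n")
        case True then show ?thesis using A[OF z] by simp
      next
        case False
        then have n: "Suc j = n" using j by simp
        have "bprod N (w n z) (W i z) = 0" if "i < n" for i
          using iso[of n _ z] that zU by (intro bprod_W_zero) auto
        then have 1: "bprod N (cnjv (W i z)) (cnjv (w n z)) = 0" if "i < n" for i
          using that by (simp add: cnj_bprod[symmetric] bprod_commute[of N "W i z"])
        show ?thesis
          using P[OF z, of "X (Suc 0) z" "cnjv (w n z)"] A'[OF z] 1 B[OF z, of 0] by (simp add: n)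
      qed
      finally show ?thesis by simp
    qed
    have Yr: "cnj (bprod N Y (cnjv x)) = bprod N Y x" for x
      unfolding cnj_bprod cnjv_cnjv by (rule bprod_cong) (simp_all add: cnjv_def YL)
    have YcW: "bprod N Y (cnjv (W i z)) = 0" if "i < n" for i
      using that Yw by (intro bprod_cW_zero) auto
    have YW: "bprod N Y (W i z) = 0" if "i < n" for i
      using Yr[of "W i z"] YcW[OF that] by simp
    define c where "c = bprod N L (f z)"
    have "bprod N Y (complexify f z) = bprod N (\<lambda>k. of_real (L k) / 4) (complexify f z)"
      by (rule bprod_cong) (simp_all add: YL)
    also have "\<dots> = of_real c / 4"
      by (simp add: bprod_def complexify_def c_def sum_divide_distrib)
    finally have Yf: "bprod N Y (complexify f z) = of_real c / 4" .
    have "L l = c * f z l" if "l < N" for l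
    proof -
      have "Y l = of_real c / 4 * of_real (f z l)"
        using isotropic_frame.frame_expansion[OF frame[OF z] that, of Y] YcW YW Yf ff[OF z]
        by (simp add: complexify_def)
      then have "complex_of_real (L l) = of_real (c * f z l)" using YL[OF that] by simp
      then show ?thesis by (simp only: of_real_eq_iff)
    qed
    then have "normal_part N f z (vdx (vdx f) z) k + normal_part N f z (vdy (vdy f) z) k = 0"
      by (intro normal_part_sum_zero[where c = c]) (use unit[OF z] tang[OF z] k in \<open>auto simp: L_def\<close>)
    then show ?thesis by (simp add: mean_curvature_vector_def)
  qed
  show "generalized_pseudoholomorphic n V f"
    unfolding generalized_pseudoholomorphic_def Let_def N_eq[symmetric]
    using V(1) f unit isoth sparse_in_subset2[OF sparse sing] mean C by (auto simp: X_def)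
qed

end

section \<open>The frame of the construction\<close>

text \<open>The parametrisation of the isotropic cone by stereographic coordinates, and the linear map carrying vectors of the smaller space to vectors orthogonal to it.\<close>

definition hat :: "nat \<Rightarrow> (nat \<Rightarrow> complex) \<Rightarrow> nat \<Rightarrow> complex" where
  "hat M p k = (if k = 0 then 1 - bprod M p p else if k = 1 then \<i> * (1 + bprod M p p) else 2 * p (k - 2))"

definition lift :: "nat \<Rightarrow> (nat \<Rightarrow> complex) \<Rightarrow> (nat \<Rightarrow> complex) \<Rightarrow> nat \<Rightarrow> complex" where
  "lift M p v k = (if k = 0 then - bprod M p v else if k = 1 then \<i> * bprod M p v else v (k - 2))"

text \<open>Each level adds the isotropic vector \<open>hat\<close> in front and lifts the frame of the level below; the frame depends on the primitives \<open>\<phi>\<close> only, not on the \<open>\<beta>\<close>.\<close>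

primrec frame :: "(nat \<Rightarrow> complex \<Rightarrow> nat \<Rightarrow> complex) \<Rightarrow> nat \<Rightarrow> nat \<Rightarrow> complex \<Rightarrow> nat \<Rightarrow> complex" where
  "frame \<phi> 0 = (\<lambda>j z k. 1)"
| "frame \<phi> (Suc r) = (\<lambda>j z. case j of 0 \<Rightarrow> hat (Suc (2 * r)) (\<phi> r z)
      | Suc i \<Rightarrow> lift (Suc (2 * r)) (\<phi> r z) (frame \<phi> r i z))"

lemma bprod_Suc_Suc:
  "bprod (Suc (Suc M)) a b = a 0 * b 0 + a 1 * b 1 + bprod M (\<lambda>k. a (k + 2)) (\<lambda>k. b (k + 2))"
  unfolding bprod_def by (simp only: sum.lessThan_Suc_shift) (simp add: add.assoc numeral_2_eq_2)

lemma bprod_hat_hat: "bprod (Suc (Suc M)) (hat M p) (hat M p) = 0"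
proof -
  have "bprod M (\<lambda>k. 2 * p k) (\<lambda>k. 2 * p k) = 4 * bprod M p p"
    unfolding bprod_scale bprod_scale_right by simp
  then have "bprod (Suc (Suc M)) (hat M p) (hat M p) = (1 - bprod M p p)\<^sup>2 + (\<i> * (1 + bprod M p p))\<^sup>2 + 4 * bprod M p p"
    by (simp add: bprod_Suc_Suc hat_def power2_eq_square)
  then show ?thesis by (simp add: power_mult_distrib power2_eq_square algebra_simps)
qed

lemma bprod_hat_lift: "bprod (Suc (Suc M)) (hat M p) (lift M p v) = 0"
proof -
  have "bprod M (\<lambda>k. 2 * p k) v = 2 * bprod M p v" by (rule bprod_scale)
  then have "bprod (Suc (Suc M)) (hat M p) (lift M p v)
      = - ((1 - bprod M p p) * bprod M p v) + \<i> * \<i> * ((1 + bprod M p p) * bprod M p v) + 2 * bprod M p v"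
    by (simp add: bprod_Suc_Suc hat_def lift_def mult_ac)
  then show ?thesis by (simp add: algebra_simps)
qed

lemma bprod_lift_lift: "bprod (Suc (Suc M)) (lift M p v) (lift M p u) = bprod M v u"
  by (simp add: bprod_Suc_Suc lift_def complex_eq_iff)

lemma frame_iso:
  "i \<le> r \<Longrightarrow> j \<le> r \<Longrightarrow> bprod (Suc (2 * r)) (frame \<phi> r i z) (frame \<phi> r j z) = of_bool (i = r \<and> j = r)"
proof (induction r arbitrary: i j)
  case 0 then show ?case by (simp add: bprod_def)
next
  case (Suc r)
  have e: "Suc (2 * Suc r) = Suc (Suc (Suc (2 * r)))" by simp
  show ?case unfolding e using Suc
    by (cases i; cases j)
       (simp_all only: frame.simps nat.case bprod_hat_hat bprod_hat_lift bprod_lift_lift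
          bprod_commute[of "Suc (Suc (Suc (2 * r)))" "lift _ _ _" "hat _ _"], auto)
qed

text \<open>Linear forms that are triangular on the frame; they prove its independence.\<close>

definition dual :: "nat \<Rightarrow> nat \<Rightarrow> (nat \<Rightarrow> complex) \<Rightarrow> complex" where
  "dual n i x = (if i < n then x (2 * i) - \<i> * x (2 * i + 1) else x (2 * n))"

lemma dual_shift: "dual (Suc n) (Suc i) x = dual n i (\<lambda>k. x (k + 2))"
  by (simp add: dual_def)

lemma lift_shift: "(\<lambda>k. lift M p v (k + 2)) = v"
  by (simp add: lift_def fun_eq_iff)

lemma dual_frame_diag: "i \<le> r \<Longrightarrow> dual r i (frame \<phi> r i z) \<noteq> 0"
proof (induction r arbitrary: i)
  case 0 then show ?case by (simp add: dual_def)
next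
  case (Suc r)
  show ?case
  proof (cases i)
    case 0 then show ?thesis by (simp add: dual_def hat_def algebra_simps flip: mult.assoc)
  next
    case (Suc a) then show ?thesis using Suc.IH[of a] Suc.prems by (simp add: dual_shift lift_shift del: add_2_eq_Suc')
  qed
qed

lemma dual_frame_upper: "i < a \<Longrightarrow> a \<le> r \<Longrightarrow> dual r i (frame \<phi> r a z) = 0"
proof (induction r arbitrary: i a)
  case 0 then show ?case by simp
next
  case (Suc r)
  then obtain b where a: "a = Suc b" by (cases a) auto
  show ?case
  proof (cases i)
    case 0 then show ?thesis by (simp add: a dual_def lift_def flip: mult.assoc)
  next
    case (Suc c) then show ?thesis using Suc.IH[of c b] Suc.prems a by (simp add: dual_shift lift_shift del: add_2_eq_Suc')
  qed
qed

lemma frame_nondeg: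
  assumes "j \<le> n" shows "nsq (2 * n + 1) (gs (2 * n + 1) (\<lambda>j. frame \<phi> n j z) j) \<noteq> 0"
proof (rule gs_nonzero[where L = "dual n"])
  show "dual n i x = 0" if "i \<le> j" "\<And>k. k < 2 * n + 1 \<Longrightarrow> x k = 0" for i x
    using that by (simp add: dual_def)
  show "dual n i (\<lambda>k. \<Sum>a\<le>j. c a * frame \<phi> n a z k) = (\<Sum>a\<le>j. c a * dual n i (frame \<phi> n a z))" for i c
    by (simp add: dual_def sum_distrib_left sum_subtractf right_diff_distrib mult_ac)
qed (use assms dual_frame_upper dual_frame_diag in auto)

lemma alpha_frame: "alpha n \<beta> \<phi> r z k = coef n \<beta> r z * frame \<phi> r 0 z k"
  by (cases r) (simp_all add: hat_def)

lemma has_field_derivative_bprod: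
  assumes "\<And>k. k < M \<Longrightarrow> ((\<lambda>z. a z k) has_field_derivative a' k) (at z)"
    and "\<And>k. k < M \<Longrightarrow> ((\<lambda>z. b z k) has_field_derivative b' k) (at z)"
  shows "((\<lambda>z. bprod M (a z) (b z)) has_field_derivative bprod M a' (b z) + bprod M (a z) b') (at z)"
proof -
  have "((\<lambda>z. \<Sum>k<M. a z k * b z k) has_field_derivative (\<Sum>k<M. a' k * b z k + a z k * b' k)) (at z)"
    by (intro DERIV_sum, drule lessThan_iff[THEN iffD1]) (use assms in \<open>auto intro!: derivative_eq_intros\<close>)
  then show ?thesis by (simp add: bprod_def sum.distrib)
qed

locale construction =
  fixes n N :: nat and U :: "complex set" and \<beta> \<phi>
  assumes data: "construction_data n U \<beta> \<phi>" and n1: "1 \<le> n" and N_eq: "N = 2 * n + 1"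
begin

lemma open_U: "open U" and U_nonempty: "U \<noteq> {}" and connected_U: "connected U"
  using data by (auto simp: construction_data_def simply_connected_imp_connected)

lemma beta_holomorphic: "s < n \<Longrightarrow> \<beta> s holomorphic_on U"
  using data by (simp add: construction_data_def)

lemma phi_deriv:
  assumes "r < n" "k < Suc (2 * r)" "z \<in> U"
  shows "((\<lambda>w. \<phi> r w k) has_field_derivative \<beta> r z * frame \<phi> r 0 z k) (at z)"
  using data assms unfolding construction_data_def by (simp add: alpha_frame coef_def)

lemma phi_holomorphic: "r < n \<Longrightarrow> k < Suc (2 * r) \<Longrightarrow> (\<lambda>z. \<phi> r z k) holomorphic_on U"
  using phi_deriv open_U by (meson field_differentiable_def field_differentiable_at_within holomorphic_on_def)

lemma frame_holomorphic:
  "r \<le> n \<Longrightarrow> j \<le> r \<Longrightarrow> k < Suc (2 * r) \<Longrightarrow> (\<lambda>z. frame \<phi> r j z k) holomorphic_on U"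
proof (induction r arbitrary: j k)
  case 0 then show ?case by simp
next
  case (Suc r)
  note p = phi_holomorphic[of r]
  show ?case
  proof (cases j)
    case 0
    have "(\<lambda>z. bprod (Suc (2 * r)) (\<phi> r z) (\<phi> r z)) holomorphic_on U"
      unfolding bprod_def using p Suc.prems by (intro holomorphic_intros) auto
    then show ?thesis using p[of "k - 2"] Suc.prems
      by (cases "k = 0"; cases "k = 1") (auto simp: 0 hat_def intro!: holomorphic_intros)
  next
    case (Suc i)
    have "(\<lambda>z. bprod (Suc (2 * r)) (\<phi> r z) (frame \<phi> r i z)) holomorphic_on U"
      unfolding bprod_def using p Suc.prems Suc.IH Suc by (intro holomorphic_intros) auto
    then show ?thesis using Suc.IH[of i "k - 2"] Suc.prems Suc
      by (cases "k = 0"; cases "k = 1") (auto simp: lift_def intro!: holomorphic_intros)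
  qed
qed

text \<open>The factor is the same at the index shifted along a diagonal: lifting commutes with differentiation because the derivative of \<open>\<phi> r\<close> is a multiple of \<open>frame \<phi> r 0\<close>, which is orthogonal to the other frame vectors.\<close>

lemma frame_deriv:
  "r \<le> n \<Longrightarrow> j < r \<Longrightarrow> k < Suc (2 * r) \<Longrightarrow> z \<in> U \<Longrightarrow>
    ((\<lambda>z. frame \<phi> r j z k) has_field_derivative 2 * \<beta> (r - 1 - j) z * frame \<phi> r (Suc j) z k) (at z)"
proof (induction r arbitrary: j k)
  case 0 then show ?case by simp
next
  case (Suc r)
  have r: "r < n" using Suc.prems by simp
  note p = phi_deriv[OF r _ Suc.prems(4)]
  let ?b = "\<lambda>z v. bprod (Suc (2 * r)) (\<phi> r z) (v z)"
  show ?case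
  proof (cases j)
    case 0
    have "((\<lambda>z. ?b z (\<phi> r)) has_field_derivative
        bprod (Suc (2 * r)) (\<lambda>k. \<beta> r z * frame \<phi> r 0 z k) (\<phi> r z)
        + bprod (Suc (2 * r)) (\<phi> r z) (\<lambda>k. \<beta> r z * frame \<phi> r 0 z k)) (at z)"
      by (rule has_field_derivative_bprod) (use p in auto)
    then have b: "((\<lambda>z. ?b z (\<phi> r)) has_field_derivative 2 * \<beta> r z * bprod (Suc (2 * r)) (\<phi> r z) (frame \<phi> r 0 z)) (at z)"
      unfolding bprod_scale bprod_scale_right bprod_commute[of "Suc (2 * r)" "frame \<phi> r 0 z" "\<phi> r z"]
      by (simp add: mult.assoc)
    consider "k = 0" | "k = 1" | l where "k = Suc (Suc l)" "l < Suc (2 * r)"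
      using Suc.prems by (cases k; cases "k - 1") auto
    then show ?thesis
    proof cases
      case 1 then show ?thesis
        using DERIV_diff[OF DERIV_const[of 1] b] by (simp add: 0 hat_def lift_def)
    next
      case 2 then show ?thesis
        using DERIV_cmult[OF DERIV_add[OF DERIV_const[of 1] b], of \<i>] by (simp add: 0 hat_def lift_def mult_ac)
    next
      case 3 then show ?thesis
        using DERIV_cmult[OF p[OF 3(2)], of 2] by (simp add: 0 hat_def lift_def mult_ac)
    qed
  next
    case (Suc i)
    have ir: "i < r" using Suc Suc.prems by simp
    have d: "((\<lambda>z. frame \<phi> r i z k) has_field_derivative 2 * \<beta> (r - 1 - i) z * frame \<phi> r (Suc i) z k) (at z)"
      if "k < Suc (2 * r)" for k using Suc.IH[OF _ ir that] Suc.prems by simp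
    have "((\<lambda>z. ?b z (frame \<phi> r i)) has_field_derivative
        bprod (Suc (2 * r)) (\<lambda>k. \<beta> r z * frame \<phi> r 0 z k) (frame \<phi> r i z)
        + bprod (Suc (2 * r)) (\<phi> r z) (\<lambda>k. 2 * \<beta> (r - 1 - i) z * frame \<phi> r (Suc i) z k)) (at z)"
      by (rule has_field_derivative_bprod) (use p d in auto)
    moreover have "bprod (Suc (2 * r)) (frame \<phi> r 0 z) (frame \<phi> r i z) = 0"
      using ir frame_iso[of 0 r i] by simp
    ultimately have b: "((\<lambda>z. ?b z (frame \<phi> r i)) has_field_derivative
         2 * \<beta> (r - 1 - i) z * bprod (Suc (2 * r)) (\<phi> r z) (frame \<phi> r (Suc i) z)) (at z)"
      unfolding bprod_scale bprod_scale_right by simp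
    consider "k = 0" | "k = 1" | l where "k = Suc (Suc l)" "l < Suc (2 * r)"
      using Suc.prems by (cases k; cases "k - 1") auto
    then show ?thesis
    proof cases
      case 1 then show ?thesis
        using DERIV_minus[OF b] by (simp add: Suc lift_def)
    next
      case 2 then show ?thesis
        using DERIV_cmult[OF b, of \<i>] by (simp add: Suc lift_def mult_ac)
    next
      case 3 then show ?thesis
        using d[OF 3(2)] by (simp add: Suc lift_def)
    qed
  qed
qed

sublocale isotropic_curve n N U "frame \<phi> n" "\<lambda>j z. 2 * \<beta> (n - 1 - j) z"
proof
  show "((\<lambda>z. frame \<phi> n j z k) has_field_derivative 2 * \<beta> (n - 1 - j) z * frame \<phi> n (Suc j) z k) (at z)"
    if "j < n" "k < N" "z \<in> U" for j k z using frame_deriv[of n j k z] that by (simp add: N_eq)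
qed (use open_U n1 frame_holomorphic frame_iso[of _ n] frame_nondeg in \<open>auto simp: N_eq\<close>)

definition P :: "nat \<Rightarrow> complex \<Rightarrow> complex" where
  "P r z = (\<Prod>i<r. 2 * \<beta> (n - 1 - i) z)"

lemma P_holomorphic: "r \<le> n \<Longrightarrow> P r holomorphic_on U"
  unfolding P_def by (intro holomorphic_intros beta_holomorphic) auto

lemma P_nonzero_mono: "P r z \<noteq> 0 \<Longrightarrow> i \<le> r \<Longrightarrow> P i z \<noteq> 0"
  by (auto simp: P_def)

text \<open>The recursion of the \<open>F\<close>'s removes the component along the previous vector, so it reproduces the recursion of the orthogonalised frame, and the derivative of the holomorphic factor \<open>P r\<close> drops out.\<close>

lemma F_eq:
  "r \<le> n \<Longrightarrow> z \<in> U \<Longrightarrow> (r \<noteq> 0 \<Longrightarrow> P (r - 1) z \<noteq> 0) \<Longrightarrow> k < N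
    \<Longrightarrow> F n \<beta> \<phi> (Suc r) z k = P r z * W r z k"
proof (induction r arbitrary: z k)
  case 0
  then show ?case by (simp add: alpha_frame coef_def P_def W_def gs.simps[of N _ 0])
next
  case (Suc r)
  define T where "T = {z \<in> U. P r z \<noteq> 0}"
  have "continuous_on U (P r)" using P_holomorphic[of r] Suc.prems by (simp add: holomorphic_on_imp_continuous_on)
  then have "open (U \<inter> P r -` (- {0}))" using open_U by (intro continuous_open_preimage) auto
  then have T: "open T" by (simp add: T_def vimage_def Int_def)
  have z: "z \<in> T" "P r z \<noteq> 0" using Suc.prems by (simp_all add: T_def)
  have F: "F n \<beta> \<phi> (Suc r) x k = P r x * W r x k" if "x \<in> T" "k < N" for x k
    by (rule Suc.IH) (use that Suc.prems P_nonzero_mono[of r x "r - 1"] in \<open>auto simp: T_def\<close>)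
  have dP: "P r differentiable (at z)"
    using P_holomorphic[of r] Suc.prems open_U
    by (meson Suc_leD field_differentiable_imp_differentiable holomorphic_on_imp_differentiable_at)
  have V: "vdz (F n \<beta> \<phi> (Suc r)) z k = dz (P r) z * W r z k + P r z * vdz (W r) z k" if "k < N" for k
  proof -
    have "vdz (F n \<beta> \<phi> (Suc r)) z k = vdz (\<lambda>z k. P r z * W r z k) z k"
      by (rule vdz_cong[OF T z(1)]) (rule F[OF _ that])
    also have "\<dots> = dz (P r) z * W r z k + P r z * vdz (W r) z k"
      unfolding vdz_def
      by (rule dz_mult[OF dP vsmooth_differentiable[OF vsmooth_W open_U]]) (use Suc.prems that in auto)
    finally show ?thesis .
  qed
  define a where "a = bprod N (W r z) (cnjv (W r z))"
  define b where "b = bprod N (vdz (W r) z) (cnjv (W r z))"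
  have a0: "a \<noteq> 0" using W_nz[of r z] Suc.prems by (simp add: a_def bprod_cnjv_self)
  have cF: "cnjv (F n \<beta> \<phi> (Suc r) z) k = cnj (P r z) * cnjv (W r z) k" if "k < N" for k
    using F[OF z(1) that] by (simp add: cnjv_def)
  have "bprod N (F n \<beta> \<phi> (Suc r) z) (cnjv (F n \<beta> \<phi> (Suc r) z))
      = bprod N (\<lambda>k. P r z * W r z k) (\<lambda>k. cnj (P r z) * cnjv (W r z) k)"
    by (rule bprod_cong) (simp_all only: F[OF z(1)] cF)
  then have 1: "bprod N (F n \<beta> \<phi> (Suc r) z) (cnjv (F n \<beta> \<phi> (Suc r) z)) = P r z * cnj (P r z) * a"
    unfolding bprod_scale_right bprod_scale a_def by (simp only: mult_ac)
  have "bprod N (vdz (F n \<beta> \<phi> (Suc r)) z) (cnjv (F n \<beta> \<phi> (Suc r) z))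
      = bprod N (\<lambda>k. dz (P r) z * W r z k + P r z * vdz (W r) z k) (\<lambda>k. cnj (P r z) * cnjv (W r z) k)"
    by (rule bprod_cong) (simp_all only: V cF)
  then have 2: "bprod N (vdz (F n \<beta> \<phi> (Suc r)) z) (cnjv (F n \<beta> \<phi> (Suc r) z)) = cnj (P r z) * (dz (P r) z * a + P r z * b)"
    unfolding bprod_scale_right bprod_add bprod_scale a_def b_def .
  have "F n \<beta> \<phi> (Suc (Suc r)) z k = dz (P r) z * W r z k + P r z * vdz (W r) z k
      - 1 / (P r z * cnj (P r z) * a) * (cnj (P r z) * (dz (P r) z * a + P r z * b)) * (P r z * W r z k)"
    unfolding F.simps(2)[of n \<beta> \<phi> "Suc r", folded N_eq] 1 2 if_not_P[OF nat.distinct(2)[of r]]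
      V[OF Suc.prems(4)] F[OF z(1) Suc.prems(4)] ..
  also have "\<dots> = P r z * (vdz (W r) z k - b / a * W r z k)"
    using z(2) a0 by (simp add: field_simps)
  also have "vdz (W r) z k - b / a * W r z k = 2 * \<beta> (n - 1 - r) z * W (Suc r) z k"
    using vdz_W[of r z k] Suc.prems unfolding a_def b_def by simp
  finally show ?case by (simp add: P_def)
qed

end

section \<open>The map defined by the construction\<close>

lemma zeros_sparse:
  assumes "f holomorphic_on U" "open U" "connected U" "z0 \<in> U" "f z0 \<noteq> 0"
  shows "{z \<in> U. f z = 0} sparse_in U"
proof -
  have "\<not> y islimpt {z \<in> U. f z = 0}" if "y \<in> U" for y
  proof
    assume y: "y islimpt {z \<in> U. f z = 0}"
    have "f z0 = 0" by (rule analytic_continuation[OF assms(1-3) _ that y _ assms(4)]) auto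
    then show False using assms(5) by simp
  qed
  then show ?thesis unfolding sparse_in_open[OF assms(2)] by blast
qed

text \<open>A holomorphic function with vanishing real part on an open set is constant there, hence everywhere.\<close>

lemma Re_zero_imp_zero:
  assumes "f holomorphic_on U" "open U" "connected U" "z0 \<in> U" "open B" "z0 \<in> B" "\<And>z. z \<in> B \<Longrightarrow> Re (f z) = 0"
    and "z \<in> U"
  shows "Re (f z) = 0"
proof -
  define C where "C = B \<inter> U"
  have C: "open C" "z0 \<in> C" "C \<subseteq> U" using assms by (auto simp: C_def)
  have d: "(f has_field_derivative deriv f x) (at x)" if "x \<in> U" for x
    using assms(1,2) that by (simp add: holomorphic_derivI)
  have "deriv f x = 0" if x: "x \<in> C" for x
  proof -
    have df: "f differentiable (at x)"
      using d[of x] x C(3) by (meson differentiable_def has_field_derivative_imp_has_derivative subsetD)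
    have "Re (dd v f x) = 0" for v
    proof -
      have "Re (dd v f x) = dd v (\<lambda>z. Re (f z)) x" by (simp add: dd_bounded_linear[OF bounded_linear_Re df])
      also have "\<dots> = dd v (\<lambda>z. 0) x"
        by (rule dd_cong[OF C(1) x]) (use assms(7) in \<open>auto simp: C_def\<close>)
      finally show ?thesis by simp
    qed
    from this[of 1] this[of \<i>] show ?thesis
      using dd_field_derivative[OF d, of x] x C(3) by (auto simp: complex_eq_iff)
  qed
  then have "deriv f x = 0" if "x \<in> U" for x
    using analytic_continuation[of "deriv f" U C z0 x] C that assms interior_limit_point[of z0 C]
    by (auto simp: holomorphic_deriv interior_open)
  then have "\<forall>x\<in>U - {}. DERIV f x :> 0" using d by auto
  then obtain c where "\<And>x. x \<in> U \<Longrightarrow> f x = c"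
    using DERIV_zero_connected_constant[of U "{}" f] assms holomorphic_on_imp_continuous_on by blast
  then show ?thesis using assms by metis
qed

declare F.simps(2) [simp del]

context construction
begin

lemma P_not_identically_zero: "{z \<in> U. P n z = 0} sparse_in U"
proof -
  have "{z \<in> U. \<beta> s z = 0} sparse_in U" if "s < n" for s
    using zeros_sparse[OF beta_holomorphic[OF that] open_U connected_U] data that
    unfolding construction_data_def by blast
  then have "(\<Union>s<n. {z \<in> U. \<beta> s z = 0}) sparse_in U" by (intro sparse_in_UN_finite) auto
  moreover have "{z \<in> U. P n z = 0} \<subseteq> (\<Union>s<n. {z \<in> U. \<beta> s z = 0})" using n1 by (force simp: P_def)
  ultimately show ?thesis by (rule sparse_in_subset2)
qed

lemma F_Suc_eq:
  assumes "P n z \<noteq> 0" "r \<le> n" "z \<in> U" "k < N"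
  shows "F n \<beta> \<phi> (Suc r) z k = P r z * W r z k"
  using assms P_nonzero_mono[OF assms(1)] by (intro F_eq) auto

lemma F_Suc_nonzero:
  assumes "P n z \<noteq> 0" "r \<le> n" "z \<in> U"
  shows "\<exists>k<N. F n \<beta> \<phi> (Suc r) z k \<noteq> 0"
proof -
  obtain k where "k < N" "W r z k \<noteq> 0" using W_nz[OF assms(2,3)] by (auto simp: nsq_eq_0_iff)
  then show ?thesis using F_Suc_eq[OF assms] P_nonzero_mono[OF assms(1,2)] by auto
qed

lemma degenerate_sparse: "degenerate_points n U \<beta> \<phi> sparse_in U"
proof (rule sparse_in_subset2[OF P_not_identically_zero])
  show "degenerate_points n U \<beta> \<phi> \<subseteq> {z \<in> U. P n z = 0}"
  proof
    fix z assume "z \<in> degenerate_points n U \<beta> \<phi>"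
    then obtain r where r: "z \<in> U" "r \<in> {1..n + 1}" "\<forall>k<N. F n \<beta> \<phi> r z k = 0"
      by (auto simp: degenerate_points_def N_eq)
    then obtain r' where "r = Suc r'" "r' \<le> n" by (cases r) auto
    then show "z \<in> {z \<in> U. P n z = 0}" using r F_Suc_nonzero[of z r'] by auto
  qed
qed

definition u :: "complex \<Rightarrow> nat \<Rightarrow> real" where "u z k = Re (W n z k)"

lemma W_n_u: "z \<in> U \<Longrightarrow> k < N \<Longrightarrow> W n z k = of_real (u z k)"
  using W_n_real[of z k] by (simp add: u_def complex_eq_iff)

lemma u_unit: "z \<in> U \<Longrightarrow> bprod N (u z) (u z) = 1"
proof -
  assume z: "z \<in> U"
  have "bprod N (\<lambda>k. of_real (u z k)) (\<lambda>k. of_real (u z k)) = bprod N (W n z) (W n z)"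
    by (rule bprod_cong) (simp_all add: W_n_u z)
  then have "complex_of_real (bprod N (u z) (u z)) = of_real 1" using W_n_unit[OF z] by (simp add: bprod_of_real)
  then show ?thesis by (simp only: of_real_eq_iff)
qed

lemma u_perp: "z \<in> U \<Longrightarrow> j < n \<Longrightarrow> bprod N (frame \<phi> n j z) (complexify u z) = 0"
proof -
  assume z: "z \<in> U" and j: "j < n"
  have "bprod N (frame \<phi> n j z) (complexify u z) = bprod N (frame \<phi> n j z) (W n z)"
    by (rule bprod_cong) (simp_all add: W_n_u z complexify_def)
  also have "\<dots> = 0" by (rule bprod_W_zero) (use iso[of j _ z] j z in auto)
  finally show ?thesis .
qed

lemma u_smooth: "k < N \<Longrightarrow> smooth_on U (\<lambda>z. u z k)"
  unfolding u_def using vsmooth_W[of n] open_U by (auto simp: vsmooth_def intro: smooth_on_Re)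

lemma F_last:
  assumes "z \<in> U" "P n z \<noteq> 0" "k < N" shows "Re (F n \<beta> \<phi> (n + 1) z k) = Re (P n z) * u z k"
proof -
  have "F n \<beta> \<phi> (Suc n) z k = P n z * of_real (u z k)"
    unfolding F_Suc_eq[OF assms(2) order_refl assms(1,3)] W_n_u[OF assms(1,3)] ..
  then show ?thesis by simp
qed

text \<open>The conditions on the earlier \<open>F\<close>'s are implied by the last one, since \<open>P r\<close> divides \<open>P n\<close>.\<close>

lemma g_domain_eq: "g_domain n U \<beta> \<phi> = {z \<in> U. Re (P n z) \<noteq> 0}"
proof (intro set_eqI iffI)
  fix z assume "z \<in> g_domain n U \<beta> \<phi>"
  then have z: "z \<in> U" "\<And>r. r < n \<Longrightarrow> \<exists>k<N. F n \<beta> \<phi> (Suc r) z k \<noteq> 0" "\<exists>k<N. Re (F n \<beta> \<phi> (n + 1) z k) \<noteq> 0"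
    by (auto simp: g_domain_def N_eq)
  have Pz: "P r z \<noteq> 0" if "r < n" for r
    using that
  proof (induction r)
    case 0 then show ?case by (simp add: P_def)
  next
    case (Suc r)
    obtain k where "k < N" "F n \<beta> \<phi> (Suc (Suc r)) z k \<noteq> 0" using z(2)[OF Suc.prems] by blast
    moreover have "F n \<beta> \<phi> (Suc (Suc r)) z k = P (Suc r) z * W (Suc r) z k"
      using Suc z(1) \<open>k < N\<close> by (intro F_eq) simp_all
    ultimately show ?case by auto
  qed
  obtain k where k: "k < N" "Re (F n \<beta> \<phi> (n + 1) z k) \<noteq> 0" using z(3) by blast
  have "F n \<beta> \<phi> (Suc n) z k = P n z * W n z k"
    using z(1) Pz n1 k by (intro F_eq) auto
  then show "z \<in> {z \<in> U. Re (P n z) \<noteq> 0}" using k z(1) by (auto simp: W_n_u)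
next
  fix z assume "z \<in> {z \<in> U. Re (P n z) \<noteq> 0}"
  then have z: "z \<in> U" "Re (P n z) \<noteq> 0" "P n z \<noteq> 0" by auto
  have "\<exists>k<N. F n \<beta> \<phi> r z k \<noteq> 0" if "r \<in> {1..n}" for r
    using F_Suc_nonzero[OF z(3), of "r - 1"] that z(1) by auto
  moreover have "\<exists>k<N. u z k \<noteq> 0"
  proof (rule ccontr)
    assume "\<not> (\<exists>k<N. u z k \<noteq> 0)"
    then have "bprod N (u z) (u z) = 0" by (simp add: bprod_def)
    then show False using u_unit[OF z(1)] by simp
  qed
  then obtain k where k: "k < N" "u z k \<noteq> 0" by blast
  then have "Re (F n \<beta> \<phi> (n + 1) z k) \<noteq> 0" using F_last[OF z(1,3)] z(2) by auto
  ultimately show "z \<in> g_domain n U \<beta> \<phi>" using z(1) k by (auto simp: g_domain_def N_eq)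
qed

lemma g_eq:
  assumes "z \<in> g_domain n U \<beta> \<phi>" "k < N"
  shows "g n \<beta> \<phi> z k = sgn (Re (P n z)) * u z k"
proof -
  have z: "z \<in> U" "Re (P n z) \<noteq> 0" "P n z \<noteq> 0" using assms(1) by (auto simp: g_domain_eq)
  have "(\<Sum>j<N. (Re (F n \<beta> \<phi> (n + 1) z j))\<^sup>2) = (\<Sum>j<N. (Re (P n z))\<^sup>2 * (u z j * u z j))"
    by (intro sum.cong) (use F_last[OF z(1,3)] in \<open>auto simp: power2_eq_square\<close>)
  also have "\<dots> = (Re (P n z))\<^sup>2" using u_unit[OF z(1)] by (simp add: bprod_def sum_distrib_left[symmetric])
  finally have "L2_set (\<lambda>j. Re (F n \<beta> \<phi> (n + 1) z j)) {..<2 * n + 1} = \<bar>Re (P n z)\<bar>"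
    by (simp add: L2_set_def N_eq)
  then show ?thesis unfolding g_def using F_last[OF z(1,3) assms(2)] z(2) by (simp add: sgn_if)
qed

lemma gamma_last_sparse: "V \<subseteq> U \<Longrightarrow> {z \<in> V. 2 * \<beta> (n - 1 - (n - 1)) z = 0} sparse_in V"
proof -
  assume V: "V \<subseteq> U"
  have "{z \<in> U. P n z = 0} sparse_in V" by (rule sparse_in_subset[OF P_not_identically_zero V])
  moreover have "{z \<in> V. 2 * \<beta> (n - 1 - (n - 1)) z = 0} \<subseteq> {z \<in> U. P n z = 0}"
    using V n1 by (auto simp: P_def intro!: bexI[of _ "n - 1"])
  ultimately show ?thesis by (rule sparse_in_subset2)
qed

lemma open_g_domain: "open (g_domain n U \<beta> \<phi>)"
proof -
  have "continuous_on U (\<lambda>z. Re (P n z))"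
    using P_holomorphic[of n] by (intro continuous_intros holomorphic_on_imp_continuous_on) auto
  then have "open (U \<inter> (\<lambda>z. Re (P n z)) -` (- {0}))" using open_U by (intro continuous_open_preimage) auto
  then show ?thesis by (simp add: g_domain_eq vimage_def Int_def)
qed

lemma sgn_locally_constant:
  assumes "z \<in> g_domain n U \<beta> \<phi>"
  obtains T where "open T" "z \<in> T" "T \<subseteq> g_domain n U \<beta> \<phi>" "\<And>x. x \<in> T \<Longrightarrow> sgn (Re (P n x)) = sgn (Re (P n z))"
proof -
  define T where "T = U \<inter> (\<lambda>x. Re (P n x) * Re (P n z)) -` {0<..}"
  have "continuous_on U (\<lambda>x. Re (P n x) * Re (P n z))"
    using P_holomorphic[of n] by (intro continuous_intros holomorphic_on_imp_continuous_on) auto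
  then have "open T" unfolding T_def using open_U by (intro continuous_open_preimage) auto
  moreover have "z \<in> T" using assms by (auto simp: T_def g_domain_eq zero_less_mult_iff)
  moreover have "T \<subseteq> g_domain n U \<beta> \<phi>" by (auto simp: T_def g_domain_eq)
  moreover have "sgn (Re (P n x)) = sgn (Re (P n z))" if "x \<in> T" for x
    using that by (auto simp: T_def zero_less_mult_iff)
  ultimately show ?thesis using that by blast
qed

lemma g_smooth:
  assumes "k < N" shows "smooth_on (g_domain n U \<beta> \<phi>) (\<lambda>z. g n \<beta> \<phi> z k)"
proof (rule smooth_on_locally[OF open_g_domain])
  fix z assume z: "z \<in> g_domain n U \<beta> \<phi>"
  then obtain T where T: "open T" "z \<in> T" "T \<subseteq> g_domain n U \<beta> \<phi>"
    "\<And>x. x \<in> T \<Longrightarrow> sgn (Re (P n x)) = sgn (Re (P n z))" using sgn_locally_constant by blast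
  have TU: "T \<subseteq> U" using T(3) by (auto simp: g_domain_eq)
  have "smooth_on T (\<lambda>x. sgn (Re (P n z)) * u x k)"
    by (rule smooth_on_mult[OF T(1) smooth_on_const smooth_on_subset[OF u_smooth[OF assms] TU]])
  then have "smooth_on T (\<lambda>x. g n \<beta> \<phi> x k)"
    by (rule smooth_on_cong[OF _ T(1)]) (use T(3,4) g_eq[OF _ assms] in auto)
  then show "\<exists>T. open T \<and> z \<in> T \<and> smooth_on T (\<lambda>z. g n \<beta> \<phi> z k)" using T by blast
qed

lemma sgn_sq: "z \<in> g_domain n U \<beta> \<phi> \<Longrightarrow> sgn (Re (P n z)) * sgn (Re (P n z)) = 1"
  by (auto simp: g_domain_eq sgn_if)

lemma g_pseudoholomorphic: "generalized_pseudoholomorphic n (g_domain n U \<beta> \<phi>) (g n \<beta> \<phi>)"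
proof (rule adapted_pseudoholomorphic(1)[OF open_g_domain])
  show sub: "g_domain n U \<beta> \<phi> \<subseteq> U" by (auto simp: g_domain_eq)
  show "smooth_on (g_domain n U \<beta> \<phi>) (\<lambda>z. g n \<beta> \<phi> z k)" if "k < N" for k by (rule g_smooth[OF that])
  show "{z \<in> g_domain n U \<beta> \<phi>. 2 * \<beta> (n - 1 - (n - 1)) z = 0} sparse_in g_domain n U \<beta> \<phi>"
    by (rule gamma_last_sparse[OF sub])
  fix z assume z: "z \<in> g_domain n U \<beta> \<phi>"
  define s where "s = sgn (Re (P n z))"
  have "bprod N (g n \<beta> \<phi> z) (g n \<beta> \<phi> z) = (\<Sum>k<N. s * s * (u z k * u z k))"
    unfolding bprod_def by (intro sum.cong) (auto simp: g_eq[OF z] s_def)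
  also have "\<dots> = bprod N (u z) (u z)" using sgn_sq[OF z] by (simp add: s_def bprod_def)
  finally show "bprod N (g n \<beta> \<phi> z) (g n \<beta> \<phi> z) = 1" using u_unit z sub by auto
  fix j assume j: "j < n"
  have "bprod N (frame \<phi> n j z) (complexify (g n \<beta> \<phi>) z)
      = bprod N (frame \<phi> n j z) (\<lambda>k. of_real s * complexify u z k)"
    by (intro bprod_cong refl) (simp add: complexify_def g_eq[OF z] s_def)
  also have "\<dots> = 0" unfolding bprod_scale_right using u_perp[of z j] j z sub by auto
  finally show "bprod N (frame \<phi> n j z) (complexify (g n \<beta> \<phi>) z) = 0" .
qed

lemma u_pseudoholomorphic: "generalized_pseudoholomorphic n U u"
  by (rule adapted_pseudoholomorphic(1)[OF open_U order_refl u_smooth u_unit u_perp gamma_last_sparse[OF order_refl]])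

lemma u_agrees: "agrees_up_to_sign n U \<beta> \<phi> u"
  unfolding agrees_up_to_sign_def N_eq[symmetric]
proof
  fix z assume z: "z \<in> g_domain n U \<beta> \<phi>"
  then have "sgn (Re (P n z)) = 1 \<or> sgn (Re (P n z)) = -1" by (auto simp: g_domain_eq sgn_if)
  then show "(\<forall>k<N. u z k = g n \<beta> \<phi> z k) \<or> (\<forall>k<N. u z k = - g n \<beta> \<phi> z k)"
    using g_eq[OF z] by auto
qed

text \<open>The zero set of the harmonic function \<open>Re (P n)\<close> has empty interior unless the function vanishes identically.\<close>

lemma g_domain_dense:
  assumes "z0 \<in> U" "Re (P n z0) \<noteq> 0"
  shows "U \<subseteq> closure (g_domain n U \<beta> \<phi>)"
proof
  fix z assume z: "z \<in> U"
  show "z \<in> closure (g_domain n U \<beta> \<phi>)"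
  proof (rule ccontr)
    assume nz: "z \<notin> closure (g_domain n U \<beta> \<phi>)"
    define B where "B = U - closure (g_domain n U \<beta> \<phi>)"
    have "open B" "z \<in> B" using nz z open_U by (auto simp: B_def open_Diff)
    moreover have "Re (P n x) = 0" if "x \<in> B" for x
      using that closure_subset[of "g_domain n U \<beta> \<phi>"] by (auto simp: B_def g_domain_eq)
    ultimately have "Re (P n z0) = 0"
      using Re_zero_imp_zero[OF P_holomorphic[OF order_refl] open_U connected_U z] assms(1) by blast
    then show False using assms(2) by simp
  qed
qed

text \<open>A real vector orthogonal to the isotropic span is also orthogonal to the conjugate span, so only the direction of \<open>u\<close> remains.\<close>

lemma unit_normal_unique:
  assumes z: "z \<in> U" and h: "bprod N (h z) (h z) = 1" "\<And>j. j < n \<Longrightarrow> bprod N (frame \<phi> n j z) (complexify h z) = 0"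
  obtains s where "s = 1 \<or> s = -1" "\<And>k. k < N \<Longrightarrow> h z k = s * u z k"
proof -
  interpret f: isotropic_frame N n "\<lambda>i. W i z" "complexify h z" by (rule adapted_frame[OF z h])
  have hh: "bprod N (complexify h z) (complexify h z) = 1" using h(1) by (simp add: bprod_complexify)
  then have "complex_of_real (nsq N (complexify h z)) = of_real 1" using bprod_cnjv_self[of N "complexify h z"] by simp
  then have nh: "nsq N (complexify h z) = 1" by (simp only: of_real_eq_iff)
  have 0: "bprod N (W n z) (cnjv (W i z)) = 0" "bprod N (W n z) (W i z) = 0" if "i < n" for i
    using W_orth[of n i z] W_iso[of n i z] that z by auto
  define s where "s = bprod N (u z) (h z)"
  have s: "bprod N (W n z) (complexify h z) = of_real s"
  proof -
    have "bprod N (W n z) (complexify h z) = bprod N (complexify u z) (complexify h z)"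
      by (rule bprod_cong) (simp_all add: W_n_u z complexify_def)
    then show ?thesis by (simp add: bprod_complexify s_def)
  qed
  have "W n z k = of_real (s * h z k)" if "k < N" for k
    using f.frame_expansion[OF that, of "W n z"] 0 s nh by (simp add: complexify_def)
  then have "of_real (u z k) = complex_of_real (s * h z k)" if "k < N" for k using W_n_u[OF z that] that by simp
  then have u: "u z k = s * h z k" if "k < N" for k using that by (simp only: of_real_eq_iff)
  have "bprod N (u z) (u z) = (\<Sum>k<N. s * s * (h z k * h z k))"
    unfolding bprod_def by (intro sum.cong) (auto simp: u)
  also have "\<dots> = s * s" using h(1) by (simp add: bprod_def sum_distrib_left[symmetric])
  finally have "s * s = 1" using u_unit[OF z] by simp
  then have "s = 1 \<or> s = -1" by (metis square_eq_1_iff)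
  then show ?thesis using u by (intro that[of s]) auto
qed

end

theorem construction_gives_pseudoholomorphic:
  assumes "1 \<le> n" "construction_data n U \<beta> \<phi>"
  shows "degenerate_points n U \<beta> \<phi> sparse_in U"
    and "generalized_pseudoholomorphic n (g_domain n U \<beta> \<phi>) (g n \<beta> \<phi>)"
    and "g_domain n U \<beta> \<phi> \<noteq> {} \<longrightarrow> U \<subseteq> closure (g_domain n U \<beta> \<phi>)"
    and "\<exists>G. generalized_pseudoholomorphic n U G \<and> agrees_up_to_sign n U \<beta> \<phi> G"
proof -
  interpret construction n "2 * n + 1" U \<beta> \<phi> using assms by unfold_locales auto
  show "degenerate_points n U \<beta> \<phi> sparse_in U" by (rule degenerate_sparse)
  show "generalized_pseudoholomorphic n (g_domain n U \<beta> \<phi>) (g n \<beta> \<phi>)" by (rule g_pseudoholomorphic)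
  show "g_domain n U \<beta> \<phi> \<noteq> {} \<longrightarrow> U \<subseteq> closure (g_domain n U \<beta> \<phi>)"
    using g_domain_dense by (auto simp: g_domain_eq)
  show "\<exists>G. generalized_pseudoholomorphic n U G \<and> agrees_up_to_sign n U \<beta> \<phi> G"
    using u_pseudoholomorphic u_agrees by blast
qed

section \<open>Accumulating zeros of almost logarithmically subharmonic functions\<close>

text \<open>The equation \<open>\<partial>\<rho> = \<kappa> \<rho>\<close> makes \<open>\<kappa>\<close> the logarithmic derivative, so that \<open>\<partial>\<close>-bar \<open>\<kappa>\<close> is a quarter of the Laplacian of \<open>ln \<rho>\<close>.  Working with \<open>\<kappa>\<close> avoids the logarithm at the zeros of \<open>\<rho>\<close>.\<close>

definition log_deriv :: "complex set \<Rightarrow> (complex \<Rightarrow> real) \<Rightarrow> (complex \<Rightarrow> complex) \<Rightarrow> bool" where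
  "log_deriv U \<rho> \<kappa> \<longleftrightarrow> open U \<and> smooth_on U \<rho> \<and> smooth_on U \<kappa>
     \<and> (\<forall>z\<in>U. dz (\<lambda>w. of_real (\<rho> w)) z = \<kappa> z * of_real (\<rho> z))"

lemma log_deriv_subset: "log_deriv U \<rho> \<kappa> \<Longrightarrow> V \<subseteq> U \<Longrightarrow> open V \<Longrightarrow> log_deriv V \<rho> \<kappa>"
  unfolding log_deriv_def by (auto intro: smooth_on_subset)

lemma smooth_on_cr: "open U \<Longrightarrow> smooth_on U \<rho> \<Longrightarrow> smooth_on U (\<lambda>w. complex_of_real (\<rho> w))"
  by (rule smooth_on_of_real)

lemma log_deriv_mult:
  assumes "log_deriv U \<rho> \<kappa>" "log_deriv U \<sigma> \<mu>"
  shows "log_deriv U (\<lambda>z. \<rho> z * \<sigma> z) (\<lambda>z. \<kappa> z + \<mu> z)"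
proof -
  have U: "open U" using assms by (simp add: log_deriv_def)
  have "dz (\<lambda>w. of_real (\<rho> w * \<sigma> w)) z = (\<kappa> z + \<mu> z) * of_real (\<rho> z * \<sigma> z)" if z: "z \<in> U" for z
  proof -
    have d: "(\<lambda>w. complex_of_real (\<rho> w)) differentiable (at z)" "(\<lambda>w. complex_of_real (\<sigma> w)) differentiable (at z)"
      using assms smooth_onD[OF smooth_on_cr[OF U] U z] by (auto simp: log_deriv_def)
    show ?thesis using dz_mult[OF d] assms z by (simp add: log_deriv_def algebra_simps)
  qed
  then show ?thesis using assms by (auto simp: log_deriv_def intro: smooth_on_mult smooth_on_add)
qed

lemma log_deriv_const: "open U \<Longrightarrow> log_deriv U (\<lambda>z. c) (\<lambda>z. 0)"
  by (simp add: log_deriv_def smooth_on_const)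

lemma log_deriv_power:
  assumes "log_deriv U \<rho> \<kappa>"
  shows "log_deriv U (\<lambda>z. \<rho> z ^ l) (\<lambda>z. of_nat l * \<kappa> z)"
proof (induction l)
  case 0 then show ?case using assms log_deriv_const[of U 1] by (simp add: log_deriv_def)
next
  case (Suc l)
  then show ?case using log_deriv_mult[OF assms Suc] by (simp add: algebra_simps)
qed

lemma log_deriv_inverse:
  assumes "log_deriv U \<rho> \<kappa>" "\<And>z. z \<in> U \<Longrightarrow> \<rho> z \<noteq> 0"
  shows "log_deriv U (\<lambda>z. inverse (\<rho> z)) (\<lambda>z. - \<kappa> z)"
proof -
  have U: "open U" using assms by (simp add: log_deriv_def)
  have "dz (\<lambda>w. of_real (inverse (\<rho> w))) z = - \<kappa> z * of_real (inverse (\<rho> z))" if z: "z \<in> U" for z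
  proof -
    have d: "(\<lambda>w. complex_of_real (\<rho> w)) differentiable (at z)"
      using assms smooth_onD[OF smooth_on_cr[OF U] U z] by (auto simp: log_deriv_def)
    have "dz (\<lambda>w. inverse (complex_of_real (\<rho> w))) z = - (\<kappa> z * of_real (\<rho> z)) / (of_real (\<rho> z))\<^sup>2"
      using dz_inverse[OF d] assms z by (simp add: log_deriv_def)
    then show ?thesis using assms(2)[OF z] by (simp add: power2_eq_square divide_simps)
  qed
  then show ?thesis using assms by (auto simp: log_deriv_def intro: smooth_on_inverse smooth_on_minus)
qed

lemma log_deriv_prod:
  assumes "finite I" "open U" "\<And>i. i \<in> I \<Longrightarrow> log_deriv U (\<rho> i) (\<kappa> i)"
  shows "log_deriv U (\<lambda>z. \<Prod>i\<in>I. \<rho> i z) (\<lambda>z. \<Sum>i\<in>I. \<kappa> i z)"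
  using assms(1,3)
proof (induction I rule: finite_induct)
  case empty then show ?case using log_deriv_const[OF assms(2), of 1] by simp
next
  case (insert i I)
  have "log_deriv U (\<lambda>z. \<rho> i z * (\<Prod>i\<in>I. \<rho> i z)) (\<lambda>z. \<kappa> i z + (\<Sum>i\<in>I. \<kappa> i z))"
    using insert by (intro log_deriv_mult) auto
  then show ?case using insert by simp
qed

lemma smooth_on_ident: "open U \<Longrightarrow> smooth_on U (\<lambda>z. z)"
  by (rule smooth_on_holomorphic) auto

lemma cmod_sq_smooth: "open U \<Longrightarrow> smooth_on U (\<lambda>z. (cmod (z - a))\<^sup>2)"
proof -
  assume U: "open U"
  have "smooth_on U (\<lambda>z. Re ((z - a) * cnj (z - a)))"
    using smooth_on_ident[OF U] U by (intro smooth_intros)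
  then show ?thesis by (rule smooth_on_cong[OF _ U]) (metis Re_complex_of_real complex_norm_square)
qed

lemma
  shows dz_cmod_sq: "dz (\<lambda>w. complex_of_real ((cmod (w - a))\<^sup>2)) z = cnj (z - a)"
    and dzb_cmod_sq: "dzb (\<lambda>w. complex_of_real ((cmod (w - a))\<^sup>2)) z = z - a"
proof -
  have e: "(\<lambda>w. complex_of_real ((cmod (w - a))\<^sup>2)) = (\<lambda>w. (w - a) * cnj (w - a))"
    by (rule ext) (simp only: complex_norm_square)
  have h: "((\<lambda>w. w - a) has_field_derivative 1) (at z)" by (auto intro!: derivative_eq_intros)
  have d: "(\<lambda>w. w - a) differentiable (at z)" by simp
  have d': "(\<lambda>w. cnj (w - a)) differentiable (at z)" by (rule differentiable_cnj[OF d])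
  show "dz (\<lambda>w. complex_of_real ((cmod (w - a))\<^sup>2)) z = cnj (z - a)"
    unfolding e dz_mult[OF d d'] dz_cnj[OF d] dz_field_derivative[OF h] dzb_field_derivative[OF h] by simp
  show "dzb (\<lambda>w. complex_of_real ((cmod (w - a))\<^sup>2)) z = z - a"
    unfolding e dzb_mult[OF d d'] dzb_cnj[OF d] dz_field_derivative[OF h] dzb_field_derivative[OF h] by simp
qed

lemma log_deriv_cmod_sq:
  assumes "open U" "a \<notin> U"
  shows "log_deriv U (\<lambda>z. (cmod (z - a))\<^sup>2) (\<lambda>z. inverse (z - a))"
  unfolding log_deriv_def
proof (intro conjI ballI)
  show "smooth_on U (\<lambda>z. inverse (z - a))"
    using assms by (intro smooth_on_holomorphic holomorphic_intros) auto
  show "dz (\<lambda>w. complex_of_real ((cmod (w - a))\<^sup>2)) z = inverse (z - a) * complex_of_real ((cmod (z - a))\<^sup>2)" if "z \<in> U" for z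
  proof -
    have "z - a \<noteq> 0" using that assms by auto
    then show ?thesis unfolding dz_cmod_sq by (simp only: complex_norm_square) (simp add: mult.assoc[symmetric])
  qed
qed (use assms cmod_sq_smooth in auto)

text \<open>The weight \<open>1 / (2 R\<^sup>2 - \<bar>z - p\<bar>\<^sup>2)\<close> is strictly logarithmically subharmonic and bounded on the ball
  of radius \<open>R\<close>.\<close>

lemma weight_log_deriv:
  fixes p :: complex
  assumes "R > 0" "open U" "U \<subseteq> ball p R"
  defines "\<kappa> \<equiv> \<lambda>z. cnj (z - p) / of_real (2 * R\<^sup>2 - (cmod (z - p))\<^sup>2)"
  shows "log_deriv U (\<lambda>z. inverse (2 * R\<^sup>2 - (cmod (z - p))\<^sup>2)) \<kappa>"
    and "\<And>z. z \<in> U \<Longrightarrow> Re (dzb \<kappa> z) \<ge> 1 / (2 * R\<^sup>2)"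
proof -
  define t where "t = (\<lambda>z. 2 * R\<^sup>2 - (cmod (z - p))\<^sup>2)"
  have pos: "t z \<ge> R\<^sup>2" "t z > 0" "t z \<le> 2 * R\<^sup>2" if "z \<in> U" for z
  proof -
    have "cmod (z - p) < R" using that assms(3) by (auto simp: dist_norm norm_minus_commute)
    then have "(cmod (z - p))\<^sup>2 \<le> R\<^sup>2" by (simp add: power_mono)
    then show "t z \<ge> R\<^sup>2" by (simp add: t_def)
    moreover have "R\<^sup>2 > 0" using assms(1) by simp
    ultimately show "t z > 0" by linarith
  qed (simp add: t_def)
  have st: "smooth_on U t" unfolding t_def by (intro smooth_on_diff smooth_on_const cmod_sq_smooth assms(2))
  have dt: "dz (\<lambda>w. complex_of_real (t w)) z = - cnj (z - p)" "dzb (\<lambda>w. complex_of_real (t w)) z = - (z - p)"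
    "(\<lambda>w. complex_of_real (t w)) differentiable (at z)" if "z \<in> U" for z
  proof -
    have sm: "smooth_on U (\<lambda>w. complex_of_real ((cmod (w - p))\<^sup>2))"
      by (rule smooth_on_cr[OF assms(2) cmod_sq_smooth[OF assms(2)]])
    have e: "(\<lambda>w. complex_of_real (t w)) = (\<lambda>w. of_real (2 * R\<^sup>2) - of_real ((cmod (w - p))\<^sup>2))"
      by (simp add: t_def fun_eq_iff)
    show "dz (\<lambda>w. complex_of_real (t w)) z = - cnj (z - p)" "dzb (\<lambda>w. complex_of_real (t w)) z = - (z - p)"
      unfolding e dz_diff[OF differentiable_const smooth_onD[OF sm assms(2) that]]
        dzb_diff[OF differentiable_const smooth_onD[OF sm assms(2) that]] dz_cmod_sq dzb_cmod_sq dz_const dzb_const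
      by simp_all
    show "(\<lambda>w. complex_of_real (t w)) differentiable (at z)"
      by (rule smooth_onD[OF smooth_on_cr[OF assms(2) st] assms(2) that])
  qed
  have "log_deriv U t (\<lambda>z. - cnj (z - p) / of_real (t z))"
    unfolding log_deriv_def
  proof (intro conjI ballI)
    show "smooth_on U (\<lambda>z. - cnj (z - p) / of_real (t z))"
      by (intro smooth_on_divide smooth_on_minus smooth_on_cnj smooth_on_diff smooth_on_ident smooth_on_const
          smooth_on_cr st assms(2)) (use pos(2) in force)
    show "dz (\<lambda>w. complex_of_real (t w)) z = - cnj (z - p) / complex_of_real (t z) * complex_of_real (t z)" if "z \<in> U" for z
      using dt(1)[OF that] pos(2)[OF that] by simp
  qed (use st assms in auto)
  then have "log_deriv U (\<lambda>z. inverse (t z)) (\<lambda>z. - (- cnj (z - p) / of_real (t z)))"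
    by (rule log_deriv_inverse) (use pos(2) in force)
  moreover have "(\<lambda>z. - (- cnj (z - p) / of_real (t z))) = \<kappa>"
    by (simp only: \<kappa>_def t_def minus_divide_left minus_minus)
  ultimately show "log_deriv U (\<lambda>z. inverse (2 * R\<^sup>2 - (cmod (z - p))\<^sup>2)) \<kappa>"
    by (simp add: t_def)
  fix z assume z: "z \<in> U"
  have d: "(\<lambda>w. cnj (w - p)) differentiable (at z)" by (rule differentiable_cnj) simp
  have t0: "complex_of_real (t z) \<noteq> 0" using pos(2)[OF z] by simp
  have h: "((\<lambda>w. w - p) has_field_derivative 1) (at z)" by (auto intro!: derivative_eq_intros)
  have c: "dzb (\<lambda>w. cnj (w - p)) z = 1"
    using dzb_cnj[of "\<lambda>w. w - p" z] dz_field_derivative[OF h] by simp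
  have "dzb \<kappa> z = dzb (\<lambda>w. cnj (w - p) * inverse (complex_of_real (t w))) z"
    by (simp add: \<kappa>_def t_def divide_inverse)
  also have "\<dots> = 1 * inverse (complex_of_real (t z)) + cnj (z - p) * ((z - p) / (of_real (t z))\<^sup>2)"
    using dzb_mult[OF d differentiable_inverse[OF dt(3)[OF z] t0]] dzb_inverse[OF dt(3)[OF z] t0] dt(2)[OF z] c by simp
  also have "\<dots> = of_real (t z + (cmod (z - p))\<^sup>2) / (of_real (t z))\<^sup>2"
    using t0 complex_norm_square[of "z - p"] by (simp add: field_simps power2_eq_square)
  also have "\<dots> = of_real (2 * R\<^sup>2 / (t z)\<^sup>2)" by (simp add: t_def)
  finally have "Re (dzb \<kappa> z) = 2 * R\<^sup>2 / (t z)\<^sup>2" by simp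
  moreover have "1 / (2 * R\<^sup>2) \<le> 2 * R\<^sup>2 / (t z)\<^sup>2"
  proof -
    have "(t z)\<^sup>2 \<le> (2 * R\<^sup>2)\<^sup>2" using pos[OF z] by (intro power_mono) auto
    then show ?thesis using pos(2)[OF z] assms(1) by (simp add: divide_simps power2_eq_square)
  qed
  ultimately show "Re (dzb \<kappa> z) \<ge> 1 / (2 * R\<^sup>2)" by simp
qed

lemma local_max_second_derivative:
  fixes \<rho> :: "complex \<Rightarrow> real"
  assumes "open U" "smooth_on U \<rho>" "z \<in> U" and max: "\<And>x. x \<in> U \<Longrightarrow> \<rho> x \<le> \<rho> z" and v: "v = 1 \<or> v = \<i>"
  shows "dd v \<rho> z = 0" "dd v (dd v \<rho>) z \<le> 0"
proof -
  obtain r where r: "r > 0" "ball z r \<subseteq> U" using assms(1,3) open_contains_ball_eq by blast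
  define h where "h = (\<lambda>t. \<rho> (z + of_real t * v))"
  have inU: "z + of_real t * v \<in> U" if "\<bar>t\<bar> < r" for t
    using r(2) that v by (auto simp: dist_norm norm_mult subset_iff)
  have sv: "smooth_on U (dd v \<rho>)" using smooth_on_dd[OF assms(2)] v by auto
  have d1: "(h has_real_derivative dd v \<rho> (z + of_real t * v)) (at t)" if "\<bar>t\<bar> < r" for t
    using has_vector_derivative_line[OF smooth_onD[OF assms(2,1) inU[OF that]]]
    by (simp add: h_def has_real_derivative_iff_has_vector_derivative)
  have d2: "((\<lambda>t. dd v \<rho> (z + of_real t * v)) has_real_derivative dd v (dd v \<rho>) z) (at 0)"
    using has_vector_derivative_line[of "dd v \<rho>" z 0 v] smooth_onD[OF sv assms(1,3)]
    by (simp add: has_real_derivative_iff_has_vector_derivative)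
  show z1: "dd v \<rho> z = 0"
  proof (rule DERIV_local_max[of h _ 0 r])
    show "(h has_real_derivative dd v \<rho> z) (at 0)" using d1[of 0] r(1) by simp
    show "\<forall>y. \<bar>0 - y\<bar> < r \<longrightarrow> h y \<le> h 0" using max inU by (auto simp: h_def)
  qed (rule r(1))
  show "dd v (dd v \<rho>) z \<le> 0"
  proof (rule ccontr)
    assume "\<not> dd v (dd v \<rho>) z \<le> 0"
    then obtain d where d: "d > 0" "\<And>t. 0 < t \<Longrightarrow> t < d \<Longrightarrow> 0 < dd v \<rho> (z + of_real t * v)"
      using DERIV_pos_inc_right[OF d2] z1 by auto
    define e where "e = min d r / 2"
    have e: "e > 0" "e < d" "e < r" using d r by (auto simp: e_def)
    obtain t where t: "0 < t" "t < e" "h e - h 0 = (e - 0) * dd v \<rho> (z + of_real t * v)"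
      using MVT2[OF e(1), of h "\<lambda>t. dd v \<rho> (z + of_real t * v)"] d1 e by auto
    have "h e - h 0 > 0" unfolding t(3) using d(2)[of t] t e by auto
    moreover have "h e \<le> h 0" using max[OF inU[of e]] e by (simp add: h_def)
    ultimately show False by simp
  qed
qed

text \<open>At an interior maximum \<open>\<partial>\<rho>\<close> vanishes, hence so does \<open>\<kappa>\<close>, and the Laplacian of \<open>\<rho>\<close> is positive there.\<close>

lemma strict_log_subharmonic_no_max:
  assumes ld: "log_deriv U \<rho> \<kappa>" and z: "z \<in> U" and pos: "\<rho> z > 0" and max: "\<And>x. x \<in> U \<Longrightarrow> \<rho> x \<le> \<rho> z"
    and strict: "Re (dzb \<kappa> z) > 0"
  shows False
proof -
  have U: "open U" and s: "smooth_on U \<rho>" "smooth_on U \<kappa>"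
    and e: "\<And>z. z \<in> U \<Longrightarrow> dz (\<lambda>w. of_real (\<rho> w)) z = \<kappa> z * of_real (\<rho> z)"
    using ld by (auto simp: log_deriv_def)
  note m = local_max_second_derivative[OF U s(1) z max]
  define c where "c = (\<lambda>w. complex_of_real (\<rho> w))"
  have sc: "smooth_on U c" unfolding c_def by (rule smooth_on_cr[OF U s(1)])
  have ddc: "dd v c x = of_real (dd v \<rho> x)" if "x \<in> U" for v x
    unfolding c_def by (rule dd_bounded_linear[OF bounded_linear_of_real smooth_onD[OF s(1) U that]])
  have "dz c z = 0" by (simp add: dz_def dx_dd dy_dd ddc[OF z] m)
  then have k0: "\<kappa> z = 0" using e[OF z] pos by (simp add: c_def)
  have "dzb (dz c) z = dzb (\<lambda>w. \<kappa> w * c w) z"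
    by (rule dzb_cong[OF U z]) (simp add: c_def e)
  also have "\<dots> = dzb \<kappa> z * of_real (\<rho> z)"
    using dzb_mult[OF smooth_onD[OF s(2) U z] smooth_onD[OF sc U z]] k0 by (simp add: c_def)
  finally have 1: "Re (dzb (dz c) z) = Re (dzb \<kappa> z) * \<rho> z" by simp
  have "dd v (dd v c) z = of_real (dd v (dd v \<rho>) z)" if "v = 1 \<or> v = \<i>" for v
  proof -
    have "dd v (dd v c) z = dd v (\<lambda>x. complex_of_real (dd v \<rho> x)) z"
      by (rule dd_cong[OF U z ddc])
    also have "\<dots> = of_real (dd v (dd v \<rho>) z)"
      using smooth_on_dd[OF s(1)] that by (intro dd_bounded_linear[OF bounded_linear_of_real] smooth_onD[OF _ U z]) auto
    finally show ?thesis .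
  qed
  then have "Re (dzb (dz c) z) = (dd 1 (dd 1 \<rho>) z + dd \<i> (dd \<i> \<rho>) z) / 4"
    unfolding dz_dzb(1)[OF U sc z] dx_dd dy_dd by simp
  then have "Re (dzb (dz c) z) \<le> 0" using m(2)[of 1] m(2)[of \<i>] by simp
  then show False using 1 strict pos by (simp add: mult_le_0_iff)
qed

text \<open>The maximum principle, with the boundary values replaced by an upper limit because \<open>\<rho>\<close> may be undefined on the boundary.\<close>

lemma strict_log_subharmonic_bound:
  assumes ld: "log_deriv U \<rho> \<kappa>" and bU: "bounded U" and pos: "\<And>z. z \<in> U \<Longrightarrow> \<rho> z > 0"
    and strict: "\<And>z. z \<in> U \<Longrightarrow> Re (dzb \<kappa> z) > 0" and "M \<ge> 0"
    and bdry: "\<And>b e. b \<in> closure U \<Longrightarrow> b \<notin> U \<Longrightarrow> e > 0 \<Longrightarrow> \<exists>d>0. \<forall>z\<in>U. dist z b < d \<longrightarrow> \<rho> z < M + e"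
    and z: "z \<in> U"
  shows "\<rho> z \<le> M"
proof (rule ccontr)
  assume "\<not> \<rho> z \<le> M"
  define e where "e = (\<rho> z - M) / 2"
  have e: "e > 0" "\<rho> z \<ge> M + e" using \<open>\<not> \<rho> z \<le> M\<close> by (auto simp: e_def field_simps)
  define K where "K = {x \<in> U. \<rho> x \<ge> M + e}"
  have U: "open U" and cont: "continuous_on U \<rho>"
    using ld smooth_on_continuous by (auto simp: log_deriv_def)
  have "b \<in> K" if b: "b \<in> closure K" for b
  proof -
    have near: "\<exists>y\<in>K. dist y b < d" if "d > 0" for d using b that by (simp add: closure_approachable)
    have bU': "b \<in> closure U" using b closure_mono[of K U] by (auto simp: K_def)
    show ?thesis
    proof (cases "b \<in> U")
      case False
      then obtain d where "d > 0" "\<forall>z\<in>U. dist z b < d \<longrightarrow> \<rho> z < M + e" using bdry[OF bU' _ e(1)] by blast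
      then show ?thesis using near[of d] by (force simp: K_def)
    next
      case True
      have "\<rho> b \<ge> M + e"
      proof (rule ccontr)
        assume "\<not> \<rho> b \<ge> M + e"
        then have g: "M + e - \<rho> b > 0" by simp
        have "continuous (at b) \<rho>" using cont True U by (simp add: continuous_on_eq_continuous_at)
        then obtain d where d: "d > 0" "\<And>x. dist x b < d \<Longrightarrow> dist (\<rho> x) (\<rho> b) < M + e - \<rho> b"
          unfolding continuous_at_eps_delta using g by blast
        then obtain y where "y \<in> K" "dist y b < d" using near by blast
        then show False using d(2)[of y] by (auto simp: K_def dist_real_def)
      qed
      then show ?thesis using True by (simp add: K_def)
    qed
  qed
  then have "closed K" by (metis closure_subset_eq subsetI)
  moreover have "bounded K" using bU by (rule bounded_subset) (auto simp: K_def)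
  ultimately have cK: "compact K" by (simp add: compact_eq_bounded_closed)
  have "K \<noteq> {}" using z e(2) by (auto simp: K_def)
  moreover have "continuous_on K \<rho>" using cont by (rule continuous_on_subset) (auto simp: K_def)
  ultimately obtain y where y: "y \<in> K" "\<And>x. x \<in> K \<Longrightarrow> \<rho> x \<le> \<rho> y"
    using continuous_attains_sup[OF cK] by blast
  have "\<rho> x \<le> \<rho> y" if "x \<in> U" for x using y that by (cases "x \<in> K") (force simp: K_def)+
  then show False using strict_log_subharmonic_no_max[OF ld, of y] y(1) pos strict by (auto simp: K_def)
qed


text \<open>Dividing \<open>D\<close> by \<open>\<bar>z - a\<bar>\<^sup>2\<close> for many zeros \<open>a\<close> close to \<open>p\<close> keeps it bounded, by the quadratic bound, and as subharmonic as before; powers of the weight absorb the error \<open>K\<close>.  The maximum principle then gains a constant factor for every zero, so that \<open>D z1\<close> lies below all terms of a geometric sequence.\<close>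

proposition zeros_accumulate_imp_zero:
  fixes D :: "complex \<Rightarrow> real"
  assumes R: "R > 0"
    and nonneg: "\<And>z. z \<in> ball p R - {p} \<Longrightarrow> 0 \<le> D z"
    and bound: "\<And>z. z \<in> ball p R - {p} \<Longrightarrow> D z \<le> M"
    and ld: "log_deriv {z \<in> ball p R - {p}. D z \<noteq> 0} D \<kappa>"
    and K: "\<And>z. z \<in> ball p R - {p} \<Longrightarrow> D z \<noteq> 0 \<Longrightarrow> Re (dzb \<kappa> z) \<ge> - K"
    and zeros: "\<And>a. a \<in> ball p R - {p} \<Longrightarrow> D a = 0 \<Longrightarrow>
       \<exists>C. \<exists>d>0. \<forall>z\<in>ball p R - {p}. dist z a < d \<longrightarrow> D z \<le> C * (dist z a)\<^sup>2"
    and acc: "p islimpt {z \<in> ball p R - {p}. D z = 0}"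
    and z1: "z1 \<in> ball p (R / 8) - {p}"
  shows "D z1 = 0"
proof (rule ccontr)
  assume Dz1: "D z1 \<noteq> 0"
  define U where "U = {z \<in> ball p R - {p}. D z \<noteq> 0}"
  have U: "open U" "U \<subseteq> ball p R" using ld by (auto simp: U_def log_deriv_def)
  have z1U: "z1 \<in> U" using z1 Dz1 R by (auto simp: U_def)
  have M0: "M \<ge> 0" using nonneg[of z1] bound[of z1] z1U by (auto simp: U_def)
  define q where "q = (\<lambda>z. inverse (2 * R\<^sup>2 - (cmod (z - p))\<^sup>2))"
  define \<kappa>1 where "\<kappa>1 = (\<lambda>z. cnj (z - p) / of_real (2 * R\<^sup>2 - (cmod (z - p))\<^sup>2))"
  note weight = weight_log_deriv[where p = p, OF R U, folded q_def \<kappa>1_def]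
  have q: "0 < q z" "q z \<le> inverse (R\<^sup>2)" if "dist z p \<le> R" for z
  proof -
    have "(cmod (z - p))\<^sup>2 \<le> R\<^sup>2" using that R by (intro power_mono) (auto simp: dist_norm)
    then have s: "R\<^sup>2 \<le> 2 * R\<^sup>2 - (cmod (z - p))\<^sup>2" by linarith
    have R2: "R\<^sup>2 > 0" using R by simp
    show "q z \<le> inverse (R\<^sup>2)" unfolding q_def by (rule le_imp_inverse_le[OF s R2])
    show "0 < q z" unfolding q_def by (rule positive_imp_inverse_positive[OF less_le_trans[OF R2 s]])
  qed
  \<comment> \<open>The exponent of the weight beats the lower bound \<open>- K\<close>.\<close>
  obtain L :: nat where L: "real L / (2 * R\<^sup>2) > 2 * K"
  proof -
    obtain L :: nat where "real L > 2 * K * (2 * R\<^sup>2)" using reals_Archimedean2 by blast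
    then show ?thesis using R by (intro that[of L]) (simp add: field_simps)
  qed
  define E where "E = M\<^sup>2 * inverse (R\<^sup>2) ^ L * R\<^sup>2"
  have key: "(D z1)\<^sup>2 * q z1 ^ L * (cmod (z1 - p))\<^sup>2 \<le> E * (1 / 9) ^ l" for l
  proof -
    have inf: "infinite ({z \<in> ball p R - {p}. D z = 0} \<inter> ball p (R / 8))"
      using acc R by (simp add: islimpt_eq_infinite_ball)
    obtain A where A: "finite A" "card A = l" "A \<subseteq> {z \<in> ball p R - {p}. D z = 0} \<inter> ball p (R / 8)"
      using infinite_arbitrarily_large[OF inf, of l] by (elim exE conjE) (rule that)
    have AU: "a \<notin> U" "a \<noteq> p" "a \<in> ball p R - {p}" "D a = 0" "dist a p < R / 8" if "a \<in> A" for a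
      using A(3) that by (auto simp: U_def dist_commute)
    have pU: "p \<notin> U" by (simp add: U_def)
    define \<rho> where "\<rho> = (\<lambda>z. (D z ^ 2 * q z ^ L) * ((cmod (z - p))\<^sup>2 * (\<Prod>a\<in>A. inverse ((cmod (z - a))\<^sup>2))))"
    define \<mu> where "\<mu> = (\<lambda>z. (of_nat 2 * \<kappa> z + of_nat L * \<kappa>1 z) + (inverse (z - p) + (\<Sum>a\<in>A. - inverse (z - a))))"
    have ldD: "log_deriv U D \<kappa>" using ld by (simp add: U_def)
    have ld1: "log_deriv U (\<lambda>z. (cmod (z - p))\<^sup>2 * (\<Prod>a\<in>A. inverse ((cmod (z - a))\<^sup>2)))
        (\<lambda>z. inverse (z - p) + (\<Sum>a\<in>A. - inverse (z - a)))"
    proof (intro log_deriv_mult log_deriv_prod log_deriv_inverse log_deriv_cmod_sq U(1) A(1) pU)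
      show "a \<notin> U" if "a \<in> A" for a by (rule AU(1)[OF that])
      show "(cmod (z - a))\<^sup>2 \<noteq> 0" if "a \<in> A" "z \<in> U" for a z using AU(1)[OF that(1)] that(2) by auto
    qed
    have ld\<rho>: "log_deriv U \<rho> \<mu>"
      unfolding \<rho>_def \<mu>_def by (intro log_deriv_mult[OF log_deriv_mult[OF log_deriv_power log_deriv_power]] ldD weight(1) ld1)
    have strict: "Re (dzb \<mu> z) > 0" if z: "z \<in> U" for z
    proof -
      have dh: "dzb (\<lambda>z. inverse (z - a)) z = 0" "(\<lambda>z. inverse (z - a)) differentiable (at z)" if "a \<notin> U" for a
      proof -
        have "z \<noteq> a" using z that by auto
        then have "((\<lambda>z. inverse (z - a)) has_field_derivative - inverse (z - a) * 1 * inverse (z - a)) (at z)"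
          by (auto intro!: derivative_eq_intros)
        then show "dzb (\<lambda>z. inverse (z - a)) z = 0" "(\<lambda>z. inverse (z - a)) differentiable (at z)"
          by (auto intro: dzb_field_derivative simp: differentiable_def has_field_derivative_def)
      qed
      have hol: "dzb (\<lambda>z. inverse (z - p) + (\<Sum>a\<in>A. - inverse (z - a))) z = 0"
        "(\<lambda>z. inverse (z - p) + (\<Sum>a\<in>A. - inverse (z - a))) differentiable (at z)"
      proof -
        have d: "(\<lambda>z. \<Sum>a\<in>A. - inverse (z - a)) differentiable (at z)"
          using dh AU(1) A(1) by (intro differentiable_sum differentiable_minus) auto
        have "dzb (\<lambda>z. \<Sum>a\<in>A. - inverse (z - a)) z = (\<Sum>a\<in>A. dzb (\<lambda>z. - inverse (z - a)) z)"
          by (rule dzb_sum) (use dh AU(1) in \<open>auto intro: differentiable_minus\<close>)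
        also have "\<dots> = 0" using dzb_minus[OF dh(2)] dh(1) AU(1) by (intro sum.neutral) auto
        finally show "dzb (\<lambda>z. inverse (z - p) + (\<Sum>a\<in>A. - inverse (z - a))) z = 0"
          using dzb_add[OF dh(2)[OF pU] d] dh(1)[OF pU] by simp
        show "(\<lambda>z. inverse (z - p) + (\<Sum>a\<in>A. - inverse (z - a))) differentiable (at z)"
          using dh(2)[OF pU] d by (rule differentiable_add)
      qed
      have s\<kappa>: "smooth_on U \<kappa>" "smooth_on U \<kappa>1" using ldD weight(1) by (auto simp: log_deriv_def)
      note d\<kappa> = smooth_onD[OF s\<kappa>(1) U(1) z] smooth_onD[OF s\<kappa>(2) U(1) z]
      have d2: "(\<lambda>z. of_nat 2 * \<kappa> z) differentiable (at z)" "(\<lambda>z. of_nat L * \<kappa>1 z) differentiable (at z)"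
        using d\<kappa> by (auto intro: differentiable_mult differentiable_const)
      have "dzb \<mu> z = of_nat 2 * dzb \<kappa> z + of_nat L * dzb \<kappa>1 z"
        unfolding \<mu>_def dzb_add[OF differentiable_add[OF d2] hol(2)] dzb_add[OF d2] hol(1)
          dzb_cmult[OF d\<kappa>(1)] dzb_cmult[OF d\<kappa>(2)] by simp
      then have "Re (dzb \<mu> z) = 2 * Re (dzb \<kappa> z) + real L * Re (dzb \<kappa>1 z)" by simp
      moreover have "Re (dzb \<kappa> z) \<ge> - K" using K z by (auto simp: U_def)
      moreover have "real L * Re (dzb \<kappa>1 z) \<ge> real L * (1 / (2 * R\<^sup>2))"
        using weight(2)[OF z] by (intro mult_left_mono) auto
      ultimately show ?thesis using L by simp
    qed
    have pos: "\<rho> z > 0" if "z \<in> U" for z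
    proof -
      have "D z > 0" "q z > 0" "z \<noteq> p" using that nonneg[of z] q(1)[of z] by (auto simp: U_def dist_commute less_le)
      moreover have "z \<noteq> a" if "a \<in> A" for a using AU(1)[OF that] \<open>z \<in> U\<close> by auto
      ultimately show ?thesis unfolding \<rho>_def by (intro mult_pos_pos prod_pos) auto
    qed
    define B where "B = E * (16 / (9 * R\<^sup>2)) ^ l"
    have E0: "E \<ge> 0" unfolding E_def by simp
    have B0: "B \<ge> 0" unfolding B_def using E0 by (intro mult_nonneg_nonneg zero_le_power) auto
    have "\<rho> z1 \<le> B"
    proof (rule strict_log_subharmonic_bound[OF ld\<rho> bounded_subset[OF bounded_ball U(2)] pos strict B0 _ z1U])
      fix b :: complex and e :: real
      assume b: "b \<in> closure U" "b \<notin> U" and e: "e > 0"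
      have "closure U \<subseteq> cball p R" using U(2) closure_mono[of U "ball p R"] R by simp
      then have bR: "dist b p \<le> R" using b(1) by (auto simp: dist_commute)
      have le: "D z \<le> M" "0 \<le> D z" "z \<in> ball p R - {p}" if "z \<in> U" for z
        using that bound nonneg by (auto simp: U_def)
      have qz: "0 < q z" "q z \<le> inverse (R\<^sup>2)" if "z \<in> U" for z
        using q[of z] that U(2) by (auto simp: dist_commute)
      consider "dist b p = R" | "b = p" | "dist b p < R" "b \<noteq> p" "D b = 0"
        using b(2) bR by (cases "dist b p = R"; cases "b = p") (simp_all add: U_def dist_commute[of p])
      then show "\<exists>d>0. \<forall>z\<in>U. dist z b < d \<longrightarrow> \<rho> z < B + e"
      proof cases
        case 1
        have le_B: "\<rho> z \<le> B" if z: "z \<in> U" "dist z b < R / 8" for z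
        proof -
          have zp: "cmod (z - p) \<le> R" using z(1) U(2) by (auto simp: dist_norm norm_minus_commute)
          have "inverse ((cmod (z - a))\<^sup>2) \<le> 16 / (9 * R\<^sup>2)" if a: "a \<in> A" for a
          proof -
            have "dist b p \<le> dist b z + dist z a + dist a p"
              using dist_triangle[of b p z] dist_triangle[of z p a] by linarith
            then have "3 * R / 4 \<le> dist z a"
              using 1 z(2) AU(5)[OF a] dist_commute[of b z] by linarith
            then have "3 * R / 4 \<le> cmod (z - a)" by (simp add: dist_norm)
            then have "(3 * R / 4)\<^sup>2 \<le> (cmod (z - a))\<^sup>2" using R by (intro power_mono) auto
            then have "inverse ((cmod (z - a))\<^sup>2) \<le> inverse ((3 * R / 4)\<^sup>2)" using R by (intro le_imp_inverse_le) auto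
            also have "\<dots> = 16 / (9 * R\<^sup>2)" by (simp add: power2_eq_square field_simps)
            finally show ?thesis .
          qed
          then have pr: "(\<Prod>a\<in>A. inverse ((cmod (z - a))\<^sup>2)) \<le> (16 / (9 * R\<^sup>2)) ^ l"
            using prod_mono[of A "\<lambda>a. inverse ((cmod (z - a))\<^sup>2)" "\<lambda>a. 16 / (9 * R\<^sup>2)"] A(2) by simp
          have "\<rho> z \<le> (M ^ 2 * inverse (R\<^sup>2) ^ L) * (R\<^sup>2 * (16 / (9 * R\<^sup>2)) ^ l)"
            unfolding \<rho>_def using le[OF z(1)] qz[OF z(1)] zp pr
            by (intro mult_mono power_mono mult_nonneg_nonneg prod_nonneg) auto
          then show ?thesis by (simp add: B_def E_def mult.assoc)
        qed
        show ?thesis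
        proof (intro exI[of _ "R / 8"] conjI ballI impI)
          show "\<rho> z < B + e" if "z \<in> U" "dist z b < R / 8" for z using le_B[OF that] e by linarith
        qed (use R in simp)
      next
        case 2
        define h where "h = (\<lambda>z. (M ^ 2 * inverse (R\<^sup>2) ^ L) * ((cmod (z - p))\<^sup>2 * (\<Prod>a\<in>A. inverse ((cmod (z - a))\<^sup>2))))"
        have "isCont h p" unfolding h_def using AU(2) by (intro continuous_intros) auto
        moreover have "h p = 0" by (simp add: h_def)
        ultimately obtain d where d: "d > 0" "\<And>z. dist z p < d \<Longrightarrow> \<bar>h z\<bar> < e"
          unfolding continuous_at_eps_delta using e by (force simp: dist_real_def)
        have "\<rho> z < B + e" if "z \<in> U" "dist z b < d" for z
        proof -
          have "\<rho> z \<le> h z"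
            unfolding \<rho>_def h_def using le[OF that(1)] qz[OF that(1)]
            by (intro mult_mono power_mono mult_nonneg_nonneg prod_nonneg order_refl) auto
          then show ?thesis using d(2)[of z] that(2) 2 B0 by auto
        qed
        then show ?thesis using d(1) by blast
      next
        case 3
        then have b3: "b \<in> ball p R - {p}" by (auto simp: dist_commute)
        then obtain C d1 where C: "d1 > 0" "\<And>z. z \<in> ball p R - {p} \<Longrightarrow> dist z b < d1 \<Longrightarrow> D z \<le> C * (dist z b)\<^sup>2"
          using zeros[OF b3 3(3)] by blast
        define h where "h = (\<lambda>z. C\<^sup>2 * (cmod (z - b))\<^sup>2 * inverse (R\<^sup>2) ^ L * (R\<^sup>2 * (\<Prod>a\<in>A - {b}. inverse ((cmod (z - a))\<^sup>2))))"
        have "isCont h b" unfolding h_def by (intro continuous_intros) auto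
        moreover have "h b = 0" by (simp add: h_def)
        ultimately obtain d2 where d2: "d2 > 0" "\<And>z. dist z b < d2 \<Longrightarrow> \<bar>h z\<bar> < e"
          unfolding continuous_at_eps_delta using e by (force simp: dist_real_def)
        define d where "d = min 1 (min d1 d2)"
        have "\<rho> z < B + e" if z: "z \<in> U" "dist z b < d" for z
        proof -
          have zp: "cmod (z - p) \<le> R" using z(1) U(2) by (auto simp: dist_norm norm_minus_commute)
          have zb: "z \<noteq> b" using z(1) b(2) by auto
          define x where "x = (cmod (z - b))\<^sup>2"
          have "cmod (z - b) \<le> 1" using z(2) by (simp add: d_def dist_norm)
          then have x: "0 < x" "x \<le> 1" using zb by (auto simp: x_def power_le_one)
          have "D z \<le> C * x" using C(2)[OF le(3)[OF z(1)]] z(2) by (simp add: d_def x_def dist_norm)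
          then have "(D z)\<^sup>2 \<le> (C * x)\<^sup>2" using le(2)[OF z(1)] by (rule power_mono)
          then have D2: "(D z)\<^sup>2 \<le> C\<^sup>2 * x * x" by (simp add: power2_eq_square mult_ac)
          define pr where "pr = (\<Prod>a\<in>A - {b}. inverse ((cmod (z - a))\<^sup>2))"
          have pr0: "pr \<ge> 0" unfolding pr_def by (intro prod_nonneg) auto
          have "x * (\<Prod>a\<in>A. inverse ((cmod (z - a))\<^sup>2)) \<le> pr"
          proof (cases "b \<in> A")
            case True
            then have "(\<Prod>a\<in>A. inverse ((cmod (z - a))\<^sup>2)) = inverse x * pr"
              unfolding pr_def x_def by (rule prod.remove[OF A(1)])
            then show ?thesis using x by (simp add: mult.assoc[symmetric])
          next
            case False
            then have "(\<Prod>a\<in>A. inverse ((cmod (z - a))\<^sup>2)) = pr" by (simp add: pr_def)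
            then show ?thesis using x pr0 by (simp add: mult_left_le_one_le)
          qed
          then have xp: "x * (\<Prod>a\<in>A. inverse ((cmod (z - a))\<^sup>2)) \<le> pr" .
          have nn: "0 \<le> (\<Prod>a\<in>A. inverse ((cmod (z - a))\<^sup>2))" by (intro prod_nonneg) auto
          have "\<rho> z \<le> (C\<^sup>2 * x * x * inverse (R\<^sup>2) ^ L) * (R\<^sup>2 * (\<Prod>a\<in>A. inverse ((cmod (z - a))\<^sup>2)))"
            unfolding \<rho>_def using D2 qz[OF z(1)] zp x nn
            by (intro mult_mono power_mono mult_nonneg_nonneg) auto
          also have "\<dots> = (C\<^sup>2 * x * inverse (R\<^sup>2) ^ L * R\<^sup>2) * (x * (\<Prod>a\<in>A. inverse ((cmod (z - a))\<^sup>2)))"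
            by (simp only: mult_ac)
          also have "\<dots> \<le> (C\<^sup>2 * x * inverse (R\<^sup>2) ^ L * R\<^sup>2) * pr"
            using x by (intro mult_left_mono xp) auto
          also have "\<dots> = h z" by (simp add: h_def x_def pr_def mult.assoc)
          finally show ?thesis using d2(2)[of z] z(2) B0 by (auto simp: d_def)
        qed
        moreover have "d > 0" using C(1) d2(1) by (simp add: d_def)
        ultimately show ?thesis by blast
      qed
    qed
    define Q where "Q = (\<Prod>a\<in>A. (cmod (z1 - a))\<^sup>2)"
    have Qpos: "Q > 0" unfolding Q_def using AU(1) z1U by (intro prod_pos) auto
    have "(cmod (z1 - a))\<^sup>2 \<le> R\<^sup>2 / 16" if a: "a \<in> A" for a
    proof -
      have "dist z1 a \<le> dist z1 p + dist a p" by (metis dist_commute dist_triangle)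
      then have "cmod (z1 - a) \<le> R / 4" using AU(5)[OF a] z1 by (simp add: dist_norm norm_minus_commute)
      then have "(cmod (z1 - a))\<^sup>2 \<le> (R / 4)\<^sup>2" by (intro power_mono) auto
      then show ?thesis by (simp add: power2_eq_square)
    qed
    then have Q: "Q \<le> (R\<^sup>2 / 16) ^ l"
      using prod_mono[of A "\<lambda>a. (cmod (z1 - a))\<^sup>2" "\<lambda>a. R\<^sup>2 / 16"] A(2) by (simp add: Q_def)
    have "(\<Prod>a\<in>A. inverse ((cmod (z1 - a))\<^sup>2)) * Q = 1"
      unfolding Q_def prod.distrib[symmetric]
    proof (intro prod.neutral ballI)
      fix a assume "a \<in> A"
      then have "z1 \<noteq> a" using AU(1) z1U by auto
      then show "inverse ((cmod (z1 - a))\<^sup>2) * (cmod (z1 - a))\<^sup>2 = 1" by simp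
    qed
    then have "(D z1)\<^sup>2 * q z1 ^ L * (cmod (z1 - p))\<^sup>2 = \<rho> z1 * Q"
      by (simp add: \<rho>_def mult.assoc)
    also have "\<dots> \<le> B * (R\<^sup>2 / 16) ^ l"
      using \<open>\<rho> z1 \<le> B\<close> Q Qpos B0 by (intro mult_mono) auto
    also have "\<dots> = E * ((16 / (9 * R\<^sup>2)) * (R\<^sup>2 / 16)) ^ l" by (simp only: B_def power_mult_distrib mult.assoc)
    also have "(16 / (9 * R\<^sup>2)) * (R\<^sup>2 / 16) = 1 / 9" using R by simp
    finally show ?thesis .
  qed
  have "(\<lambda>l. E * (1 / 9) ^ l) \<longlonglongrightarrow> E * 0" by (intro tendsto_intros LIMSEQ_realpow_zero) auto
  then have "(D z1)\<^sup>2 * q z1 ^ L * (cmod (z1 - p))\<^sup>2 \<le> E * 0"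
    by (rule tendsto_lowerbound) (use key in auto)
  moreover have "(D z1)\<^sup>2 * q z1 ^ L * (cmod (z1 - p))\<^sup>2 > 0"
  proof (intro mult_pos_pos)
    show "q z1 ^ L > 0" using q(1)[of z1] z1 R by (intro zero_less_power) (auto simp: dist_commute)
  qed (use Dz1 z1 in auto)
  ultimately show False by simp
qed

section \<open>The harmonic sequence\<close>

lemma cmod_bprod_cnjv_le: "(cmod (bprod N a (cnjv b)))\<^sup>2 \<le> nsq N a * nsq N b"
proof -
  have "cmod (bprod N a (cnjv b)) \<le> (\<Sum>k<N. cmod (a k) * cmod (b k))"
    unfolding bprod_def cnjv_def by (rule order_trans[OF norm_sum]) (simp add: norm_mult)
  then have "(cmod (bprod N a (cnjv b)))\<^sup>2 \<le> (\<Sum>k<N. cmod (a k) * cmod (b k))\<^sup>2"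
    by (rule power_mono) simp
  also have "\<dots> \<le> nsq N a * nsq N b"
    unfolding nsq_def by (rule Cauchy_Schwarz_ineq_sum)
  finally show ?thesis .
qed

lemma smooth_on_nsq: "open U \<Longrightarrow> vsmooth U N a \<Longrightarrow> smooth_on U (\<lambda>z. nsq N (a z))"
proof -
  assume U: "open U" and a: "vsmooth U N a"
  have "smooth_on U (\<lambda>z. Re (bprod N (a z) (cnjv (a z))))"
    by (intro smooth_on_Re smooth_on_bprod vsmooth_cnjv U a)
  then show ?thesis by (rule smooth_on_cong[OF _ U]) (simp add: bprod_cnjv_self)
qed

text \<open>A square norm vanishes to second order, as required for the division by \<open>\<bar>z - a\<bar>\<^sup>2\<close>.\<close>

lemma nsq_zero_quadratic:
  fixes a :: "complex \<Rightarrow> nat \<Rightarrow> complex"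
  assumes "\<And>k. k < N \<Longrightarrow> (\<lambda>z. a z k) differentiable (at b)" "nsq N (a b) = 0"
  shows "\<exists>C\<ge>0. \<exists>d>0. \<forall>z. dist z b < d \<longrightarrow> nsq N (a z) \<le> C * (dist z b)\<^sup>2"
proof -
  have "\<exists>C\<ge>0. \<exists>d>0. \<forall>z. dist z b < d \<longrightarrow> cmod (a z k) \<le> C * dist z b" if k: "k < N" for k
  proof -
    have D: "((\<lambda>z. a z k) has_derivative (\<lambda>v. dd v (\<lambda>z. a z k) b)) (at b)" by (rule has_derivative_dd[OF assms(1)[OF k]])
    have z: "a b k = 0" using assms(2) k by (simp add: nsq_eq_0_iff)
    obtain d where d: "d > 0" "\<And>y. norm (y - b) < d \<Longrightarrow>
        norm (a y k - a b k - dd (y - b) (\<lambda>z. a z k) b) \<le> 1 * norm (y - b)"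
      using D unfolding has_derivative_at_alt by (meson zero_less_one)
    obtain B where B: "\<And>v. norm (dd v (\<lambda>z. a z k) b) \<le> norm v * B" "B > 0"
      using bounded_linear.pos_bounded[OF has_derivative_bounded_linear[OF D]] by blast
    have "cmod (a y k) \<le> (1 + B) * dist y b" if "dist y b < d" for y
    proof -
      have "cmod (a y k) \<le> norm (a y k - a b k - dd (y - b) (\<lambda>z. a z k) b) + norm (dd (y - b) (\<lambda>z. a z k) b)"
        using norm_triangle_ineq[of "a y k - a b k - dd (y - b) (\<lambda>z. a z k) b" "dd (y - b) (\<lambda>z. a z k) b"] z by simp
      also have "\<dots> \<le> (1 + B) * dist y b"
        using d(2)[of y] B(1)[of "y - b"] that by (simp add: dist_norm algebra_simps)
      finally show ?thesis .
    qed
    then show ?thesis using d(1) B(2) by (intro exI[of _ "1 + B"]) auto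
  qed
  then obtain C d where C: "\<And>k. k < N \<Longrightarrow> C k \<ge> 0" and d: "\<And>k. k < N \<Longrightarrow> d k > 0"
    "\<And>k z. k < N \<Longrightarrow> dist z b < d k \<Longrightarrow> cmod (a z k) \<le> C k * dist z b" by metis
  define e where "e = Min (insert 1 (d ` {..<N}))"
  have e: "e > 0" "\<And>k. k < N \<Longrightarrow> e \<le> d k" using d(1) by (auto simp: e_def)
  have "nsq N (a z) \<le> (\<Sum>k<N. (C k)\<^sup>2) * (dist z b)\<^sup>2" if "dist z b < e" for z
    unfolding nsq_def sum_distrib_right
  proof (rule sum_mono)
    fix k assume "k \<in> {..<N}"
    then have "cmod (a z k) \<le> C k * dist z b" using d(2)[of k z] e(2)[of k] that by simp
    then have "(cmod (a z k))\<^sup>2 \<le> (C k * dist z b)\<^sup>2" by (rule power_mono) simp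
    then show "(cmod (a z k))\<^sup>2 \<le> (C k)\<^sup>2 * (dist z b)\<^sup>2" by (simp add: power_mult_distrib)
  qed
  then show ?thesis using e(1) by (intro exI[of _ "\<Sum>k<N. (C k)\<^sup>2"]) (auto intro: sum_nonneg)
qed

locale harmonic_sequence =
  fixes N :: nat and V :: "complex set" and f :: "complex \<Rightarrow> nat \<Rightarrow> real"
  assumes V: "open V"
    and smooth_f: "\<And>k. k < N \<Longrightarrow> smooth_on V (\<lambda>z. f z k)"
    and unit_f: "\<And>z. z \<in> V \<Longrightarrow> bprod N (f z) (f z) = 1"
    and iso_f: "\<And>z j l. z \<in> V \<Longrightarrow> j + l > 0 \<Longrightarrow>
      bprod N ((vdz ^^ j) (complexify f) z) ((vdz ^^ l) (complexify f) z) = 0"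
    and harmonic_f: "\<And>z k. z \<in> V \<Longrightarrow> k < N \<Longrightarrow>
      vdzb (vdz (complexify f)) z k = - of_real (nsq N (vdz (complexify f) z)) * complexify f z k"
begin

definition X :: "nat \<Rightarrow> complex \<Rightarrow> nat \<Rightarrow> complex" where "X j = (vdz ^^ j) (complexify f)"

lemma X_0: "X 0 = complexify f" and X_Suc: "X (Suc j) = vdz (X j)" by (simp_all add: X_def)

lemma X_smooth: "vsmooth V N (X j)"
  unfolding X_def by (intro vsmooth_funpow_vdz complexify_vsmooth V smooth_f)

lemma X_iso: "z \<in> V \<Longrightarrow> j + l > 0 \<Longrightarrow> bprod N (X j z) (X l z) = 0"
  using iso_f by (simp add: X_def)

text \<open>Gram--Schmidt on \<open>f, \<partial>f, \<partial>\<^sup>2f, \<dots>\<close>, in the form where only the component along the previous vector has to be removed.\<close>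

primrec H :: "nat \<Rightarrow> complex \<Rightarrow> nat \<Rightarrow> complex" where
  "H 0 = complexify f"
| "H (Suc j) = (\<lambda>z k. vdz (H j) z k
     - bprod N (vdz (H j) z) (cnjv (H j z)) / bprod N (H j z) (cnjv (H j z)) * H j z k)"

definition kap :: "nat \<Rightarrow> complex \<Rightarrow> complex" where
  "kap j z = bprod N (vdz (H j) z) (cnjv (H j z)) / bprod N (H j z) (cnjv (H j z))"

definition rho :: "nat \<Rightarrow> complex \<Rightarrow> real" where "rho j z = nsq N (H j z)"

definition Om :: "nat \<Rightarrow> complex set" where "Om k = {z \<in> V. \<forall>j\<le>k. rho j z \<noteq> 0}"

lemma H_Suc: "H (Suc j) z k = vdz (H j) z k - kap j z * H j z k" by (simp add: kap_def)

declare H.simps(2) [simp del]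

lemma rho_bprod: "bprod N (H j z) (cnjv (H j z)) = of_real (rho j z)"
  by (simp add: rho_def bprod_cnjv_self)

lemma ff: "z \<in> V \<Longrightarrow> bprod N (complexify f z) (complexify f z) = 1"
  by (simp add: bprod_complexify unit_f)

lemma rho_0: "z \<in> V \<Longrightarrow> rho 0 z = 1"
  using rho_bprod[of 0 z] ff[of z] by simp

lemma Om_0: "Om 0 = V" by (auto simp: Om_def rho_0)

lemma Om_Suc: "Om (Suc k) = {z \<in> Om k. rho (Suc k) z \<noteq> 0}"
  by (auto simp: Om_def le_Suc_eq)

lemma Om_subset: "Om k \<subseteq> V" by (auto simp: Om_def)

lemma Om_mono: "j \<le> k \<Longrightarrow> Om k \<subseteq> Om j" by (auto simp: Om_def)

lemma Om_rho: "z \<in> Om k \<Longrightarrow> j \<le> k \<Longrightarrow> rho j z \<noteq> 0" by (simp add: Om_def)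

lemma Om_smooth: "open (Om k) \<and> (\<forall>j\<le>Suc k. vsmooth (Om k) N (H j))"
proof -
  have step: "vsmooth U N (H (Suc j))" if U: "open U" and s: "vsmooth U N (H j)" and nz: "\<And>z. z \<in> U \<Longrightarrow> rho j z \<noteq> 0" for U j
  proof -
    have "smooth_on U (kap j)"
      unfolding kap_def by (intro smooth_on_divide smooth_on_bprod vsmooth_cnjv vsmooth_vdz U s) (simp add: rho_bprod nz)
    then have "vsmooth U N (\<lambda>z k. vdz (H j) z k - kap j z * H j z k)"
      by (intro vsmooth_diff vsmooth_scale vsmooth_vdz U s)
    then show ?thesis by (rule vsmooth_cong[OF _ U]) (simp add: H_Suc)
  qed
  show ?thesis
  proof (induction k)
    case 0
    have "vsmooth V N (H 0)" using X_smooth[of 0] by (simp add: X_0)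
    moreover from this have "vsmooth V N (H (Suc 0))" by (rule step[OF V]) (simp add: rho_0)
    ultimately show ?case using V by (auto simp: Om_0 le_Suc_eq)
  next
    case (Suc k)
    have "continuous_on (Om k) (rho (Suc k))"
      unfolding rho_def by (intro smooth_on_continuous smooth_on_nsq) (use Suc in auto)
    then have "open (Om k \<inter> rho (Suc k) -` (- {0}))" using Suc by (intro continuous_open_preimage) auto
    then have o: "open (Om (Suc k))" by (simp add: Om_Suc vimage_def Int_def)
    have s: "vsmooth (Om (Suc k)) N (H j)" if "j \<le> Suc k" for j
      using Suc that by (intro vsmooth_subset[OF _ Om_mono[of k "Suc k"]]) auto
    have "vsmooth (Om (Suc k)) N (H (Suc (Suc k)))"
      by (rule step[OF o s]) (use Om_rho in auto)
    then show ?case using o s by (auto simp: le_Suc_eq[of _ "Suc k"])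
  qed
qed

lemma Om_open: "open (Om k)" using Om_smooth by blast

lemma H_smooth: "j \<le> Suc k \<Longrightarrow> vsmooth (Om k) N (H j)" using Om_smooth by blast

lemma H_diff: "j \<le> Suc k \<Longrightarrow> z \<in> Om k \<Longrightarrow> l < N \<Longrightarrow> (\<lambda>z. H j z l) differentiable (at z)"
  using vsmooth_differentiable[OF H_smooth Om_open] .

lemma kap_smooth: "smooth_on (Om k) (kap k)"
  unfolding kap_def
  by (intro smooth_on_divide smooth_on_bprod vsmooth_cnjv vsmooth_vdz Om_open H_smooth) (auto simp: rho_bprod Om_rho)

lemma kap_0: "z \<in> V \<Longrightarrow> kap 0 z = 0"
  using X_iso[of z 1 0] by (simp add: kap_def X_def)

lemma H_1: "z \<in> V \<Longrightarrow> H (Suc 0) z k = X (Suc 0) z k"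
  by (simp add: H_Suc kap_0 X_Suc X_0)

lemma vdz_H: "vdz (H j) z k = H (Suc j) z k + kap j z * H j z k"
  by (simp add: H_Suc)

lemma H_orth_prev: "z \<in> Om k \<Longrightarrow> bprod N (H (Suc k) z) (cnjv (H k z)) = 0"
proof -
  assume z: "z \<in> Om k"
  have "bprod N (H (Suc k) z) (cnjv (H k z)) = bprod N (\<lambda>l. vdz (H k) z l - kap k z * H k z l) (cnjv (H k z))"
    by (simp add: H_Suc[abs_def])
  also have "\<dots> = 0" unfolding bprod_diff bprod_scale using Om_rho[OF z order_refl] by (simp add: kap_def rho_bprod)
  finally show ?thesis .
qed

text \<open>Each \<open>H j\<close> is a combination of the derivatives of \<open>f\<close> of orders 1 to \<open>j\<close>, so it inherits their isotropy.\<close>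

lemma H_X_iso:
  "1 \<le> j \<Longrightarrow> j \<le> Suc k \<Longrightarrow> z \<in> Om k \<Longrightarrow> bprod N (H j z) (X l z) = 0"
proof (induction j arbitrary: z l k rule: dec_induct)
  case base
  have "z \<in> V" using base Om_subset by blast
  then show ?case using X_iso[of z 1 l] H_1[of z] by (simp add: bprod_def)
next
  case (step j)
  then obtain k' where k: "k = Suc k'" "j \<le> Suc k'" by (cases k) auto
  have z': "z \<in> Om k'" using step.prems k Om_mono[of k' k] by auto
  have sX: "vsmooth (Om k') N (X l)" by (rule vsmooth_subset[OF X_smooth Om_subset])
  have "bprod N (vdz (H j) z) (X l z) = - bprod N (H j z) (vdz (X l) z)"
    by (rule vdz_const_bprod[OF Om_open H_smooth[OF k(2)] sX z' step.IH[OF k(2)]])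
  also have "\<dots> = 0" using step.IH[OF k(2) z', of "Suc l"] by (simp add: X_Suc)
  finally show ?case unfolding H_Suc[abs_def] bprod_diff bprod_scale using step.IH[OF k(2) z'] by simp
qed

lemma funpow_H_smooth: "j \<le> Suc k \<Longrightarrow> vsmooth (Om k) N ((vdz ^^ a) (H j))"
  by (rule vsmooth_funpow_vdz[OF Om_open H_smooth])

lemma funpow_H_X_iso:
  "1 \<le> j \<Longrightarrow> j \<le> Suc k \<Longrightarrow> z \<in> Om k \<Longrightarrow> bprod N ((vdz ^^ a) (H j) z) (X l z) = 0"
proof (induction a arbitrary: z l)
  case 0 then show ?case using H_X_iso by simp
next
  case (Suc a)
  have sX: "vsmooth (Om k) N (X l)" by (rule vsmooth_subset[OF X_smooth Om_subset])
  have "bprod N (vdz ((vdz ^^ a) (H j)) z) (X l z) = - bprod N ((vdz ^^ a) (H j) z) (vdz (X l) z)"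
    by (rule vdz_const_bprod[OF Om_open funpow_H_smooth[OF Suc.prems(2)] sX Suc.prems(3) Suc.IH[OF Suc.prems(1,2)]])
  also have "\<dots> = 0" using Suc.IH[OF Suc.prems, of "Suc l"] by (simp add: X_Suc)
  finally show ?case by simp
qed

lemma funpow_H_iso:
  "1 \<le> j \<Longrightarrow> j \<le> Suc k \<Longrightarrow> i \<le> Suc k \<Longrightarrow> z \<in> Om k \<Longrightarrow> bprod N ((vdz ^^ a) (H j) z) (H i z) = 0"
proof (induction i arbitrary: z a)
  case 0 then show ?case using funpow_H_X_iso[of j k z a 0] by (simp add: X_0)
next
  case (Suc i)
  then have i: "i \<le> Suc k" by simp
  note IH = Suc.IH[OF Suc.prems(1,2) i]
  have "bprod N (vdz (H i) z) ((vdz ^^ a) (H j) z) = - bprod N (H i z) (vdz ((vdz ^^ a) (H j)) z)"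
    by (rule vdz_const_bprod[OF Om_open H_smooth[OF i] funpow_H_smooth[OF Suc.prems(2)] Suc.prems(4)])
       (use IH in \<open>simp add: bprod_commute[of N "H i _"]\<close>)
  also have "\<dots> = 0" using IH[OF Suc.prems(4), of "Suc a"] by (simp add: bprod_commute[of N "H i z"])
  finally have "bprod N (H (Suc i) z) ((vdz ^^ a) (H j) z) = 0"
    unfolding H_Suc[abs_def] bprod_diff bprod_scale
    using IH[OF Suc.prems(4)] by (simp add: bprod_commute[of N "H i z"])
  then show ?case by (simp add: bprod_commute)
qed

lemma H_iso:
  assumes "i \<le> Suc k" "j \<le> Suc k" "0 < i + j" "z \<in> Om k"
  shows "bprod N (H i z) (H j z) = 0"
proof (cases "1 \<le> i")
  case True then show ?thesis using funpow_H_iso[of i k j z 0] assms by simp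
next
  case False then show ?thesis using funpow_H_iso[of j k i z 0] assms by (simp add: bprod_commute[of N "H i z"])
qed

lemma vdzb_cnjv_H: "j \<le> Suc k \<Longrightarrow> z \<in> Om k \<Longrightarrow> l < N \<Longrightarrow> vdzb (\<lambda>z. cnjv (H j z)) z l = cnj (vdz (H j) z l)"
  by (rule vdzb_cnjv[where a = "H j" and k = l]) (rule H_diff)

lemma vdz_cnjv_H: "j \<le> Suc k \<Longrightarrow> z \<in> Om k \<Longrightarrow> l < N \<Longrightarrow> vdz (\<lambda>z. cnjv (H j z)) z l = cnj (vdzb (H j) z l)"
  by (rule vdz_cnjv[where a = "H j" and k = l]) (rule H_diff)

definition Dbar :: "nat \<Rightarrow> bool" where
  "Dbar k \<longleftrightarrow> (\<forall>z\<in>Om k. \<forall>l<N. vdzb (H (Suc k)) z l = - of_real (rho (Suc k) z / rho k z) * H k z l)"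

lemma Dbar_0: "Dbar 0"
  unfolding Dbar_def
proof (intro ballI allI impI)
  fix z l assume "z \<in> Om 0" and l: "l < N"
  then have z: "z \<in> V" by (simp add: Om_0)
  have "vdzb (H (Suc 0)) z l = vdzb (X (Suc 0)) z l" by (rule vdzb_cong[OF V z]) (rule H_1)
  also have "\<dots> = - of_real (nsq N (X (Suc 0) z)) * complexify f z l"
    using harmonic_f[OF z l] by (simp add: X_Suc X_0)
  also have "nsq N (X (Suc 0) z) = rho (Suc 0) z" using H_1[OF z] by (simp add: rho_def nsq_def)
  finally show "vdzb (H (Suc 0)) z l = - of_real (rho (Suc 0) z / rho 0 z) * H 0 z l" using rho_0[OF z] by simp
qed

lemma H_orth_aux:
  assumes "\<And>k'. k' < k \<Longrightarrow> Dbar k'"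
  shows "i < j \<Longrightarrow> j \<le> Suc k \<Longrightarrow> z \<in> Om k \<Longrightarrow> bprod N (H j z) (cnjv (H i z)) = 0"
  using assms
proof (induction j arbitrary: i z k)
  case 0 then show ?case by simp
next
  case (Suc j)
  show ?case
  proof (cases "i = j")
    case True then show ?thesis using H_orth_prev[of z j] Suc.prems Om_mono[of j k] by auto
  next
    case False
    then obtain k' where k: "k = Suc k'" "i < j" "j \<le> Suc k'" using Suc.prems by (cases k) auto
    have z': "z \<in> Om k'" using Suc.prems k Om_mono[of k' k] by auto
    have IH: "bprod N (H j x) (cnjv (H a x)) = 0" if "a < j" "x \<in> Om k'" for a x
      using Suc.IH[OF that(1) k(3) that(2)] Suc.prems(4) k(1) by simp
    have "bprod N (vdz (H j) z) (cnjv (H i z)) = - bprod N (H j z) (vdz (\<lambda>z. cnjv (H i z)) z)"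
      by (rule vdz_const_bprod[OF Om_open H_smooth[OF k(3)] vsmooth_cnjv[OF Om_open H_smooth] z' IH[OF k(2)]]) (use k in auto)
    also have "bprod N (H j z) (vdz (\<lambda>z. cnjv (H i z)) z) = 0"
    proof (cases i)
      case 0
      have "vdz (\<lambda>z. cnjv (H i z)) z l = H (Suc 0) z l" for l
        using H_1[of z l] z' Om_subset[of k'] by (auto simp: 0 X_Suc X_0)
      then have "bprod N (H j z) (vdz (\<lambda>z. cnjv (H i z)) z) = bprod N (H j z) (H (Suc 0) z)" by (intro bprod_cong refl)
      then show ?thesis using H_iso[of j k' "Suc 0" z] k z' by auto
    next
      case (Suc i')
      have "Dbar i'" using Suc.prems k \<open>i = Suc i'\<close> by auto
      then have "vdz (\<lambda>z. cnjv (H i z)) z l = - of_real (rho (Suc i') z / rho i' z) * cnjv (H i' z) l" if "l < N" for l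
        using vdz_cnjv_H[of i k' z l] that k z' Om_mono[of i' k'] unfolding Suc Dbar_def
        by (auto simp: cnjv_def)
      then have "bprod N (H j z) (vdz (\<lambda>z. cnjv (H i z)) z)
          = bprod N (H j z) (\<lambda>l. - of_real (rho (Suc i') z / rho i' z) * cnjv (H i' z) l)" by (intro bprod_cong refl)
      also have "\<dots> = 0" unfolding bprod_scale_right using IH[of i' z] Suc k z' by simp
      finally show ?thesis .
    qed
    finally show ?thesis
      unfolding H_Suc[abs_def] bprod_diff bprod_scale using IH[OF k(2) z'] by simp
  qed
qed

lemma dz_rho_aux:
  assumes "\<And>k'. k' < j \<Longrightarrow> Dbar k'" "z \<in> Om j"
  shows "dz (\<lambda>z. complex_of_real (rho j z)) z = kap j z * of_real (rho j z)"
proof (cases j)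
  case 0
  have z: "z \<in> V" using assms(2) Om_subset by blast
  have "dz (\<lambda>z. complex_of_real (rho 0 z)) z = dz (\<lambda>z. 1) z" by (rule dz_cong[OF V z]) (simp add: rho_0)
  then show ?thesis using kap_0[OF z] by (simp add: 0)
next
  case (Suc i)
  have z: "z \<in> Om i" using assms(2) Om_mono[of i j] Suc by auto
  have "dz (\<lambda>z. complex_of_real (rho j z)) z = dz (\<lambda>z. bprod N (H j z) (cnjv (H j z))) z"
    by (rule dz_cong[OF V]) (use assms(2) Om_subset in \<open>auto simp: rho_bprod\<close>)
  also have "\<dots> = bprod N (vdz (H j) z) (cnjv (H j z)) + bprod N (H j z) (vdz (\<lambda>z. cnjv (H j z)) z)"
    by (rule dz_bprod) (use H_diff[of j j z] assms(2) in \<open>auto simp: cnjv_def intro: differentiable_cnj\<close>)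
  also have "bprod N (H j z) (vdz (\<lambda>z. cnjv (H j z)) z)
      = bprod N (H j z) (\<lambda>l. - of_real (rho (Suc i) z / rho i z) * cnjv (H i z) l)"
    by (intro bprod_cong refl) (use vdz_cnjv_H[of j j z] assms Suc z in \<open>auto simp: Dbar_def cnjv_def\<close>)
  also have "\<dots> = 0" unfolding bprod_scale_right using H_orth_prev[OF z] by (simp add: Suc)
  finally show ?thesis using Om_rho[OF assms(2), of j] by (simp add: kap_def rho_bprod)
qed

text \<open>The two structure equations \<open>\<partial>H\<^sub>j\<close> and \<open>\<partial>\<close>-bar \<open>H\<^sub>j\<close> propagate together: commuting the two operators
  on \<open>H\<^sub>j\<close> gives the equation for \<open>H\<^sub>j\<^sub>+\<^sub>1\<close> up to a factor, which the orthogonality to \<open>H\<^sub>j\<close> determines.\<close>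

lemma Dbar_step:
  assumes D: "\<And>k'. k' \<le> k \<Longrightarrow> Dbar k'"
  shows "Dbar (Suc k)"
    and "\<And>z. z \<in> Om (Suc k) \<Longrightarrow> dzb (kap (Suc k)) z
      = of_real (rho (Suc (Suc k)) z / rho (Suc k) z - rho (Suc k) z / rho k z)"
proof -
  let ?j = "Suc k"
  define q where "q = (\<lambda>z. rho ?j z / rho k z)"
  have main: "dzb (kap ?j) z = of_real (rho (Suc ?j) z / rho ?j z - q z)
      \<and> (\<forall>l<N. vdzb (H (Suc ?j)) z l = - of_real (rho (Suc ?j) z / rho ?j z) * H ?j z l)" if z: "z \<in> Om ?j" for z
  proof -
    let ?U = "Om ?j"
    have U: "open ?U" by (rule Om_open)
    have Uk: "?U \<subseteq> Om k" by (rule Om_mono) simp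
    have nz: "rho ?j x \<noteq> 0" "rho k x \<noteq> 0" if "x \<in> ?U" for x using Om_rho[OF that] by auto
    have sr: "smooth_on ?U (rho i)" if "i \<le> ?j" for i
      unfolding rho_def using that by (intro smooth_on_nsq U H_smooth) auto
    have dr: "(\<lambda>z. complex_of_real (rho i z)) differentiable (at z)" if "i \<le> ?j" for i
      by (rule smooth_onD[OF smooth_on_cr[OF U sr[OF that]] U z])
    have dzr: "dz (\<lambda>z. complex_of_real (rho i z)) z = kap i z * of_real (rho i z)" if "i \<le> ?j" for i
      using dz_rho_aux[of i z] D that z Om_mono[of i ?j] by auto
    have dq: "dz (\<lambda>z. complex_of_real (q z)) z = (kap ?j z - kap k z) * of_real (q z)"
      "(\<lambda>z. complex_of_real (q z)) differentiable (at z)"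
    proof -
      have e: "(\<lambda>z. complex_of_real (q z)) = (\<lambda>z. of_real (rho ?j z) * inverse (of_real (rho k z)))"
        by (simp add: q_def fun_eq_iff divide_inverse)
      have k0: "complex_of_real (rho k z) \<noteq> 0" using nz[OF z] by simp
      have di: "(\<lambda>z. inverse (complex_of_real (rho k z))) differentiable (at z)"
        using dr[of k] k0 by (intro differentiable_inverse) auto
      show "(\<lambda>z. complex_of_real (q z)) differentiable (at z)"
        unfolding e using dr[of ?j] di by (intro differentiable_mult) auto
      show "dz (\<lambda>z. complex_of_real (q z)) z = (kap ?j z - kap k z) * of_real (q z)"
        unfolding e dz_mult[OF dr[OF order_refl] di] dz_inverse[OF dr[of k, simplified] k0] dzr[OF order_refl]
        using dzr[of k] k0 by (simp add: q_def field_simps power2_eq_square)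
    qed
    have dk: "kap ?j differentiable (at z)" by (rule smooth_onD[OF kap_smooth U z])
    have H': "vdzb (H (Suc ?j)) z l = - (of_real (q z) + dzb (kap ?j) z) * H ?j z l" if l: "l < N" for l
    proof -
      have dH: "(\<lambda>z. H ?j z l) differentiable (at z)" "(\<lambda>z. H k z l) differentiable (at z)"
        using H_diff[of _ ?j z l] z l by auto
      have sm: "smooth_on ?U (\<lambda>z. H ?j z l)" using vsmoothD[OF H_smooth l] by simp
      have dv: "dz (\<lambda>z. H ?j z l) differentiable (at z)" by (rule smooth_onD[OF smooth_on_dz[OF U sm] U z])
      have "dzb (dz (\<lambda>z. H ?j z l)) z = dz (dzb (\<lambda>z. H ?j z l)) z"
        by (rule trans[OF dz_dzb(1)[OF U sm z] dz_dzb(2)[OF U sm z, symmetric]])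
      also have "\<dots> = dz (\<lambda>z. - (of_real (q z) * H k z l)) z"
        by (rule dz_cong[OF U z]) (use D[OF order_refl] Uk l in \<open>auto simp: Dbar_def vdzb_def q_def\<close>)
      also have "\<dots> = - (dz (\<lambda>z. complex_of_real (q z)) z * H k z l + of_real (q z) * vdz (H k) z l)"
        unfolding dz_minus[OF differentiable_mult[OF dq(2) dH(2)]] dz_mult[OF dq(2) dH(2)] by (simp add: vdz_def)
      also have "\<dots> = - of_real (q z) * (kap ?j z * H k z l + H ?j z l)"
        unfolding dq(1) vdz_H by (simp add: algebra_simps)
      finally have 1: "dzb (dz (\<lambda>z. H ?j z l)) z = - of_real (q z) * (kap ?j z * H k z l + H ?j z l)" .
      have 2: "dzb (\<lambda>z. H ?j z l) z = - of_real (q z) * H k z l"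
        using D[OF order_refl] Uk l z by (auto simp: Dbar_def vdzb_def q_def)
      have "vdzb (H (Suc ?j)) z l = dzb (\<lambda>z. dz (\<lambda>z. H ?j z l) z - kap ?j z * H ?j z l) z"
        by (simp add: vdzb_def H_Suc vdz_def)
      also have "\<dots> = dzb (dz (\<lambda>z. H ?j z l)) z - (dzb (kap ?j) z * H ?j z l + kap ?j z * dzb (\<lambda>z. H ?j z l) z)"
        unfolding dzb_diff[OF dv differentiable_mult[OF dk dH(1)]] dzb_mult[OF dk dH(1)] ..
      finally show ?thesis unfolding 1 2 by (simp add: algebra_simps)
    qed
    define t where "t = of_real (q z) + dzb (kap ?j) z"
    have "bprod N (vdzb (H (Suc ?j)) z) (cnjv (H ?j z)) = - bprod N (H (Suc ?j) z) (vdzb (\<lambda>z. cnjv (H ?j z)) z)"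
      by (rule vdzb_const_bprod[OF U H_smooth vsmooth_cnjv[OF U H_smooth] z H_orth_prev]) auto
    also have "bprod N (H (Suc ?j) z) (vdzb (\<lambda>z. cnjv (H ?j z)) z)
        = bprod N (H (Suc ?j) z) (\<lambda>l. cnjv (H (Suc ?j) z) l + cnj (kap ?j z) * cnjv (H ?j z) l)"
      by (intro bprod_cong refl) (use vdzb_cnjv_H[of ?j ?j z] z in \<open>simp add: vdz_H cnjv_def\<close>)
    also have "\<dots> = of_real (rho (Suc ?j) z)"
      unfolding bprod_add_right bprod_scale_right using H_orth_prev[OF z] by (simp add: rho_bprod)
    finally have "bprod N (vdzb (H (Suc ?j)) z) (cnjv (H ?j z)) = - of_real (rho (Suc ?j) z)" .
    moreover have "bprod N (vdzb (H (Suc ?j)) z) (cnjv (H ?j z)) = bprod N (\<lambda>l. - t * H ?j z l) (cnjv (H ?j z))"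
      by (rule bprod_cong) (simp_all add: H' t_def)
    ultimately have "t * of_real (rho ?j z) = of_real (rho (Suc ?j) z)"
      unfolding bprod_scale rho_bprod by simp
    then have t: "t = of_real (rho (Suc ?j) z / rho ?j z)" using nz[OF z] by (simp add: field_simps)
    then have "dzb (kap ?j) z = of_real (rho (Suc ?j) z / rho ?j z - q z)"
      unfolding t_def by (simp add: algebra_simps)
    moreover have "vdzb (H (Suc ?j)) z l = - of_real (rho (Suc ?j) z / rho ?j z) * H ?j z l" if "l < N" for l
      using H'[OF that] t unfolding t_def by simp
    ultimately show ?thesis by blast
  qed
  show "Dbar (Suc k)" unfolding Dbar_def using main by blast
  show "dzb (kap (Suc k)) z = of_real (rho (Suc (Suc k)) z / rho (Suc k) z - rho (Suc k) z / rho k z)"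
    if "z \<in> Om (Suc k)" for z using main[OF that] by (simp add: q_def)
qed

lemma Dbar: "Dbar k"
proof (induction k rule: less_induct)
  case (less k) then show ?case using Dbar_0 Dbar_step(1) by (cases k) auto
qed

lemma vdzb_H:
  assumes "z \<in> Om k" "l < N"
  shows "vdzb (H (Suc k)) z l = - of_real (rho (Suc k) z / rho k z) * H k z l"
  using Dbar[of k] assms by (simp add: Dbar_def)

lemma dzb_kap:
  assumes "z \<in> Om (Suc k)"
  shows "dzb (kap (Suc k)) z = of_real (rho (Suc (Suc k)) z / rho (Suc k) z - rho (Suc k) z / rho k z)"
  using Dbar_step(2)[OF Dbar assms] .

lemma H_orth: "i < j \<Longrightarrow> j \<le> Suc k \<Longrightarrow> z \<in> Om k \<Longrightarrow> bprod N (H j z) (cnjv (H i z)) = 0"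
  using H_orth_aux Dbar by blast

lemma log_deriv_rho: "log_deriv (Om k) (rho k) (kap k)"
  unfolding log_deriv_def using Om_open kap_smooth dz_rho_aux Dbar H_smooth[of k k]
  by (auto simp: rho_def[abs_def] intro: smooth_on_nsq)

lemma X_H:
  "i \<le> j \<Longrightarrow> z \<in> Om j \<Longrightarrow> bprod N (X i z) (cnjv (H j z)) = (if i = j then of_real (rho j z) else 0)"
proof (induction i arbitrary: j z)
  case 0
  have z: "z \<in> V" using 0 Om_subset by blast
  show ?case
  proof (cases "j = 0")
    case True then show ?thesis using rho_bprod[of 0 z] by (simp add: X_0)
  next
    case False
    then have "bprod N (H 0 z) (H j z) = 0" using H_iso[of 0 j j z] 0 by simp
    then have "cnj (bprod N (H 0 z) (H j z)) = 0" by simp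
    then show ?thesis unfolding cnj_bprod using False by (simp add: X_0)
  qed
next
  case (Suc i)
  then obtain j' where j: "j = Suc j'" "i \<le> j'" by (cases j) auto
  have z': "z \<in> Om j'" using Suc.prems j Om_mono[of j' j] by auto
  have const: "bprod N (X i x) (cnjv (H j x)) = 0" if "x \<in> Om j" for x using Suc.IH[OF _ that] j by auto
  have sX: "vsmooth (Om j) N (X i)" by (rule vsmooth_subset[OF X_smooth Om_subset])
  have "bprod N (vdz (X i) z) (cnjv (H j z)) = - bprod N (X i z) (vdz (\<lambda>z. cnjv (H j z)) z)"
    by (rule vdz_const_bprod[OF Om_open sX vsmooth_cnjv[OF Om_open H_smooth] Suc.prems(2) const]) simp
  also have "bprod N (X i z) (vdz (\<lambda>z. cnjv (H j z)) z)
      = bprod N (X i z) (\<lambda>l. - of_real (rho j z / rho j' z) * cnjv (H j' z) l)"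
    by (intro bprod_cong refl) (use vdz_cnjv_H[of j j z] vdzb_H[OF z'] Suc.prems j in \<open>simp add: cnjv_def\<close>)
  also have "\<dots> = - of_real (rho j z / rho j' z) * (if i = j' then of_real (rho j' z) else 0)"
    unfolding bprod_scale_right using Suc.IH[OF j(2) z'] by simp
  finally show ?case using j Om_rho[OF z' order_refl] by (simp add: X_Suc)
qed

text \<open>\<open>X j\<close> projects onto \<open>H j\<close>, so \<open>rho j\<close> stays bounded near the points where the sequence is undefined.\<close>

lemma rho_le_nsq_X: "z \<in> Om j \<Longrightarrow> rho j z \<le> nsq N (X j z)"
proof -
  assume z: "z \<in> Om j"
  have "(cmod (bprod N (X j z) (cnjv (H j z))))\<^sup>2 \<le> nsq N (X j z) * rho j z"
    unfolding rho_def by (rule cmod_bprod_cnjv_le)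
  then have "rho j z * rho j z \<le> nsq N (X j z) * rho j z"
    using X_H[OF order_refl z] by (simp add: power2_eq_square abs_mult_self_eq)
  moreover have "rho j z > 0" using Om_rho[OF z order_refl] nsq_nonneg[of N "H j z"] by (simp add: rho_def)
  ultimately show ?thesis by simp
qed

end

section \<open>The order of the harmonic sequence\<close>

locale regular_harmonic_sequence = harmonic_sequence +
  assumes connected_V: "connected V" and V_nonempty: "V \<noteq> {}"
    and regular_f: "\<And>z. z \<in> V \<Longrightarrow> nsq N (vdz (complexify f) z) \<noteq> 0"
begin

text \<open>The square norm of \<open>H\<^sub>1 \<and> \<dots> \<and> H\<^sub>k\<close>.  For this product the terms of \<open>dzb_kap\<close> telescope, and a lower bound of the Laplacian of its logarithm remains although the single \<open>rho j\<close> have none.\<close>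

definition D :: "nat \<Rightarrow> complex \<Rightarrow> real" where "D k z = (\<Prod>i<k. rho (Suc i) z)"

definition kapsum :: "nat \<Rightarrow> complex \<Rightarrow> complex" where "kapsum k z = (\<Sum>i<k. kap (Suc i) z)"

lemma rho_nonneg: "0 \<le> rho j z" by (simp add: rho_def nsq_nonneg)

lemma D_nonneg: "0 \<le> D k z" unfolding D_def by (intro prod_nonneg) (simp add: rho_nonneg)

lemma D_nonzero: "z \<in> Om k \<Longrightarrow> D k z \<noteq> 0" by (auto simp: D_def Om_def)

lemma D_Suc: "D (Suc k) z = D k z * rho (Suc k) z" by (simp add: D_def)

lemma log_deriv_D: "log_deriv (Om k) (D k) (kapsum k)"
proof -
  have "log_deriv (Om k) (\<lambda>z. \<Prod>i<k. rho (Suc i) z) (\<lambda>z. \<Sum>i<k. kap (Suc i) z)"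
    by (intro log_deriv_prod Om_open log_deriv_subset[OF log_deriv_rho Om_mono]) auto
  then show ?thesis by (simp add: D_def[abs_def] kapsum_def[abs_def])
qed

lemma kap_diff: "z \<in> Om j \<Longrightarrow> kap j differentiable (at z)"
  using smooth_onD[OF kap_smooth Om_open] .

lemma kapsum_diff: "z \<in> Om k \<Longrightarrow> kapsum k differentiable (at z)"
  using log_deriv_D[of k] smooth_onD[of "Om k" "kapsum k" z] by (simp add: log_deriv_def)

lemma dzb_kapsum:
  "z \<in> Om k \<Longrightarrow> dzb (kapsum k) z = of_real (rho (Suc k) z / rho k z - rho (Suc 0) z)"
proof (induction k)
  case 0
  then have "z \<in> V" using Om_subset by blast
  then show ?case by (simp add: kapsum_def[abs_def] rho_0)
next
  case (Suc k)
  have z: "z \<in> Om k" using Suc.prems Om_mono[of k "Suc k"] by auto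
  have "kapsum (Suc k) = (\<lambda>z. kapsum k z + kap (Suc k) z)" by (simp add: kapsum_def fun_eq_iff)
  then show ?case
    using dzb_add[OF kapsum_diff[OF z] kap_diff[OF Suc.prems]] Suc.IH[OF z] dzb_kap[OF Suc.prems] by simp
qed

lemma good_ball:
  assumes p: "p \<in> V" and sp: "(V - Om k) sparse_in V"
  obtains R B where "R > 0" "ball p R \<subseteq> V" "ball p R - {p} \<subseteq> Om k" "B \<ge> 1"
    "\<And>j z. j \<le> Suc k \<Longrightarrow> z \<in> ball p R - {p} \<Longrightarrow> rho j z \<le> B"
    "\<And>z. z \<in> ball p R \<Longrightarrow> rho (Suc 0) z \<le> B"
proof -
  obtain r1 where r1: "r1 > 0" "cball p r1 \<subseteq> V" using p V open_contains_cball_eq by blast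
  have "\<forall>\<^sub>F y in at p. y \<notin> V - Om k" using sp p V sparse_in_eventually_iff by blast
  then obtain r2 where r2: "r2 > 0" "\<And>y. y \<noteq> p \<Longrightarrow> dist y p < r2 \<Longrightarrow> y \<notin> V - Om k"
    unfolding eventually_at by auto
  define R where "R = min r1 r2"
  have R: "R > 0" "ball p R \<subseteq> cball p r1" using r1 r2 by (auto simp: R_def)
  have sub: "ball p R - {p} \<subseteq> Om k"
  proof
    fix x assume x: "x \<in> ball p R - {p}"
    then have "x \<in> V" using R(2) r1(2) by blast
    moreover have "x \<notin> V - Om k" by (rule r2(2)) (use x in \<open>auto simp: R_def dist_commute\<close>)
    ultimately show "x \<in> Om k" by blast
  qed
  have "\<exists>B. \<forall>z\<in>cball p r1. nsq N (X j z) \<le> B" for j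
  proof -
    have "continuous_on V (\<lambda>z. nsq N (X j z))" by (intro smooth_on_continuous smooth_on_nsq V X_smooth)
    then have "continuous_on (cball p r1) (\<lambda>z. nsq N (X j z))" using r1(2) by (rule continuous_on_subset)
    then have "bounded ((\<lambda>z. nsq N (X j z)) ` cball p r1)"
      by (intro compact_imp_bounded compact_continuous_image) auto
    then show ?thesis unfolding bounded_iff by (auto simp: abs_le_iff)
  qed
  then obtain B where B: "\<And>j z. z \<in> cball p r1 \<Longrightarrow> nsq N (X j z) \<le> B j" by metis
  define B' where "B' = Max (insert 1 (B ` {..Suc k}))"
  have B': "B' \<ge> 1" "B j \<le> B'" if "j \<le> Suc k" for j
    unfolding B'_def by (rule Max_ge; use that in auto)+
  note B'1 = B'(1)[of 0, simplified]
  show ?thesis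
  proof (rule that[OF R(1) _ sub B'1])
    show "ball p R \<subseteq> V" using R(2) r1(2) by blast
    fix j z assume j: "j \<le> Suc k" and z: "z \<in> ball p R - {p}"
    have zr: "z \<in> cball p r1" using z R(2) by blast
    show "rho j z \<le> B'"
    proof (cases "z \<in> Om j")
      case True then show ?thesis using rho_le_nsq_X[OF True] B[OF zr, of j] B'(2)[OF j] by linarith
    next
      case False
      then have "\<exists>i\<le>j. rho i z = 0" using zr r1(2) by (auto simp: Om_def)
      moreover have "rho i z \<noteq> 0" if "i \<le> k" for i using z sub that by (auto simp: Om_def)
      ultimately have "rho j z = 0" using j by (metis le_Suc_eq order_trans)
      then show ?thesis using B'1 by simp
    qed
  next
    fix z assume z: "z \<in> ball p R"
    then have zr: "z \<in> cball p r1" using R(2) by blast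
    have "rho (Suc 0) z = nsq N (X (Suc 0) z)" using H_1[of z] zr r1(2) by (auto simp: rho_def nsq_def)
    then show "rho (Suc 0) z \<le> B'" using B[OF zr, of "Suc 0"] B'(2)[of "Suc 0"] by simp
  qed
qed

lemma D_bound:
  assumes "\<And>j. j \<le> k \<Longrightarrow> rho j z \<le> B" "B \<ge> 1"
  shows "D k z \<le> B ^ k"
  unfolding D_def using prod_mono[of "{..<k}" "\<lambda>i. rho (Suc i) z" "\<lambda>i. B"] assms by (auto simp: rho_nonneg)

lemma accumulation_spreads:
  assumes p: "p \<in> V" and sp: "(V - Om k) sparse_in V" and acc: "p islimpt {z \<in> Om k. rho (Suc k) z = 0}"
  shows "\<exists>r>0. ball p r \<subseteq> V \<and> (\<forall>z\<in>ball p r - {p}. z \<in> Om k \<and> rho (Suc k) z = 0)"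
proof -
  obtain R B where R: "R > 0" "ball p R \<subseteq> V" "ball p R - {p} \<subseteq> Om k" "B \<ge> 1"
    and B: "\<And>j z. j \<le> Suc k \<Longrightarrow> z \<in> ball p R - {p} \<Longrightarrow> rho j z \<le> B"
    using good_ball[OF p sp] by metis
  have Dz: "D (Suc k) z = 0 \<longleftrightarrow> rho (Suc k) z = 0" if "z \<in> ball p R - {p}" for z
    using D_nonzero[of z k] that R(3) by (auto simp: D_Suc)
  have sub: "{z \<in> ball p R - {p}. D (Suc k) z \<noteq> 0} = (ball p R - {p}) \<inter> Om (Suc k)"
    using Dz R(3) by (auto simp: Om_Suc)
  have "D (Suc k) z = 0" if "z \<in> ball p (R / 8) - {p}" for z
  proof (rule zeros_accumulate_imp_zero[OF R(1) _ _ _ _ _ _ that])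
    show "0 \<le> D (Suc k) z" for z by (rule D_nonneg)
    show "D (Suc k) z \<le> B ^ Suc k" if "z \<in> ball p R - {p}" for z
      by (rule D_bound) (use B that R(4) in auto)
    show "log_deriv {z \<in> ball p R - {p}. D (Suc k) z \<noteq> 0} (D (Suc k)) (kapsum (Suc k))"
      unfolding sub by (rule log_deriv_subset[OF log_deriv_D]) (auto intro: Om_open)
    show "- B \<le> Re (dzb (kapsum (Suc k)) z)" if "z \<in> ball p R - {p}" "D (Suc k) z \<noteq> 0" for z
    proof -
      have "z \<in> Om (Suc k)" using that sub by blast
      then have "Re (dzb (kapsum (Suc k)) z) = rho (Suc (Suc k)) z / rho (Suc k) z - rho (Suc 0) z"
        by (simp add: dzb_kapsum)
      moreover have "rho (Suc 0) z \<le> B" by (rule B) (use that in auto)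
      moreover have "rho (Suc (Suc k)) z / rho (Suc k) z \<ge> 0" by (simp add: rho_nonneg)
      ultimately show ?thesis by linarith
    qed
    show "\<exists>C. \<exists>d>0. \<forall>z\<in>ball p R - {p}. dist z a < d \<longrightarrow> D (Suc k) z \<le> C * (dist z a)\<^sup>2"
      if a: "a \<in> ball p R - {p}" "D (Suc k) a = 0" for a
    proof -
      have aO: "a \<in> Om k" using a R(3) by blast
      obtain C d where C: "C \<ge> 0" "d > 0" "\<And>z. dist z a < d \<Longrightarrow> rho (Suc k) z \<le> C * (dist z a)\<^sup>2"
        using nsq_zero_quadratic[of N "H (Suc k)" a] H_diff[OF order_refl aO] Dz[OF a(1)] a(2)
        unfolding rho_def by blast
      have "D (Suc k) z \<le> B ^ k * C * (dist z a)\<^sup>2" if z: "z \<in> ball p R - {p}" "dist z a < d" for z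
      proof -
        have "D k z \<le> B ^ k" by (rule D_bound) (use B z R(4) in auto)
        then have "D k z * rho (Suc k) z \<le> B ^ k * (C * (dist z a)\<^sup>2)"
          using C(3)[OF z(2)] R(4) by (intro mult_mono) (auto simp: rho_nonneg)
        then show ?thesis by (simp add: D_Suc mult.assoc)
      qed
      then show ?thesis using C(2) by blast
    qed
    show "p islimpt {z \<in> ball p R - {p}. D (Suc k) z = 0}"
      unfolding islimpt_approachable
    proof (intro allI impI)
      fix e :: real assume "e > 0"
      then obtain y where "y \<in> {z \<in> Om k. rho (Suc k) z = 0}" "y \<noteq> p" "dist y p < min e R"
        using acc R(1) unfolding islimpt_approachable by (metis min_less_iff_conj)
      then show "\<exists>x'\<in>{z \<in> ball p R - {p}. D (Suc k) z = 0}. x' \<noteq> p \<and> dist x' p < e"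
        by (intro bexI[of _ y]) (auto simp: D_Suc dist_commute)
    qed
  qed
  moreover have "ball p (R / 8) \<subseteq> ball p R" using R(1) by auto
  ultimately have "\<forall>z\<in>ball p (R / 8) - {p}. z \<in> Om k \<and> rho (Suc k) z = 0" using Dz R(3) by blast
  then show ?thesis using R \<open>ball p (R / 8) \<subseteq> ball p R\<close> by (intro exI[of _ "R / 8"]) auto
qed

text \<open>The points where the zeros of \<open>rho (Suc k)\<close> accumulate form a set that is open by the previous lemma and closed; \<open>V\<close> is connected.\<close>

lemma order_dichotomy:
  assumes sp: "(V - Om k) sparse_in V"
  shows "(V - Om (Suc k)) sparse_in V \<or> (\<forall>z\<in>Om k. rho (Suc k) z = 0)"
proof -
  define Z where "Z = {z \<in> Om k. rho (Suc k) z = 0}"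
  define A where "A = {p \<in> V. p islimpt Z}"
  have oA: "open A"
    unfolding open_contains_ball
  proof
    fix p assume "p \<in> A"
    then obtain r where r: "r > 0" "ball p r \<subseteq> V" "\<And>z. z \<in> ball p r - {p} \<Longrightarrow> z \<in> Z"
      using accumulation_spreads[OF _ sp] unfolding A_def Z_def by blast
    have "y islimpt Z" if y: "y \<in> ball p r" for y
    proof -
      have "y islimpt (ball p r - {p})"
      proof (cases "y = p")
        case True
        have "p islimpt ball p r" using r(1) by (intro interior_limit_point) simp
        then show ?thesis using True islimpt_punctured by blast
      next
        case False
        have "open (ball p r - {p})" by (simp add: open_delete)
        then show ?thesis using y False by (intro interior_limit_point) (simp add: interior_open)
      qed
      then show ?thesis by (rule islimpt_subset) (use r(3) in blast)
    qed
    then show "\<exists>e>0. ball p e \<subseteq> A" using r by (auto simp: A_def)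
  qed
  have oB: "open (V - A)"
    unfolding open_contains_ball
  proof
    fix p assume p: "p \<in> V - A"
    obtain e where e: "e > 0" "ball p e \<subseteq> V" using p V open_contains_ball_eq by blast
    have "\<not> p islimpt Z" using p by (simp add: A_def)
    then obtain d where d: "d > 0" "\<And>x. x \<in> Z \<Longrightarrow> x \<noteq> p \<Longrightarrow> \<not> dist x p < d"
      unfolding islimpt_approachable by blast
    have "\<not> y islimpt Z" if y: "y \<in> ball p d" for y
    proof
      assume "y islimpt Z"
      then have "infinite (ball p d \<inter> Z)" using y unfolding islimpt_eq_acc_point by blast
      moreover have "ball p d \<inter> Z \<subseteq> {p}"
      proof
        fix x assume "x \<in> ball p d \<inter> Z"
        then show "x \<in> {p}" using d(2)[of x] by (cases "x = p") (auto simp: dist_commute)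
      qed
      ultimately show False using finite_subset by blast
    qed
    then show "\<exists>e>0. ball p e \<subseteq> V - A" using d(1) e by (intro exI[of _ "min d e"]) (auto simp: A_def)
  qed
  have "A = {} \<or> A = V"
    using connectedD[OF connected_V oA oB] by (auto simp: A_def)
  then show ?thesis
  proof
    assume "A = {}"
    then have "Z sparse_in V" unfolding sparse_in_open[OF V] by (auto simp: A_def)
    moreover have "V - Om (Suc k) = (V - Om k) \<union> Z" using Om_subset[of k] by (auto simp: Om_Suc Z_def)
    ultimately show ?thesis using sp sparse_in_union' by metis
  next
    assume AV: "A = V"
    have "rho (Suc k) z = 0" if z: "z \<in> Om k" for z
    proof (rule ccontr)
      assume nz: "rho (Suc k) z \<noteq> 0"
      have lim: "z islimpt Z" using AV z Om_subset by (auto simp: A_def)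
      have "continuous_on (Om k) (rho (Suc k))"
        unfolding rho_def by (intro smooth_on_continuous smooth_on_nsq Om_open H_smooth) auto
      then have op: "open (Om k \<inter> rho (Suc k) -` (- {0}))" using Om_open by (intro continuous_open_preimage) auto
      have "z \<in> Om k \<inter> rho (Suc k) -` (- {0})" using z nz by simp
      from islimptE[OF lim this op] obtain y where "y \<in> Z" "y \<in> Om k \<inter> rho (Suc k) -` (- {0})" .
      then show False by (auto simp: Z_def)
    qed
    then show ?thesis by blast
  qed
qed

text \<open>\<open>f\<close>, the \<open>H\<^sub>i\<close> and their conjugates are orthogonal, and an orthogonal system of nonzero vectors has at most \<open>N\<close> members.\<close>

lemma Om_card:
  assumes z: "z \<in> Om k" shows "2 * k + 1 \<le> N"
proof -
  define e where "e = (\<lambda>s :: nat + nat. case s of Inl i \<Rightarrow> H i z | Inr i \<Rightarrow> cnjv (H i z))"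
  have o: "bprod N (H i z) (cnjv (H j z)) = 0" if "i \<noteq> j" "i \<le> k" "j \<le> k" for i j
  proof (cases "j < i")
    case True then show ?thesis using H_orth[of j i k z] that z by simp
  next
    case False
    then have "bprod N (H j z) (cnjv (H i z)) = 0" using H_orth[of i j k z] that z by simp
    then show ?thesis using bprod_cnjv_swap[of N "H j z" "H i z"] by (simp add: bprod_commute[of N "H i z"])
  qed
  have i: "bprod N (H i z) (H j z) = 0" if "i \<le> k" "j \<le> k" "0 < i \<or> 0 < j" for i j
    using H_iso[of i k j z] that z by auto
  have c: "bprod N (cnjv a) (cnjv b) = 0" if "bprod N a b = 0" for a b using that cnj_bprod[of N a b] by simp
  interpret orthogonal_system N "{..k} <+> {1..k}" e
  proof
    show "nsq N (e s) \<noteq> 0" if "s \<in> {..k} <+> {1..k}" for s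
      using that z by (auto simp: e_def nsq_cnjv Om_def rho_def)
    show "bprod N (e s) (cnjv (e t)) = 0" if "s \<in> {..k} <+> {1..k}" "t \<in> {..k} <+> {1..k}" "s \<noteq> t" for s t
    proof (cases s; cases t)
      fix a b assume st: "s = Inl a" "t = Inl b"
      then show ?thesis using o[of a b] that by (auto simp: e_def)
    next
      fix a b assume st: "s = Inl a" "t = Inr b"
      then show ?thesis using i[of a b] that by (auto simp: e_def)
    next
      fix a b assume st: "s = Inr a" "t = Inl b"
      then show ?thesis using c[OF i[of a b]] that by (auto simp: e_def)
    next
      fix a b assume st: "s = Inr a" "t = Inr b"
      then show ?thesis using c[OF o[of a b]] that by (auto simp: e_def)
    qed
  qed simp
  show ?thesis using card_le by (simp add: card_Plus)
qed

lemma order_exists: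
  obtains m where "1 \<le> m" "2 * m + 1 \<le> N" "(V - Om m) sparse_in V" "\<And>z. z \<in> Om m \<Longrightarrow> rho (Suc m) z = 0"
proof -
  have ne: "\<exists>z. z \<in> Om k" if sp: "(V - Om k) sparse_in V" for k
  proof -
    obtain p where p: "p \<in> V" using V_nonempty by blast
    obtain R B where "R > 0" "ball p R - {p} \<subseteq> Om k" using good_ball[OF p sp] by metis
    moreover from this have "p + of_real (R / 2) \<in> ball p R - {p}" by (simp add: dist_norm)
    ultimately show ?thesis by blast
  qed
  have nN: "\<not> (V - Om N) sparse_in V"
  proof
    assume "(V - Om N) sparse_in V"
    then obtain z where "z \<in> Om N" using ne by blast
    then show False using Om_card by fastforce
  qed
  define k where "k = (LEAST k. \<not> (V - Om k) sparse_in V)"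
  have k: "\<not> (V - Om k) sparse_in V" "\<And>i. i < k \<Longrightarrow> (V - Om i) sparse_in V"
    using LeastI[of "\<lambda>k. \<not> (V - Om k) sparse_in V", OF nN] not_less_Least[of _ "\<lambda>k. \<not> (V - Om k) sparse_in V"]
    unfolding k_def by blast+
  then obtain m where m: "k = Suc m" by (cases k) (auto simp: Om_0)
  then have sp: "(V - Om m) sparse_in V" using k(2) by simp
  have z: "\<And>z. z \<in> Om m \<Longrightarrow> rho (Suc m) z = 0" using order_dichotomy[OF sp] k(1) m by blast
  have "m \<noteq> 0"
  proof
    assume "m = 0"
    obtain p where p: "p \<in> V" using V_nonempty by blast
    then have "rho (Suc 0) p = 0" using z[of p] \<open>m = 0\<close> by (simp add: Om_0)
    then show False using regular_f[OF p] H_1[OF p] by (simp add: rho_def nsq_def X_Suc X_0)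
  qed
  moreover have "2 * m + 1 \<le> N" using ne[OF sp] Om_card by blast
  ultimately show ?thesis using sp z by (intro that) auto
qed

end

section \<open>Normalising an isotropic curve at an isolated singularity\<close>

text \<open>By the great Picard theorem, quotients that avoid the values 0 and 1 have a limit in the sphere; dividing by
  a component of maximal growth removes the singularity of all components.\<close>

lemma removable_by_division:
  fixes a :: "nat \<Rightarrow> complex \<Rightarrow> complex"
  assumes r: "r > 0"
    and hol: "\<And>i. i < M \<Longrightarrow> a i holomorphic_on ball p r - {p}"
    and zero: "\<And>i. i < M \<Longrightarrow> (\<forall>z\<in>ball p r - {p}. a i z = 0) \<or> (\<forall>z\<in>ball p r - {p}. a i z \<noteq> 0)"
    and diff: "\<And>i j. i < M \<Longrightarrow> j < M \<Longrightarrow>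
      (\<forall>z\<in>ball p r - {p}. a i z = a j z) \<or> (\<forall>z\<in>ball p r - {p}. a i z \<noteq> a j z)"
    and ne: "\<exists>i<M. \<forall>z\<in>ball p r - {p}. a i z \<noteq> 0"
  obtains j b where "j < M" "\<And>z. z \<in> ball p r - {p} \<Longrightarrow> a j z \<noteq> 0"
    "\<And>i. i < M \<Longrightarrow> b i holomorphic_on ball p r"
    "\<And>i z. i < M \<Longrightarrow> z \<in> ball p r - {p} \<Longrightarrow> b i z = a i z / a j z" "b j p = 1"
proof -
  define S where "S = {i. i < M \<and> (\<forall>z\<in>ball p r - {p}. a i z \<noteq> 0)}"
  define le where "le = (\<lambda>i j. \<exists>l. ((\<lambda>z. a i z / a j z) \<longlongrightarrow> l) (at p))"
  have S: "finite S" "S \<noteq> {}" using ne by (auto simp: S_def)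
  have nz: "a i z \<noteq> 0" if "i \<in> S" "z \<in> ball p r - {p}" for i z using that by (auto simp: S_def)
  have ev: "\<forall>\<^sub>F z in at p. z \<in> ball p r - {p}"
    using r unfolding eventually_at by (intro exI[of _ r]) (auto simp: dist_commute)
  have total: "le i j \<or> le j i" if "i \<in> S" "j \<in> S" for i j
  proof (cases "\<forall>z\<in>ball p r - {p}. a i z = a j z")
    case True
    have "((\<lambda>z. a i z / a j z) \<longlongrightarrow> 1) (at p)"
      by (rule tendsto_eventually) (use ev in \<open>eventually_elim; use True nz[OF that(2)] in auto\<close>)
    then show ?thesis unfolding le_def by blast
  next
    case False
    then have d: "\<forall>z\<in>ball p r - {p}. a i z \<noteq> a j z" using diff[of i j] that by (auto simp: S_def)
    have h: "(\<lambda>z. a i z / a j z) holomorphic_on ball p r - {p}"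
      using that by (intro holomorphic_intros hol nz) (auto simp: S_def)
    obtain l where "((\<lambda>z. a i z / a j z) \<longlongrightarrow> l) (at p) \<or> ((inverse \<circ> (\<lambda>z. a i z / a j z)) \<longlongrightarrow> l) (at p)"
    proof (rule great_Picard[of "ball p r" p 0 1 "\<lambda>z. a i z / a j z"])
      show "a i w / a j w \<noteq> 0 \<and> a i w / a j w \<noteq> 1" if "w \<in> ball p r - {p}" for w
        using d nz[OF \<open>i \<in> S\<close> that] nz[OF \<open>j \<in> S\<close> that] that by auto
    qed (use r h in auto)
    moreover have "(inverse \<circ> (\<lambda>z. a i z / a j z)) = (\<lambda>z. a j z / a i z)" by (simp add: fun_eq_iff)
    ultimately show ?thesis unfolding le_def by auto
  qed
  have trans: "le i k" if le: "le i j" "le j k" and jS: "j \<in> S" for i j k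
  proof -
    obtain l l' where l: "((\<lambda>z. a i z / a j z) \<longlongrightarrow> l) (at p)" "((\<lambda>z. a j z / a k z) \<longlongrightarrow> l') (at p)"
      using le unfolding le_def by blast
    have "((\<lambda>z. a i z / a j z * (a j z / a k z)) \<longlongrightarrow> l * l') (at p)" by (rule tendsto_mult[OF l])
    then have "((\<lambda>z. a i z / a k z) \<longlongrightarrow> l * l') (at p)"
    proof (rule Lim_transform_eventually)
      show "\<forall>\<^sub>F z in at p. a i z / a j z * (a j z / a k z) = a i z / a k z"
        using ev by eventually_elim (use nz[OF jS] in auto)
    qed
    then show ?thesis unfolding le_def by blast
  qed
  have "\<exists>j\<in>T. \<forall>i\<in>T. le i j" if "finite T" "T \<noteq> {}" "T \<subseteq> S" for T
    using that
  proof (induction T rule: finite_ne_induct)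
    case (singleton x) then show ?case using total[of x x] by auto
  next
    case (insert x T)
    then obtain j where j: "j \<in> T" "\<And>i. i \<in> T \<Longrightarrow> le i j" by auto
    have jx: "j \<in> S" "x \<in> S" using j(1) insert.prems by auto
    show ?case
    proof (cases "le x j")
      case True then show ?thesis using j by auto
    next
      case False
      then have "le j x" using total[of x j] jx by blast
      then have "le i x" if "i \<in> T" for i using trans[OF j(2)[OF that] _ jx(1)] by blast
      moreover have "le x x" using total[of x x] jx by blast
      ultimately show ?thesis by blast
    qed
  qed
  from this[OF S order_refl] obtain j where j: "j \<in> S" "\<And>i. i \<in> S \<Longrightarrow> le i j" by blast
  have "\<exists>l. ((\<lambda>z. a i z / a j z) \<longlongrightarrow> l) (at p)" if "i < M" for i
  proof (cases "i \<in> S")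
    case True then show ?thesis using j(2) unfolding le_def by blast
  next
    case False
    then have "\<forall>z\<in>ball p r - {p}. a i z = 0" using zero[OF that] that by (auto simp: S_def)
    then have "((\<lambda>z. a i z / a j z) \<longlongrightarrow> 0) (at p)"
      by (intro tendsto_eventually) (use ev in \<open>eventually_elim; auto\<close>)
    then show ?thesis by blast
  qed
  then obtain l where l: "\<And>i. i < M \<Longrightarrow> ((\<lambda>z. a i z / a j z) \<longlongrightarrow> l i) (at p)" by metis
  define b where "b = (\<lambda>i z. if z = p then l i else a i z / a j z)"
  show ?thesis
  proof (rule that[of j b])
    show "j < M" using j(1) by (simp add: S_def)
    show "a j z \<noteq> 0" if "z \<in> ball p r - {p}" for z by (rule nz[OF j(1) that])
    show "b i z = a i z / a j z" if "i < M" "z \<in> ball p r - {p}" for i z using that by (simp add: b_def)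
    show "b i holomorphic_on ball p r" if i: "i < M" for i
    proof (rule no_isolated_singularity'[where K = "{p}"])
      have "(\<lambda>z. a i z / a j z) holomorphic_on ball p r - {p}"
        using j(1) i by (intro holomorphic_intros hol nz[OF j(1)]) (auto simp: S_def)
      then show "b i holomorphic_on ball p r - {p}" by (rule holomorphic_transform) (simp add: b_def)
      show "(b i \<longlongrightarrow> b i z) (at z within ball p r)" if "z \<in> {p}" for z
      proof -
        have "(b i \<longlongrightarrow> l i) (at p)"
          by (rule Lim_transform_eventually[OF l[OF i]]) (use ev in \<open>eventually_elim; simp add: b_def\<close>)
        then show ?thesis using that by (auto simp: b_def intro: tendsto_within_subset)
      qed
    qed auto
    have "((\<lambda>z. a j z / a j z) \<longlongrightarrow> 1) (at p)"
      by (rule tendsto_eventually) (use ev in \<open>eventually_elim; use nz[OF j(1)] in auto\<close>)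
    moreover have "((\<lambda>z. a j z / a j z) \<longlongrightarrow> l j) (at p)" using l[of j] j(1) unfolding S_def by blast
    ultimately have "l j = 1" using tendsto_unique[of "at p"] by (metis trivial_limit_at)
    then show "b j p = 1" by (simp add: b_def)
  qed
qed

section \<open>The holomorphic curve of a pseudoholomorphic surface\<close>

locale full_order = regular_harmonic_sequence +
  fixes m :: nat
  assumes m1: "1 \<le> m" and sparse_m: "(V - Om m) sparse_in V"
    and last_m: "\<And>z. z \<in> Om m \<Longrightarrow> rho (Suc m) z = 0"
begin

lemma H_last: "z \<in> Om m \<Longrightarrow> k < N \<Longrightarrow> H (Suc m) z k = 0"
  using last_m by (simp add: rho_def nsq_eq_0_iff)

lemma connected_Om: "connected (Om m)"
proof -
  have "connected (V - (V - Om m))" by (rule sparse_imp_connected[OF _ connected_V V sparse_m]) simp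
  moreover have "V - (V - Om m) = Om m" using Om_subset by blast
  ultimately show ?thesis by simp
qed

lemma eventually_Om: "p \<in> V \<Longrightarrow> \<forall>\<^sub>F z in at p. z \<in> Om m"
proof -
  assume p: "p \<in> V"
  have 1: "\<forall>\<^sub>F y in at p. y \<notin> V - Om m" using sparse_m p sparse_in_eventually_iff[OF V] by blast
  have 2: "\<forall>\<^sub>F y in at p. y \<in> V" using eventually_at_in_open'[OF V p] .
  show ?thesis using 1 2 by eventually_elim blast
qed

lemma Om_nonempty: "Om m \<noteq> {}"
proof -
  obtain p where "p \<in> V" using V_nonempty by blast
  then have "\<exists>z. z \<in> Om m" using eventually_happens'[OF _ eventually_Om] by (metis trivial_limit_at)
  then show ?thesis by blast
qed

definition hterm :: "nat \<Rightarrow> nat \<Rightarrow> nat \<Rightarrow> complex \<Rightarrow> complex" where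
  "hterm i k l z = H (Suc i) z k * cnj (H (Suc i) z l) / of_real (rho (Suc i) z)"

text \<open>The orthogonal projection onto the span of \<open>f\<close>, the \<open>H\<^sub>j\<close> and their conjugates.\<close>

definition pr :: "complex \<Rightarrow> nat \<Rightarrow> nat \<Rightarrow> complex" where
  "pr z k l = complexify f z k * complexify f z l + (\<Sum>i<m. hterm i k l z + hterm i l k z)"

lemma hterm_differentiable:
  assumes z: "z \<in> Om m" and i: "i < m" and k: "k < N" "l < N"
  shows "hterm i k l differentiable (at z)"
    and "dz (hterm i k l) z = H (Suc (Suc i)) z k * cnj (H (Suc i) z l) / of_real (rho (Suc i) z)
      - H (Suc i) z k * cnj (H i z l) / of_real (rho i z)"
proof -
  have zi: "z \<in> Om (Suc i)" "z \<in> Om i" using z Om_mono[of "Suc i" m] Om_mono[of i m] i by auto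
  have d: "(\<lambda>z. H (Suc i) z k) differentiable (at z)" "(\<lambda>z. H (Suc i) z l) differentiable (at z)"
    using H_diff[of "Suc i" m z] z i k by auto
  have dc: "(\<lambda>z. cnj (H (Suc i) z l)) differentiable (at z)" by (rule differentiable_cnj[OF d(2)])
  have ld: "log_deriv (Om (Suc i)) (rho (Suc i)) (kap (Suc i))" by (rule log_deriv_rho)
  have dr: "(\<lambda>z. complex_of_real (rho (Suc i) z)) differentiable (at z)"
    by (rule smooth_onD[OF smooth_on_cr[OF Om_open] Om_open zi(1)]) (use ld in \<open>simp add: log_deriv_def\<close>)
  have r0: "complex_of_real (rho (Suc i) z) \<noteq> 0" "complex_of_real (rho i z) \<noteq> 0"
    using Om_rho[OF zi(1)] by auto
  note di = differentiable_inverse[OF dr r0(1)]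
  have e: "hterm i k l = (\<lambda>z. (H (Suc i) z k * cnj (H (Suc i) z l)) * inverse (of_real (rho (Suc i) z)))"
    by (simp add: hterm_def fun_eq_iff divide_inverse)
  show "hterm i k l differentiable (at z)"
    unfolding e by (rule differentiable_mult[OF differentiable_mult[OF d(1) dc] di])
  have 1: "dz (\<lambda>z. H (Suc i) z k) z = H (Suc (Suc i)) z k + kap (Suc i) z * H (Suc i) z k"
    using vdz_H[of "Suc i" z k] by (simp add: vdz_def)
  have 2: "dz (\<lambda>z. cnj (H (Suc i) z l)) z = - of_real (rho (Suc i) z / rho i z) * cnj (H i z l)"
    unfolding dz_cnj[OF d(2)] using vdzb_H[OF zi(2) k(2)] by (simp add: vdzb_def)
  have 3: "dz (\<lambda>z. complex_of_real (rho (Suc i) z)) z = kap (Suc i) z * of_real (rho (Suc i) z)"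
    using ld zi(1) by (simp add: log_deriv_def)
  show "dz (hterm i k l) z = H (Suc (Suc i)) z k * cnj (H (Suc i) z l) / of_real (rho (Suc i) z)
      - H (Suc i) z k * cnj (H i z l) / of_real (rho i z)"
    unfolding e dz_mult[OF differentiable_mult[OF d(1) dc] di] dz_mult[OF d(1) dc] dz_inverse[OF dr r0(1)] 1 2 3
    using r0 by (simp add: field_simps power2_eq_square)
qed

lemma f_differentiable: "z \<in> V \<Longrightarrow> k < N \<Longrightarrow> (\<lambda>z. complexify f z k) differentiable (at z)"
  using vsmooth_differentiable[OF X_smooth[of 0] V] by (simp add: X_0)

text \<open>The derivatives of the rank one terms of the projection telescope.\<close>

lemma dz_pr:
  assumes z: "z \<in> Om m" and k: "k < N" "l < N"
  shows "(\<lambda>z. pr z k l) differentiable (at z)" "dz (\<lambda>z. pr z k l) z = 0"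
proof -
  have zV: "z \<in> V" using z Om_subset by blast
  note df = f_differentiable[OF zV]
  note dff = differentiable_mult[OF df[OF k(1)] df[OF k(2)]]
  have dt: "(\<lambda>z. hterm i k l z + hterm i l k z) differentiable (at z)" if "i < m" for i
    using hterm_differentiable(1)[OF z that] k by (intro differentiable_add) auto
  have ds: "(\<lambda>z. \<Sum>i<m. hterm i k l z + hterm i l k z) differentiable (at z)"
    using dt by (intro differentiable_sum) auto
  have e: "(\<lambda>z. pr z k l) = (\<lambda>z. complexify f z k * complexify f z l + (\<Sum>i<m. hterm i k l z + hterm i l k z))"
    by (simp add: pr_def)
  show "(\<lambda>z. pr z k l) differentiable (at z)" unfolding e by (rule differentiable_add[OF dff ds])
  define a where "a = (\<lambda>k l i. H (Suc i) z k * cnj (H i z l) / of_real (rho i z))"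
  have "dz (\<lambda>z. \<Sum>i<m. hterm i k l z + hterm i l k z) z = (\<Sum>i<m. dz (\<lambda>z. hterm i k l z + hterm i l k z) z)"
    by (rule dz_sum) (use dt in auto)
  also have "\<dots> = (\<Sum>i<m. (a k l (Suc i) - a k l i) + (a l k (Suc i) - a l k i))"
  proof (rule sum.cong)
    fix i assume "i \<in> {..<m}"
    then have i: "i < m" by simp
    show "dz (\<lambda>z. hterm i k l z + hterm i l k z) z = (a k l (Suc i) - a k l i) + (a l k (Suc i) - a l k i)"
      using dz_add[OF hterm_differentiable(1)[OF z i k] hterm_differentiable(1)[OF z i k(2,1)]]
        hterm_differentiable(2)[OF z i k] hterm_differentiable(2)[OF z i k(2,1)] by (simp add: a_def)
  qed simp
  also have "\<dots> = (a k l m - a k l 0) + (a l k m - a l k 0)"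
    unfolding sum.distrib sum_lessThan_telescope ..
  also have "\<dots> = - (H (Suc 0) z k * complexify f z l + complexify f z k * H (Suc 0) z l)"
    using H_last[OF z] k rho_0[OF zV] by (simp add: a_def complexify_def mult.commute)
  finally have 1: "dz (\<lambda>z. \<Sum>i<m. hterm i k l z + hterm i l k z) z
      = - (H (Suc 0) z k * complexify f z l + complexify f z k * H (Suc 0) z l)" .
  have 2: "dz (\<lambda>z. complexify f z k') z = H (Suc 0) z k'" for k'
    using H_1[OF zV, of k'] by (simp add: X_Suc X_0 vdz_def)
  show "dz (\<lambda>z. pr z k l) z = 0"
    unfolding e dz_add[OF dff ds] dz_mult[OF df[OF k(1)] df[OF k(2)]] 1 2 by simp
qed

lemma cnj_pr: "cnj (pr z k l) = pr z k l"
  by (simp add: pr_def hterm_def complexify_def sum.distrib mult_ac add_ac)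

text \<open>All first derivatives of the projection vanish, and the complement of a sparse set in a connected domain is connected.\<close>

lemma pr_constant:
  assumes "z0 \<in> Om m" "z \<in> Om m" "k < N" "l < N" shows "pr z k l = pr z0 k l"
proof -
  have "((\<lambda>z. pr z k l) has_field_derivative 0) (at x)" if x: "x \<in> Om m" for x
  proof -
    note d = dz_pr[OF x assms(3,4)]
    have "dzb (\<lambda>z. pr z k l) x = cnj (dz (\<lambda>z. cnj (pr z k l)) x)" unfolding dz_cnj[OF d(1)] by simp
    then have "dzb (\<lambda>z. pr z k l) x = 0" using d(2) by (simp add: cnj_pr)
    then show ?thesis using field_derivative_dz[OF d(1)] d(2) by simp
  qed
  then have "\<forall>x\<in>Om m - {}. DERIV (\<lambda>z. pr z k l) x :> 0" by blast
  moreover from this have "continuous_on (Om m) (\<lambda>z. pr z k l)"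
    by (intro DERIV_continuous_on) (auto intro: has_field_derivative_at_within)
  ultimately obtain c where "\<And>x. x \<in> Om m \<Longrightarrow> pr x k l = c"
    using DERIV_zero_connected_constant[OF connected_Om Om_open finite.emptyI] by blast
  then show ?thesis using assms by simp
qed

lemma bprod_pr:
  "(\<Sum>k<N. \<Sum>l<N. x k * pr z k l * y l) = bprod N x (complexify f z) * bprod N (complexify f z) y
    + (\<Sum>i<m. (bprod N x (H (Suc i) z) * bprod N (cnjv (H (Suc i) z)) y
        + bprod N x (cnjv (H (Suc i) z)) * bprod N (H (Suc i) z) y) / of_real (rho (Suc i) z))"
proof -
  have *: "(\<Sum>k<N. \<Sum>l<N. x k * (a k * b l) * y l) = bprod N x a * bprod N b y" for a b :: "nat \<Rightarrow> complex"
    unfolding bprod_def sum_product by (intro sum.cong refl) (simp add: mult_ac)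
  have "(\<Sum>k<N. \<Sum>l<N. x k * pr z k l * y l) = (\<Sum>k<N. \<Sum>l<N. x k * (complexify f z k * complexify f z l) * y l)
     + (\<Sum>k<N. \<Sum>l<N. \<Sum>i<m. x k * (hterm i k l z + hterm i l k z) * y l)"
    unfolding pr_def by (simp add: distrib_left distrib_right sum.distrib sum_distrib_left sum_distrib_right mult_ac)
  also have "(\<Sum>k<N. \<Sum>l<N. \<Sum>i<m. x k * (hterm i k l z + hterm i l k z) * y l)
      = (\<Sum>i<m. \<Sum>k<N. \<Sum>l<N. x k * (hterm i k l z + hterm i l k z) * y l)"
  proof -
    have "(\<Sum>k<N. \<Sum>l<N. \<Sum>i<m. x k * (hterm i k l z + hterm i l k z) * y l)
        = (\<Sum>k<N. \<Sum>i<m. \<Sum>l<N. x k * (hterm i k l z + hterm i l k z) * y l)"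
      by (intro sum.cong refl sum.swap)
    also have "\<dots> = (\<Sum>i<m. \<Sum>k<N. \<Sum>l<N. x k * (hterm i k l z + hterm i l k z) * y l)"
      by (rule sum.swap)
    finally show ?thesis .
  qed
  also have "\<dots> = (\<Sum>i<m. (bprod N x (H (Suc i) z) * bprod N (cnjv (H (Suc i) z)) y
        + bprod N x (cnjv (H (Suc i) z)) * bprod N (H (Suc i) z) y) / of_real (rho (Suc i) z))"
  proof (rule sum.cong)
    fix i
    have "x k * (hterm i k l z + hterm i l k z) * y l
       = (x k * (H (Suc i) z k * cnjv (H (Suc i) z) l) * y l + x k * (cnjv (H (Suc i) z) k * H (Suc i) z l) * y l)
          / of_real (rho (Suc i) z)" for k l
      by (simp add: hterm_def cnjv_def add_divide_distrib algebra_simps)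
    then show "(\<Sum>k<N. \<Sum>l<N. x k * (hterm i k l z + hterm i l k z) * y l)
       = (bprod N x (H (Suc i) z) * bprod N (cnjv (H (Suc i) z)) y
        + bprod N x (cnjv (H (Suc i) z)) * bprod N (H (Suc i) z) y) / of_real (rho (Suc i) z)"
      unfolding *[symmetric] by (simp add: sum.distrib sum_divide_distrib[symmetric])
  qed simp
  finally show ?thesis unfolding * .
qed

lemma real_parts:
  shows "bprod N (\<lambda>k. Re (a k)) (\<lambda>k. Re (b k)) = Re (bprod N a b + bprod N a (cnjv b)) / 2"
    and "bprod N (\<lambda>k. Im (a k)) (\<lambda>k. Im (b k)) = Re (bprod N a (cnjv b) - bprod N a b) / 2"
    and "bprod N (\<lambda>k. Re (a k)) (\<lambda>k. Im (b k)) = Im (bprod N a b - bprod N a (cnjv b)) / 2"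
  by (simp_all add: bprod_def cnjv_def sum.distrib[symmetric] sum_subtractf[symmetric] sum_divide_distrib mult.commute)

lemma H_orth_Om:
  assumes "z \<in> Om m" "i \<le> m" "j \<le> m"
  shows "bprod N (H i z) (cnjv (H j z)) = (if i = j then of_real (rho i z) else 0)"
proof -
  consider "i = j" | "j < i" | "i < j" by linarith
  then show ?thesis
  proof cases
    case 1 then show ?thesis by (simp add: rho_bprod)
  next
    case 2 then show ?thesis using H_orth[of j i m z] assms by simp
  next
    case 3
    then have "bprod N (H j z) (cnjv (H i z)) = 0" using H_orth[of i j m z] assms by simp
    then show ?thesis using bprod_cnjv_swap[of N "H j z" "H i z"] 3 by (simp add: bprod_commute[of N "H i z"])
  qed
qed

lemma H_iso_Om:
  assumes "z \<in> Om m" "i \<le> m" "j \<le> m"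
  shows "bprod N (H i z) (H j z) = of_bool (i = 0 \<and> j = 0)"
  using H_iso[of i m j z] assms ff[of z] Om_subset by (cases "i = 0 \<and> j = 0") auto

text \<open>The columns are the normalised real and imaginary parts of the sequence at one point, together with \<open>f\<close>; since the projection is constant they serve for all points.\<close>

lemma isometry_exists:
  obtains A where "linear_isometry (2 * m + 1) N A"
    "\<And>z k l. z \<in> Om m \<Longrightarrow> k < N \<Longrightarrow> l < N \<Longrightarrow> (\<Sum>i<2 * m + 1. complex_of_real (A k i) * of_real (A l i)) = pr z k l"
proof -
  obtain z0 where z0: "z0 \<in> Om m" using Om_nonempty by blast
  define sc where "sc = (\<lambda>j. if j = 0 then 1 else sqrt (2 / rho j z0))"
  define b where "b = (\<lambda>s :: nat + nat. case s of Inl j \<Rightarrow> (\<lambda>k. sc j * Re (H j z0 k)) | Inr j \<Rightarrow> (\<lambda>k. sc j * Im (H j z0 k)))"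
  let ?J = "{..m} <+> {1..m}"
  have sc2: "sc j * sc j = 2 / rho j z0" if "j \<noteq> 0" for j using that by (simp add: sc_def rho_nonneg)
  have sc0: "sc 0 = 1" by (simp add: sc_def)
  have rj: "rho j z0 \<noteq> 0" if "j \<le> m" for j using Om_rho[OF z0 that] .
  have scal: "bprod N (\<lambda>k. s * x k) (\<lambda>k. t * y k) = s * t * bprod N x y" for s t :: real and x y
    by (simp add: bprod_def sum_distrib_left mult_ac)
  have r0: "rho 0 z0 = 1" using rho_0 z0 Om_subset by blast
  have mixed: "bprod N (\<lambda>k. sc i * Re (H i z0 k)) (\<lambda>k. sc j * Im (H j z0 k)) = 0" if "i \<le> m" "j \<le> m" for i j
    unfolding scal real_parts H_orth_Om[OF z0 that] H_iso_Om[OF z0 that] by simp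
  have re_re: "bprod N (\<lambda>k. sc i * Re (H i z0 k)) (\<lambda>k. sc j * Re (H j z0 k)) = of_bool (i = j)"
    if "i \<le> m" "j \<le> m" for i j
    unfolding scal real_parts H_orth_Om[OF z0 that] H_iso_Om[OF z0 that]
    using sc2[of i] rj[of i] that by (cases "i = 0"; cases "j = 0") (auto simp: sc0 r0)
  have on: "bprod N (b s) (b t) = of_bool (s = t)" if "s \<in> ?J" "t \<in> ?J" for s t
  proof (cases s; cases t)
    fix i j assume st: "s = Inl i" "t = Inl j"
    then show ?thesis using that re_re[of i j] by (auto simp: b_def)
  next
    fix i j assume st: "s = Inl i" "t = Inr j"
    then show ?thesis using that mixed[of i j] by (auto simp: b_def)
  next
    fix i j assume st: "s = Inr i" "t = Inl j"
    then show ?thesis using that mixed[of j i]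
      by (auto simp: b_def bprod_commute[of N "\<lambda>k. sc i * Im (H i z0 k)"])
  next
    fix i j assume st: "s = Inr i" "t = Inr j"
    then show ?thesis using that sc2[of i] rj[of i] H_orth_Om[OF z0, of i j] H_iso_Om[OF z0, of i j]
      by (auto simp: b_def scal real_parts)
  qed
  have sumb: "complex_of_real (\<Sum>s\<in>?J. b s k * b s l) = pr z0 k l" for k l
  proof -
    have "(\<Sum>s\<in>?J. b s k * b s l) = (\<Sum>j\<le>m. sc j * sc j * (Re (H j z0 k) * Re (H j z0 l)))
       + (\<Sum>j=1..m. sc j * sc j * (Im (H j z0 k) * Im (H j z0 l)))"
      by (subst sum.Plus) (auto simp: b_def mult_ac)
    also have "(\<Sum>j\<le>m. sc j * sc j * (Re (H j z0 k) * Re (H j z0 l)))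
        = f z0 k * f z0 l + (\<Sum>j<m. sc (Suc j) * sc (Suc j) * (Re (H (Suc j) z0 k) * Re (H (Suc j) z0 l)))"
      by (simp add: sum.atMost_shift sc0 complexify_def)
    also have "(\<Sum>j=1..m. sc j * sc j * (Im (H j z0 k) * Im (H j z0 l)))
        = (\<Sum>j<m. sc (Suc j) * sc (Suc j) * (Im (H (Suc j) z0 k) * Im (H (Suc j) z0 l)))"
      by (simp add: sum.atLeast1_atMost_eq)
    finally have "(\<Sum>s\<in>?J. b s k * b s l) = f z0 k * f z0 l + (\<Sum>j<m. 2 / rho (Suc j) z0
        * (Re (H (Suc j) z0 k) * Re (H (Suc j) z0 l) + Im (H (Suc j) z0 k) * Im (H (Suc j) z0 l)))"
      using sc2 by (simp add: sum.distrib[symmetric] distrib_left del: of_real_divide)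
    moreover have "hterm i k l z0 + hterm i l k z0 = complex_of_real (2 / rho (Suc i) z0
        * (Re (H (Suc i) z0 k) * Re (H (Suc i) z0 l) + Im (H (Suc i) z0 k) * Im (H (Suc i) z0 l)))" for i
      by (simp add: hterm_def complex_eq_iff field_simps add_divide_distrib[symmetric])
    ultimately show ?thesis by (simp add: pr_def complexify_def)
  qed
  have card: "card ?J = 2 * m + 1" by (simp add: card_Plus)
  obtain h where h: "bij_betw h {0..<2 * m + 1} ?J"
    using ex_bij_betw_nat_finite[of ?J] card by auto
  then have h': "bij_betw h {..<2 * m + 1} ?J" by (simp add: atLeast0LessThan)
  show ?thesis
  proof (rule that[of "\<lambda>k i. b (h i) k"])
    show "linear_isometry (2 * m + 1) N (\<lambda>k i. b (h i) k)"
      unfolding linear_isometry_def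
    proof (intro allI impI)
      fix i j assume ij: "i < 2 * m + 1" "j < 2 * m + 1"
      have "h i \<in> ?J" "h j \<in> ?J" "h i = h j \<longleftrightarrow> i = j"
        using h' ij by (auto simp: bij_betw_def inj_on_eq_iff)
      then show "(\<Sum>k<N. b (h i) k * b (h j) k) = (if i = j then 1 else 0)"
        using on[of "h i" "h j"] by (simp add: bprod_def)
    qed
    fix z k l assume z: "z \<in> Om m" and kl: "k < N" "l < N"
    have "(\<Sum>i<2 * m + 1. complex_of_real (b (h i) k) * of_real (b (h i) l)) = complex_of_real (\<Sum>s\<in>?J. b s k * b s l)"
      using sum.reindex_bij_betw[OF h', of "\<lambda>s. complex_of_real (b s k) * of_real (b s l)"] by simp
    then show "(\<Sum>i<2 * m + 1. complex_of_real (b (h i) k) * of_real (b (h i) l)) = pr z k l"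
      using sumb pr_constant[OF z0 z kl] by simp
  qed
qed

end

section \<open>The derivatives of the directrix\<close>

lemma higher_deriv_eqI:
  fixes F :: "nat \<Rightarrow> complex \<Rightarrow> complex"
  assumes "open S" "\<And>j z. z \<in> S \<Longrightarrow> (F j has_field_derivative F (Suc j) z) (at z)" "z \<in> S"
  shows "(deriv ^^ j) (F 0) z = F j z"
  using assms(3)
proof (induction j arbitrary: z)
  case 0 then show ?case by simp
next
  case (Suc j)
  have "deriv ((deriv ^^ j) (F 0)) z = deriv (F j) z"
    using eventually_nhds_in_open[OF assms(1) Suc.prems] by (intro deriv_cong_ev) (auto elim!: eventually_mono simp: Suc.IH)
  also have "\<dots> = F (Suc j) z" by (rule DERIV_imp_deriv[OF assms(2)[OF Suc.prems]])
  finally show ?case by simp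
qed

context full_order
begin

text \<open>The directrix.  Dividing by \<open>rho m\<close> makes it holomorphic, since \<open>\<partial>H\<^sub>m = \<kappa>\<^sub>m H\<^sub>m\<close> and \<open>\<kappa>\<^sub>m\<close> is the logarithmic derivative of \<open>rho m\<close>.\<close>

definition alph :: "complex \<Rightarrow> nat \<Rightarrow> complex" where
  "alph z k = cnj (H m z k) / of_real (rho m z)"

definition alphd :: "nat \<Rightarrow> complex \<Rightarrow> nat \<Rightarrow> complex" where
  "alphd j z k = (deriv ^^ j) (\<lambda>z. alph z k) z"

lemma alph_holomorphic:
  assumes k: "k < N" shows "(\<lambda>z. alph z k) holomorphic_on Om m"
proof -
  have "((\<lambda>z. alph z k) has_field_derivative dz (\<lambda>z. alph z k) z) (at z)" if z: "z \<in> Om m" for z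
  proof (rule field_derivative_dz)
    have ld: "log_deriv (Om m) (rho m) (kap m)" by (rule log_deriv_rho)
    have dH: "(\<lambda>z. H m z k) differentiable (at z)" using H_diff[of m m z] z k by simp
    note dc = differentiable_cnj[OF dH]
    have dr: "(\<lambda>z. complex_of_real (rho m z)) differentiable (at z)"
      by (rule smooth_onD[OF smooth_on_cr[OF Om_open] Om_open z]) (use ld in \<open>simp add: log_deriv_def\<close>)
    have r0: "complex_of_real (rho m z) \<noteq> 0" using Om_rho[OF z order_refl] by simp
    note di = differentiable_inverse[OF dr r0]
    have e: "(\<lambda>z. alph z k) = (\<lambda>z. cnj (H m z k) * inverse (of_real (rho m z)))"
      by (simp add: alph_def divide_inverse)
    show "(\<lambda>z. alph z k) differentiable (at z)" unfolding e by (rule differentiable_mult[OF dc di])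
    have 1: "dzb (\<lambda>z. cnj (H m z k)) z = cnj (kap m z) * cnj (H m z k)"
      unfolding dzb_cnj[OF dH] using vdz_H[of m z k] H_last[OF z k] by (simp add: vdz_def)
    have "dzb (\<lambda>z. complex_of_real (rho m z)) z = cnj (dz (\<lambda>z. cnj (complex_of_real (rho m z))) z)"
      unfolding dz_cnj[OF dr] by simp
    then have 2: "dzb (\<lambda>z. complex_of_real (rho m z)) z = cnj (kap m z) * of_real (rho m z)"
      using ld z by (simp add: log_deriv_def)
    show "dzb (\<lambda>z. alph z k) z = 0"
      unfolding e dzb_mult[OF dc di] dzb_inverse[OF dr r0] 1 2 using r0 by (simp add: field_simps power2_eq_square)
  qed
  then show ?thesis using Om_open by (meson field_differentiable_def holomorphic_on_open)
qed

lemma alphd_holomorphic: "k < N \<Longrightarrow> (\<lambda>z. alphd j z k) holomorphic_on Om m"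
proof -
  assume k: "k < N"
  have "(\<lambda>z. alphd j z k) = (deriv ^^ j) (\<lambda>z. alph z k)" by (simp add: alphd_def fun_eq_iff)
  then show ?thesis using holomorphic_higher_deriv[OF alph_holomorphic[OF k] Om_open] by simp
qed

lemma alphd_deriv:
  "k < N \<Longrightarrow> z \<in> Om m \<Longrightarrow> ((\<lambda>z. alphd j z k) has_field_derivative alphd (Suc j) z k) (at z)"
proof -
  assume k: "k < N" and z: "z \<in> Om m"
  have "(\<lambda>z. alphd j z k) = (deriv ^^ j) (\<lambda>z. alph z k)" by (simp add: alphd_def fun_eq_iff)
  then show ?thesis using holomorphic_derivI[OF alphd_holomorphic[OF k] Om_open z, of j] by (simp add: alphd_def)
qed

lemma alphd_0: "alphd 0 z k = alph z k" by (simp add: alphd_def)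

lemma alphd_smooth: "vsmooth (Om m) N (alphd j)"
  by (rule holomorphic_vsmooth[OF Om_open alphd_holomorphic])

lemma vdz_alphd: "k < N \<Longrightarrow> z \<in> Om m \<Longrightarrow> vdz (alphd j) z k = alphd (Suc j) z k"
  unfolding vdz_def by (rule dz_field_derivative[OF alphd_deriv])

lemma vdzb_alphd: "k < N \<Longrightarrow> z \<in> Om m \<Longrightarrow> vdzb (alphd j) z k = 0"
  unfolding vdzb_def by (rule dzb_field_derivative[OF alphd_deriv])

lemma X_smooth_Om: "vsmooth (Om m) N (X i)" by (rule vsmooth_subset[OF X_smooth Om_subset])

text \<open>The products of the directrix with the derivatives of \<open>f\<close> are constant, so differentiation moves from one factor to the other at the cost of a sign.\<close>

lemma alphd_X:
  "i + j \<le> m \<Longrightarrow> z \<in> Om m \<Longrightarrow> bprod N (alphd j z) (X i z) = (if i + j = m then (-1) ^ j else 0)"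
proof (induction j arbitrary: i z)
  case 0
  have e: "alphd 0 z = (\<lambda>k. inverse (of_real (rho m z)) * cnjv (H m z) k)"
    by (simp add: fun_eq_iff alphd_0 alph_def cnjv_def divide_inverse mult.commute)
  show ?case unfolding e bprod_scale
    using X_H[of i m z] 0 Om_rho[OF 0(2) order_refl] by (auto simp: bprod_commute[of N "cnjv _"])
next
  case (Suc j)
  have "bprod N (vdz (alphd j) z) (X i z) = - bprod N (alphd j z) (vdz (X i) z)"
    by (rule vdz_const_bprod[OF Om_open alphd_smooth X_smooth_Om Suc.prems(2), where c = 0])
       (use Suc in auto)
  also have "vdz (X i) z = X (Suc i) z" by (simp add: X_Suc)
  also have "bprod N (vdz (alphd j) z) (X i z) = bprod N (alphd (Suc j) z) (X i z)"
    by (rule bprod_cong) (simp_all add: vdz_alphd Suc.prems)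
  finally show ?case using Suc.IH[of "Suc i" z] Suc.prems by simp
qed

lemma alphd_f: "j \<le> m \<Longrightarrow> z \<in> Om m \<Longrightarrow> bprod N (alphd j z) (complexify f z) = (if j = m then (-1) ^ j else 0)"
  using alphd_X[of 0 j z] by (simp add: X_0)

lemma alphd_cnjv_H:
  assumes "j \<le> m" "i < m" "z \<in> Om m"
  shows "bprod N (alphd j z) (cnjv (H (Suc i) z)) = 0"
  using assms(2,3)
proof (induction i arbitrary: z)
  case 0
  have "bprod N (vdzb (alphd j) z) (cnjv (H 0 z)) = - bprod N (alphd j z) (vdzb (\<lambda>z. cnjv (H 0 z)) z)"
    by (rule vdzb_const_bprod[OF Om_open alphd_smooth vsmooth_cnjv[OF Om_open H_smooth] 0(2)])
       (use alphd_f[OF assms(1)] in auto)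
  moreover have "bprod N (vdzb (alphd j) z) (cnjv (H 0 z)) = 0"
    using vdzb_alphd 0(2) by (simp add: bprod_def)
  moreover have "bprod N (alphd j z) (vdzb (\<lambda>z. cnjv (H 0 z)) z) = bprod N (alphd j z) (cnjv (H (Suc 0) z))"
  proof (intro bprod_cong refl)
    fix k assume k: "k < N"
    have "z \<in> V" using 0(2) Om_subset by blast
    then show "vdzb (\<lambda>z. cnjv (H 0 z)) z k = cnjv (H (Suc 0) z) k"
      using vdzb_cnjv_H[of 0 m z k] 0(2) k vdz_H[of 0 z k] kap_0[of z] by (simp add: cnjv_def)
  qed
  ultimately show ?case by simp
next
  case (Suc i)
  then have IH: "bprod N (alphd j x) (cnjv (H (Suc i) x)) = 0" if "x \<in> Om m" for x using that by simp
  have "bprod N (vdzb (alphd j) z) (cnjv (H (Suc i) z)) = - bprod N (alphd j z) (vdzb (\<lambda>z. cnjv (H (Suc i) z)) z)"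
    by (rule vdzb_const_bprod[OF Om_open alphd_smooth vsmooth_cnjv[OF Om_open H_smooth] Suc.prems(2) IH])
       (use Suc.prems in auto)
  moreover have "bprod N (vdzb (alphd j) z) (cnjv (H (Suc i) z)) = 0"
    using vdzb_alphd Suc.prems(2) by (simp add: bprod_def)
  moreover have "bprod N (alphd j z) (vdzb (\<lambda>z. cnjv (H (Suc i) z)) z)
      = bprod N (alphd j z) (\<lambda>k. cnjv (H (Suc (Suc i)) z) k + cnj (kap (Suc i) z) * cnjv (H (Suc i) z) k)"
    by (intro bprod_cong refl) (use vdzb_cnjv_H[of "Suc i" m z] Suc.prems in \<open>simp add: vdz_H cnjv_def\<close>)
  ultimately show ?case unfolding bprod_add_right bprod_scale_right using IH[OF Suc.prems(2)] by simp
qed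

text \<open>Isolated singularities of \<open>alph\<close> could still be accumulation points of zeros of a linear form.  The function \<open>\<bar>h\<bar>\<^sup>2 D m\<close> is bounded and almost logarithmically subharmonic, so the accumulation argument applies to it as well.\<close>

lemma linear_zeros_isolated:
  assumes p: "p \<in> V"
  shows "(\<exists>r>0. \<forall>z\<in>ball p r - {p}. bprod N (alph z) c = 0) \<or> (\<exists>r>0. \<forall>z\<in>ball p r - {p}. bprod N (alph z) c \<noteq> 0)"
proof (rule disjCI)
  assume no: "\<not> (\<exists>r>0. \<forall>z\<in>ball p r - {p}. bprod N (alph z) c \<noteq> 0)"
  define h where "h = (\<lambda>z. bprod N (alph z) c)"
  obtain R B where R: "R > 0" "ball p R \<subseteq> V" "ball p R - {p} \<subseteq> Om m" "B \<ge> 1"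
    and B: "\<And>j z. j \<le> Suc m \<Longrightarrow> z \<in> ball p R - {p} \<Longrightarrow> rho j z \<le> B"
    using good_ball[OF p sparse_m] by metis
  have hol: "h holomorphic_on Om m"
    unfolding h_def bprod_def by (intro holomorphic_intros alph_holomorphic) auto
  define E where "E = (\<lambda>z. (cmod (h z))\<^sup>2 * D m z)"
  define \<kappa> where "\<kappa> = (\<lambda>z. deriv h z / h z + kapsum m z)"
  define U where "U = (ball p R - {p}) \<inter> {z \<in> Om m. h z \<noteq> 0}"
  have E0: "E z = 0 \<longleftrightarrow> h z = 0" if "z \<in> ball p R - {p}" for z
    using D_nonzero[of z m] that R(3) by (auto simp: E_def)
  have U_eq: "{z \<in> ball p R - {p}. E z \<noteq> 0} = U" using E0 R(3) by (auto simp: U_def)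
  have oU: "open U"
  proof -
    have "open (Om m \<inter> h -` (- {0}))"
      using Om_open hol by (intro continuous_open_preimage holomorphic_on_imp_continuous_on) auto
    moreover have "U = (ball p R - {p}) \<inter> (Om m \<inter> h -` (- {0}))" by (auto simp: U_def)
    ultimately show ?thesis by (auto intro: open_Int open_delete)
  qed
  have hU: "h holomorphic_on U" by (rule holomorphic_on_subset[OF hol]) (auto simp: U_def)
  have hder: "(h has_field_derivative deriv h z) (at z)" if "z \<in> Om m" for z
    using holomorphic_derivI[OF hol Om_open that] .
  have holq: "(\<lambda>z. deriv h z / h z) holomorphic_on U"
    by (intro holomorphic_intros holomorphic_deriv hU oU) (auto simp: U_def)
  have ldh: "log_deriv U (\<lambda>z. (cmod (h z))\<^sup>2) (\<lambda>z. deriv h z / h z)"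
    unfolding log_deriv_def
  proof (intro conjI ballI oU)
    have sh: "smooth_on U h" by (rule smooth_on_holomorphic[OF oU hU])
    have "smooth_on U (\<lambda>z. Re (h z * cnj (h z)))" by (intro smooth_on_Re smooth_on_mult smooth_on_cnj oU sh)
    then show "smooth_on U (\<lambda>z. (cmod (h z))\<^sup>2)"
      by (rule smooth_on_cong[OF _ oU]) (metis Re_complex_of_real complex_norm_square)
    show "smooth_on U (\<lambda>z. deriv h z / h z)" by (rule smooth_on_holomorphic[OF oU holq])
    fix z assume z: "z \<in> U"
    then have zO: "z \<in> Om m" "h z \<noteq> 0" by (auto simp: U_def)
    have dh: "h differentiable (at z)" using smooth_onD[OF sh oU z] .
    have "dz (\<lambda>w. complex_of_real ((cmod (h w))\<^sup>2)) z = dz (\<lambda>w. h w * cnj (h w)) z"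
      by (simp only: complex_norm_square)
    also have "\<dots> = deriv h z * cnj (h z)"
      unfolding dz_mult[OF dh differentiable_cnj[OF dh]] dz_cnj[OF dh]
        dz_field_derivative[OF hder[OF zO(1)]] dzb_field_derivative[OF hder[OF zO(1)]] by simp
    also have "\<dots> = deriv h z / h z * complex_of_real ((cmod (h z))\<^sup>2)"
      unfolding complex_norm_square using zO(2) by simp
    finally show "dz (\<lambda>w. complex_of_real ((cmod (h w))\<^sup>2)) z = deriv h z / h z * complex_of_real ((cmod (h z))\<^sup>2)" .
  qed
  have ldE: "log_deriv U E \<kappa>"
    unfolding E_def \<kappa>_def by (rule log_deriv_mult[OF ldh log_deriv_subset[OF log_deriv_D _ oU]]) (auto simp: U_def)
  have hbound: "(cmod (h z))\<^sup>2 * rho m z \<le> nsq N c" if z: "z \<in> Om m" for z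
  proof -
    have "(cmod (h z))\<^sup>2 \<le> nsq N (alph z) * nsq N (cnjv c)"
      using cmod_bprod_cnjv_le[of N "alph z" "cnjv c"] by (simp add: h_def)
    also have "nsq N (alph z) = 1 / rho m z"
    proof -
      have "nsq N (alph z) = (\<Sum>k<N. (cmod (H m z k))\<^sup>2 * (1 / (rho m z)\<^sup>2))"
        unfolding nsq_def by (intro sum.cong) (simp_all add: alph_def norm_divide power_divide)
      also have "\<dots> = rho m z * (1 / (rho m z)\<^sup>2)" unfolding sum_distrib_right[symmetric] by (simp add: rho_def nsq_def)
      finally show ?thesis using Om_rho[OF z order_refl] by (simp add: power2_eq_square)
    qed
    finally have "(cmod (h z))\<^sup>2 \<le> 1 / rho m z * nsq N c" by (simp add: nsq_cnjv)
    moreover have "rho m z > 0" using Om_rho[OF z order_refl] rho_nonneg[of m z] by simp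
    ultimately show ?thesis by (simp add: field_simps)
  qed
  obtain m' where m': "m = Suc m'" using m1 by (cases m) auto
  have E_le: "E z \<le> nsq N c * B ^ m'" if z: "z \<in> ball p R - {p}" for z
  proof -
    have "E z = ((cmod (h z))\<^sup>2 * rho m z) * D m' z" by (simp add: E_def m' D_Suc)
    also have "\<dots> \<le> nsq N c * B ^ m'"
      using hbound[of z] z R(3,4) D_bound[of m' z B] B[OF _ z] m'
      by (intro mult_mono) (auto simp: D_nonneg nsq_nonneg)
    finally show ?thesis .
  qed
  have acc: "p islimpt {z \<in> ball p R - {p}. E z = 0}"
    unfolding islimpt_approachable
  proof (intro allI impI)
    fix e :: real assume "e > 0"
    then have "min e R > 0" using R(1) by simp
    then obtain z where "z \<in> ball p (min e R) - {p}" "h z = 0" using no unfolding h_def by blast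
    then show "\<exists>x'\<in>{z \<in> ball p R - {p}. E z = 0}. x' \<noteq> p \<and> dist x' p < e"
      by (intro bexI[of _ z]) (auto simp: E_def dist_commute)
  qed
  have "E z = 0" if z: "z \<in> ball p (R / 8) - {p}" for z
  proof (rule zeros_accumulate_imp_zero[OF R(1) _ E_le _ _ _ acc z])
    show "0 \<le> E z" for z unfolding E_def by (intro mult_nonneg_nonneg D_nonneg) simp
    show "log_deriv {z \<in> ball p R - {p}. E z \<noteq> 0} E \<kappa>" unfolding U_eq by (rule ldE)
    show "- B \<le> Re (dzb \<kappa> z)" if "z \<in> ball p R - {p}" "E z \<noteq> 0" for z
    proof -
      have zU: "z \<in> U" using that U_eq by blast
      then have zO: "z \<in> Om m" by (auto simp: U_def)
      have hq: "((\<lambda>z. deriv h z / h z) has_field_derivative deriv (\<lambda>z. deriv h z / h z) z) (at z)"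
        by (rule holomorphic_derivI[OF holq oU zU])
      have "(\<lambda>z. deriv h z / h z) differentiable (at z)"
        using hq by (auto simp: differentiable_def has_field_derivative_def)
      then have "dzb \<kappa> z = of_real (rho (Suc m) z / rho m z - rho (Suc 0) z)"
        unfolding \<kappa>_def using dzb_add[OF _ kapsum_diff[OF zO]] dzb_field_derivative[OF hq] dzb_kapsum[OF zO] by simp
      then have "Re (dzb \<kappa> z) = - rho (Suc 0) z" using last_m[OF zO] by simp
      moreover have "rho (Suc 0) z \<le> B" by (rule B) (use that in auto)
      ultimately show ?thesis by simp
    qed
    show "\<exists>C. \<exists>d>0. \<forall>z\<in>ball p R - {p}. dist z a < d \<longrightarrow> E z \<le> C * (dist z a)\<^sup>2"
      if a: "a \<in> ball p R - {p}" "E a = 0" for a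
    proof -
      have aO: "a \<in> Om m" using a R(3) by blast
      have "(\<lambda>z. h z) differentiable (at a)"
        using hder[OF aO] by (auto simp: differentiable_def has_field_derivative_def)
      then obtain C d where C: "C \<ge> 0" "d > 0" "\<And>z. dist z a < d \<Longrightarrow> (cmod (h z))\<^sup>2 \<le> C * (dist z a)\<^sup>2"
        using nsq_zero_quadratic[of 1 "\<lambda>z k. h z" a] E0[OF a(1)] a(2) by (auto simp: nsq_def)
      have "E z \<le> B ^ m * C * (dist z a)\<^sup>2" if z: "z \<in> ball p R - {p}" "dist z a < d" for z
      proof -
        have "D m z \<le> B ^ m" by (rule D_bound) (use B z R(4) in auto)
        then have "(cmod (h z))\<^sup>2 * D m z \<le> (C * (dist z a)\<^sup>2) * B ^ m"
          using C(1) C(3)[OF z(2)] R(4) by (intro mult_mono) (auto simp: D_nonneg)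
        then show ?thesis by (simp add: E_def mult_ac)
      qed
      then show ?thesis using C(2) by blast
    qed
  qed
  then have "\<forall>z\<in>ball p (R / 8) - {p}. h z = 0"
    using E0 R(1) by auto
  then show "\<exists>r>0. \<forall>z\<in>ball p r - {p}. bprod N (alph z) c = 0"
    using R(1) unfolding h_def by (intro exI[of _ "R / 8"]) auto
qed

end

section \<open>Higher derivatives of holomorphic curves\<close>

definition dv :: "(complex \<Rightarrow> nat \<Rightarrow> complex) \<Rightarrow> nat \<Rightarrow> complex \<Rightarrow> nat \<Rightarrow> complex" where
  "dv b j z i = (deriv ^^ j) (\<lambda>z. b z i) z"

definition vhol :: "nat \<Rightarrow> complex set \<Rightarrow> (complex \<Rightarrow> nat \<Rightarrow> complex) \<Rightarrow> bool" where
  "vhol M S b \<longleftrightarrow> (\<forall>i<M. (\<lambda>z. b z i) holomorphic_on S)"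

lemma vhol_subset: "vhol M S b \<Longrightarrow> T \<subseteq> S \<Longrightarrow> vhol M T b"
  unfolding vhol_def using holomorphic_on_subset by blast

lemma vhol_dv: "open S \<Longrightarrow> vhol M S b \<Longrightarrow> vhol M S (dv b j)"
  unfolding vhol_def dv_def using holomorphic_higher_deriv by (simp add: eta_contract_eq)

lemma dv_0: "dv b 0 z i = b z i" by (simp add: dv_def)

lemma dv_deriv:
  assumes "open S" "vhol M S b" "z \<in> S" "i < M"
  shows "((\<lambda>z. dv b j z i) has_field_derivative dv b (Suc j) z i) (at z)"
proof -
  have "(\<lambda>z. dv b j z i) holomorphic_on S" using vhol_dv[OF assms(1,2)] assms(4) by (simp add: vhol_def)
  from holomorphic_derivI[OF this assms(1,3)] show ?thesis by (simp add: dv_def)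
qed

lemma dv_eqI:
  fixes Q :: "nat \<Rightarrow> complex \<Rightarrow> nat \<Rightarrow> complex"
  assumes "open S" "\<And>j z. z \<in> S \<Longrightarrow> ((\<lambda>z. Q j z i) has_field_derivative Q (Suc j) z i) (at z)"
    "\<And>z. z \<in> S \<Longrightarrow> b z i = Q 0 z i" "z \<in> S"
  shows "dv b j z i = Q j z i"
proof -
  have "(deriv ^^ j) (\<lambda>z. b z i) z = (deriv ^^ j) (\<lambda>z. Q 0 z i) z"
  proof (rule higher_deriv_cong_ev[OF _ refl])
    show "\<forall>\<^sub>F x in nhds z. b x i = Q 0 x i"
      using eventually_nhds_in_open[OF assms(1,4)] by eventually_elim (rule assms(3))
  qed
  also have "\<dots> = Q j z i" by (rule higher_deriv_eqI[where F = "\<lambda>j z. Q j z i", OF assms(1,2,4)])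
  finally show ?thesis by (simp add: dv_def)
qed

lemma dv_scale:
  assumes "open S" "vhol M S b" "\<mu> holomorphic_on S" "z \<in> S" "i < M"
  shows "dv (\<lambda>z i. \<mu> z * b z i) j z i = (\<Sum>s\<le>j. of_nat (j choose s) * (deriv ^^ s) \<mu> z * dv b (j - s) z i)"
  unfolding dv_def using higher_deriv_mult[OF assms(3) _ assms(1,4), of "\<lambda>z. b z i" j] assms(2,5)
  by (simp add: vhol_def atLeast0AtMost)

lemma bprod_dv_scale:
  assumes "open S" "vhol M S b" "\<mu> holomorphic_on S" "z \<in> S"
  shows "bprod M (dv (\<lambda>z i. \<mu> z * b z i) j z) v
    = (\<Sum>s\<le>j. of_nat (j choose s) * (deriv ^^ s) \<mu> z * bprod M (dv b (j - s) z) v)"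
proof -
  have "bprod M (dv (\<lambda>z i. \<mu> z * b z i) j z) v
      = bprod M (\<lambda>i. \<Sum>s\<le>j. of_nat (j choose s) * (deriv ^^ s) \<mu> z * dv b (j - s) z i) v"
    by (rule bprod_cong[OF dv_scale[OF assms] refl])
  then show ?thesis unfolding bprod_sum bprod_scale .
qed

lemma dv_scale_perp:
  assumes "open S" "vhol M S b" "\<mu> holomorphic_on S" "\<And>j. j < r \<Longrightarrow> bprod M (dv b j z) v = 0" "z \<in> S" "j < r"
  shows "bprod M (dv (\<lambda>z i. \<mu> z * b z i) j z) v = 0"
  unfolding bprod_dv_scale[OF assms(1-3,5)] using assms(4,6) by (intro sum.neutral) auto

text \<open>The osculating spaces of dimension at most \<open>r\<close> of such a curve are isotropic.\<close>

definition isotropic_on :: "nat \<Rightarrow> nat \<Rightarrow> complex set \<Rightarrow> (complex \<Rightarrow> nat \<Rightarrow> complex) \<Rightarrow> bool" where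
  "isotropic_on M r S b \<longleftrightarrow> (\<forall>z\<in>S. \<forall>j<r. \<forall>l<r. bprod M (dv b j z) (dv b l z) = 0)"

lemma dv_vsmooth: "open S \<Longrightarrow> vhol M S b \<Longrightarrow> vsmooth S M (dv b j)"
  using holomorphic_vsmooth[of S M "dv b j"] vhol_dv[of S M b j] by (simp add: vhol_def)

lemma bprod_dv_deriv_const:
  assumes S: "open S" "vhol M S b" and z: "z \<in> S" and c: "\<And>z. z \<in> S \<Longrightarrow> bprod M (dv b j z) (dv b l z) = c"
  shows "bprod M (dv b (Suc j) z) (dv b l z) + bprod M (dv b j z) (dv b (Suc l) z) = 0"
proof -
  have e: "vdz (dv b j) z i = dv b (Suc j) z i" if "i < M" for i j
    unfolding vdz_def by (rule dz_field_derivative[OF dv_deriv[OF S z that]])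
  have "bprod M (vdz (dv b j) z) (dv b l z) = - bprod M (dv b j z) (vdz (dv b l) z)"
    by (rule vdz_const_bprod[OF S(1) dv_vsmooth[OF S] dv_vsmooth[OF S] z c])
  moreover have "bprod M (vdz (dv b j) z) (dv b l z) = bprod M (dv b (Suc j) z) (dv b l z)"
    "bprod M (dv b j z) (vdz (dv b l) z) = bprod M (dv b j z) (dv b (Suc l) z)"
    by (rule bprod_cong; simp add: e)+
  ultimately show ?thesis by simp
qed

text \<open>Differentiating the isotropy relations: products of total order below \<open>2 r\<close> vanish, those of order
  \<open>2 r\<close> agree up to sign.\<close>

lemma isotropic_products:
  assumes S: "open S" "vhol M S b" and iso: "isotropic_on M r S b"
  shows "i \<le> r \<Longrightarrow> (\<forall>z\<in>S. \<forall>l. (r - i) + l < 2 * r \<longrightarrow> bprod M (dv b (r - i) z) (dv b l z) = 0)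
    \<and> (\<forall>z\<in>S. bprod M (dv b (r - i) z) (dv b (r + i) z) = (-1) ^ i * bprod M (dv b r z) (dv b r z))"
proof (induction i)
  case 0
  have "bprod M (dv b r z) (dv b l z) = 0" if z: "z \<in> S" and l: "l < r" for z l
  proof -
    obtain r' where r: "r = Suc r'" using l by (cases r) auto
    have "bprod M (dv b (Suc r') z) (dv b l z) + bprod M (dv b r' z) (dv b (Suc l) z) = 0"
      by (rule bprod_dv_deriv_const[OF S z, of r' l 0]) (use iso l r in \<open>auto simp: isotropic_on_def\<close>)
    moreover have "bprod M (dv b r' z) (dv b (Suc l) z) = (if Suc l = r then bprod M (dv b r z) (dv b l z) else 0)"
      using iso z l r by (auto simp: isotropic_on_def bprod_commute)
    ultimately show ?thesis using r by (auto split: if_splits)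
  qed
  then show ?case by simp
next
  case (Suc i)
  then obtain j where j: "j = r - Suc i" "Suc j = r - i" by (cases "r - i") auto
  have IH: "bprod M (dv b (Suc j) z) (dv b l z) = 0" if "z \<in> S" "Suc j + l < 2 * r" for z l
    using Suc j that by auto
  have z0: "bprod M (dv b j z) (dv b l z) = 0" if "z \<in> S" "j + l < 2 * r" for z l
    using that
  proof (induction l arbitrary: z)
    case 0
    have "j < r" "0 < r" using j Suc.prems by auto
    then show ?case using iso 0 by (auto simp: isotropic_on_def)
  next
    case (Suc l)
    have "bprod M (dv b (Suc j) z) (dv b l z) + bprod M (dv b j z) (dv b (Suc l) z) = 0"
      by (rule bprod_dv_deriv_const[OF S Suc.prems(1), of j l 0]) (use Suc in auto)
    then show ?case using IH[of z l] Suc.prems by simp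
  qed
  have "bprod M (dv b j z) (dv b (r + Suc i) z) = (-1) ^ Suc i * bprod M (dv b r z) (dv b r z)" if z: "z \<in> S" for z
  proof -
    have "bprod M (dv b (Suc j) z) (dv b (r + i) z) + bprod M (dv b j z) (dv b (Suc (r + i)) z) = 0"
      by (rule bprod_dv_deriv_const[OF S z, of j "r + i" 0]) (use z0 j Suc.prems in auto)
    moreover have "bprod M (dv b (Suc j) z) (dv b (r + i) z) = (-1) ^ i * bprod M (dv b r z) (dv b r z)"
      using Suc.IH Suc.prems z j by auto
    ultimately show ?thesis by (simp add: eq_neg_iff_add_eq_0 add.commute)
  qed
  then show ?case using z0 unfolding j(1)[symmetric] by blast
qed

lemma isotropic_below:
  assumes "open S" "vhol M S b" "isotropic_on M r S b" "z \<in> S" "j + l < 2 * r"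
  shows "bprod M (dv b j z) (dv b l z) = 0"
proof (cases "j \<le> r")
  case True
  then show ?thesis using isotropic_products[OF assms(1-3), of "r - j"] assms(4,5) by simp
next
  case False
  then have "bprod M (dv b l z) (dv b j z) = 0"
    using isotropic_products[OF assms(1-3), of "r - l"] assms(4,5) by (simp add: add.commute)
  then show ?thesis by (simp add: bprod_commute)
qed

lemma isotropic_top:
  assumes "open S" "vhol M S b" "isotropic_on M r S b" "z \<in> S" "j \<le> r"
  shows "bprod M (dv b j z) (dv b (2 * r - j) z) = (-1) ^ (r - j) * bprod M (dv b r z) (dv b r z)"
proof -
  have "r + (r - j) = 2 * r - j" "r - (r - j) = j" using assms(5) by auto
  then show ?thesis using isotropic_products[OF assms(1-3), of "r - j"] assms(4) by auto
qed

text \<open>In the Leibniz expansion every product of total order below \<open>2 r\<close> vanishes, and a single one of order \<open>2 r\<close> is left.\<close>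

lemma isotropic_scale:
  assumes S: "open S" "vhol M S b" and iso: "isotropic_on M r S b" and l: "\<mu> holomorphic_on S"
  shows "isotropic_on M r S (\<lambda>z i. \<mu> z * b z i)"
    and "z \<in> S \<Longrightarrow> bprod M (dv (\<lambda>z i. \<mu> z * b z i) r z) (dv (\<lambda>z i. \<mu> z * b z i) r z)
      = (\<mu> z)\<^sup>2 * bprod M (dv b r z) (dv b r z)"
proof -
  let ?b = "\<lambda>z i. \<mu> z * b z i"
  have exp2: "bprod M (dv ?b j z) (dv ?b k z) = (\<Sum>s\<le>j. of_nat (j choose s) * (deriv ^^ s) \<mu> z *
      (\<Sum>t\<le>k. of_nat (k choose t) * (deriv ^^ t) \<mu> z * bprod M (dv b (k - t) z) (dv b (j - s) z)))" if "z \<in> S" for j k z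
    unfolding bprod_dv_scale[OF S l that, of j "dv ?b k z"]
    unfolding bprod_commute[of M "dv b _ z" "dv ?b k z"] bprod_dv_scale[OF S l that, of k] ..
  show "isotropic_on M r S ?b"
    unfolding isotropic_on_def
  proof (intro ballI allI impI)
    fix z j k assume "z \<in> S" "j < r" "k < r"
    then show "bprod M (dv ?b j z) (dv ?b k z) = 0"
      unfolding exp2[OF \<open>z \<in> S\<close>] using isotropic_below[OF S iso] by (simp add: sum.neutral)
  qed
  assume z: "z \<in> S"
  have inner: "(\<Sum>t\<le>r. of_nat (r choose t) * (deriv ^^ t) \<mu> z * bprod M (dv b (r - t) z) (dv b (r - s) z))
      = (if s = 0 then \<mu> z * bprod M (dv b r z) (dv b r z) else 0)" if "s \<le> r" for s
  proof -
    have "(\<Sum>t\<le>r. of_nat (r choose t) * (deriv ^^ t) \<mu> z * bprod M (dv b (r - t) z) (dv b (r - s) z))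
        = (\<Sum>t\<le>r. if t = 0 then (if s = 0 then \<mu> z * bprod M (dv b r z) (dv b r z) else 0) else 0)"
    proof (rule sum.cong)
      fix t assume "t \<in> {..r}"
      then show "of_nat (r choose t) * (deriv ^^ t) \<mu> z * bprod M (dv b (r - t) z) (dv b (r - s) z)
          = (if t = 0 then (if s = 0 then \<mu> z * bprod M (dv b r z) (dv b r z) else 0) else 0)"
        using isotropic_below[OF S iso z, of "r - t" "r - s"] that by (cases "t = 0"; cases "s = 0") auto
    qed simp
    then show ?thesis by simp
  qed
  have "bprod M (dv ?b r z) (dv ?b r z)
      = (\<Sum>s\<le>r. if s = 0 then \<mu> z * (\<mu> z * bprod M (dv b r z) (dv b r z)) else 0)"
    unfolding exp2[OF z] by (intro sum.cong refl) (auto simp: inner)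
  then show "bprod M (dv ?b r z) (dv ?b r z) = (\<mu> z)\<^sup>2 * bprod M (dv b r z) (dv b r z)"
    by (simp add: power2_eq_square)
qed

lemma bprod_isometry:
  fixes a :: "nat \<Rightarrow> nat \<Rightarrow> 'a::comm_ring_1"
  assumes "\<And>i j. i < M \<Longrightarrow> j < M \<Longrightarrow> (\<Sum>k<N. a k i * a k j) = of_bool (i = j)"
  shows "bprod N (\<lambda>k. \<Sum>i<M. a k i * x i) (\<lambda>k. \<Sum>i<M. a k i * y i) = bprod M x y"
proof -
  have "bprod N (\<lambda>k. \<Sum>i<M. a k i * x i) (\<lambda>k. \<Sum>i<M. a k i * y i)
      = (\<Sum>k<N. \<Sum>i<M. \<Sum>j<M. x i * y j * (a k i * a k j))"
    unfolding bprod_def sum_product by (intro sum.cong refl) (simp add: mult_ac)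
  also have "\<dots> = (\<Sum>i<M. \<Sum>k<N. \<Sum>j<M. x i * y j * (a k i * a k j))" by (rule sum.swap)
  also have "\<dots> = (\<Sum>i<M. \<Sum>j<M. \<Sum>k<N. x i * y j * (a k i * a k j))" by (intro sum.cong refl sum.swap)
  also have "\<dots> = (\<Sum>i<M. \<Sum>j<M. x i * y j * of_bool (i = j))"
    unfolding sum_distrib_left[symmetric] using assms by (intro sum.cong refl) auto
  also have "\<dots> = (\<Sum>i<M. \<Sum>j<M. if i = j then x i * y j else 0)" by (intro sum.cong refl) auto
  finally show ?thesis by (simp add: bprod_def)
qed

lemma linear_isometry_complex:
  assumes "linear_isometry M N A" "i < M" "j < M"
  shows "(\<Sum>k<N. complex_of_real (A k i) * of_real (A k j)) = of_bool (i = j)"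
proof -
  have "(\<Sum>k<N. complex_of_real (A k i) * of_real (A k j)) = of_real (\<Sum>k<N. A k i * A k j)" by simp
  also have "\<dots> = of_bool (i = j)" using assms by (simp add: linear_isometry_def)
  finally show ?thesis .
qed

lemma zero_at_centre:
  fixes h :: "complex \<Rightarrow> complex"
  assumes "r > 0" "continuous_on (ball p r) h" "\<And>z. z \<in> ball p r - {p} \<Longrightarrow> h z = 0" "z \<in> ball p r"
  shows "h z = 0"
proof (cases "z = p")
  case True
  have "(h \<longlongrightarrow> h p) (at p)" using assms(1,2) by (simp add: continuous_on_eq_continuous_at isCont_def)
  moreover have "(h \<longlongrightarrow> 0) (at p)"
  proof (rule tendsto_eventually)
    show "\<forall>\<^sub>F z in at p. h z = 0"
      unfolding eventually_at using assms(1,3) by (intro exI[of _ r]) (auto simp: dist_commute)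
  qed
  ultimately show ?thesis using True tendsto_unique[OF trivial_limit_at] by blast
qed (use assms in auto)

lemma vhol_continuous: "vhol M S b \<Longrightarrow> i < M \<Longrightarrow> continuous_on S (\<lambda>z. b z i)"
  unfolding vhol_def by (simp add: holomorphic_on_imp_continuous_on)

lemma isotropic_on_centre:
  assumes r: "r > 0" and v: "vhol M (ball p r) b" and iso: "isotropic_on M k (ball p r - {p}) b"
  shows "isotropic_on M k (ball p r) b"
  unfolding isotropic_on_def
proof (intro ballI allI impI)
  fix z j l assume z: "z \<in> ball p r" and jl: "j < k" "l < k"
  show "bprod M (dv b j z) (dv b l z) = 0"
  proof (rule zero_at_centre[OF r _ _ z])
    show "continuous_on (ball p r) (\<lambda>z. bprod M (dv b j z) (dv b l z))"
      unfolding bprod_def by (intro continuous_intros vhol_continuous[OF vhol_dv[OF open_ball v]]) auto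
    show "bprod M (dv b j z) (dv b l z) = 0" if "z \<in> ball p r - {p}" for z
      using iso that jl by (simp add: isotropic_on_def)
  qed
qed

text \<open>A common radius for finitely many components, after which \<open>removable_by_division\<close> applies.\<close>

lemma divide_out:
  fixes a :: "nat \<Rightarrow> complex \<Rightarrow> complex"
  assumes R: "R > 0" and hol: "\<And>i. i < M \<Longrightarrow> a i holomorphic_on ball p R - {p}"
    and zero: "\<And>i. i < M \<Longrightarrow> \<exists>s>0. (\<forall>z\<in>ball p s - {p}. a i z = 0) \<or> (\<forall>z\<in>ball p s - {p}. a i z \<noteq> 0)"
    and diff: "\<And>i j. i < M \<Longrightarrow> j < M \<Longrightarrow>
      \<exists>s>0. (\<forall>z\<in>ball p s - {p}. a i z = a j z) \<or> (\<forall>z\<in>ball p s - {p}. a i z \<noteq> a j z)"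
    and ne: "\<And>s. 0 < s \<Longrightarrow> s \<le> R \<Longrightarrow> \<exists>i<M. \<exists>z\<in>ball p s - {p}. a i z \<noteq> 0"
  obtains r j b where "0 < r" "r \<le> R" "j < M" "\<And>z. z \<in> ball p r - {p} \<Longrightarrow> a j z \<noteq> 0"
    "\<And>i. i < M \<Longrightarrow> b i holomorphic_on ball p r"
    "\<And>i z. i < M \<Longrightarrow> z \<in> ball p r - {p} \<Longrightarrow> b i z = a i z / a j z" "b j p = 1"
proof -
  obtain s where s: "\<And>i. i < M \<Longrightarrow> s i > 0"
      "\<And>i. i < M \<Longrightarrow> (\<forall>z\<in>ball p (s i) - {p}. a i z = 0) \<or> (\<forall>z\<in>ball p (s i) - {p}. a i z \<noteq> 0)"
    using zero by metis
  obtain t where t: "\<And>i j. i < M \<Longrightarrow> j < M \<Longrightarrow> t i j > 0"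
      "\<And>i j. i < M \<Longrightarrow> j < M \<Longrightarrow> (\<forall>z\<in>ball p (t i j) - {p}. a i z = a j z) \<or> (\<forall>z\<in>ball p (t i j) - {p}. a i z \<noteq> a j z)"
    using diff by metis
  define K where "K = {R} \<union> s ` {..<M} \<union> (\<lambda>(i, j). t i j) ` ({..<M} \<times> {..<M})"
  define r where "r = Min K"
  have K: "finite K" "K \<noteq> {}" "\<forall>x\<in>K. x > 0" using R s(1) t(1) by (auto simp: K_def)
  have r: "r > 0" unfolding r_def using K by simp
  have le: "r \<le> x" if "x \<in> K" for x unfolding r_def using Min_le[OF K(1) that] .
  have rle: "r \<le> R" by (rule le) (simp add: K_def)
  have rs: "r \<le> s i" if "i < M" for i by (rule le) (use that in \<open>simp add: K_def\<close>)
  have rt: "r \<le> t i j" if "i < M" "j < M" for i j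
    by (rule le) (use that in \<open>auto simp: K_def intro!: image_eqI[of _ _ "(i, j)"]\<close>)
  show thesis
  proof (rule removable_by_division[of r M a p, OF r])
    fix i assume i: "i < M"
    show "a i holomorphic_on ball p r - {p}"
      by (rule holomorphic_on_subset[OF hol[OF i]]) (use subset_ball[OF rle, of p] in blast)
    show "(\<forall>z\<in>ball p r - {p}. a i z = 0) \<or> (\<forall>z\<in>ball p r - {p}. a i z \<noteq> 0)"
      using s(2)[OF i] subset_ball[OF rs[OF i], of p] by blast
    fix j assume j: "j < M"
    show "(\<forall>z\<in>ball p r - {p}. a i z = a j z) \<or> (\<forall>z\<in>ball p r - {p}. a i z \<noteq> a j z)"
      using t(2)[OF i j] subset_ball[OF rt[OF i j], of p] by blast
  next
    obtain i z where iz: "i < M" "z \<in> ball p r - {p}" "a i z \<noteq> 0" using ne[OF r rle] by blast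
    then show "\<exists>i<M. \<forall>z\<in>ball p r - {p}. a i z \<noteq> 0"
      using s(2)[OF iz(1)] subset_ball[OF rs[OF iz(1)], of p] by blast
  next
    fix j b assume 1: "j < M" and 2: "\<And>z. z \<in> ball p r - {p} \<Longrightarrow> a j z \<noteq> 0"
      and 3: "\<And>i. i < M \<Longrightarrow> b i holomorphic_on ball p r"
      and 4: "\<And>i z. i < M \<Longrightarrow> z \<in> ball p r - {p} \<Longrightarrow> b i z = a i z / a j z" and 5: "b j p = 1"
    show thesis by (rule that[OF r rle 1 2 3 4 5])
  qed
qed

section \<open>Reduction to a totally geodesic subsphere\<close>

locale reduced = full_order +
  fixes M :: nat and A :: "nat \<Rightarrow> nat \<Rightarrow> real"
  assumes M_eq: "M = 2 * m + 1" and isoA: "linear_isometry M N A"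
    and repr: "\<And>z k l. z \<in> Om m \<Longrightarrow> k < N \<Longrightarrow> l < N \<Longrightarrow>
      (\<Sum>i<M. complex_of_real (A k i) * of_real (A l i)) = pr z k l"
begin

definition T :: "(nat \<Rightarrow> complex) \<Rightarrow> nat \<Rightarrow> complex" where "T x i = (\<Sum>k<N. of_real (A k i) * x k)"

definition G :: "complex \<Rightarrow> nat \<Rightarrow> real" where "G z i = (\<Sum>k<N. A k i * f z k)"

definition a :: "complex \<Rightarrow> nat \<Rightarrow> complex" where "a z = T (alph z)"

lemma T_f: "T (complexify f z) = complexify G z"
  by (simp add: T_def G_def complexify_def fun_eq_iff)

text \<open>\<open>A A\<^sup>t\<close> is the projection \<open>pr\<close>, so the products of reduced vectors are read off from its expansion in the harmonic sequence.\<close>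

lemma bprod_T:
  assumes z: "z \<in> Om m"
  shows "bprod M (T x) (T y) = bprod N x (complexify f z) * bprod N (complexify f z) y
    + (\<Sum>i<m. (bprod N x (H (Suc i) z) * bprod N (cnjv (H (Suc i) z)) y
        + bprod N x (cnjv (H (Suc i) z)) * bprod N (H (Suc i) z) y) / of_real (rho (Suc i) z))"
proof -
  have "bprod M (T x) (T y) = (\<Sum>i<M. \<Sum>k<N. \<Sum>l<N. x k * (of_real (A k i) * of_real (A l i)) * y l)"
    unfolding bprod_def T_def sum_product by (intro sum.cong refl) (simp add: mult_ac)
  also have "\<dots> = (\<Sum>k<N. \<Sum>i<M. \<Sum>l<N. x k * (of_real (A k i) * of_real (A l i)) * y l)" by (rule sum.swap)
  also have "\<dots> = (\<Sum>k<N. \<Sum>l<N. \<Sum>i<M. x k * (of_real (A k i) * of_real (A l i)) * y l)"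
    by (intro sum.cong refl sum.swap)
  also have "\<dots> = (\<Sum>k<N. \<Sum>l<N. x k * pr z k l * y l)"
    unfolding sum_distrib_left[symmetric] sum_distrib_right[symmetric]
    by (intro sum.cong refl) (simp add: repr[OF z])
  finally show ?thesis unfolding bprod_pr .
qed

lemma f_H: "z \<in> Om m \<Longrightarrow> i < m \<Longrightarrow> bprod N (complexify f z) (H (Suc i) z) = 0"
  "z \<in> Om m \<Longrightarrow> i < m \<Longrightarrow> bprod N (cnjv (H (Suc i) z)) (complexify f z) = 0"
  "z \<in> Om m \<Longrightarrow> i < m \<Longrightarrow> bprod N (H (Suc i) z) (complexify f z) = 0"
proof -
  assume "z \<in> Om m" "i < m"
  then show 1: "bprod N (H (Suc i) z) (complexify f z) = 0" using H_iso_Om[of z "Suc i" 0] by simp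
  then show "bprod N (complexify f z) (H (Suc i) z) = 0" by (simp add: bprod_commute)
  have "cnj (bprod N (H (Suc i) z) (complexify f z)) = 0" using 1 by simp
  then show "bprod N (cnjv (H (Suc i) z)) (complexify f z) = 0" unfolding cnj_bprod by simp
qed

lemma f_AG_Om:
  assumes z: "z \<in> Om m" and k: "k < N" shows "complex_of_real (f z k) = (\<Sum>i<M. of_real (A k i) * of_real (G z i))"
proof -
  define d where "d = (\<lambda>l. of_bool (l = k) :: complex)"
  have d: "bprod N d x = x k" for x
  proof -
    have "bprod N d x = (\<Sum>l<N. if l = k then x l else 0)" by (auto simp: bprod_def d_def intro!: sum.cong)
    then show ?thesis using k by simp
  qed
  have zV: "z \<in> V" using z Om_subset by blast
  have "T d i = of_real (A k i)" for i using d[of "\<lambda>l. of_real (A l i)"] by (simp add: T_def bprod_def mult.commute)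
  then have "(\<Sum>i<M. of_real (A k i) * of_real (G z i)) = bprod M (T d) (T (complexify f z))"
    unfolding T_f by (simp add: bprod_def complexify_def)
  also have "\<dots> = complexify f z k" unfolding bprod_T[OF z] using f_H[OF z] ff[OF zV] d by simp
  finally show ?thesis by (simp add: complexify_def)
qed

lemma f_continuous: "k < N \<Longrightarrow> continuous_on V (\<lambda>z. f z k)"
  by (rule smooth_on_continuous[OF smooth_f])

lemma G_continuous: "continuous_on V (\<lambda>z. G z i)"
  unfolding G_def by (intro continuous_intros f_continuous) auto

lemma f_AG:
  assumes z: "z \<in> V" and k: "k < N" shows "f z k = (\<Sum>i<M. A k i * G z i)"
proof -
  define h where "h = (\<lambda>z. f z k - (\<Sum>i<M. A k i * G z i))"
  have "continuous_on V h" unfolding h_def by (intro continuous_intros f_continuous G_continuous k)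
  then have "(h \<longlongrightarrow> h z) (at z)" using V z by (simp add: continuous_on_eq_continuous_at isCont_def)
  moreover have "(h \<longlongrightarrow> 0) (at z)"
  proof (rule tendsto_eventually)
    show "\<forall>\<^sub>F x in at z. h x = 0" using eventually_Om[OF z]
    proof eventually_elim
      fix x assume "x \<in> Om m"
      from f_AG_Om[OF this k] have "complex_of_real (h x) = 0" by (simp add: h_def)
      then show "h x = 0" by simp
    qed
  qed
  ultimately have "h z = 0" using tendsto_unique[OF trivial_limit_at] by blast
  then show ?thesis by (simp add: h_def)
qed

lemma G_unit: "z \<in> V \<Longrightarrow> bprod M (G z) (G z) = 1"
proof -
  assume z: "z \<in> V"
  have "bprod N (f z) (f z) = bprod N (\<lambda>k. \<Sum>i<M. A k i * G z i) (\<lambda>k. \<Sum>i<M. A k i * G z i)"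
    by (rule bprod_cong) (simp_all add: f_AG[OF z])
  also have "\<dots> = bprod M (G z) (G z)"
    by (rule bprod_isometry) (use isoA in \<open>simp add: linear_isometry_def\<close>)
  finally show ?thesis using unit_f[OF z] by simp
qed

lemma a_vhol: "vhol M (Om m) a"
  unfolding vhol_def a_def T_def by (intro allI impI holomorphic_intros alph_holomorphic) auto

lemma dv_a: "z \<in> Om m \<Longrightarrow> i < M \<Longrightarrow> dv a j z i = T (alphd j z) i"
proof -
  assume z: "z \<in> Om m" and i: "i < M"
  show ?thesis
  proof (rule dv_eqI[where Q = "\<lambda>j z. T (alphd j z)", OF Om_open _ _ z])
    show "((\<lambda>z. T (alphd j z) i) has_field_derivative T (alphd (Suc j) z) i) (at z)" if "z \<in> Om m" for j z
      unfolding T_def by (intro DERIV_sum DERIV_cmult alphd_deriv that) auto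
    show "a z i = T (alphd 0 z) i" if "z \<in> Om m" for z by (simp add: a_def alphd_0[abs_def] T_def alphd_0)
  qed
qed

lemma bprod_dv_a:
  assumes "z \<in> Om m" "j \<le> m" "l \<le> m"
  shows "bprod M (dv a j z) (dv a l z) = of_bool (j = m \<and> l = m)"
proof -
  have "bprod M (dv a j z) (dv a l z) = bprod M (T (alphd j z)) (T (alphd l z))"
    by (rule bprod_cong) (simp_all add: dv_a assms)
  also have "\<dots> = bprod N (alphd j z) (complexify f z) * bprod N (alphd l z) (complexify f z)"
    unfolding bprod_T[OF assms(1)] using alphd_cnjv_H[OF assms(2) _ assms(1)] alphd_cnjv_H[OF assms(3) _ assms(1)]
    by (simp add: bprod_commute[of N "cnjv _" "alphd l z"] bprod_commute[of N "complexify f z" "alphd l z"])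
  also have "\<dots> = of_bool (j = m \<and> l = m)"
    using alphd_f[OF assms(2,1)] alphd_f[OF assms(3,1)] by (auto simp: power_mult_distrib[symmetric])
  finally show ?thesis .
qed

lemma bprod_dv_a_G:
  assumes "z \<in> Om m" "j < m" shows "bprod M (dv a j z) (complexify G z) = 0"
proof -
  have zV: "z \<in> V" using assms(1) Om_subset by blast
  have "bprod M (dv a j z) (complexify G z) = bprod M (T (alphd j z)) (T (complexify f z))"
    unfolding T_f by (rule bprod_cong) (simp_all add: dv_a assms)
  also have "\<dots> = 0" unfolding bprod_T[OF assms(1)] using f_H[OF assms(1)] alphd_f[of j z] assms by simp
  finally show ?thesis .
qed

text \<open>A linear form in the directrix either vanishes near \<open>p\<close> or has no zeros near \<open>p\<close>, so the quotients of components satisfy the hypotheses of the Picard argument.  Scaling does not affect isotropy, and the relations extend to \<open>p\<close> by continuity.\<close>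

lemma directrix_germ:
  assumes p: "p \<in> V"
  obtains r b where "r > 0" "ball p r \<subseteq> V" "vhol M (ball p r) b" "\<exists>j<M. b p j \<noteq> 0"
    "isotropic_on M m (ball p r) b" "\<And>z. z \<in> ball p r - {p} \<Longrightarrow> bprod M (dv b m z) (dv b m z) \<noteq> 0"
    "\<And>z j. z \<in> ball p r \<Longrightarrow> j < m \<Longrightarrow> bprod M (dv b j z) (complexify G z) = 0"
proof -
  define comp where "comp = (\<lambda>i k. complex_of_real (A k i))"
  have a_comp: "a z i = bprod N (alph z) (comp i)" for z i
    by (simp add: a_def T_def bprod_def comp_def mult.commute)
  have a_diff: "a z i - a z j = bprod N (alph z) (\<lambda>k. comp i k - comp j k)" for z i j
    unfolding a_comp bprod_diff_right ..
  obtain r0 where r0: "r0 > 0" "ball p r0 \<subseteq> V" using p V open_contains_ball_eq by blast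
  obtain r1 where r1: "r1 > 0" "\<And>y. y \<noteq> p \<Longrightarrow> dist y p < r1 \<Longrightarrow> y \<in> Om m"
    using eventually_Om[OF p] unfolding eventually_at by auto
  define R where "R = min r0 r1"
  have R: "R > 0" using r0(1) r1(1) by (simp add: R_def)
  have sub: "ball p R - {p} \<subseteq> Om m"
  proof
    fix x assume "x \<in> ball p R - {p}"
    then have "x \<noteq> p" "dist x p < r1" by (auto simp: R_def dist_commute)
    then show "x \<in> Om m" by (rule r1(2))
  qed
  have zero: "\<exists>s>0. (\<forall>z\<in>ball p s - {p}. a z i = 0) \<or> (\<forall>z\<in>ball p s - {p}. a z i \<noteq> 0)" for i
    using linear_zeros_isolated[OF p, of "comp i"] unfolding a_comp by blast
  have "\<exists>t>0. (\<forall>z\<in>ball p t - {p}. a z i - a z j = 0) \<or> (\<forall>z\<in>ball p t - {p}. a z i - a z j \<noteq> 0)" for i j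
    using linear_zeros_isolated[OF p, of "\<lambda>k. comp i k - comp j k"] unfolding a_diff by blast
  then have diff: "\<exists>t>0. (\<forall>z\<in>ball p t - {p}. a z i = a z j) \<or> (\<forall>z\<in>ball p t - {p}. a z i \<noteq> a z j)" for i j
    unfolding right_minus_eq .
  have ne: "\<exists>i<M. \<exists>z\<in>ball p s - {p}. a z i \<noteq> 0" if s: "0 < s" "s \<le> R" for s
  proof (rule ccontr)
    assume no: "\<not> (\<exists>i<M. \<exists>z\<in>ball p s - {p}. a z i \<noteq> 0)"
    define q where "q = p + of_real (s / 2)"
    have q: "q \<in> ball p s - {p}" using s by (simp add: q_def dist_norm)
    have qO: "q \<in> Om m" using q sub subset_ball[OF s(2), of p] by blast
    have "dv a m q i = 0" if i: "i < M" for i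
    proof -
      have op: "open (ball p s - {p})" by (simp add: open_delete)
      show ?thesis by (rule dv_eqI[where Q = "\<lambda>j z i. 0", OF op _ _ q]) (use no i in auto)
    qed
    then have "bprod M (dv a m q) (dv a m q) = 0" by (simp add: bprod_def)
    then show False using bprod_dv_a[OF qO, of m m] by simp
  qed
  have hol: "(\<lambda>z. a z i) holomorphic_on ball p R - {p}" if "i < M" for i
    using a_vhol that holomorphic_on_subset[OF _ sub] by (simp add: vhol_def)
  obtain r j b where r: "0 < r" "r \<le> R" and j: "j < M" "\<And>z. z \<in> ball p r - {p} \<Longrightarrow> a z j \<noteq> 0"
    and b: "\<And>i. i < M \<Longrightarrow> b i holomorphic_on ball p r"
      "\<And>i z. i < M \<Longrightarrow> z \<in> ball p r - {p} \<Longrightarrow> b i z = a z i / a z j" "b j p = 1"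
    by (rule divide_out[where a = "\<lambda>i z. a z i", OF R hol zero diff ne]) auto
  have bV: "ball p r \<subseteq> V" using r0(2) r(2) subset_ball[of r r0 p] by (auto simp: R_def)
  have sub: "ball p r - {p} \<subseteq> Om m" using sub subset_ball[OF r(2), of p] by blast
  define S where "S = ball p r - {p}"
  have S: "open S" "S \<subseteq> Om m" using sub by (auto simp: S_def open_delete)
  define \<mu> where "\<mu> = (\<lambda>z. inverse (a z j))"
  have lhol: "\<mu> holomorphic_on S"
    unfolding \<mu>_def using a_vhol j S holomorphic_on_subset[OF _ S(2)]
    by (intro holomorphic_intros) (auto simp: vhol_def S_def)
  define B where "B = (\<lambda>z i. b i z)"
  have vB: "vhol M (ball p r) B" using b(1) by (simp add: vhol_def B_def)
  have va: "vhol M S a" by (rule vhol_subset[OF a_vhol S(2)])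
  have BS: "dv B k z i = dv (\<lambda>z i. \<mu> z * a z i) k z i" if z: "z \<in> S" and i: "i < M" for k z i
  proof (rule dv_eqI[where Q = "dv (\<lambda>z i. \<mu> z * a z i)", OF S(1) _ _ z])
    have v: "vhol M S (\<lambda>z i. \<mu> z * a z i)"
      using va lhol unfolding vhol_def by (auto intro: holomorphic_intros)
    show "((\<lambda>z. dv (\<lambda>z i. \<mu> z * a z i) k z i) has_field_derivative dv (\<lambda>z i. \<mu> z * a z i) (Suc k) z i) (at z)"
      if "z \<in> S" for k z by (rule dv_deriv[OF S(1) v that i])
    show "B z i = dv (\<lambda>z i. \<mu> z * a z i) 0 z i" if "z \<in> S" for z
      using b(2)[OF i, of z] that by (simp add: dv_0 B_def \<mu>_def S_def divide_inverse mult.commute)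
  qed
  have BSb: "bprod M (dv B k z) x = bprod M (dv (\<lambda>z i. \<mu> z * a z i) k z) x" if "z \<in> S" for k z x
    by (rule bprod_cong) (simp_all add: BS that)
  have BSb2: "bprod M (dv B k z) (dv B l z) = bprod M (dv (\<lambda>z i. \<mu> z * a z i) k z) (dv (\<lambda>z i. \<mu> z * a z i) l z)"
    if "z \<in> S" for k l z by (rule bprod_cong; rule BS[OF that])
  have isoa: "isotropic_on M m S a" unfolding isotropic_on_def using bprod_dv_a S(2) by auto
  note sc = isotropic_scale[OF S(1) va isoa lhol]
  show ?thesis
  proof (rule that[OF r(1) bV vB])
    show "\<exists>j<M. B p j \<noteq> 0" using j(1) b(3) by (auto simp: B_def)
    have "isotropic_on M m S B"
      using sc(1) unfolding isotropic_on_def by (simp add: BSb2)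
    then show "isotropic_on M m (ball p r) B" unfolding S_def by (rule isotropic_on_centre[OF r(1) vB])
    show "bprod M (dv B m z) (dv B m z) \<noteq> 0" if "z \<in> ball p r - {p}" for z
    proof -
      have z: "z \<in> S" using that by (simp add: S_def)
      have "bprod M (dv B m z) (dv B m z) = (\<mu> z)\<^sup>2 * bprod M (dv a m z) (dv a m z)"
        using sc(2)[OF z] by (simp only: BSb2[OF z])
      then show ?thesis using bprod_dv_a[of z m m] z S(2) j(2)[OF that] by (auto simp: \<mu>_def)
    qed
    fix z k assume z: "z \<in> ball p r" and k: "k < m"
    show "bprod M (dv B k z) (complexify G z) = 0"
    proof (rule zero_at_centre[OF r(1) _ _ z])
      have "continuous_on (ball p r) (\<lambda>z. G z i)" for i by (rule continuous_on_subset[OF G_continuous bV])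
      then show "continuous_on (ball p r) (\<lambda>z. bprod M (dv B k z) (complexify G z))"
        unfolding bprod_def complexify_def
        by (intro continuous_on_sum continuous_on_mult continuous_on_of_real
            vhol_continuous[OF vhol_dv[OF open_ball vB]]) auto
      show "bprod M (dv B k z) (complexify G z) = 0" if "z \<in> ball p r - {p}" for z
      proof -
        have z: "z \<in> S" using that by (simp add: S_def)
        have zO: "z \<in> Om m" using z S(2) by blast
        show ?thesis unfolding BSb[OF z]
          by (rule dv_scale_perp[where r = m, OF S(1) va lhol _ z k]) (rule bprod_dv_a_G[OF zO])
      qed
    qed
  qed
qed

end

section \<open>Recovering the data of the construction\<close>

lemma frame_cong: "(\<And>s. s < r \<Longrightarrow> \<phi> s = \<phi>' s) \<Longrightarrow> frame \<phi> r = frame \<phi>' r"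
proof (induction r)
  case (Suc r)
  then have "\<phi> r = \<phi>' r" "frame \<phi> r = frame \<phi>' r" by simp_all
  then show ?case by (simp only: frame.simps)
qed simp

text \<open>The recursion of the construction on the levels up to \<open>r\<close>, with \<open>\<beta>\<close> free of zeros off \<open>E\<close>.  The function \<open>\<beta> r\<close> is arbitrary here; it stands in for the convention that the last coefficient is 1.\<close>

definition recursive_data :: "nat \<Rightarrow> complex set \<Rightarrow> complex set \<Rightarrow> (nat \<Rightarrow> complex \<Rightarrow> complex) \<Rightarrow>
    (nat \<Rightarrow> complex \<Rightarrow> nat \<Rightarrow> complex) \<Rightarrow> bool" where
  "recursive_data r E S \<beta> \<phi> \<longleftrightarrow>
     (\<forall>s\<le>r. \<beta> s holomorphic_on S \<and> (\<forall>z\<in>S - E. \<beta> s z \<noteq> 0)) \<and>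
     (\<forall>s<r. \<forall>k<Suc (2 * s). \<forall>z\<in>S. ((\<lambda>w. \<phi> s w k) has_field_derivative \<beta> s z * frame \<phi> s 0 z k) (at z))"

definition generated :: "nat \<Rightarrow> complex set \<Rightarrow> complex set \<Rightarrow> (complex \<Rightarrow> nat \<Rightarrow> complex) \<Rightarrow> bool" where
  "generated r E S b \<longleftrightarrow> (\<exists>\<beta> \<phi>. recursive_data r E S \<beta> \<phi> \<and>
     (\<forall>z\<in>S. \<forall>k<Suc (2 * r). b z k = \<beta> r z * frame \<phi> r 0 z k))"

lemma generated_subset:
  assumes "generated r E S b" "T \<subseteq> S" shows "generated r E T b"
proof -
  obtain \<beta> \<phi> where h: "recursive_data r E S \<beta> \<phi>" "\<And>z k. z \<in> S \<Longrightarrow> k < Suc (2 * r) \<Longrightarrow> b z k = \<beta> r z * frame \<phi> r 0 z k"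
    using assms(1) unfolding generated_def by blast
  have "\<beta> s holomorphic_on T" if "s \<le> r" for s
    using h(1) that holomorphic_on_subset[OF _ assms(2)] by (simp add: recursive_data_def)
  then have "recursive_data r E T \<beta> \<phi>" using h(1) assms(2) unfolding recursive_data_def by blast
  then show ?thesis using h(2) assms(2) unfolding generated_def by blast
qed

lemma generated_scale:
  assumes "generated r E S b" "\<mu> holomorphic_on S" "\<And>z. z \<in> S - E \<Longrightarrow> \<mu> z \<noteq> 0"
    and b': "\<And>z k. z \<in> S \<Longrightarrow> k < Suc (2 * r) \<Longrightarrow> b' z k = \<mu> z * b z k"
  shows "generated r E S b'"
proof -
  obtain \<beta> \<phi> where h: "recursive_data r E S \<beta> \<phi>" "\<And>z k. z \<in> S \<Longrightarrow> k < Suc (2 * r) \<Longrightarrow> b z k = \<beta> r z * frame \<phi> r 0 z k"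
    using assms(1) unfolding generated_def by blast
  define \<beta>' where "\<beta>' = \<beta>(r := \<lambda>z. \<mu> z * \<beta> r z)"
  have "\<beta>' s holomorphic_on S \<and> (\<forall>z\<in>S - E. \<beta>' s z \<noteq> 0)" if "s \<le> r" for s
    using that h(1) assms(2,3) by (auto simp: \<beta>'_def recursive_data_def intro!: holomorphic_on_mult)
  moreover have "\<beta>' s = \<beta> s" if "s < r" for s using that by (simp add: \<beta>'_def)
  ultimately have "recursive_data r E S \<beta>' \<phi>" using h(1) by (simp add: recursive_data_def)
  moreover have "b' z k = \<beta>' r z * frame \<phi> r 0 z k" if "z \<in> S" "k < Suc (2 * r)" for z k
    using that by (simp add: b' h(2) \<beta>'_def)
  ultimately show ?thesis unfolding generated_def by blast
qed

text \<open>A nonzero isotropic vector is a multiple of a hat: stereographic projection of the quadric.\<close>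

lemma isotropic_hat:
  assumes x: "bprod (Suc (Suc M)) x x = 0" and l: "l = x 0 - \<i> * x 1" "l \<noteq> 0"
  shows "x k = l / 2 * hat M (\<lambda>k. x (k + 2) / l) k"
proof -
  define q where "q = bprod M (\<lambda>k. x (k + 2)) (\<lambda>k. x (k + 2))"
  have "bprod M (\<lambda>k. x (k + 2) / l) (\<lambda>k. x (k + 2) / l) = q / l\<^sup>2"
    by (simp add: q_def bprod_def sum_divide_distrib power2_eq_square)
  moreover have "q = - (l * (x 0 + \<i> * x 1))"
    using x unfolding bprod_Suc_Suc q_def[symmetric] l(1) by (simp add: algebra_simps eq_neg_iff_add_eq_0)
  ultimately have qq: "bprod M (\<lambda>k. x (k + 2) / l) (\<lambda>k. x (k + 2) / l) = - ((x 0 + \<i> * x 1) / l)"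
    using l(2) by (simp add: power2_eq_square)
  consider "k = 0" | "k = 1" | "k \<noteq> 0" "k \<noteq> 1" by blast
  then show ?thesis
  proof cases
    case 1
    have "l / 2 * (1 - - ((x 0 + \<i> * x 1) / l)) = (l + (x 0 + \<i> * x 1)) / 2" using l(2) by (simp add: field_simps)
    then show ?thesis unfolding hat_def qq by (simp add: 1 l(1))
  next
    case 2
    have "l / 2 * (\<i> * (1 + - ((x 0 + \<i> * x 1) / l))) = \<i> * (l - (x 0 + \<i> * x 1)) / 2"
      using l(2) by (simp add: field_simps)
    also have "\<dots> = x 1" by (simp add: l(1) algebra_simps)
    finally show ?thesis unfolding hat_def qq by (simp add: 2)
  next
    case 3
    have "k - 2 + 2 = k" using 3 by arith
    then have "x k = l / 2 * (2 * (x (k - 2 + 2) / l))" using l(2) by simp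
    then show ?thesis unfolding hat_def using 3 by (simp only: if_False)
  qed
qed

text \<open>The curve \<open>b\<close> adds one level: its stereographic coordinate is the next primitive, and half of the linear form is the next coefficient.\<close>

lemma generated_step:
  assumes l: "l holomorphic_on S" "\<And>z. z \<in> S \<Longrightarrow> l z = b z 0 - \<i> * b z 1" "\<And>z. z \<in> S \<Longrightarrow> l z \<noteq> 0"
    and iso: "\<And>z. z \<in> S \<Longrightarrow> bprod (Suc (Suc (Suc (2 * r)))) (b z) (b z) = 0"
    and p: "p = (\<lambda>z k. b z (k + 2) / l z)"
    and c: "\<And>k z. k < Suc (2 * r) \<Longrightarrow> z \<in> S \<Longrightarrow> ((\<lambda>w. p w k) has_field_derivative c z k) (at z)"
    and gen: "generated r E S c"
  shows "generated (Suc r) E S b"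
proof -
  obtain \<beta> \<phi> where h: "recursive_data r E S \<beta> \<phi>" "\<And>z k. z \<in> S \<Longrightarrow> k < Suc (2 * r) \<Longrightarrow> c z k = \<beta> r z * frame \<phi> r 0 z k"
    using gen unfolding generated_def by blast
  define \<beta>' where "\<beta>' = \<beta>(Suc r := \<lambda>z. l z / 2)"
  define \<phi>' where "\<phi>' = \<phi>(r := p)"
  have pr: "\<phi>' r = p" by (simp add: \<phi>'_def)
  have fr: "frame \<phi>' s = frame \<phi> s" if "s \<le> r" for s
    by (rule frame_cong) (use that in \<open>simp add: \<phi>'_def\<close>)
  have "\<beta>' s holomorphic_on S \<and> (\<forall>z\<in>S - E. \<beta>' s z \<noteq> 0)" if "s \<le> Suc r" for s
  proof (cases "s = Suc r")
    case True then show ?thesis using l by (auto simp: \<beta>'_def intro!: holomorphic_intros)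
  next
    case False then show ?thesis using that h(1) by (simp add: \<beta>'_def recursive_data_def)
  qed
  moreover have "((\<lambda>w. \<phi>' s w k) has_field_derivative \<beta>' s z * frame \<phi>' s 0 z k) (at z)"
    if "s < Suc r" "k < Suc (2 * s)" "z \<in> S" for s k z
  proof (cases "s = r")
    case True
    then show ?thesis using c[of k z] h(2)[of z k] that fr[of r] pr by (simp add: \<beta>'_def)
  next
    case False
    then have "s < r" "\<phi>' s = \<phi> s" "\<beta>' s = \<beta> s" using that by (simp_all add: \<beta>'_def \<phi>'_def)
    then show ?thesis using that h(1) fr[of s] by (simp add: recursive_data_def)
  qed
  ultimately have 1: "recursive_data (Suc r) E S \<beta>' \<phi>'" unfolding recursive_data_def by blast
  have "b z k = \<beta>' (Suc r) z * frame \<phi>' (Suc r) 0 z k" if z: "z \<in> S" for z k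
  proof -
    have "b z k = l z / 2 * hat (Suc (2 * r)) (\<lambda>k. b z (k + 2) / l z) k"
      by (rule isotropic_hat[OF iso[OF z] l(2,3)[OF z]])
    then show ?thesis unfolding frame.simps nat.case pr by (simp add: \<beta>'_def p)
  qed
  then show ?thesis using 1 unfolding generated_def by blast
qed

section \<open>Stereographic projection of an isotropic curve\<close>

lemma dv_cong:
  assumes "open S" "\<And>z. z \<in> S \<Longrightarrow> b z i = b' z i" "z \<in> S" shows "dv b j z i = dv b' j z i"
  unfolding dv_def
proof (rule higher_deriv_cong_ev[OF _ refl])
  show "\<forall>\<^sub>F x in nhds z. b x i = b' x i"
    using eventually_nhds_in_open[OF assms(1,3)] by eventually_elim (rule assms(2))
qed

lemma isotropic_self:
  assumes "isotropic_on M r S b" "0 < r" "z \<in> S" shows "bprod M (b z) (b z) = 0"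
proof -
  have "dv b 0 = b" by (simp add: fun_eq_iff dv_0)
  moreover have "bprod M (dv b 0 z) (dv b 0 z) = 0" using assms by (simp add: isotropic_on_def)
  ultimately show ?thesis by simp
qed

lemma dv_dv: "dv (dv b j) l = dv b (l + j)"
  by (simp add: dv_def fun_eq_iff funpow_add)

lemma isotropic_divide:
  assumes r: "r > 0" and v: "vhol M (ball p r) B" and va: "vhol M (ball p r - {p}) a"
    and iso: "isotropic_on M k (ball p r - {p}) a" and mu: "\<mu> holomorphic_on ball p r - {p}"
    and B: "\<And>z i. z \<in> ball p r - {p} \<Longrightarrow> i < M \<Longrightarrow> B z i = \<mu> z * a z i"
  shows "isotropic_on M k (ball p r) B"
    and "z \<in> ball p r - {p} \<Longrightarrow> bprod M (dv B k z) (dv B k z) = (\<mu> z)\<^sup>2 * bprod M (dv a k z) (dv a k z)"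
proof -
  have S: "open (ball p r - {p})" by (simp add: open_delete)
  have e: "bprod M (dv B j z) (dv B l z) = bprod M (dv (\<lambda>z i. \<mu> z * a z i) j z) (dv (\<lambda>z i. \<mu> z * a z i) l z)"
    if "z \<in> ball p r - {p}" for j l z
  proof -
    have "dv B j z i = dv (\<lambda>z i. \<mu> z * a z i) j z i" if "i < M" for i j
      by (rule dv_cong[OF S _ \<open>z \<in> _\<close>]) (rule B[OF _ that])
    then show ?thesis by (intro bprod_cong)
  qed
  note sc = isotropic_scale[OF S va iso mu]
  show "bprod M (dv B k z) (dv B k z) = (\<mu> z)\<^sup>2 * bprod M (dv a k z) (dv a k z)" if "z \<in> ball p r - {p}"
    unfolding e[OF that] by (rule sc(2)[OF that])
  have "isotropic_on M k (ball p r - {p}) B" using sc(1) unfolding isotropic_on_def by (simp add: e)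
  then show "isotropic_on M k (ball p r) B" by (rule isotropic_on_centre[OF r v])
qed

text \<open>The first two coordinates of the derivatives are \<open>-q\<close> and \<open>\<i> q\<close> with a common \<open>q\<close>, so their products cancel.\<close>

lemma bprod_dv_hat:
  assumes S: "open S" "vhol M S \<phi>" and z: "z \<in> S"
  shows "bprod (Suc (Suc M)) (dv (\<lambda>z. hat M (\<phi> z)) (Suc j) z) (dv (\<lambda>z. hat M (\<phi> z)) (Suc l) z)
    = 4 * bprod M (dv \<phi> (Suc j) z) (dv \<phi> (Suc l) z)"
proof -
  define q where "q = (\<lambda>z. bprod M (\<phi> z) (\<phi> z))"
  have hq: "q holomorphic_on S" unfolding q_def bprod_def using S(2) by (intro holomorphic_intros) (auto simp: vhol_def)
  have dq: "((deriv ^^ j) q has_field_derivative (deriv ^^ Suc j) q z) (at z)" if "z \<in> S" for j z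
    using holomorphic_derivI[OF holomorphic_higher_deriv[OF hq S(1)] S(1) that] by simp
  define Q where "Q = (\<lambda>j z k. case j of 0 \<Rightarrow> hat M (\<phi> z) k
     | Suc j \<Rightarrow> if k = 0 then - (deriv ^^ Suc j) q z else if k = 1 then \<i> * (deriv ^^ Suc j) q z
        else 2 * dv \<phi> (Suc j) z (k - 2))"
  have "((\<lambda>z. Q j z k) has_field_derivative Q (Suc j) z k) (at z)" if z: "z \<in> S" and k: "k < Suc (Suc M)" for j z k
  proof -
    have d2: "((\<lambda>z. dv \<phi> j z (k - 2)) has_field_derivative dv \<phi> (Suc j) z (k - 2)) (at z)" if "k \<noteq> 0" "k \<noteq> 1"
      by (rule dv_deriv[OF S z]) (use that k in arith)
    have d0: "((\<lambda>z. \<phi> z (k - 2)) has_field_derivative dv \<phi> (Suc 0) z (k - 2)) (at z)" if "k \<noteq> 0" "k \<noteq> 1"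
      using dv_deriv[OF S z, of "k - 2" 0] that k by (simp add: dv_0)
    have dq0: "(q has_field_derivative (deriv ^^ Suc 0) q z) (at z)" using dq[OF z, of 0] by simp
    show ?thesis
    proof (cases j)
      case 0
      then show ?thesis using d0 unfolding Q_def nat.case hat_def q_def[symmetric]
        using DERIV_diff[OF DERIV_const[of 1] dq0] DERIV_cmult[OF DERIV_add[OF DERIV_const[of 1] dq0], of \<i>]
          DERIV_cmult[OF d0, of 2] by (simp add: q_def)
    next
      case (Suc i)
      then show ?thesis
        using DERIV_minus[OF dq[OF z, of j]] DERIV_cmult[OF dq[OF z, of j], of \<i>] DERIV_cmult[OF d2, of 2]
        by (simp add: Q_def del: funpow.simps)
    qed
  qed
  then have e: "dv (\<lambda>z. hat M (\<phi> z)) j z k = Q j z k" if "k < Suc (Suc M)" for j k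
    by (rule dv_eqI[where Q = Q, OF S(1) _ _ z]) (use that in \<open>auto simp: Q_def\<close>)
  have ii: "\<i> * x * (\<i> * y) = - (x * y)" for x y by (simp add: complex_eq_iff)
  have "bprod (Suc (Suc M)) (dv (\<lambda>z. hat M (\<phi> z)) (Suc j) z) (dv (\<lambda>z. hat M (\<phi> z)) (Suc l) z)
      = bprod (Suc (Suc M)) (Q (Suc j) z) (Q (Suc l) z)" by (rule bprod_cong; rule e; assumption)
  also have "\<dots> = bprod M (\<lambda>k. 2 * dv \<phi> (Suc j) z k) (\<lambda>k. 2 * dv \<phi> (Suc l) z k)"
    unfolding bprod_Suc_Suc by (simp add: Q_def ii del: funpow.simps)
  also have "\<dots> = 4 * bprod M (dv \<phi> (Suc j) z) (dv \<phi> (Suc l) z)"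
    unfolding bprod_scale bprod_scale_right by simp
  finally show ?thesis .
qed

lemma stereographic_derivative:
  assumes S: "open S" and v: "vhol (Suc (Suc M)) S b" and iso: "isotropic_on (Suc (Suc M)) (Suc r) S b"
    and l: "l = (\<lambda>z. b z 0 - \<i> * b z 1)" "\<And>z. z \<in> S \<Longrightarrow> l z \<noteq> 0" and p: "p = (\<lambda>z k. b z (k + 2) / l z)"
  shows "l holomorphic_on S" "vhol M S p" "isotropic_on M r S (dv p 1)"
    and "z \<in> S \<Longrightarrow> bprod M (dv (dv p 1) r z) (dv (dv p 1) r z)
      = bprod (Suc (Suc M)) (dv b (Suc r) z) (dv b (Suc r) z) / (l z)\<^sup>2"
proof -
  show hl: "l holomorphic_on S" unfolding l(1) using v by (intro holomorphic_intros) (auto simp: vhol_def)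
  show vp: "vhol M S p" unfolding p vhol_def using v hl l(2)
    by (intro allI impI holomorphic_intros) (auto simp: vhol_def)
  have hm: "(\<lambda>z. 2 / l z) holomorphic_on S" by (intro holomorphic_intros hl) (use l(2) in auto)
  have h: "hat M (p z) k = 2 / l z * b z k" if z: "z \<in> S" for z k
  proof -
    have "bprod (Suc (Suc M)) (b z) (b z) = 0" by (rule isotropic_self[OF iso _ z]) simp
    then have "b z k = l z / 2 * hat M (p z) k" unfolding p by (rule isotropic_hat) (use l z in auto)
    then show ?thesis using l(2)[OF z] by (simp add: field_simps)
  qed
  note sc = isotropic_scale[OF S v iso hm]
  have "dv (\<lambda>z. hat M (p z)) j z k = dv (\<lambda>z k. 2 / l z * b z k) j z k" if "z \<in> S" for j k z
    by (rule dv_cong[OF S _ that]) (rule h)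
  then have e: "bprod M' (dv (\<lambda>z. hat M (p z)) j z) (dv (\<lambda>z. hat M (p z)) k z)
     = bprod M' (dv (\<lambda>z k. 2 / l z * b z k) j z) (dv (\<lambda>z k. 2 / l z * b z k) k z)" if "z \<in> S" for j k z M'
    using that by (intro bprod_cong) auto
  show "isotropic_on M r S (dv p 1)"
    unfolding isotropic_on_def dv_dv
  proof (intro ballI allI impI)
    fix z j k assume z: "z \<in> S" and jk: "j < r" "k < r"
    have "4 * bprod M (dv p (Suc j) z) (dv p (Suc k) z) = 0"
      unfolding bprod_dv_hat[OF S vp z, symmetric] e[OF z] using sc(1) z jk by (simp add: isotropic_on_def)
    then show "bprod M (dv p (j + 1) z) (dv p (k + 1) z) = 0" by simp
  qed
  assume z: "z \<in> S"
  have "4 * bprod M (dv p (Suc r) z) (dv p (Suc r) z)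
      = (2 / l z)\<^sup>2 * bprod (Suc (Suc M)) (dv b (Suc r) z) (dv b (Suc r) z)"
    unfolding bprod_dv_hat[OF S vp z, symmetric] e[OF z] by (rule sc(2)[OF z])
  also have "\<dots> = 4 * (bprod (Suc (Suc M)) (dv b (Suc r) z) (dv b (Suc r) z) / (l z)\<^sup>2)"
    by (simp add: power_divide)
  finally have "bprod M (dv p (Suc r) z) (dv p (Suc r) z)
      = bprod (Suc (Suc M)) (dv b (Suc r) z) (dv b (Suc r) z) / (l z)\<^sup>2"
    by (simp only: mult_cancel_left) simp
  then show "bprod M (dv (dv p 1) r z) (dv (dv p 1) r z)
      = bprod (Suc (Suc M)) (dv b (Suc r) z) (dv b (Suc r) z) / (l z)\<^sup>2"
    by (simp add: dv_dv)
qed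

text \<open>The derivatives of order at most \<open>2 R\<close> form a basis: their Gram matrix is triangular with respect to the antidiagonal.\<close>

lemma isotropic_curve_full:
  assumes S: "open S" and v: "vhol (Suc (2 * R)) S b" and iso: "isotropic_on (Suc (2 * R)) R S b"
    and z: "z \<in> S" and top: "bprod (Suc (2 * R)) (dv b R z) (dv b R z) \<noteq> 0"
    and x: "\<And>j. bprod (Suc (2 * R)) (dv b j z) x = 0" and k: "k < Suc (2 * R)"
  shows "x k = 0"
proof -
  define N where "N = Suc (2 * R)"
  define w where "w = (\<lambda>j. dv b (2 * R - j) z)"
  have diag: "bprod N (w i) (dv b i z) \<noteq> 0" if "i \<le> 2 * R" for i
  proof (cases "i \<le> R")
    case True
    then show ?thesis using isotropic_top[OF S v iso z True] top by (simp add: N_def w_def bprod_commute)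
  next
    case False
    then have "2 * R - i \<le> R" "2 * R - (2 * R - i) = i" using that by auto
    then show ?thesis using isotropic_top[OF S v iso z, of "2 * R - i"] top by (simp add: N_def w_def)
  qed
  have nz: "nsq N (gs N w j) \<noteq> 0" if "j \<le> 2 * R" for j
  proof (rule gs_nonzero[where L = "\<lambda>i x. bprod N x (dv b i z)"])
    show "bprod N (w i) (dv b i z) \<noteq> 0" if "i \<le> j" for i using diag \<open>j \<le> 2 * R\<close> that by simp
    show "bprod N (w a) (dv b i z) = 0" if "i \<le> j" "a \<le> j" "i < a" for i a
      unfolding w_def N_def by (rule isotropic_below[OF S v iso z]) (use that \<open>j \<le> 2 * R\<close> in arith)
    show "bprod N y (dv b i z) = 0" if "\<And>k. k < N \<Longrightarrow> y k = 0" for i y using that by (simp add: bprod_def)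
    show "bprod N (\<lambda>k. \<Sum>a\<le>j. c a * w a k) (dv b i z) = (\<Sum>a\<le>j. c a * bprod N (w a) (dv b i z))" for i c
      unfolding bprod_sum bprod_scale ..
  qed
  interpret o: orthogonal_system N "{..2 * R}" "gs N w"
    by unfold_locales (auto intro!: gs_orth nz)
  have "bprod N (cnjv x) (cnjv (gs N w i)) = 0" for i
  proof -
    have "bprod N (gs N w i) x = 0" by (rule gs_bprod_zero) (use x in \<open>simp add: w_def N_def\<close>)
    then show ?thesis unfolding cnj_bprod[symmetric] by (simp add: bprod_commute)
  qed
  then have "cnjv x k = 0" using o.expansion[of k "cnjv x"] k by (simp add: N_def)
  then show ?thesis by (simp add: cnjv_def)
qed

text \<open>If the linear form vanished identically, the vector \<open>(1, -\<i>, 0, \<dots>, 0)\<close> would be orthogonal to all derivatives of the curve.\<close>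

lemma isotropic_curve_functional_nonzero:
  assumes S: "open S" and M: "M = Suc (2 * r)" and v: "vhol (Suc (Suc M)) S b"
    and iso: "isotropic_on (Suc (Suc M)) (Suc r) S b"
    and z: "z \<in> S" and top: "bprod (Suc (Suc M)) (dv b (Suc r) z) (dv b (Suc r) z) \<noteq> 0"
  shows "\<exists>z\<in>S. b z 0 - \<i> * b z 1 \<noteq> 0"
proof (rule ccontr)
  assume "\<not> ?thesis"
  then have l0: "b z 0 = \<i> * b z 1" if "z \<in> S" for z using that by auto
  define x where "x = (\<lambda>k::nat. if k = 0 then 1 else if k = 1 then - \<i> else 0)"
  have "dv b j z 0 = \<i> * dv b j z 1" for j
    by (rule dv_eqI[where Q = "\<lambda>j z i. \<i> * dv b j z 1", OF S _ _ z])
       (auto intro!: DERIV_cmult dv_deriv[OF S v] simp: l0 dv_0)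
  then have "bprod (Suc (Suc M)) (dv b j z) x = 0" for j
    unfolding bprod_Suc_Suc by (simp add: x_def bprod_def)
  moreover have e: "Suc (2 * Suc r) = Suc (Suc M)" by (simp add: M)
  ultimately have "x 0 = 0"
    using isotropic_curve_full[of S "Suc r" b z x 0, unfolded e, OF S v iso z top] by blast
  then show False by (simp add: x_def)
qed

lemma holomorphic_zeros_isolated:
  fixes h :: "complex \<Rightarrow> complex"
  assumes R: "R > 0" and h: "h holomorphic_on ball p R"
  shows "\<exists>s>0. (\<forall>z\<in>ball p s - {p}. h z = 0) \<or> (\<forall>z\<in>ball p s - {p}. h z \<noteq> 0)"
proof (cases "h p = 0")
  case False
  have "\<exists>e>0. \<forall>y. dist p y < e \<longrightarrow> h y \<noteq> 0"
    by (rule continuous_on_open_avoid[OF holomorphic_on_imp_continuous_on[OF h] open_ball _ False]) (use R in simp)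
  then show ?thesis by auto
next
  case True
  show ?thesis
  proof (cases "\<forall>z\<in>ball p R. h z = 0")
    case True then show ?thesis using R by (intro exI[of _ R]) auto
  next
    case False
    then obtain q where q: "q \<in> ball p R" "h q \<noteq> 0" by blast
    obtain s where "0 < s" "\<And>z. z \<in> ball p s - {p} \<Longrightarrow> h z \<noteq> 0"
      using isolated_zeros[OF h open_ball connected_ball _ True q] R by (metis centre_in_ball)
    then show ?thesis by blast
  qed
qed

section \<open>Orthogonal changes of coordinates\<close>

definition orthm :: "nat \<Rightarrow> (nat \<Rightarrow> nat \<Rightarrow> real) \<Rightarrow> bool" where
  "orthm M Q \<longleftrightarrow> (\<forall>i<M. \<forall>j<M. bprod M (\<lambda>k. Q k i) (\<lambda>k. Q k j) = of_bool (i = j)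
      \<and> bprod M (Q i) (Q j) = of_bool (i = j))"

text \<open>The transpose of \<open>Q\<close> applied to a complex vector.\<close>

definition rot :: "nat \<Rightarrow> (nat \<Rightarrow> nat \<Rightarrow> real) \<Rightarrow> (nat \<Rightarrow> complex) \<Rightarrow> nat \<Rightarrow> complex" where
  "rot M Q x k = bprod M (\<lambda>i. of_real (Q i k)) x"

lemma bprod_rot:
  assumes "orthm M Q" shows "bprod M (rot M Q x) (rot M Q y) = bprod M x y"
proof -
  have "(\<Sum>k<M. complex_of_real (Q i k) * of_real (Q j k)) = of_bool (i = j)" if "i < M" "j < M" for i j
  proof -
    have "(\<Sum>k<M. complex_of_real (Q i k) * of_real (Q j k)) = of_real (bprod M (Q i) (Q j))" by (simp add: bprod_def)
    then show ?thesis using assms that by (simp add: orthm_def)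
  qed
  from bprod_isometry[where a = "\<lambda>k i. complex_of_real (Q i k)", OF this, of M x y]
  show ?thesis unfolding rot_def[abs_def] bprod_def by simp
qed

lemma bprod_permute:
  fixes x y :: "nat \<Rightarrow> 'a::comm_semiring_1"
  assumes "\<pi> permutes {..<M}" shows "bprod M (\<lambda>k. x (\<pi> k)) (\<lambda>k. y (\<pi> k)) = bprod M x y"
  unfolding bprod_def using sum.permute[OF assms, of "\<lambda>k. x k * y k"] by (simp add: o_def)

lemma orthm_permute:
  assumes "orthm M Q" and p: "\<pi> permutes {..<M}" shows "orthm M (\<lambda>i. Q (inv \<pi> i))"
  unfolding orthm_def
proof (intro allI impI conjI)
  fix i j assume ij: "i < M" "j < M"
  show "bprod M (\<lambda>k. Q (inv \<pi> k) i) (\<lambda>k. Q (inv \<pi> k) j) = of_bool (i = j)"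
    using assms(1) ij bprod_permute[OF permutes_inv[OF p], of "\<lambda>k. Q k i" "\<lambda>k. Q k j"] by (simp add: orthm_def)
  have "inv \<pi> i < M" "inv \<pi> j < M" using permutes_in_image[OF permutes_inv[OF p]] ij by auto
  moreover have "inv \<pi> i = inv \<pi> j \<longleftrightarrow> i = j" using permutes_inj[OF permutes_inv[OF p]] by (auto dest: injD)
  ultimately show "bprod M (Q (inv \<pi> i)) (Q (inv \<pi> j)) = of_bool (i = j)" using assms(1) by (simp add: orthm_def)
qed

text \<open>Two fixed coordinates in front of a smaller matrix, matching the two coordinates that \<open>hat\<close> adds.\<close>

definition block :: "(nat \<Rightarrow> nat \<Rightarrow> real) \<Rightarrow> nat \<Rightarrow> nat \<Rightarrow> real" where
  "block Q i k = (if i < 2 \<or> k < 2 then of_bool (i = k) else Q (i - 2) (k - 2))"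

lemma block_simps:
  "block Q 0 k = of_bool (k = 0)" "block Q 1 k = of_bool (k = 1)"
  "block Q k 0 = of_bool (k = 0)" "block Q k 1 = of_bool (k = 1)" "block Q (k + 2) (l + 2) = Q k l"
  by (auto simp: block_def)

lemma orthm_block:
  assumes "orthm M Q" shows "orthm (Suc (Suc M)) (block Q)"
  unfolding orthm_def
proof (intro allI impI)
  fix i j assume ij: "i < Suc (Suc M)" "j < Suc (Suc M)"
  have z: "bprod M (\<lambda>k. 0) x = 0" "bprod M x (\<lambda>k. 0) = 0" for x :: "nat \<Rightarrow> real" by (simp_all add: bprod_def)
  have d: "l = 0 \<or> l = 1 \<or> (\<exists>l'<M. l = l' + 2)" if "l < Suc (Suc M)" for l
  proof -
    have "l = 0 \<or> l = 1 \<or> (l - 2 < M \<and> l = l - 2 + 2)" using that by arith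
    then show ?thesis by blast
  qed
  consider "i = 0" | "i = 1" | i' where "i' < M" "i = i' + 2" using d[OF ij(1)] by blast
  then show "bprod (Suc (Suc M)) (\<lambda>k. block Q k i) (\<lambda>k. block Q k j) = of_bool (i = j)
      \<and> bprod (Suc (Suc M)) (block Q i) (block Q j) = of_bool (i = j)"
  proof cases
    case 1
    then show ?thesis unfolding bprod_Suc_Suc by (simp add: block_simps(1-4)[simplified] z eq_commute[of 0 j])
  next
    case 2
    then show ?thesis unfolding bprod_Suc_Suc by (simp add: block_simps(1-4)[simplified] z eq_commute[of "Suc 0" j])
  next
    case i: 3
    consider "j = 0" | "j = 1" | j' where "j' < M" "j = j' + 2" using d[OF ij(2)] by blast
    then show ?thesis
    proof cases
      case 3
      then show ?thesis using assms i unfolding bprod_Suc_Suc i(2) 3(2) block_simps by (simp add: orthm_def)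
    qed (simp_all add: bprod_Suc_Suc block_simps(1-4)[simplified] z i)
  qed
qed

lemma rot_block:
  "rot (Suc (Suc M)) (block Q) x 0 = x 0" "rot (Suc (Suc M)) (block Q) x 1 = x 1"
  "rot (Suc (Suc M)) (block Q) x (k + 2) = rot M Q (\<lambda>i. x (i + 2)) k"
proof -
  have z: "bprod M (\<lambda>k. complex_of_real 0) y = 0" for y by (simp add: bprod_def)
  show "rot (Suc (Suc M)) (block Q) x 0 = x 0" "rot (Suc (Suc M)) (block Q) x 1 = x 1"
    "rot (Suc (Suc M)) (block Q) x (k + 2) = rot M Q (\<lambda>i. x (i + 2)) k"
    unfolding rot_def bprod_Suc_Suc block_simps(5) unfolding block_simps(1-4) using z by simp_all
qed

lemma rot_permute:
  assumes p: "\<pi> permutes {..<M}" shows "rot M (\<lambda>i. Q (inv \<pi> i)) x k = rot M Q (\<lambda>i. x (\<pi> i)) k"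
proof -
  have "bprod M (\<lambda>i. complex_of_real (Q (inv \<pi> (\<pi> i)) k)) (\<lambda>i. x (\<pi> i)) = bprod M (\<lambda>i. of_real (Q (inv \<pi> i) k)) x"
    by (rule bprod_permute[OF p, of "\<lambda>i. complex_of_real (Q (inv \<pi> i) k)" x])
  then show ?thesis by (simp add: rot_def permutes_inverses[OF p])
qed

lemma rot_holomorphic_deriv:
  assumes "\<And>i. i < M \<Longrightarrow> ((\<lambda>w. p w i) has_field_derivative c z i) (at z)"
  shows "((\<lambda>w. rot M Q (p w) k) has_field_derivative rot M Q (c z) k) (at z)"
  unfolding rot_def bprod_def by (intro DERIV_sum DERIV_cmult) (use assms in auto)

text \<open>If the form vanished for two coordinates in both orders, then \<open>x j = \<i> (\<i> x j) = - x j\<close>.\<close>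

lemma leading_coordinates:
  fixes x :: "nat \<Rightarrow> complex"
  assumes j: "j < M" "x j \<noteq> 0" and M: "2 \<le> M"
  obtains \<pi> where "\<pi> permutes {..<M}" "x (\<pi> 0) - \<i> * x (\<pi> 1) \<noteq> 0"
proof -
  define a where "a = (if j = 0 then 1 else 0 :: nat)"
  have a: "a < M" "a \<noteq> j" using M by (auto simp: a_def)
  have "\<exists>s t. s < M \<and> t < M \<and> s \<noteq> t \<and> x s - \<i> * x t \<noteq> 0"
  proof (rule ccontr)
    assume "\<not> ?thesis"
    then have "x j = \<i> * x a" "x a = \<i> * x j" using a j by auto
    then have "x j = \<i> * (\<i> * x j)" by simp
    also have "\<dots> = - x j" by (simp flip: mult.assoc)
    finally show False using j(2) by simp
  qed
  then obtain s t where st: "s < M" "t < M" "s \<noteq> t" "x s - \<i> * x t \<noteq> 0" by blast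
  define u where "u = Transposition.transpose 0 s t"
  have u: "u < M" "u \<noteq> 0" "Transposition.transpose 0 s u = t" using st by (auto simp: u_def Transposition.transpose_def)
  define \<pi> where "\<pi> = Transposition.transpose 0 s \<circ> Transposition.transpose 1 u"
  have "\<pi> permutes {..<M}" unfolding \<pi>_def
    by (rule permutes_compose; rule permutes_swap_id) (use M st u in simp_all)
  moreover have "\<pi> 0 = s" "\<pi> 1 = t" using u by (auto simp: \<pi>_def Transposition.transpose_def)
  ultimately show thesis using that st(4) by blast
qed

section \<open>Isotropic curves come from the construction\<close>

lemma generated_zero:
  assumes "vhol 1 S b" "\<And>z. z \<in> S - E \<Longrightarrow> b z 0 \<noteq> 0"
  shows "generated 0 E S b"
proof -
  have "recursive_data 0 E S (\<lambda>s z. b z 0) undefined" using assms by (simp add: recursive_data_def vhol_def)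
  moreover have "\<forall>z\<in>S. \<forall>k<Suc (2 * 0). b z k = b z 0 * frame undefined 0 0 z k" by simp
  ultimately show ?thesis unfolding generated_def by blast
qed

lemma top_nonzero_component:
  assumes S: "open S" "z \<in> S" and top: "bprod M (dv b r z) (dv b r z) \<noteq> 0"
  shows "\<exists>i<M. \<exists>z\<in>S. b z i \<noteq> 0"
proof (rule ccontr)
  assume no: "\<not> ?thesis"
  have "dv b r z i = 0" if i: "i < M" for i
    by (rule dv_eqI[where Q = "\<lambda>j z i. 0", OF S(1) _ _ S(2)]) (use no i in auto)
  then have "bprod M (dv b r z) (dv b r z) = 0" by (simp add: bprod_def)
  then show False using top by simp
qed

text \<open>Removes the common zero of the components at \<open>p\<close>, which the derivative of the stereographic coordinate may have at every level.\<close>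

lemma divide_curve:
  assumes R: "R > 0" and v: "vhol M (ball p R) b" and iso: "isotropic_on M r (ball p R) b"
    and top: "\<And>z. z \<in> ball p R - {p} \<Longrightarrow> bprod M (dv b r z) (dv b r z) \<noteq> 0"
  obtains \<rho> j B where "0 < \<rho>" "\<rho> \<le> R" "j < M" "\<And>z. z \<in> ball p \<rho> - {p} \<Longrightarrow> b z j \<noteq> 0" "vhol M (ball p \<rho>) B"
    "\<And>z i. i < M \<Longrightarrow> z \<in> ball p \<rho> \<Longrightarrow> b z i = b z j * B z i" "B p j = 1" "isotropic_on M r (ball p \<rho>) B"
    "\<And>z. z \<in> ball p \<rho> - {p} \<Longrightarrow> bprod M (dv B r z) (dv B r z) \<noteq> 0"
proof -
  have hol: "(\<lambda>z. b z i) holomorphic_on ball p R" if "i < M" for i using v that by (simp add: vhol_def)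
  have hol': "(\<lambda>z. b z i) holomorphic_on ball p R - {p}" if "i < M" for i
    by (rule holomorphic_on_subset[OF hol[OF that]]) auto
  have zero: "\<exists>s>0. (\<forall>z\<in>ball p s - {p}. b z i = 0) \<or> (\<forall>z\<in>ball p s - {p}. b z i \<noteq> 0)" if "i < M" for i
    by (rule holomorphic_zeros_isolated[OF R hol[OF that]])
  have diff: "\<exists>s>0. (\<forall>z\<in>ball p s - {p}. b z i = b z j) \<or> (\<forall>z\<in>ball p s - {p}. b z i \<noteq> b z j)"
    if "i < M" "j < M" for i j
    using holomorphic_zeros_isolated[OF R holomorphic_on_diff[OF hol[OF that(1)] hol[OF that(2)]]] unfolding right_minus_eq .
  have ne: "\<exists>i<M. \<exists>z\<in>ball p s - {p}. b z i \<noteq> 0" if s: "0 < s" "s \<le> R" for s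
  proof -
    define q where "q = p + of_real (s / 2)"
    have q: "q \<in> ball p s - {p}" using s by (simp add: q_def dist_norm)
    then have "q \<in> ball p R - {p}" using s by auto
    then show ?thesis by (intro top_nonzero_component[OF _ q top]) (simp_all add: open_delete)
  qed
  obtain \<rho> j B0 where r: "0 < \<rho>" "\<rho> \<le> R" and j: "j < M" "\<And>z. z \<in> ball p \<rho> - {p} \<Longrightarrow> b z j \<noteq> 0"
    and B0: "\<And>i. i < M \<Longrightarrow> B0 i holomorphic_on ball p \<rho>"
      "\<And>i z. i < M \<Longrightarrow> z \<in> ball p \<rho> - {p} \<Longrightarrow> B0 i z = b z i / b z j" "B0 j p = 1"
    by (rule divide_out[where a = "\<lambda>i z. b z i", OF R hol' zero diff ne]) auto
  define B where "B = (\<lambda>z i. B0 i z)"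
  have sub: "ball p \<rho> \<subseteq> ball p R" by (rule subset_ball[OF r(2)])
  have vB: "vhol M (ball p \<rho>) B" using B0(1) by (simp add: vhol_def B_def)
  have vb: "vhol M (ball p \<rho> - {p}) b" by (rule vhol_subset[OF v]) (use sub in blast)
  have ib: "isotropic_on M r (ball p \<rho> - {p}) b" using iso sub unfolding isotropic_on_def by blast
  have mu: "(\<lambda>z. inverse (b z j)) holomorphic_on ball p \<rho> - {p}"
    by (intro holomorphic_intros) (use vb j in \<open>auto simp: vhol_def\<close>)
  have Bm: "B z i = inverse (b z j) * b z i" if "z \<in> ball p \<rho> - {p}" "i < M" for z i
    using B0(2)[OF that(2,1)] by (simp add: B_def field_simps)
  have iB: "isotropic_on M r (ball p \<rho>) B" by (rule isotropic_divide(1)[OF r(1) vB vb ib mu Bm])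
  have tB: "bprod M (dv B r z) (dv B r z) = (inverse (b z j))\<^sup>2 * bprod M (dv b r z) (dv b r z)"
    if "z \<in> ball p \<rho> - {p}" for z by (rule isotropic_divide(2)[OF r(1) vB vb ib mu Bm that])
  show thesis
  proof (rule that[OF r j vB _ _ iB])
    show "B p j = 1" using B0(3) by (simp add: B_def)
    show "bprod M (dv B r z) (dv B r z) \<noteq> 0" if "z \<in> ball p \<rho> - {p}" for z
      using tB[OF that] top[of z] j(2)[OF that] that sub by auto
    fix z i assume i: "i < M" and z: "z \<in> ball p \<rho>"
    have "b z i - b z j * B z i = 0"
    proof (rule zero_at_centre[OF r(1) _ _ z])
      show "continuous_on (ball p \<rho>) (\<lambda>z. b z i - b z j * B z i)"
        by (intro continuous_intros vhol_continuous[OF vB i] continuous_on_subset[OF vhol_continuous[OF v] sub] i j(1))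
      show "b z i - b z j * B z i = 0" if "z \<in> ball p \<rho> - {p}" for z
        using Bm[OF that i] j(2)[OF that] by simp
    qed
    then show "b z i = b z j * B z i" by simp
  qed
qed

text \<open>A permutation of the coordinates makes the linear form nonzero at \<open>p\<close>; the rotation found for \<open>\<phi>'\<close> acts on the remaining coordinates and leaves the form unchanged.\<close>

lemma generated_at_point:
  "R > 0 \<Longrightarrow> vhol (Suc (2 * r)) (ball p R) b \<Longrightarrow> isotropic_on (Suc (2 * r)) r (ball p R) b \<Longrightarrow>
    (\<And>z. z \<in> ball p R - {p} \<Longrightarrow> bprod (Suc (2 * r)) (dv b r z) (dv b r z) \<noteq> 0) \<Longrightarrow>
    \<exists>\<rho> Q. 0 < \<rho> \<and> \<rho> \<le> R \<and> orthm (Suc (2 * r)) Q \<and> generated r {p} (ball p \<rho>) (\<lambda>z. rot (Suc (2 * r)) Q (b z))"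
proof (induction r arbitrary: b R)
  case 0
  have "orthm 1 (\<lambda>i k. 1)" by (simp add: orthm_def bprod_def)
  moreover have e: "rot (Suc 0) (\<lambda>i k. 1) (b z) k = b z 0" for z k by (simp add: rot_def bprod_def)
  have "generated 0 {p} (ball p R) (\<lambda>z. rot 1 (\<lambda>i k. 1) (b z))"
  proof (rule generated_zero)
    show "vhol 1 (ball p R) (\<lambda>z. rot 1 (\<lambda>i k. 1) (b z))" using 0(2) by (simp add: vhol_def e)
    show "rot 1 (\<lambda>i k. 1) (b z) 0 \<noteq> 0" if "z \<in> ball p R - {p}" for z
      using 0(4)[OF that] by (simp add: e bprod_def dv_0)
  qed
  ultimately show ?case using 0(1) by (auto intro!: exI[of _ R])
next
  case (Suc r)
  define M where "M = Suc (2 * r)"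
  have e: "Suc (2 * Suc r) = Suc (Suc M)" by (simp add: M_def)
  note prems = Suc.prems[unfolded e]
  obtain r1 j B where r1: "0 < r1" "r1 \<le> R" and j: "j < Suc (Suc M)" "\<And>z. z \<in> ball p r1 - {p} \<Longrightarrow> b z j \<noteq> 0"
    and vB: "vhol (Suc (Suc M)) (ball p r1) B"
    and bB: "\<And>z i. i < Suc (Suc M) \<Longrightarrow> z \<in> ball p r1 \<Longrightarrow> b z i = b z j * B z i" and Bp: "B p j = 1"
    and iB: "isotropic_on (Suc (Suc M)) (Suc r) (ball p r1) B"
    and tB: "\<And>z. z \<in> ball p r1 - {p} \<Longrightarrow> bprod (Suc (Suc M)) (dv B (Suc r) z) (dv B (Suc r) z) \<noteq> 0"
    using divide_curve[OF prems] by blast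
  obtain \<pi> where pi: "\<pi> permutes {..<Suc (Suc M)}" and lp: "B p (\<pi> 0) - \<i> * B p (\<pi> 1) \<noteq> 0"
    by (rule leading_coordinates[of j "Suc (Suc M)" "B p"]) (use j(1) Bp in auto)
  have pil: "\<pi> k < Suc (Suc M)" if "k < Suc (Suc M)" for k using permutes_in_image[OF pi, of k] that by simp
  define C where "C = (\<lambda>z k. B z (\<pi> k))"
  define l where "l = (\<lambda>z. C z 0 - \<i> * C z 1)"
  define q where "q = (\<lambda>z k. C z (k + 2) / l z)"
  have dC: "dv C i z = (\<lambda>k. dv B i z (\<pi> k))" for i z by (simp add: dv_def C_def fun_eq_iff)
  have vC1: "vhol (Suc (Suc M)) (ball p r1) C" using vB pil by (simp add: vhol_def C_def)
  have "continuous_on (ball p r1) l"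
    unfolding l_def by (intro continuous_intros vhol_continuous[OF vC1]) auto
  then have "\<exists>e>0. \<forall>y. dist p y < e \<longrightarrow> l y \<noteq> 0"
    by (rule continuous_on_open_avoid[OF _ open_ball]) (use r1(1) lp in \<open>auto simp: l_def C_def\<close>)
  then obtain e where e: "e > 0" "\<And>y. dist p y < e \<Longrightarrow> l y \<noteq> 0" by blast
  define r2 where "r2 = min e r1"
  have r2: "0 < r2" "r2 \<le> r1" using e(1) r1(1) by (auto simp: r2_def)
  have sub: "ball p r2 \<subseteq> ball p r1" by (rule subset_ball[OF r2(2)])
  have l0: "l z \<noteq> 0" if "z \<in> ball p r2" for z using e(2)[of z] that by (simp add: r2_def)
  have vC: "vhol (Suc (Suc M)) (ball p r2) C" by (rule vhol_subset[OF vC1 sub])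
  have iC: "isotropic_on (Suc (Suc M)) (Suc r) (ball p r2) C"
    using iB sub unfolding isotropic_on_def dC bprod_permute[OF pi] by blast
  have st: "l holomorphic_on ball p r2" "vhol M (ball p r2) q" "isotropic_on M r (ball p r2) (dv q 1)"
    by (rule stereographic_derivative(1-3)[OF open_ball vC iC l_def l0 q_def]; assumption)+
  have st4: "bprod M (dv (dv q 1) r z) (dv (dv q 1) r z)
      = bprod (Suc (Suc M)) (dv C (Suc r) z) (dv C (Suc r) z) / (l z)\<^sup>2" if "z \<in> ball p r2" for z
    by (rule stereographic_derivative(4)[OF open_ball vC iC l_def l0 q_def that])
  have tq: "bprod M (dv (dv q 1) r z) (dv (dv q 1) r z) \<noteq> 0" if z: "z \<in> ball p r2 - {p}" for z
  proof -
    have "z \<in> ball p r2" "z \<in> ball p r1 - {p}" using z sub by auto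
    then show ?thesis using st4[of z] tB[of z] l0[of z] unfolding dC bprod_permute[OF pi] by simp
  qed
  obtain \<rho> Q where \<rho>: "0 < \<rho>" "\<rho> \<le> r2" and Q: "orthm M Q"
    and gen: "generated r {p} (ball p \<rho>) (\<lambda>z. rot M Q (dv q 1 z))"
    using Suc.IH[folded M_def, OF r2(1) vhol_dv[OF open_ball st(2)] st(3) tq] by blast
  define Q' where "Q' = (\<lambda>i. block Q (inv \<pi> i))"
  have Q': "orthm (Suc (Suc M)) Q'" unfolding Q'_def by (rule orthm_permute[OF orthm_block[OF Q] pi])
  have rO: "rot (Suc (Suc M)) Q' (B z) = rot (Suc (Suc M)) (block Q) (C z)" for z
    unfolding Q'_def C_def by (rule ext) (rule rot_permute[OF pi])
  have sub2: "ball p \<rho> \<subseteq> ball p r2" by (rule subset_ball[OF \<rho>(2)])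
  define D where "D = (\<lambda>z. rot (Suc (Suc M)) Q' (B z))"
  have D: "D z 0 = C z 0" "D z 1 = C z 1" "D z (k + 2) = rot M Q (\<lambda>i. C z (i + 2)) k" for z k
    unfolding D_def rO by (rule rot_block)+
  have "generated (Suc r) {p} (ball p \<rho>) D"
  proof (rule generated_step[OF _ _ _ _ refl _ gen, where l = l, folded M_def])
    show "l holomorphic_on ball p \<rho>" by (rule holomorphic_on_subset[OF st(1) sub2])
    fix z assume z: "z \<in> ball p \<rho>"
    show "l z = D z 0 - \<i> * D z 1" unfolding D l_def ..
    show "l z \<noteq> 0" using l0 z sub2 by blast
    show "bprod (Suc (Suc M)) (D z) (D z) = 0"
      unfolding D_def bprod_rot[OF Q'] by (rule isotropic_self[OF iB]) (use z sub sub2 in blast)+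
    fix k
    have "D w (k + 2) / l w = rot M Q (q w) k" for w
      unfolding D q_def rot_def bprod_def by (simp add: sum_divide_distrib)
    moreover have "((\<lambda>w. rot M Q (q w) k) has_field_derivative rot M Q (dv q 1 z) k) (at z)"
    proof (rule rot_holomorphic_deriv)
      fix i assume "i < M"
      from dv_deriv[OF open_ball st(2) _ this, of z 0] z sub2
      show "((\<lambda>w. q w i) has_field_derivative dv q 1 z i) (at z)" by (auto simp: dv_0)
    qed
    ultimately show "((\<lambda>w. D w (k + 2) / l w) has_field_derivative rot M Q (dv q 1 z) k) (at z)" by simp
  qed
  then have "generated (Suc r) {p} (ball p \<rho>) (\<lambda>z. rot (Suc (Suc M)) Q' (b z))"
  proof (rule generated_scale[where \<mu> = "\<lambda>z. b z j"])
    have s: "ball p \<rho> \<subseteq> ball p r1" using sub sub2 by blast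
    then have "ball p \<rho> \<subseteq> ball p R" using subset_ball[OF r1(2), of p] by blast
    then show "(\<lambda>z. b z j) holomorphic_on ball p \<rho>"
      using prems(2) j(1) holomorphic_on_subset unfolding vhol_def by blast
    show "b z j \<noteq> 0" if "z \<in> ball p \<rho> - {p}" for z using j(2) that s by blast
    fix z k assume z: "z \<in> ball p \<rho>"
    have "rot (Suc (Suc M)) Q' (b z) k = bprod (Suc (Suc M)) (\<lambda>i. of_real (Q' i k)) (\<lambda>i. b z j * B z i)"
      unfolding rot_def by (rule bprod_cong[OF refl bB]) (use z s in auto)
    then show "rot (Suc (Suc M)) Q' (b z) k = b z j * D z k" unfolding bprod_scale_right D_def rot_def .
  qed
  moreover have "\<rho> \<le> R" using \<rho>(2) r2(2) r1(2) by linarith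
  ultimately have "0 < \<rho> \<and> \<rho> \<le> R \<and> orthm (Suc (Suc M)) Q' \<and> generated (Suc r) {p} (ball p \<rho>) (\<lambda>z. rot (Suc (Suc M)) Q' (b z))"
    using \<rho>(1) Q' by blast
  moreover have "Suc (Suc M) = Suc (2 * Suc r)" by (simp add: M_def)
  ultimately show ?case by metis
qed

lemma eventually_at_ball:
  "0 < R \<Longrightarrow> (\<And>q. q \<in> ball p R - {p} \<Longrightarrow> P q) \<Longrightarrow> eventually P (at (p::complex))"
  unfolding eventually_at by (intro exI[of _ R]) (auto simp: dist_commute)

text \<open>No rotation is available here, so points with a vanishing linear form are discarded at each level.  The induction runs on \<open>l\<^sup>2 \<phi>'\<close>, which is holomorphic also where \<open>\<phi>\<close> has a pole.\<close>

lemma generated_near: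
  "R > 0 \<Longrightarrow> vhol (Suc (2 * r)) (ball p R) b \<Longrightarrow> isotropic_on (Suc (2 * r)) r (ball p R) b \<Longrightarrow>
    (\<And>z. z \<in> ball p R - {p} \<Longrightarrow> bprod (Suc (2 * r)) (dv b r z) (dv b r z) \<noteq> 0) \<Longrightarrow>
    \<forall>\<^sub>F q in at p. \<exists>\<rho>>0. ball q \<rho> \<subseteq> ball p R \<and> generated r {} (ball q \<rho>) b"
proof (induction r arbitrary: b R)
  case 0
  show ?case
  proof (rule eventually_at_ball[OF 0(1)])
    fix q assume "q \<in> ball p R - {p}"
    moreover have "open (ball p R - {p})" by (simp add: open_delete)
    ultimately obtain \<rho> where \<rho>: "\<rho> > 0" "ball q \<rho> \<subseteq> ball p R - {p}" using open_contains_ball by metis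
    have "generated 0 {} (ball q \<rho>) b"
    proof (rule generated_zero)
      show "vhol 1 (ball q \<rho>) b" by (rule vhol_subset[of _ "ball p R"]) (use 0(2) \<rho>(2) in auto)
      show "b z 0 \<noteq> 0" if "z \<in> ball q \<rho> - {}" for z
      proof -
        have "z \<in> ball p R - {p}" using that \<rho>(2) by blast
        from 0(4)[OF this] show ?thesis by (simp add: bprod_def dv_0)
      qed
    qed
    then show "\<exists>\<rho>>0. ball q \<rho> \<subseteq> ball p R \<and> generated 0 {} (ball q \<rho>) b" using \<rho> by blast
  qed
next
  case (Suc r)
  define M where "M = Suc (2 * r)"
  have e: "Suc (2 * Suc r) = Suc (Suc M)" by (simp add: M_def)
  note prems = Suc.prems[unfolded e]
  define l where "l = (\<lambda>z. b z 0 - \<i> * b z 1)"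
  define c where "c = (\<lambda>z k. b z (k + 2) / l z)"
  have hb: "(\<lambda>z. b z i) holomorphic_on ball p R" if "i < Suc (Suc M)" for i using prems(2) that by (simp add: vhol_def)
  have hl: "l holomorphic_on ball p R" unfolding l_def by (intro holomorphic_intros hb) auto
  obtain s where s: "s > 0" "(\<forall>z\<in>ball p s - {p}. l z = 0) \<or> (\<forall>z\<in>ball p s - {p}. l z \<noteq> 0)"
    using holomorphic_zeros_isolated[OF prems(1) hl] by blast
  define R1 where "R1 = min s R"
  have R1: "R1 > 0" "R1 \<le> s" "R1 \<le> R" using s(1) prems(1) by (auto simp: R1_def)
  define S where "S = ball p R1 - {p}"
  have S: "open S" by (simp add: S_def open_delete)
  have SR: "S \<subseteq> ball p R - {p}" and Ss: "S \<subseteq> ball p s - {p}"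
    using subset_ball[OF R1(3), of p] subset_ball[OF R1(2), of p] by (auto simp: S_def)
  have sub: "ball p R1 \<subseteq> ball p R" by (rule subset_ball[OF R1(3)])
  have vb: "vhol (Suc (Suc M)) S b" by (rule vhol_subset[OF prems(2)]) (use SR in blast)
  have ib: "isotropic_on (Suc (Suc M)) (Suc r) S b" using prems(3) SR unfolding isotropic_on_def by blast
  define q0 where "q0 = p + of_real (R1 / 2)"
  have q0: "q0 \<in> S" using R1(1) by (simp add: q0_def S_def dist_norm)
  have "q0 \<in> ball p R - {p}" using q0 SR by blast
  then have "\<exists>z\<in>S. b z 0 - \<i> * b z 1 \<noteq> 0"
    by (rule isotropic_curve_functional_nonzero[OF S M_def vb ib q0 prems(4)])
  then have l0: "l z \<noteq> 0" if "z \<in> S" for z using s(2) Ss that unfolding l_def by blast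
  have st: "l holomorphic_on S" "vhol M S c" "isotropic_on M r S (dv c 1)"
    by (rule stereographic_derivative(1-3)[OF S vb ib l_def l0 c_def]; assumption)+
  have st4: "bprod M (dv (dv c 1) r z) (dv (dv c 1) r z)
      = bprod (Suc (Suc M)) (dv b (Suc r) z) (dv b (Suc r) z) / (l z)\<^sup>2" if "z \<in> S" for z
    by (rule stereographic_derivative(4)[OF S vb ib l_def l0 c_def that])
  have l1: "(l has_field_derivative deriv l z) (at z)" if "z \<in> ball p R" for z
    by (rule holomorphic_derivI[OF hl open_ball that])
  define C where "C = (\<lambda>z k. dv b 1 z (k + 2) * l z - b z (k + 2) * deriv l z)"
  have Cc: "C z k = (l z)\<^sup>2 * dv c 1 z k" if z: "z \<in> S" and k: "k < M" for z k
  proof -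
    have zR: "z \<in> ball p R" using z SR by blast
    have k2: "k + 2 < Suc (Suc M)" using k by simp
    have d1: "((\<lambda>z. b z (k + 2)) has_field_derivative dv b 1 z (k + 2)) (at z)"
      using dv_deriv[OF open_ball prems(2) zR k2, of 0] by (simp add: dv_0)
    have "((\<lambda>z. c z k) has_field_derivative C z k / (l z * l z)) (at z)"
      unfolding c_def C_def by (rule DERIV_divide[OF d1 l1[OF zR] l0[OF z]])
    moreover have "((\<lambda>z. c z k) has_field_derivative dv c 1 z k) (at z)"
      using dv_deriv[OF S st(2) z k, of 0] by (simp add: dv_0)
    ultimately have "C z k / (l z * l z) = dv c 1 z k" by (rule DERIV_unique)
    then show ?thesis using l0[OF z] by (simp add: field_simps power2_eq_square)
  qed
  have vC: "vhol M (ball p R1) C"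
    unfolding vhol_def C_def
  proof (intro allI impI)
    fix k assume k: "k < M"
    have "(\<lambda>z. dv b 1 z (k + 2)) holomorphic_on ball p R" using vhol_dv[OF open_ball prems(2), of 1] k by (simp add: vhol_def)
    moreover have "(\<lambda>z. b z (k + 2)) holomorphic_on ball p R" by (rule hb) (use k in simp)
    ultimately have "(\<lambda>z. dv b 1 z (k + 2) * l z - b z (k + 2) * deriv l z) holomorphic_on ball p R"
      by (intro holomorphic_on_diff holomorphic_on_mult hl holomorphic_deriv open_ball)
    then show "(\<lambda>z. dv b 1 z (k + 2) * l z - b z (k + 2) * deriv l z) holomorphic_on ball p R1"
      by (rule holomorphic_on_subset[OF _ sub])
  qed
  have hm: "(\<lambda>z. (l z)\<^sup>2) holomorphic_on S" by (intro holomorphic_intros st(1))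
  note dvd = isotropic_divide[OF R1(1) vC, folded S_def, OF vhol_dv[OF S st(2)] st(3) hm Cc]
  have iC: "isotropic_on M r (ball p R1) C" by (rule dvd(1))
  have tC': "bprod M (dv C r z) (dv C r z) = ((l z)\<^sup>2)\<^sup>2 * bprod M (dv (dv c 1) r z) (dv (dv c 1) r z)" if "z \<in> S" for z
    by (rule dvd(2)) (use that in auto)
  have tC: "bprod M (dv C r z) (dv C r z) \<noteq> 0" if z: "z \<in> ball p R1 - {p}" for z
  proof -
    have zS: "z \<in> S" "z \<in> ball p R - {p}" using z SR by (auto simp: S_def)
    show ?thesis using tC'[OF zS(1)] st4[OF zS(1)] l0[OF zS(1)] prems(4)[OF zS(2)] by simp
  qed
  have "\<forall>\<^sub>F q in at p. q \<in> S" by (rule eventually_at_ball[OF R1(1)]) (simp add: S_def)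
  moreover have "\<forall>\<^sub>F q in at p. \<exists>\<rho>>0. ball q \<rho> \<subseteq> ball p R1 \<and> generated r {} (ball q \<rho>) C"
    by (rule Suc.IH[folded M_def, OF R1(1) vC iC tC])
  ultimately show ?case
  proof eventually_elim
    case (elim q)
    then obtain \<rho>1 where \<rho>1: "\<rho>1 > 0" "generated r {} (ball q \<rho>1) C" by blast
    obtain \<rho>2 where \<rho>2: "\<rho>2 > 0" "ball q \<rho>2 \<subseteq> S" using elim(1) S open_contains_ball by metis
    define \<rho> where "\<rho> = min \<rho>1 \<rho>2"
    have \<rho>: "\<rho> > 0" "ball q \<rho> \<subseteq> ball q \<rho>1" "ball q \<rho> \<subseteq> S"
      using \<rho>1(1) \<rho>2 subset_ball[of \<rho> \<rho>2 q] subset_ball[of \<rho> \<rho>1 q] by (auto simp: \<rho>_def)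
    have gC: "generated r {} (ball q \<rho>) C" by (rule generated_subset[OF \<rho>1(2) \<rho>(2)])
    have gc: "generated r {} (ball q \<rho>) (dv c 1)"
    proof (rule generated_scale[OF gC, where \<mu> = "\<lambda>z. inverse ((l z)\<^sup>2)"])
      show "(\<lambda>z. inverse ((l z)\<^sup>2)) holomorphic_on ball q \<rho>"
        by (intro holomorphic_intros holomorphic_on_subset[OF st(1) \<rho>(3)]) (use l0 \<rho>(3) in auto)
      show "inverse ((l z)\<^sup>2) \<noteq> 0" if "z \<in> ball q \<rho> - {}" for z using l0 \<rho>(3) that by auto
      fix z k assume z: "z \<in> ball q \<rho>" and k: "k < Suc (2 * r)"
      have "z \<in> S" using z \<rho>(3) by blast
      from Cc[OF this k[folded M_def]] l0[OF this]
      show "dv c 1 z k = inverse ((l z)\<^sup>2) * C z k" by simp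
    qed
    have "generated (Suc r) {} (ball q \<rho>) b"
    proof (rule generated_step[OF _ _ _ _ c_def _ gc, folded M_def])
      show "l holomorphic_on ball q \<rho>" by (rule holomorphic_on_subset[OF st(1) \<rho>(3)])
      fix z assume "z \<in> ball q \<rho>"
      then have z: "z \<in> S" using \<rho>(3) by blast
      show "l z = b z 0 - \<i> * b z 1" by (simp add: l_def)
      show "l z \<noteq> 0" by (rule l0[OF z])
      show "bprod (Suc (Suc M)) (b z) (b z) = 0" by (rule isotropic_self[OF ib _ z]) simp
      fix k assume "k < M"
      from dv_deriv[OF S st(2) z this, of 0]
      show "((\<lambda>w. c w k) has_field_derivative dv c 1 z k) (at z)" by (simp add: dv_0)
    qed
    moreover have "ball q \<rho> \<subseteq> ball p R" using \<rho>(3) SR by blast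
    ultimately show ?case using \<rho>(1) by blast
  qed
qed

section \<open>Pseudoholomorphic surfaces give harmonic sequences\<close>

text \<open>The tangential part of the Laplacian vanishes because \<open>\<langle>\<partial>f, \<partial>f\<rangle> = 0\<close>, the normal part by minimality, so the Laplacian is radial; its length comes from differentiating \<open>\<langle>\<partial>f, f\<rangle> = 0\<close>.\<close>

lemma pseudoholomorphic_harmonic:
  assumes ph: "pseudoholomorphic n V f" and N: "N = 2 * n + 1"
  shows "harmonic_sequence N V f" and "z \<in> V \<Longrightarrow> nsq N (vdz (complexify f) z) \<noteq> 0"
proof -
  have gp: "open V" "\<And>k. k < N \<Longrightarrow> smooth_on V (\<lambda>z. f z k)" "\<And>z. z \<in> V \<Longrightarrow> bprod N (f z) (f z) = 1"
    "isothermal_on N V f" "metric_singular N V f = {}"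
    "\<And>z k. z \<in> V \<Longrightarrow> k < N \<Longrightarrow> mean_curvature_vector N f z k = 0"
    "\<And>z j l. z \<in> V \<Longrightarrow> j + l > 0 \<Longrightarrow>
      bprod N ((vdz ^^ j) (complexify f) z) ((vdz ^^ l) (complexify f) z) = 0"
    using ph unfolding pseudoholomorphic_def generalized_pseudoholomorphic_def Let_def N[symmetric] by auto
  have df: "(\<lambda>z. f z k) differentiable (at z)" if "z \<in> V" "k < N" for z k
    by (rule smooth_onD[OF gp(2)[OF that(2)] gp(1) that(1)])
  have reg: "nsq N (vdz (complexify f) z) \<noteq> 0" if "z \<in> V" for z
    using gp(5) metric_singular_eq[OF gp(4) df] that by auto
  define X where "X = vdz (complexify f)"
  have sf: "vsmooth V N (complexify f)" by (rule complexify_vsmooth[OF gp(1,2)])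
  have sX: "vsmooth V N X" unfolding X_def by (rule vsmooth_vdz[OF gp(1) sf])
  have XX: "bprod N (X z) (X z) = 0" if "z \<in> V" for z using gp(7)[OF that, of 1 1] by (simp add: X_def)
  have Xf: "bprod N (X z) (complexify f z) = 0" if "z \<in> V" for z using gp(7)[OF that, of 1 0] by (simp add: X_def)
  have harm: "vdzb X z k = - of_real (nsq N (X z)) * complexify f z k" if z: "z \<in> V" and k: "k < N" for z k
  proof -
    define L where "L = (\<lambda>k. vdx (vdx f) z k + vdy (vdy f) z k)"
    have vL: "vdzb X z k = of_real (L k) / 4" if "k < N" for k
      unfolding X_def L_def by (rule laplace_complexify[where f = f and k = k, OF gp(1) gp(2)[OF that] z])
    have "bprod N (vdzb X z) (X z) = - bprod N (X z) (vdzb X z)"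
      by (rule vdzb_const_bprod[OF gp(1) sX sX z XX])
    then have 1: "bprod N (vdzb X z) (X z) = 0" by (simp add: bprod_commute[of N "X z"])
    have "bprod N (vdzb X z) (complexify f z) = - bprod N (X z) (vdzb (complexify f) z)"
      by (rule vdzb_const_bprod[OF gp(1) sX sf z Xf])
    also have "bprod N (X z) (vdzb (complexify f) z) = bprod N (X z) (cnjv (X z))"
      by (rule bprod_cong[OF refl])
         (use vdzb_complexify[where f = f and k = k for k] df[OF z] in \<open>auto simp: X_def cnjv_def\<close>)
    finally have 2: "bprod N (vdzb X z) (complexify f z) = - of_real (nsq N (X z))" by (simp add: bprod_cnjv_self)
    have Xk: "X z k = (of_real (vdx f z k) - \<i> * of_real (vdy f z k)) / 2" if "k < N" for k
      unfolding X_def by (rule vdz_complexify[where f = f and k = k, OF df[OF z that]])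
    have "bprod N (vdzb X z) (X z) = (\<Sum>k<N. (of_real (L k * vdx f z k) - \<i> * of_real (L k * vdy f z k)) / 8)"
      unfolding bprod_def by (intro sum.cong) (auto simp: vL Xk right_diff_distrib)
    also have "\<dots> = (of_real (bprod N L (vdx f z)) - \<i> * of_real (bprod N L (vdy f z))) / 8"
      by (simp add: bprod_def sum_subtractf sum_divide_distrib[symmetric] sum_distrib_left)
    finally have Lx: "bprod N L (vdx f z) = 0" and Ly: "bprod N L (vdy f z) = 0"
      using 1 by (auto simp: complex_eq_iff)
    have E: "bprod N (vdx f z) (vdx f z) \<noteq> 0"
      using reg[OF z] nsq_vdz_complexify[of N f z, OF df[OF z]] gp(4) z by (auto simp: isothermal_on_def)
    have add: "bprod N (vdx (vdx f) z) y + bprod N (vdy (vdy f) z) y = bprod N L y" for y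
      by (simp add: bprod_def L_def algebra_simps sum.distrib)
    have "normal_part N f z (vdx (vdx f) z) k + normal_part N f z (vdy (vdy f) z) k = 0"
      using gp(6)[OF z k] E by (simp add: mean_curvature_vector_def)
    moreover have "normal_part N f z (vdx (vdx f) z) k + normal_part N f z (vdy (vdy f) z) k
      = L k - (bprod N (vdx (vdx f) z) (f z) + bprod N (vdy (vdy f) z) (f z)) * f z k
        - (bprod N (vdx (vdx f) z) (vdx f z) + bprod N (vdy (vdy f) z) (vdx f z)) / bprod N (vdx f z) (vdx f z) * vdx f z k
        - (bprod N (vdx (vdx f) z) (vdy f z) + bprod N (vdy (vdy f) z) (vdy f z)) / bprod N (vdy f z) (vdy f z) * vdy f z k"
      unfolding normal_part_def L_def add_divide_distrib distrib_right by linarith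
    ultimately have Lf: "L k = bprod N L (f z) * f z k" unfolding add by (simp add: Lx Ly)
    have "bprod N (vdzb X z) (complexify f z) = (\<Sum>k<N. of_real (L k * f z k) / 4)"
      unfolding bprod_def by (intro sum.cong) (auto simp: vL complexify_def)
    also have "\<dots> = of_real (bprod N L (f z)) / 4" by (simp add: bprod_def sum_divide_distrib)
    finally have "of_real (bprod N L (f z)) / 4 = - complex_of_real (nsq N (X z))" using 2 by simp
    then show ?thesis unfolding vL[OF k] Lf complexify_def by simp
  qed
  show "harmonic_sequence N V f"
  proof
    show "vdzb (vdz (complexify f)) z k = - of_real (nsq N (vdz (complexify f) z)) * complexify f z k"
      if "z \<in> V" "k < N" for z k using harm[OF that] unfolding X_def .
  qed (fact gp(1), fact gp(2), fact gp(3), fact gp(7))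
  show "z \<in> V \<Longrightarrow> nsq N (vdz (complexify f) z) \<noteq> 0" by (rule reg)
qed

lemma pseudoholomorphic_reduced:
  assumes ph: "pseudoholomorphic n V f" and N: "N = 2 * n + 1"
    and S: "open S" "S \<subseteq> V" "connected S" "S \<noteq> {}"
  obtains m A where "1 \<le> m" "m \<le> n" "reduced N S f m (2 * m + 1) A"
proof -
  interpret h: harmonic_sequence N V f by (rule pseudoholomorphic_harmonic(1)[OF ph N])
  interpret regular_harmonic_sequence N S f
  proof
    show "smooth_on S (\<lambda>z. f z k)" if "k < N" for k by (rule smooth_on_subset[OF h.smooth_f[OF that] S(2)])
    show "open S" "connected S" "S \<noteq> {}" by (fact S)+
    fix z assume "z \<in> S"
    then have z: "z \<in> V" using S(2) by blast
    show "bprod N (f z) (f z) = 1" by (rule h.unit_f[OF z])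
    show "bprod N ((vdz ^^ j) (complexify f) z) ((vdz ^^ l) (complexify f) z) = 0" if "j + l > 0" for j l
      by (rule h.iso_f[OF z that])
    show "vdzb (vdz (complexify f)) z k = - of_real (nsq N (vdz (complexify f) z)) * complexify f z k" if "k < N" for k
      by (rule h.harmonic_f[OF z that])
    show "nsq N (vdz (complexify f) z) \<noteq> 0" by (rule pseudoholomorphic_harmonic(2)[OF ph N z])
  qed
  obtain m where m: "1 \<le> m" "2 * m + 1 \<le> N" "(S - Om m) sparse_in S" "\<And>z. z \<in> Om m \<Longrightarrow> rho (Suc m) z = 0"
    using order_exists by blast
  interpret full_order N S f m
  proof
    show "1 \<le> m" "(S - Om m) sparse_in S" by (fact m)+
    show "rho (Suc m) z = 0" if "z \<in> Om m" for z by (rule m(4)[OF that])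
  qed
  obtain A where A: "linear_isometry (2 * m + 1) N A"
    "\<And>z k l. z \<in> Om m \<Longrightarrow> k < N \<Longrightarrow> l < N \<Longrightarrow> (\<Sum>i<2 * m + 1. complex_of_real (A k i) * of_real (A l i)) = pr z k l"
    using isometry_exists by blast
  have "reduced N S f m (2 * m + 1) A"
  proof
    show "linear_isometry (2 * m + 1) N A" by (fact A(1))
    show "(\<Sum>i<2 * m + 1. complex_of_real (A k i) * of_real (A l i)) = pr z k l"
      if "z \<in> Om m" "k < N" "l < N" for z k l by (rule A(2)[OF that])
  qed simp
  then show thesis using that[of m A] m N by simp
qed

lemma dv_linear:
  assumes S: "open S" "vhol M S b" and z: "z \<in> S"
  shows "dv (\<lambda>z k. \<Sum>i<M. c k i * b z i) j z k = (\<Sum>i<M. c k i * dv b j z i)"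
proof (rule dv_eqI[where Q = "\<lambda>j z k. \<Sum>i<M. c k i * dv b j z i", OF S(1) _ _ z])
  fix j z assume z: "z \<in> S"
  show "((\<lambda>z. \<Sum>i<M. c k i * dv b j z i) has_field_derivative (\<Sum>i<M. c k i * dv b (Suc j) z i)) (at z)"
  proof (rule DERIV_sum)
    fix i assume "i \<in> {..<M}"
    then have "i < M" by simp
    then show "((\<lambda>z. c k i * dv b j z i) has_field_derivative c k i * dv b (Suc j) z i) (at z)"
      by (intro DERIV_cmult dv_deriv[OF S z])
  qed
qed (simp add: dv_0)

text \<open>Successive frame vectors are derivatives of the first one divided by the \<open>\<beta>\<close>'s, so orthogonality to the derivatives of the curve passes to the frame.\<close>

lemma (in construction) frame_perp:
  assumes T: "open T" "T \<subseteq> U" "z \<in> T" and nz: "\<And>w s. w \<in> T \<Longrightarrow> s < n \<Longrightarrow> \<beta> s w \<noteq> 0"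
    and \<kappa>: "\<kappa> holomorphic_on T" "\<And>w. w \<in> T \<Longrightarrow> \<kappa> w \<noteq> 0"
    and b: "\<And>w k. w \<in> T \<Longrightarrow> k < N \<Longrightarrow> b w k = \<kappa> w * frame \<phi> n 0 w k"
    and perp: "\<And>j. j < n \<Longrightarrow> bprod N (dv b j z) x = 0" and i: "i < n"
  shows "bprod N (frame \<phi> n i z) x = 0"
proof -
  have vf: "vhol N T (frame \<phi> n i)" if "i \<le> n" for i
    unfolding vhol_def using frame_holomorphic[of n i] that holomorphic_on_subset[OF _ T(2)] by (simp add: N_eq)
  have "i < n \<Longrightarrow> j + i < n \<Longrightarrow> bprod N (dv (frame \<phi> n i) j z) x = 0" for j
  proof (induction i arbitrary: j)
    case 0
    have hk: "(\<lambda>w. inverse (\<kappa> w)) holomorphic_on T" by (rule holomorphic_on_inverse[OF \<kappa>])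
    have h: "(\<lambda>w. \<kappa> w * frame \<phi> n 0 w k) holomorphic_on T" if "k < N" for k
      using vf[of 0] \<kappa>(1) that by (intro holomorphic_on_mult) (auto simp: vhol_def)
    have "(\<lambda>w. b w k) holomorphic_on T" if "k < N" for k
      by (rule holomorphic_transform[OF h[OF that]]) (simp add: b that)
    then have vb: "vhol N T b" by (simp add: vhol_def)
    have "dv (frame \<phi> n 0) j z k = dv (\<lambda>w k. inverse (\<kappa> w) * b w k) j z k" if "k < N" for k
      by (rule dv_cong[OF T(1) _ T(3)]) (use b[OF _ that] \<kappa>(2) in simp)
    then have "bprod N (dv (frame \<phi> n 0) j z) x = bprod N (dv (\<lambda>w k. inverse (\<kappa> w) * b w k) j z) x"
      by (intro bprod_cong) auto
    also have "\<dots> = 0" by (rule dv_scale_perp[where r = n, OF T(1) vb hk _ T(3)]) (use perp 0 in auto)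
    finally show ?case .
  next
    case (Suc i)
    define g where "g = (\<lambda>w. 2 * \<beta> (n - 1 - i) w)"
    have ni: "n - 1 - i < n" using Suc.prems by simp
    have "\<beta> (n - 1 - i) holomorphic_on T" by (rule holomorphic_on_subset[OF beta_holomorphic[OF ni] T(2)])
    then have g: "g holomorphic_on T" unfolding g_def by (intro holomorphic_on_mult holomorphic_on_const)
    have g0: "g w \<noteq> 0" if "w \<in> T" for w using nz[OF that ni] by (simp add: g_def)
    have hg: "(\<lambda>w. inverse (g w)) holomorphic_on T" by (rule holomorphic_on_inverse[OF g g0])
    have vd: "vhol N T (dv (frame \<phi> n i) 1)" by (rule vhol_dv[OF T(1) vf]) (use Suc.prems in simp)
    have fr: "frame \<phi> n (Suc i) w k = inverse (g w) * dv (frame \<phi> n i) 1 w k" if w: "w \<in> T" and k: "k < N" for w k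
    proof -
      have "((\<lambda>z. frame \<phi> n i z k) has_field_derivative g w * frame \<phi> n (Suc i) w k) (at w)"
        unfolding g_def using frame_deriv[of n i k w] Suc.prems w k T(2) N_eq by auto
      moreover have "((\<lambda>z. frame \<phi> n i z k) has_field_derivative dv (frame \<phi> n i) 1 w k) (at w)"
        using dv_deriv[OF T(1) vf w k, of i 0] Suc.prems by (simp add: dv_0)
      ultimately have "g w * frame \<phi> n (Suc i) w k = dv (frame \<phi> n i) 1 w k" by (rule DERIV_unique)
      then show ?thesis using g0[OF w] by (simp add: field_simps)
    qed
    have "dv (frame \<phi> n (Suc i)) j z k = dv (\<lambda>w k. inverse (g w) * dv (frame \<phi> n i) 1 w k) j z k" if "k < N" for k
      by (rule dv_cong[OF T(1) _ T(3)]) (rule fr[OF _ that])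
    then have "bprod N (dv (frame \<phi> n (Suc i)) j z) x = bprod N (dv (\<lambda>w k. inverse (g w) * dv (frame \<phi> n i) 1 w k) j z) x"
      by (intro bprod_cong) auto
    also have "\<dots> = 0"
    proof (rule dv_scale_perp[where r = "Suc j", OF T(1) vd hg _ T(3)])
      fix l assume "l < Suc j"
      then show "bprod N (dv (dv (frame \<phi> n i) 1) l z) x = 0" unfolding dv_dv using Suc.IH[of "l + 1"] Suc.prems by simp
    qed simp
    finally show ?case .
  qed
  from this[of 0] i have "bprod N (dv (frame \<phi> n i) 0 z) x = 0" by simp
  moreover have "dv (frame \<phi> n i) 0 = frame \<phi> n i" by (simp add: fun_eq_iff dv_0)
  ultimately show ?thesis by simp
qed

text \<open>Rotating the coordinate leaves the frame vectors unchanged and multiplies every \<open>\<beta>\<close> by \<open>\<omega>\<close>; this freedom controls the argument of \<open>P\<close>.\<close>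

lemma recursive_data_construction:
  assumes rd: "recursive_data m E (ball x \<rho>) \<beta> \<phi>" and E: "E \<subseteq> {x}" and \<rho>: "0 < \<rho>" and \<omega>: "cmod \<omega> = 1"
    and \<beta>': "\<beta>' = (\<lambda>s z. \<omega> * \<beta> s (x + \<omega> * z))" and \<phi>': "\<phi>' = (\<lambda>s z. \<phi> s (x + \<omega> * z))"
  shows "construction_data m (ball 0 \<rho>) \<beta>' \<phi>'"
    and "frame \<phi>' r j z = frame \<phi> r j (x + \<omega> * z)"
    and "(\<Prod>i<m. 2 * \<beta>' (m - 1 - i) z) = \<omega> ^ m * (\<Prod>i<m. 2 * \<beta> (m - 1 - i) (x + \<omega> * z))"
    and "z \<in> ball 0 \<rho> \<longleftrightarrow> x + \<omega> * z \<in> ball x \<rho>"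
    and "ball x \<rho> \<subseteq> V \<Longrightarrow> coordinate_change (ball 0 \<rho>) (\<lambda>z. x + \<omega> * z) V x"
proof -
  have \<omega>0: "\<omega> \<noteq> 0" using \<omega> by auto
  have ball: "z \<in> ball 0 \<rho> \<longleftrightarrow> x + \<omega> * z \<in> ball x \<rho>" for z by (simp add: dist_norm norm_mult \<omega>)
  then show "z \<in> ball 0 \<rho> \<longleftrightarrow> x + \<omega> * z \<in> ball x \<rho>" .
  have fr: "frame \<phi>' r j z = frame \<phi> r j (x + \<omega> * z)" for r j z
  proof (induction r arbitrary: j)
    case (Suc r)
    then show ?case by (cases j) (simp_all add: \<phi>')
  qed simp
  then show "frame \<phi>' r j z = frame \<phi> r j (x + \<omega> * z)" .
  show "(\<Prod>i<m. 2 * \<beta>' (m - 1 - i) z) = \<omega> ^ m * (\<Prod>i<m. 2 * \<beta> (m - 1 - i) (x + \<omega> * z))"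
  proof -
    have "(\<Prod>i<m. 2 * \<beta>' (m - 1 - i) z) = (\<Prod>i<m. \<omega> * (2 * \<beta> (m - 1 - i) (x + \<omega> * z)))"
      by (intro prod.cong refl) (simp add: \<beta>' mult_ac)
    then show ?thesis by (simp add: prod.distrib)
  qed
  have "\<beta>' s holomorphic_on ball 0 \<rho> \<and> (\<exists>z\<in>ball 0 \<rho>. \<beta>' s z \<noteq> 0)" if s: "s < m" for s
  proof
    have "\<beta> s holomorphic_on ball x \<rho>" using rd s by (simp add: recursive_data_def)
    then have "(\<lambda>z. \<beta> s (x + \<omega> * z)) holomorphic_on ball 0 \<rho>"
    proof (rule holomorphic_on_compose_gen[where f = "\<lambda>z. x + \<omega> * z", unfolded o_def, rotated])
      show "(\<lambda>z. x + \<omega> * z) ` ball 0 \<rho> \<subseteq> ball x \<rho>" using ball by blast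
    qed (intro holomorphic_intros)
    then show "\<beta>' s holomorphic_on ball 0 \<rho>" unfolding \<beta>' by (intro holomorphic_on_mult holomorphic_on_const)
    define z where "z = complex_of_real (\<rho> / 2)"
    have z: "z \<in> ball 0 \<rho>" "z \<noteq> 0" using \<rho> by (simp_all add: z_def norm_divide)
    then have "x + \<omega> * z \<in> ball x \<rho>" "x + \<omega> * z \<noteq> x" using \<omega>0 ball[of z] by simp_all
    then have "x + \<omega> * z \<in> ball x \<rho> - E" using E by blast
    then have "\<beta>' s z \<noteq> 0" using rd s \<omega>0 unfolding recursive_data_def \<beta>' by simp
    then show "\<exists>z\<in>ball 0 \<rho>. \<beta>' s z \<noteq> 0" using z by blast
  qed
  moreover have "((\<lambda>w. \<phi>' r w k) has_field_derivative alpha m \<beta>' \<phi>' r z k) (at z)"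
    if r: "r < m" and k: "k < 2 * r + 1" and z: "z \<in> ball 0 \<rho>" for r k z
  proof -
    have d: "((\<lambda>w. \<phi> r w k) has_field_derivative \<beta> r (x + \<omega> * z) * frame \<phi> r 0 (x + \<omega> * z) k) (at (x + \<omega> * z))"
      using rd r k z unfolding ball recursive_data_def by simp
    have "((\<lambda>z. x + \<omega> * z) has_field_derivative \<omega>) (at z)" by (auto intro!: derivative_eq_intros)
    from DERIV_chain2[OF d this] show ?thesis
      unfolding alpha_frame coef_def fr using r by (simp add: \<beta>' \<phi>' mult_ac)
  qed
  ultimately show "construction_data m (ball 0 \<rho>) \<beta>' \<phi>'"
    unfolding construction_data_def using \<rho> by (simp add: convex_imp_simply_connected)
  show "coordinate_change (ball 0 \<rho>) (\<lambda>z. x + \<omega> * z) V x" if "ball x \<rho> \<subseteq> V"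
    unfolding coordinate_change_def
  proof (intro conjI)
    show "inj_on (\<lambda>z. x + \<omega> * z) (ball 0 \<rho>)" by (rule inj_onI) (use \<omega>0 in simp)
    show "(\<lambda>z. x + \<omega> * z) ` ball 0 \<rho> \<subseteq> V" using ball that by blast
    show "x \<in> (\<lambda>z. x + \<omega> * z) ` ball 0 \<rho>" using \<rho> by (intro image_eqI[of _ _ 0]) simp_all
    show "(\<lambda>z. x + \<omega> * z) holomorphic_on ball 0 \<rho>" by (intro holomorphic_intros)
  qed
qed

lemma recursive_data_construction_id:
  assumes "recursive_data m E (ball x \<rho>) \<beta> \<phi>" "E \<subseteq> {x}" "0 < \<rho>"
  shows "construction_data m (ball x \<rho>) \<beta> \<phi>"
proof -
  define q where "q = x + of_real (\<rho> / 2)"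
  have "q \<in> ball x \<rho>" "q \<noteq> x" using assms(3) by (simp_all add: q_def dist_norm norm_divide)
  then have "q \<in> ball x \<rho> - E" using assms(2) by blast
  then have nz: "\<beta> s q \<noteq> 0" "\<beta> s holomorphic_on ball x \<rho>" if "s \<le> m" for s
    using assms(1) that by (simp_all add: recursive_data_def)
  have q: "q \<in> ball x \<rho>" using assms(3) by (simp add: q_def dist_norm norm_divide)
  show ?thesis
    unfolding construction_data_def
  proof (intro conjI allI impI ballI)
    show "open (ball x \<rho>)" "ball x \<rho> \<noteq> {}" "simply_connected (ball x \<rho>)"
      using assms(3) by (simp_all add: convex_imp_simply_connected)
    show "\<beta> s holomorphic_on ball x \<rho>" if "s < m" for s using nz(2) that by simp
    show "\<exists>z\<in>ball x \<rho>. \<beta> s z \<noteq> 0" if "s < m" for s by (rule bexI[OF _ q]) (use nz(1) that in simp)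
    show "((\<lambda>w. \<phi> r w k) has_field_derivative alpha m \<beta> \<phi> r z k) (at z)"
      if "r < m" "k < 2 * r + 1" "z \<in> ball x \<rho>" for r k z
      using assms(1) that unfolding recursive_data_def alpha_frame coef_def by simp
  qed
qed

lemma unit_root_rotation:
  fixes c :: complex
  assumes "1 \<le> m" "s = 1 \<or> s = (-1::real)"
  obtains \<omega> where "cmod \<omega> = 1" "\<omega> ^ m * c = of_real (s * cmod c)"
proof -
  define d where "d = of_real s * c"
  have ss: "of_real s * of_real s = (1::complex)" using assms(2) by auto
  have cd: "cmod d = cmod c" using assms(2) by (auto simp: d_def norm_mult)
  define \<omega> where "\<omega> = cis (- Arg d / real m)"
  have "real m * (- Arg d / real m) = - Arg d" using assms(1) by simp
  then have "\<omega> ^ m = cis (- Arg d)" unfolding \<omega>_def Complex.DeMoivre by (rule arg_cong)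
  moreover have "d = of_real (cmod d) * cis (Arg d)" using rcis_cmod_Arg[of d] by (simp add: rcis_def)
  ultimately have "\<omega> ^ m * d = cis (- Arg d) * (of_real (cmod d) * cis (Arg d))" by simp
  also have "\<dots> = of_real (cmod d) * (cis (- Arg d) * cis (Arg d))" by (simp only: mult_ac)
  also have "cis (- Arg d) * cis (Arg d) = 1" by (simp add: cis_mult)
  finally have "\<omega> ^ m * d = of_real (cmod c)" by (simp add: cd)
  then have *: "\<omega> ^ m * (of_real s * c) = of_real (cmod c)" by (simp only: d_def)
  have "\<omega> ^ m * c = (of_real s * of_real s) * (\<omega> ^ m * c)" unfolding ss by simp
  also have "\<dots> = of_real s * (\<omega> ^ m * (of_real s * c))" by (simp only: mult_ac)
  also have "\<dots> = of_real (s * cmod c)" unfolding * by simp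
  finally have "\<omega> ^ m * c = of_real (s * cmod c)" .
  moreover have "cmod \<omega> = 1" by (simp add: \<omega>_def)
  ultimately show thesis using that by blast
qed

context reduced
begin

lemma M_Suc: "M = Suc (2 * m)" by (simp add: M_eq)

text \<open>The factor \<open>\<omega>\<close> makes \<open>P m\<close> positive at one point, so that its real part is not identically zero.\<close>

lemma local_representation:
  assumes p: "p \<in> V"
  shows "\<exists>A' U \<psi> \<beta> \<phi> G'. linear_isometry M N A' \<and> construction_data m U \<beta> \<phi> \<and> coordinate_change U \<psi> V p
    \<and> U \<subseteq> closure (g_domain m U \<beta> \<phi>) \<and> agrees_up_to_sign m U \<beta> \<phi> G'
    \<and> (\<forall>z\<in>U. \<forall>k<N. f (\<psi> z) k = (\<Sum>j<M. A' k j * G' z j))"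
proof -
  obtain r b where r: "r > 0" and bV: "ball p r \<subseteq> V" and vb: "vhol M (ball p r) b"
    and ib: "isotropic_on M m (ball p r) b"
    and top: "\<And>z. z \<in> ball p r - {p} \<Longrightarrow> bprod M (dv b m z) (dv b m z) \<noteq> 0"
    and bG: "\<And>z j. z \<in> ball p r \<Longrightarrow> j < m \<Longrightarrow> bprod M (dv b j z) (complexify G z) = 0"
    using directrix_germ[OF p] by metis
  obtain \<rho> Q where \<rho>: "0 < \<rho>" "\<rho> \<le> r" and Q: "orthm M Q"
    and gen: "generated m {p} (ball p \<rho>) (\<lambda>z. rot M Q (b z))"
    using generated_at_point[of r m p b, folded M_Suc, OF r vb ib top] by blast
  obtain \<beta> \<phi> where rd: "recursive_data m {p} (ball p \<rho>) \<beta> \<phi>"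
    and bq: "\<And>z k. z \<in> ball p \<rho> \<Longrightarrow> k < M \<Longrightarrow> rot M Q (b z) k = \<beta> m z * frame \<phi> m 0 z k"
    using gen unfolding generated_def M_Suc[symmetric] by blast
  have sub: "ball p \<rho> \<subseteq> ball p r" by (rule subset_ball[OF \<rho>(2)])
  have cd0: "construction_data m (ball p \<rho>) \<beta> \<phi>" by (rule recursive_data_construction_id[OF rd order_refl \<rho>(1)])
  interpret c0: construction m M "ball p \<rho>" \<beta> \<phi> by unfold_locales (fact cd0 m1 M_eq)+
  have nz: "\<beta> s z \<noteq> 0" if "z \<in> ball p \<rho> - {p}" "s \<le> m" for s z using rd that by (simp add: recursive_data_def)
  define Gq where "Gq = (\<lambda>z k. \<Sum>i<M. Q i k * G z i)"
  have cGq: "complexify Gq z = rot M Q (complexify G z)" for z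
    by (simp add: fun_eq_iff complexify_def Gq_def rot_def bprod_def)
  have Gq_unit: "bprod M (Gq z) (Gq z) = 1" if "z \<in> V" for z
  proof -
    have "complex_of_real (bprod M (Gq z) (Gq z)) = bprod M (complexify G z) (complexify G z)"
      unfolding bprod_complexify[symmetric] cGq by (rule bprod_rot[OF Q])
    also have "\<dots> = of_real 1" unfolding bprod_complexify G_unit[OF that] ..
    finally show ?thesis by (simp only: of_real_eq_iff)
  qed
  have Gq_cont: "continuous_on (ball p \<rho>) (\<lambda>z. complexify Gq z k)" for k
    unfolding complexify_def Gq_def using sub bV
    by (intro continuous_on_of_real continuous_on_sum continuous_on_mult continuous_on_const continuous_on_subset[OF G_continuous]) blast
  have perp0: "bprod M (frame \<phi> m i z) (complexify Gq z) = 0" if z: "z \<in> ball p \<rho> - {p}" and i: "i < m" for i z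
  proof (rule c0.frame_perp[where T = "ball p \<rho> - {p}" and \<kappa> = "\<beta> m" and b = "\<lambda>z. rot M Q (b z)", OF _ _ z _ _ _ _ _ i])
    show "open (ball p \<rho> - {p})" by (simp add: open_delete)
    show "ball p \<rho> - {p} \<subseteq> ball p \<rho>" by blast
    show "\<beta> s w \<noteq> 0" if "w \<in> ball p \<rho> - {p}" "s < m" for w s using nz[OF that(1), of s] that(2) by simp
    have "\<beta> m holomorphic_on ball p \<rho>" using rd by (simp add: recursive_data_def)
    then show "\<beta> m holomorphic_on ball p \<rho> - {p}" by (rule holomorphic_on_subset) blast
    show "\<beta> m w \<noteq> 0" if "w \<in> ball p \<rho> - {p}" for w using nz[OF that, of m] by simp
    show "rot M Q (b w) k = \<beta> m w * frame \<phi> m 0 w k" if "w \<in> ball p \<rho> - {p}" "k < M" for w k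
      by (rule bq) (use that in simp_all)
    fix j assume j: "j < m"
    have zr: "z \<in> ball p r" using z sub by blast
    have "dv (\<lambda>z. rot M Q (b z)) j z = rot M Q (dv b j z)"
      using dv_linear[OF open_ball vb zr, of "\<lambda>k i. of_real (Q i k)" j]
      by (simp add: fun_eq_iff rot_def[abs_def] bprod_def)
    then show "bprod M (dv (\<lambda>z. rot M Q (b z)) j z) (complexify Gq z) = 0"
      using bG[OF zr j] by (simp only: cGq bprod_rot[OF Q])
  qed
  have perp: "bprod M (frame \<phi> m i z) (complexify Gq z) = 0" if z: "z \<in> ball p \<rho>" and i: "i < m" for i z
  proof (rule zero_at_centre[OF \<rho>(1) _ _ z])
    have "continuous_on (ball p \<rho>) (\<lambda>z. frame \<phi> m i z k)" if "k < M" for k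
      by (rule holomorphic_on_imp_continuous_on[OF c0.frame_holomorphic]) (use i that M_Suc in simp_all)
    then show "continuous_on (ball p \<rho>) (\<lambda>z. bprod M (frame \<phi> m i z) (complexify Gq z))"
      unfolding bprod_def by (intro continuous_on_sum continuous_on_mult Gq_cont) simp
  qed (rule perp0[OF _ i])
  define q0 where "q0 = p + of_real (\<rho> / 2)"
  have q0: "q0 \<in> ball p \<rho>" "q0 \<noteq> p" using \<rho>(1) by (simp_all add: q0_def dist_norm norm_divide)
  define c where "c = (\<Prod>i<m. 2 * \<beta> (m - 1 - i) q0)"
  have c: "c \<noteq> 0" unfolding c_def using nz[of q0] q0 by simp
  obtain \<omega> where \<omega>: "cmod \<omega> = 1" "\<omega> ^ m * c = of_real (1 * cmod c)"
    using unit_root_rotation[OF m1, of 1 c] by blast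
  define \<beta>' where "\<beta>' = (\<lambda>s z. \<omega> * \<beta> s (p + \<omega> * z))"
  define \<phi>' where "\<phi>' = (\<lambda>s z. \<phi> s (p + \<omega> * z))"
  define \<psi> where "\<psi> = (\<lambda>z. p + \<omega> * z)"
  note rc = recursive_data_construction[OF rd order_refl \<rho>(1) \<omega>(1) \<beta>'_def \<phi>'_def]
  interpret c1: construction m M "ball 0 \<rho>" \<beta>' \<phi>' by unfold_locales (fact rc(1) m1 M_eq)+
  have inb: "\<psi> z \<in> ball p \<rho>" if "z \<in> ball 0 \<rho>" for z using rc(4)[of z] that unfolding \<psi>_def by blast
  have inV: "\<psi> z \<in> V" if "z \<in> ball 0 \<rho>" for z using inb[OF that] sub bV by blast
  define z0 where "z0 = inverse \<omega> * of_real (\<rho> / 2)"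
  have "\<omega> \<noteq> 0" using \<omega>(1) by auto
  then have z0: "p + \<omega> * z0 = q0" by (simp add: z0_def q0_def)
  have z0b: "z0 \<in> ball 0 \<rho>" unfolding rc(4) z0 by (rule q0(1))
  have "c1.P m z0 = of_real (cmod c)" unfolding c1.P_def rc(3) z0 c_def[symmetric] using \<omega>(2) by simp
  then have "Re (c1.P m z0) \<noteq> 0" using c by simp
  then have dense: "ball 0 \<rho> \<subseteq> closure (g_domain m (ball 0 \<rho>) \<beta>' \<phi>')" by (rule c1.g_domain_dense[OF z0b])
  have agree: "agrees_up_to_sign m (ball 0 \<rho>) \<beta>' \<phi>' (\<lambda>z. Gq (\<psi> z))"
    unfolding agrees_up_to_sign_def M_eq[symmetric]
  proof
    fix z assume z: "z \<in> g_domain m (ball 0 \<rho>) \<beta>' \<phi>'"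
    then have zb: "z \<in> ball 0 \<rho>" unfolding g_domain_def by blast
    have h1: "bprod M (Gq (\<psi> z)) (Gq (\<psi> z)) = 1" by (rule Gq_unit[OF inV[OF zb]])
    have h2: "bprod M (frame \<phi>' m j z) (complexify (\<lambda>z. Gq (\<psi> z)) z) = 0" if "j < m" for j
    proof -
      have e: "complexify (\<lambda>z. Gq (\<psi> z)) z = complexify Gq (\<psi> z)" by (simp add: fun_eq_iff complexify_def)
      show ?thesis unfolding e rc(2) using perp[OF inb[OF zb] that] unfolding \<psi>_def .
    qed
    obtain s where s: "s = 1 \<or> s = -1" "\<And>k. k < M \<Longrightarrow> Gq (\<psi> z) k = s * c1.u z k"
      using c1.unit_normal_unique[where h = "\<lambda>z. Gq (\<psi> z)", OF zb h1 h2] by metis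
    have "(\<forall>k<M. c1.u z k = g m \<beta>' \<phi>' z k) \<or> (\<forall>k<M. c1.u z k = - g m \<beta>' \<phi>' z k)"
      using c1.u_agrees z unfolding agrees_up_to_sign_def M_eq[symmetric] by blast
    then show "(\<forall>k<M. Gq (\<psi> z) k = g m \<beta>' \<phi>' z k) \<or> (\<forall>k<M. Gq (\<psi> z) k = - g m \<beta>' \<phi>' z k)"
      using s by (elim disjE) simp_all
  qed
  define A' where "A' = (\<lambda>k j. \<Sum>i<M. A k i * Q i j)"
  have isoA': "linear_isometry M N A'"
    unfolding linear_isometry_def
  proof (intro allI impI)
    fix i j assume ij: "i < M" "j < M"
    have "bprod N (\<lambda>k. \<Sum>l<M. A k l * Q l i) (\<lambda>k. \<Sum>l<M. A k l * Q l j) = bprod M (\<lambda>l. Q l i) (\<lambda>l. Q l j)"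
      by (rule bprod_isometry) (use isoA in \<open>simp add: linear_isometry_def\<close>)
    also have "\<dots> = of_bool (i = j)" using Q ij by (simp add: orthm_def)
    finally show "(\<Sum>k<N. A' k i * A' k j) = (if i = j then 1 else 0)" by (simp add: A'_def bprod_def)
  qed
  have GQ: "G w i = (\<Sum>j<M. Q i j * Gq w j)" if i: "i < M" for w i
  proof -
    have "(\<Sum>j<M. Q i j * Gq w j) = (\<Sum>j<M. \<Sum>l<M. Q i j * Q l j * G w l)"
      by (simp add: Gq_def sum_distrib_left mult.assoc)
    also have "\<dots> = (\<Sum>l<M. \<Sum>j<M. Q i j * Q l j * G w l)" by (rule sum.swap)
    also have "\<dots> = (\<Sum>l<M. bprod M (Q i) (Q l) * G w l)" by (simp add: bprod_def sum_distrib_right)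
    also have "\<dots> = (\<Sum>l<M. if l = i then G w l else 0)"
      using Q i by (intro sum.cong refl) (auto simp: orthm_def)
    also have "\<dots> = G w i" using i by simp
    finally show ?thesis ..
  qed
  have "f (\<psi> z) k = (\<Sum>j<M. A' k j * Gq (\<psi> z) j)" if "z \<in> ball 0 \<rho>" "k < N" for z k
  proof -
    have "f (\<psi> z) k = (\<Sum>i<M. A k i * G (\<psi> z) i)" by (rule f_AG[OF inV[OF that(1)] that(2)])
    also have "\<dots> = (\<Sum>i<M. \<Sum>j<M. A k i * Q i j * Gq (\<psi> z) j)"
      by (intro sum.cong refl) (simp add: GQ sum_distrib_left mult.assoc)
    also have "\<dots> = (\<Sum>j<M. \<Sum>i<M. A k i * Q i j * Gq (\<psi> z) j)" by (rule sum.swap)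
    finally show ?thesis by (simp add: A'_def sum_distrib_right)
  qed
  moreover have "coordinate_change (ball 0 \<rho>) \<psi> V p" unfolding \<psi>_def by (rule rc(5)) (use sub bV in blast)
  ultimately show ?thesis using isoA' rc(1) dense agree by blast
qed

text \<open>If \<open>A\<close> is not surjective, a nonzero column of \<open>1 - A A\<^sup>t\<close> is orthogonal to the whole surface.\<close>

lemma dimension_full:
  assumes "\<And>c. (\<And>z. z \<in> V \<Longrightarrow> bprod N (f z) c = 0) \<Longrightarrow> \<forall>k<N. c k = 0"
  shows "M = N"
proof -
  define c where "c = (\<lambda>k l. of_bool (l = k) - (\<Sum>i<M. A k i * A l i))"
  have "c k k = 0" if k: "k < N" for k
  proof -
    have "bprod N (f z) (c k) = 0" if z: "z \<in> V" for z
    proof -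
      have "bprod N (f z) (c k) = (\<Sum>l<N. (if l = k then f z l else 0) - f z l * (\<Sum>i<M. A k i * A l i))"
        unfolding bprod_def c_def by (intro sum.cong) (auto simp: algebra_simps)
      also have "\<dots> = f z k - (\<Sum>l<N. \<Sum>i<M. A k i * (A l i * f z l))"
        using k by (simp add: sum_subtractf sum_distrib_left mult_ac)
      also have "(\<Sum>l<N. \<Sum>i<M. A k i * (A l i * f z l)) = (\<Sum>i<M. A k i * G z i)"
        unfolding G_def sum_distrib_left by (rule sum.swap)
      finally show ?thesis using f_AG[OF z k] by simp
    qed
    from assms[OF this] k show ?thesis by blast
  qed
  then have "real N = (\<Sum>k<N. \<Sum>i<M. A k i * A k i)" by (simp add: c_def)
  also have "\<dots> = (\<Sum>i<M. \<Sum>k<N. A k i * A k i)" by (rule sum.swap)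
  also have "\<dots> = real M" using isoA by (simp add: linear_isometry_def)
  finally show ?thesis by simp
qed

text \<open>Near a good point \<open>q\<close> the signs of \<open>Re (P m)\<close> and of the product of \<open>f\<close> with \<open>u\<close> are constant; \<open>\<omega>\<close> is chosen so that they coincide.  The normal \<open>u\<close> at \<open>q\<close> does not depend on \<open>\<omega>\<close>, which makes this choice possible.\<close>

lemma generic_representation:
  assumes p: "p \<in> V" and MN: "M = N"
  shows "\<forall>\<^sub>F q in at p. \<exists>U \<psi> \<beta> \<phi>. construction_data m U \<beta> \<phi> \<and> coordinate_change U \<psi> V q
    \<and> g_domain m U \<beta> \<phi> = U \<and> (\<forall>z\<in>U. \<forall>k<N. f (\<psi> z) k = g m \<beta> \<phi> z k)"
proof -
  obtain r b where r: "r > 0" and bV: "ball p r \<subseteq> V" and vb: "vhol M (ball p r) b"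
    and ib: "isotropic_on M m (ball p r) b"
    and top: "\<And>z. z \<in> ball p r - {p} \<Longrightarrow> bprod M (dv b m z) (dv b m z) \<noteq> 0"
    and bG: "\<And>z j. z \<in> ball p r \<Longrightarrow> j < m \<Longrightarrow> bprod M (dv b j z) (complexify G z) = 0"
    using directrix_germ[OF p] by metis
  define B where "B = (\<lambda>z k. \<Sum>i<M. complex_of_real (A k i) * b z i)"
  have dB: "dv B j z = (\<lambda>k. \<Sum>i<M. of_real (A k i) * dv b j z i)" if "z \<in> ball p r" for j z
    unfolding B_def using dv_linear[OF open_ball vb that, of "\<lambda>k i. complex_of_real (A k i)" j] by (simp add: fun_eq_iff)
  have BB: "bprod N (\<lambda>k. \<Sum>i<M. of_real (A k i) * x i) (\<lambda>k. \<Sum>i<M. of_real (A k i) * y i) = bprod M x y" for x y :: "nat \<Rightarrow> complex"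
    by (rule bprod_isometry) (rule linear_isometry_complex[OF isoA])
  have vB: "vhol N (ball p r) B"
    unfolding vhol_def B_def
    by (intro allI impI holomorphic_on_sum holomorphic_on_mult holomorphic_on_const) (use vb in \<open>simp add: vhol_def\<close>)
  have iB: "isotropic_on N m (ball p r) B" using ib unfolding isotropic_on_def by (simp add: dB BB)
  have tB: "bprod N (dv B m z) (dv B m z) \<noteq> 0" if "z \<in> ball p r - {p}" for z
    using top[OF that] that by (simp add: dB BB)
  have Bf: "bprod N (dv B j z) (complexify f z) = 0" if z: "z \<in> ball p r" and j: "j < m" for z j
  proof -
    have zV: "z \<in> V" using z bV by blast
    have "bprod N (dv B j z) (complexify f z)
        = bprod N (\<lambda>k. \<Sum>i<M. of_real (A k i) * dv b j z i) (\<lambda>k. \<Sum>i<M. of_real (A k i) * complexify G z i)"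
      by (rule bprod_cong) (simp_all add: dB[OF z] complexify_def f_AG[OF zV])
    then show ?thesis unfolding BB bG[OF z j] .
  qed
  have N_Suc: "N = Suc (2 * m)" using M_Suc MN by simp
  have "\<forall>\<^sub>F q in at p. \<exists>\<rho>>0. ball q \<rho> \<subseteq> ball p r \<and> generated m {} (ball q \<rho>) B"
    by (rule generated_near[of r m p B, folded N_Suc, OF r vB iB tB])
  then show ?thesis
  proof eventually_elim
    case (elim q)
    then obtain \<rho>1 where \<rho>1: "\<rho>1 > 0" "ball q \<rho>1 \<subseteq> ball p r" and gen: "generated m {} (ball q \<rho>1) B" by blast
    obtain \<beta> \<phi> where rd: "recursive_data m {} (ball q \<rho>1) \<beta> \<phi>"
      and bq: "\<And>z k. z \<in> ball q \<rho>1 \<Longrightarrow> k < N \<Longrightarrow> B z k = \<beta> m z * frame \<phi> m 0 z k"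
      using gen unfolding generated_def N_Suc[symmetric] by blast
    have cd0: "construction_data m (ball q \<rho>1) \<beta> \<phi>" by (rule recursive_data_construction_id[OF rd empty_subsetI \<rho>1(1)])
    have N_eq': "N = 2 * m + 1" using N_Suc by simp
    interpret c0: construction m N "ball q \<rho>1" \<beta> \<phi> by unfold_locales (fact cd0 m1 N_eq')+
    have nz: "\<beta> s z \<noteq> 0" "\<beta> s holomorphic_on ball q \<rho>1" if "z \<in> ball q \<rho>1" "s \<le> m" for s z
      using rd that by (simp_all add: recursive_data_def)
    have q: "q \<in> ball q \<rho>1" using \<rho>1(1) by simp
    have inV: "z \<in> V" if "z \<in> ball q \<rho>1" for z using that \<rho>1(2) bV by blast
    have perp: "bprod N (frame \<phi> m i z) (complexify f z) = 0" if z: "z \<in> ball q \<rho>1" and i: "i < m" for i z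
      by (rule c0.frame_perp[where T = "ball q \<rho>1" and \<kappa> = "\<beta> m" and b = B, OF open_ball order_refl z _ _ _ bq _ i])
         (use nz Bf \<rho>1(2) z in auto)
    have sign: "\<exists>s. (s = 1 \<or> s = -1) \<and> (\<forall>k<N. f z k = s * c0.u z k)" if z: "z \<in> ball q \<rho>1" for z
      using c0.unit_normal_unique[where h = f, OF z unit_f[OF inV[OF z]] perp[OF z]] by metis
    have sign_eq: "s = bprod N (f z) (c0.u z)" if "z \<in> ball q \<rho>1" "\<forall>k<N. f z k = s * c0.u z k" for s z
    proof -
      have "bprod N (f z) (c0.u z) = (\<Sum>k<N. s * (c0.u z k * c0.u z k))" unfolding bprod_def using that(2) by (simp add: mult.assoc)
      also have "\<dots> = s * bprod N (c0.u z) (c0.u z)" by (simp add: bprod_def sum_distrib_left)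
      finally show ?thesis using c0.u_unit[OF that(1)] by simp
    qed
    obtain s0 where s0: "s0 = 1 \<or> s0 = -1" "\<forall>k<N. f q k = s0 * c0.u q k" using sign[OF q] by blast
    have s00: "s0 * s0 = 1" using s0(1) by auto
    define C where "C = (\<lambda>z. \<Prod>i<m. 2 * \<beta> (m - 1 - i) z)"
    have C0: "C q \<noteq> 0" unfolding C_def using nz(1)[OF q] by simp
    obtain \<omega> where \<omega>: "cmod \<omega> = 1" "\<omega> ^ m * C q = of_real (s0 * cmod (C q))"
      using unit_root_rotation[OF m1 s0(1)] by blast
    define h1 where "h1 = (\<lambda>z. s0 * Re (\<omega> ^ m * C z))"
    define h2 where "h2 = (\<lambda>z. s0 * bprod N (f z) (c0.u z))"
    have "C holomorphic_on ball q \<rho>1"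
      unfolding C_def by (intro holomorphic_on_prod holomorphic_on_mult holomorphic_on_const nz(2)[OF q]) simp
    then have h1c: "continuous_on (ball q \<rho>1) h1"
      unfolding h1_def by (intro continuous_intros holomorphic_on_imp_continuous_on)
    have fc: "continuous_on (ball q \<rho>1) (\<lambda>z. f z k)" if "k < N" for k
      by (rule continuous_on_subset[OF f_continuous[OF that]]) (use inV in blast)
    have h2c: "continuous_on (ball q \<rho>1) h2"
      unfolding h2_def bprod_def
      by (intro continuous_on_mult continuous_on_const continuous_on_sum fc smooth_on_continuous[OF c0.u_smooth]) simp_all
    have "Re (\<omega> ^ m * C q) = s0 * cmod (C q)" unfolding \<omega>(2) by simp
    then have "h1 q = s0 * s0 * cmod (C q)" by (simp add: h1_def)
    then have h1q: "h1 q > 0" using s00 C0 by simp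
    have h2q: "h2 q > 0" using sign_eq[OF q s0(2)] s00 by (simp add: h2_def)
    have "open (ball q \<rho>1 \<inter> h1 -` {0<..})" "open (ball q \<rho>1 \<inter> h2 -` {0<..})"
      by (intro continuous_open_preimage h1c h2c open_ball open_greaterThan)+
    then have "open ((ball q \<rho>1 \<inter> h1 -` {0<..}) \<inter> (ball q \<rho>1 \<inter> h2 -` {0<..}))" by (rule open_Int)
    then obtain \<rho> where \<rho>: "\<rho> > 0" "ball q \<rho> \<subseteq> (ball q \<rho>1 \<inter> h1 -` {0<..}) \<inter> (ball q \<rho>1 \<inter> h2 -` {0<..})"
      using h1q h2q q by (metis IntI greaterThan_iff open_contains_ball vimageI)
    have sub: "ball q \<rho> \<subseteq> ball q \<rho>1" using \<rho>(2) by blast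
    have rd': "recursive_data m {} (ball q \<rho>) \<beta> \<phi>"
      unfolding recursive_data_def
    proof (intro conjI allI impI ballI)
      show "\<beta> s holomorphic_on ball q \<rho>" if "s \<le> m" for s by (rule holomorphic_on_subset[OF nz(2)[OF q that] sub])
      show "\<beta> s z \<noteq> 0" if "s \<le> m" "z \<in> ball q \<rho> - {}" for s z by (rule nz(1)) (use that sub in auto)
      fix s k z assume sk: "s < m" "k < Suc (2 * s)" and "z \<in> ball q \<rho>"
      then have z: "z \<in> ball q \<rho>1" using sub by blast
      show "((\<lambda>w. \<phi> s w k) has_field_derivative \<beta> s z * frame \<phi> s 0 z k) (at z)"
        using rd sk z unfolding recursive_data_def by blast
    qed
    define \<beta>' where "\<beta>' = (\<lambda>s z. \<omega> * \<beta> s (q + \<omega> * z))"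
    define \<phi>' where "\<phi>' = (\<lambda>s z. \<phi> s (q + \<omega> * z))"
    define \<psi> where "\<psi> = (\<lambda>z. q + \<omega> * z)"
    note rc = recursive_data_construction[OF rd' empty_subsetI \<rho>(1) \<omega>(1) \<beta>'_def \<phi>'_def]
    interpret c1: construction m N "ball 0 \<rho>" \<beta>' \<phi>' by unfold_locales (fact rc(1) m1 N_eq')+
    have inb: "\<psi> z \<in> ball q \<rho>" if "z \<in> ball 0 \<rho>" for z using rc(4)[of z] that unfolding \<psi>_def by blast
    have u: "c1.u z k = c0.u (\<psi> z) k" for z k
      unfolding c1.u_def c0.u_def c1.W_def c0.W_def rc(2) \<psi>_def ..
    have P: "s0 * Re (c1.P m z) > 0" if "z \<in> ball 0 \<rho>" for z
    proof -
      have "h1 (\<psi> z) > 0" using inb[OF that] \<rho>(2) by auto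
      then show ?thesis unfolding c1.P_def rc(3) h1_def C_def \<psi>_def .
    qed
    have dom: "g_domain m (ball 0 \<rho>) \<beta>' \<phi>' = ball 0 \<rho>"
      unfolding c1.g_domain_eq using P by force
    have "f (\<psi> z) k = g m \<beta>' \<phi>' z k" if z: "z \<in> ball 0 \<rho>" and k: "k < N" for z k
    proof -
      have zb: "\<psi> z \<in> ball q \<rho>1" using inb[OF z] sub by blast
      obtain s where s: "s = 1 \<or> s = -1" "\<forall>k<N. f (\<psi> z) k = s * c0.u (\<psi> z) k" using sign[OF zb] by blast
      have "h2 (\<psi> z) > 0" using inb[OF z] \<rho>(2) by auto
      then have "s0 * s > 0" using sign_eq[OF zb s(2)] by (simp add: h2_def)
      then have "s = s0" using s(1) s0(1) by auto
      moreover have "sgn (Re (c1.P m z)) = s0"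
        using P[OF z] s0(1) by (auto simp: sgn_if zero_less_mult_iff)
      ultimately show ?thesis using c1.g_eq[of z k] s(2) k z unfolding dom u by simp
    qed
    moreover have "coordinate_change (ball 0 \<rho>) \<psi> V q" unfolding \<psi>_def by (rule rc(5)) (use sub inV in blast)
    ultimately show ?case using rc(1) dom by blast
  qed
qed

end

lemma pseudoholomorphic_local_representation:
  assumes ph: "pseudoholomorphic n V f" and p: "p \<in> V"
  shows "\<exists>m A U \<psi> \<beta> \<phi> G. 1 \<le> m \<and> m \<le> n \<and> linear_isometry (2 * m + 1) (2 * n + 1) A
    \<and> construction_data m U \<beta> \<phi> \<and> coordinate_change U \<psi> V p
    \<and> U \<subseteq> closure (g_domain m U \<beta> \<phi>) \<and> agrees_up_to_sign m U \<beta> \<phi> G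
    \<and> (\<forall>z\<in>U. \<forall>k<2 * n + 1. f (\<psi> z) k = (\<Sum>j<2 * m + 1. A k j * G z j))"
proof -
  have "open V" using ph by (simp add: pseudoholomorphic_def generalized_pseudoholomorphic_def Let_def)
  then obtain R where R: "R > 0" "ball p R \<subseteq> V" using p open_contains_ball by blast
  obtain m A where m: "1 \<le> m" "m \<le> n" and red: "reduced (2 * n + 1) (ball p R) f m (2 * m + 1) A"
    by (rule pseudoholomorphic_reduced[OF ph refl open_ball R(2)]) (use R(1) in simp_all)
  have "p \<in> ball p R" using R(1) by simp
  from reduced.local_representation[OF red this] obtain A' U \<psi> \<beta> \<phi> G
    where h: "linear_isometry (2 * m + 1) (2 * n + 1) A'" "construction_data m U \<beta> \<phi>" "coordinate_change U \<psi> (ball p R) p"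
      "U \<subseteq> closure (g_domain m U \<beta> \<phi>)" "agrees_up_to_sign m U \<beta> \<phi> G"
      "\<forall>z\<in>U. \<forall>k<2 * n + 1. f (\<psi> z) k = (\<Sum>j<2 * m + 1. A' k j * G z j)"
    by blast
  have "coordinate_change U \<psi> V p" using h(3) R(2) unfolding coordinate_change_def by blast
  then show ?thesis using m h by blast
qed

lemma substantial_generic_representation:
  assumes ph: "pseudoholomorphic n V f" and V: "connected V" "substantial n V f"
  shows "{p\<in>V. \<not> (\<exists>U \<psi> \<beta> \<phi>.
      construction_data n U \<beta> \<phi> \<and> coordinate_change U \<psi> V p
    \<and> g_domain n U \<beta> \<phi> = U
    \<and> (\<forall>z\<in>U. \<forall>k<2 * n + 1. f (\<psi> z) k = g n \<beta> \<phi> z k))} sparse_in V"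
    (is "?B sparse_in V")
proof -
  have op: "open V" using ph by (simp add: pseudoholomorphic_def generalized_pseudoholomorphic_def Let_def)
  show ?thesis
  proof (cases "V = {}")
    case False
    obtain m A where m: "1 \<le> m" "m \<le> n" and red: "reduced (2 * n + 1) V f m (2 * m + 1) A"
      by (rule pseudoholomorphic_reduced[OF ph refl op order_refl V(1) False])
    have "2 * m + 1 = 2 * n + 1"
      by (rule reduced.dimension_full[OF red]) (use V(2) in \<open>unfold substantial_def, blast\<close>)
    then have mn: "m = n" by simp
    have "\<forall>\<^sub>F q in at p. q \<notin> ?B" if "p \<in> V" for p
      using reduced.generic_representation[OF red[unfolded mn] that refl] by eventually_elim blast
    then show ?thesis unfolding sparse_in_eventually_iff[OF op] by blast
  qed simp
qed

theorem theorem1: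
  fixes n :: nat
  assumes "1 \<le> n"
  shows
    "(\<forall>U \<beta> \<phi>. construction_data n U \<beta> \<phi> \<longrightarrow>
        degenerate_points n U \<beta> \<phi> sparse_in U
        \<and> generalized_pseudoholomorphic n (g_domain n U \<beta> \<phi>) (g n \<beta> \<phi>)
        \<and> (g_domain n U \<beta> \<phi> \<noteq> {} \<longrightarrow> U \<subseteq> closure (g_domain n U \<beta> \<phi>))
        \<and> (\<exists>G. generalized_pseudoholomorphic n U G \<and> agrees_up_to_sign n U \<beta> \<phi> G))
     \<and>
     (\<forall>V f. pseudoholomorphic n V f \<longrightarrow>
        (\<forall>p\<in>V. \<exists>m A U \<psi> \<beta> \<phi> G.
            1 \<le> m \<and> m \<le> n \<and> linear_isometry (2 * m + 1) (2 * n + 1) A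
          \<and> construction_data m U \<beta> \<phi> \<and> coordinate_change U \<psi> V p
          \<and> U \<subseteq> closure (g_domain m U \<beta> \<phi>) \<and> agrees_up_to_sign m U \<beta> \<phi> G
          \<and> (\<forall>z\<in>U. \<forall>k<2 * n + 1. f (\<psi> z) k = (\<Sum>j<2 * m + 1. A k j * G z j)))
        \<and>
        (connected V \<and> substantial n V f \<longrightarrow>
          {p\<in>V. \<not> (\<exists>U \<psi> \<beta> \<phi>.
              construction_data n U \<beta> \<phi> \<and> coordinate_change U \<psi> V p
            \<and> g_domain n U \<beta> \<phi> = U
            \<and> (\<forall>z\<in>U. \<forall>k<2 * n + 1. f (\<psi> z) k = g n \<beta> \<phi> z k))} sparse_in V))"
proof (intro conjI allI impI ballI)
  fix U \<beta> \<phi> assume cd: "construction_data n U \<beta> \<phi>"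
  note cg = construction_gives_pseudoholomorphic[OF assms cd]
  show "degenerate_points n U \<beta> \<phi> sparse_in U" by (rule cg(1))
  show "generalized_pseudoholomorphic n (g_domain n U \<beta> \<phi>) (g n \<beta> \<phi>)" by (rule cg(2))
  show "U \<subseteq> closure (g_domain n U \<beta> \<phi>)" if "g_domain n U \<beta> \<phi> \<noteq> {}" using cg(3) that by blast
  show "\<exists>G. generalized_pseudoholomorphic n U G \<and> agrees_up_to_sign n U \<beta> \<phi> G" by (rule cg(4))
next
  fix V f p assume "pseudoholomorphic n V f" "p \<in> V"
  then show "\<exists>m A U \<psi> \<beta> \<phi> G. 1 \<le> m \<and> m \<le> n \<and> linear_isometry (2 * m + 1) (2 * n + 1) A
      \<and> construction_data m U \<beta> \<phi> \<and> coordinate_change U \<psi> V p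
      \<and> U \<subseteq> closure (g_domain m U \<beta> \<phi>) \<and> agrees_up_to_sign m U \<beta> \<phi> G
      \<and> (\<forall>z\<in>U. \<forall>k<2 * n + 1. f (\<psi> z) k = (\<Sum>j<2 * m + 1. A k j * G z j))"
    by (rule pseudoholomorphic_local_representation)
next
  fix V f assume "pseudoholomorphic n V f" and "connected V \<and> substantial n V f"
  then show "{p\<in>V. \<not> (\<exists>U \<psi> \<beta> \<phi>. construction_data n U \<beta> \<phi> \<and> coordinate_change U \<psi> V p
      \<and> g_domain n U \<beta> \<phi> = U
      \<and> (\<forall>z\<in>U. \<forall>k<2 * n + 1. f (\<psi> z) k = g n \<beta> \<phi> z k))} sparse_in V"
    using substantial_generic_representation by blast
qed

end
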